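(* Let $N\ge 2$, $q>1$, $0\le\tau<1$ and $\rho,\lambda,\theta\in\mathbb R$. Consider the equation $$(E)\qquad \mathbb L_{\rho,\lambda,\tau}[u]=|x|^\theta u^q\quad\text{in }\mathbb R^N\setminus\{0\}.$$ $\bullet$ Equation $(E)$ has positive solutions if and only if $f_\rho(\beta)>0$. $\bullet$ Assume that $\theta<-2$ and $f_\rho(\beta)>0$. Then every positive solution $u$ of $(E)$ is radially symmetric ($u(x)=u(|x|)$ for all $x\in\mathbb R^N\setminus\{0\}$), $\lim_{r\to0^+}u(r)=0$ and $u'>0$ on $(0,\infty)$. Moreover: (i) For every $c\in\mathbb R_+$, there exists a unique positive solution $u_{\infty,c}$ of $(E)$ satisfying $u(x)\sim U_{\rho,\beta}(x)$ as $|x|\to0$ together with the following behaviour as $|x|\to\infty$, according to the case that holds: - $u(x)\sim c\,|x|^{-\varpi_1(\rho)}$ in Case $[N_1]$ with $\beta<\varpi_1(\rho)$; - $u(x)\sim c\,\Psi_{\varpi_1(\rho)}(|x|)$ in Case $[N_2]$ with $\beta<\varpi_1(\rho)$; - $u(x)\sim c\,\log|x|$ if $\tau=0$ and $\lambda=2\rho$; - $u(x)\sim c$ in Case $[N_0]$ (with $\lambda\ne2\rho$ if $\tau=0$), or if $\beta\in(\varpi_2(\rho),0)$ in Case $[N_2]$. (ii) If $\beta\in(\varpi_2(\rho),0)$ in Case $[N_2]$, then for every $b,c\in\mathbb R_+$ there exists a unique positive solution $u_b$ (respectively, $u_{b,\infty,c}$) of $(E)$ satisfying $u(x)\sim b\,\Phi_{\varpi_2(\rho)}(|x|)$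 as $|x|\to0$ and $u(x)\sim U_{\rho,\beta}(|x|)$ (respectively, $u(x)\sim c$) as $|x|\to\infty$. (iii) The set of all positive solutions of $(E)$ is $$\{U_{\rho,\beta}\}\cup\{u_{\infty,c}\}_{c>0}\cup\{u_b\}_{b>0}\cup\{u_{b,\infty,c}\}_{b,c>0}\quad\text{if }\beta\in(\varpi_2(\rho),0)\text{ in Case }[N_2],$$ and it is $\{U_{\rho,\beta}\}\cup\{u_{\infty,c}\}_{c>0}$ otherwise.
   Context: $\mathbb R_+=(0,\infty)$, $\beta=\frac{\theta+2}{q-1}$, and $$\mathbb L_{\rho,\lambda,\tau}[u]=\Delta u-(N-2+2\rho)\frac{x\cdot\nabla u}{|x|^2}+\lambda\,\frac{u^\tau|\nabla u|^{1-\tau}}{|x|^{1+\tau}}$$ (for $\tau=0$ the last term is $\lambda|\nabla u|/|x|$). A positive solution of $(E)$ is a positive function $u\in C^1(\mathbb R^N\setminus\{0\})$ satisfying $(E)$ in the sense of distributions in $\mathbb R^N\setminus\{0\}$ (test functions in $C^1_c(\mathbb R^N\setminus\{0\})$). The notation $f\sim g$ as $|x|\to0$ (or $\infty$) means $f/g\to1$. $f_\rho(t)=t(t+2\rho)+\lambda|t|^{1-\tau}$ for $t\in\mathbb R$. When $f_\rho(\beta)>0$, $U_{\rho,\beta}(x)=\Lambda|x|^{-\beta}$ with $\Lambda=[f_\rho(\beta)]^{1/(q-1)}$ (also written as a function of $|x|$). For $t<0$ let $\widetilde f_\rho(t)=-t-2\rho+\lambda(-t)^{-\tau}$ (same sign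 as $f_\rho(t)$). When $\lambda>0$ and $\tau\in(0,1)$ let $\Upsilon=\frac{\tau+1}{2\tau}(\lambda\tau)^{1/(\tau+1)}$. Cases: - Case $[N_0]$: (a) $\tau=0$, $\lambda\ge2\rho$; or (b) $\lambda>0$, $\tau\in(0,1)$, $\rho<\Upsilon$. Then $\widetilde f_\rho>0$ on $(-\infty,0)$. - Case $[N_1]$: (a) $\tau=0$, $\lambda<2\rho$; or (b) $\lambda<0$, $\tau\in(0,1)$, $\rho\in\mathbb R$. Then $\widetilde f_\rho=0$ has exactly one negative root, $\varpi_1(\rho)$. - Case $[N_2]$: $\lambda>0$, $\tau\in(0,1)$, $\rho\ge\Upsilon$. The negative roots of $\widetilde f_\rho=0$ are $\varpi_1(\rho)\le\varpi_2(\rho)$, with $\varpi_1(\rho)<-(\lambda\tau)^{1/(\tau+1)}<\varpi_2(\rho)$ if $\rho\neq\Upsilon$ and $\varpi_1(\rho)=\varpi_2(\rho)=-(\lambda\tau)^{1/(\tau+1)}$ if $\rho=\Upsilon$. - Convention: if $\lambda=0$, the equation and $f_\rho$ do not depend on $\tau$, and the case distinction is made with $\tau=0$. In Case $[N_2]$: $\Psi_{\varpi_1(\rho)}(t)=t^{-\varpi_1(\rho)}$ if $\rho>\Upsilon$ and $\Psi_{\varpi_1(\rho)}(t)=t^{-\varpi_1(\rho)}(\log t)^{\frac2{1+\tau}}$ if $\rho=\Upsilon$, for $t>1$; $\Phi_{\varpi_2(\rho)}(r)=r^{-\varpi_2(\rho)}$ if $\rho>\Upsilon$ and $\Phi_{\varpi_2(\rho)}(r)=r^{-\varpi_2(\rho)}|\log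 r|^{\frac2{1+\tau}}$ if $\rho=\Upsilon$, for $r\in(0,1)$. *)

theory Defs
  imports "HOL-Analysis.Analysis" "HOL-Library.Landau_Symbols" "HOL-Library.FuncSet"
begin

definition grad :: "('a::real_inner \<Rightarrow> real) \<Rightarrow> 'a \<Rightarrow> 'a" where
  "grad f x = (THE D. GDERIV f x :> D)"

definition C1_on :: "'a::real_inner set \<Rightarrow> ('a \<Rightarrow> real) \<Rightarrow> bool" where
  "C1_on S f \<longleftrightarrow> (\<forall>x\<in>S. \<exists>D. GDERIV f x :> D) \<and> continuous_on S (grad f)"

text \<open>Functions in $C^1_c(R^N \setminus \{0\})$, extended by zero to the whole space.\<close>

definition test_function :: "('a::euclidean_space \<Rightarrow> real) \<Rightarrow> bool" where
  "test_function \<phi> \<longleftrightarrow>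
     C1_on UNIV \<phi> \<and> (\<exists>K. compact K \<and> K \<subseteq> - {0} \<and> (\<forall>x. x \<notin> K \<longrightarrow> \<phi> x = 0))"

text \<open>The terms of the operator of order at most one. The powers are only used with
  base \<open>u x > 0\<close>, or with a positive exponent, so \<open>0 powr a = 0\<close> is the right value.\<close>

definition lower_order_terms ::
  "real \<Rightarrow> real \<Rightarrow> real \<Rightarrow> (real^'n \<Rightarrow> real) \<Rightarrow> real^'n \<Rightarrow> real" where
  "lower_order_terms \<rho> lam \<tau> u x =
     - (real CARD('n) - 2 + 2 * \<rho>) * inner x (grad u x) / (norm x)\<^sup>2
     + lam * (u x powr \<tau> * norm (grad u x) powr (1 - \<tau>)) / norm x powr (1 + \<tau>)"

text \<open>The Laplacian is moved to the test function once. All integrands are continuous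
  with compact support in the punctured space.\<close>

definition distributional_solution ::
  "real \<Rightarrow> real \<Rightarrow> real \<Rightarrow> real \<Rightarrow> real \<Rightarrow> (real^'n \<Rightarrow> real) \<Rightarrow> bool" where
  "distributional_solution \<rho> lam \<tau> \<theta> q u \<longleftrightarrow>
     (\<forall>\<phi>. test_function \<phi> \<longrightarrow>
        (LINT x:-{0}|lborel. - (inner (grad u x) (grad \<phi> x)) + lower_order_terms \<rho> lam \<tau> u x * \<phi> x)
        = (LINT x:-{0}|lborel. norm x powr \<theta> * u x powr q * \<phi> x))"

text \<open>A function on the punctured space is represented by its extension with value
  \<open>undefined\<close> at the origin (\<open>extensional\<close>), so that equality of HOL functions is
  equality on the punctured space.\<close>

definition positive_solution ::
  "real \<Rightarrow> real \<Rightarrow> real \<Rightarrow> real \<Rightarrow> real \<Rightarrow> (real^'n \<Rightarrow> real) \<Rightarrow> bool" where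
  "positive_solution \<rho> lam \<tau> \<theta> q u \<longleftrightarrow>
     u \<in> extensional (- {0}) \<and> C1_on (- {0}) u \<and> (\<forall>x. x \<noteq> 0 \<longrightarrow> u x > 0) \<and>
     distributional_solution \<rho> lam \<tau> \<theta> q u"

definition beta_exp :: "real \<Rightarrow> real \<Rightarrow> real" where
  "beta_exp \<theta> q = (\<theta> + 2) / (q - 1)"

definition f_rho :: "real \<Rightarrow> real \<Rightarrow> real \<Rightarrow> real \<Rightarrow> real" where
  "f_rho \<rho> lam \<tau> t = t * (t + 2 * \<rho>) + lam * \<bar>t\<bar> powr (1 - \<tau>)"

text \<open>Used for \<open>t < 0\<close> only.\<close>

definition f_tilde :: "real \<Rightarrow> real \<Rightarrow> real \<Rightarrow> real \<Rightarrow> real" where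
  "f_tilde \<rho> lam \<tau> t = - t - 2 * \<rho> + lam * (- t) powr (- \<tau>)"

definition U_sol :: "real \<Rightarrow> real \<Rightarrow> real \<Rightarrow> real \<Rightarrow> real \<Rightarrow> real^'n \<Rightarrow> real" where
  "U_sol \<rho> lam \<tau> \<theta> q =
     restrict (\<lambda>x. f_rho \<rho> lam \<tau> (beta_exp \<theta> q) powr (1 / (q - 1)) * norm x powr (- beta_exp \<theta> q))
       (- {0})"

definition Upsilon :: "real \<Rightarrow> real \<Rightarrow> real" where
  "Upsilon lam \<tau> = (\<tau> + 1) / (2 * \<tau>) * (lam * \<tau>) powr (1 / (\<tau> + 1))"

text \<open>The disjuncts \<open>lam = 0\<close> implement the convention that for \<open>lam = 0\<close> the
  case distinction is made with \<open>\<tau> = 0\<close>.\<close>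

definition case_N0 :: "real \<Rightarrow> real \<Rightarrow> real \<Rightarrow> bool" where
  "case_N0 \<rho> lam \<tau> \<longleftrightarrow>
     ((\<tau> = 0 \<or> lam = 0) \<and> lam \<ge> 2 * \<rho>) \<or>
     (lam > 0 \<and> 0 < \<tau> \<and> \<tau> < 1 \<and> \<rho> < Upsilon lam \<tau>)"

definition case_N0_log :: "real \<Rightarrow> real \<Rightarrow> real \<Rightarrow> bool" where
  "case_N0_log \<rho> lam \<tau> \<longleftrightarrow> (\<tau> = 0 \<or> lam = 0) \<and> lam = 2 * \<rho>"

definition case_N1 :: "real \<Rightarrow> real \<Rightarrow> real \<Rightarrow> bool" where
  "case_N1 \<rho> lam \<tau> \<longleftrightarrow>
     ((\<tau> = 0 \<or> lam = 0) \<and> lam < 2 * \<rho>) \<or>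
     (lam < 0 \<and> 0 < \<tau> \<and> \<tau> < 1)"

definition case_N2 :: "real \<Rightarrow> real \<Rightarrow> real \<Rightarrow> bool" where
  "case_N2 \<rho> lam \<tau> \<longleftrightarrow> lam > 0 \<and> 0 < \<tau> \<and> \<tau> < 1 \<and> \<rho> \<ge> Upsilon lam \<tau>"

text \<open>In the case N1 there is exactly one negative root, in the case N2 there are at most
  two; hence the smallest and the largest negative root are the two roots in increasing order.
  These constants are not used in the case N0.\<close>

definition varpi1 :: "real \<Rightarrow> real \<Rightarrow> real \<Rightarrow> real" where
  "varpi1 \<rho> lam \<tau> = Min {t. t < 0 \<and> f_tilde \<rho> lam \<tau> t = 0}"

definition varpi2 :: "real \<Rightarrow> real \<Rightarrow> real \<Rightarrow> real" where
  "varpi2 \<rho> lam \<tau> = Max {t. t < 0 \<and> f_tilde \<rho> lam \<tau> t = 0}"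

text \<open>For \<open>t > 1\<close>, in the case N2.\<close>

definition Psi :: "real \<Rightarrow> real \<Rightarrow> real \<Rightarrow> real \<Rightarrow> real" where
  "Psi \<rho> lam \<tau> t =
     (if \<rho> = Upsilon lam \<tau> then t powr (- varpi1 \<rho> lam \<tau>) * ln t powr (2 / (1 + \<tau>))
      else t powr (- varpi1 \<rho> lam \<tau>))"

text \<open>For \<open>0 < r < 1\<close>, in the case N2.\<close>

definition Phi :: "real \<Rightarrow> real \<Rightarrow> real \<Rightarrow> real \<Rightarrow> real" where
  "Phi \<rho> lam \<tau> r =
     (if \<rho> = Upsilon lam \<tau> then r powr (- varpi2 \<rho> lam \<tau>) * \<bar>ln r\<bar> powr (2 / (1 + \<tau>))
      else r powr (- varpi2 \<rho> lam \<tau>))"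

definition N2_between :: "real \<Rightarrow> real \<Rightarrow> real \<Rightarrow> real \<Rightarrow> bool" where
  "N2_between \<rho> lam \<tau> \<beta> \<longleftrightarrow> case_N2 \<rho> lam \<tau> \<and> varpi2 \<rho> lam \<tau> < \<beta> \<and> \<beta> < 0"

text \<open>For \<open>\<beta> < 0\<close> and \<open>f_rho \<rho> lam \<tau> \<beta> > 0\<close> exactly one of the four alternatives applies.\<close>

definition behaviour_at_infinity ::
  "real \<Rightarrow> real \<Rightarrow> real \<Rightarrow> real \<Rightarrow> real \<Rightarrow> (real^'n \<Rightarrow> real) \<Rightarrow> bool" where
  "behaviour_at_infinity \<rho> lam \<tau> \<beta> c u \<longleftrightarrow>
     (case_N1 \<rho> lam \<tau> \<and> \<beta> < varpi1 \<rho> lam \<tau> \<longrightarrow>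
        u \<sim>[at_infinity] (\<lambda>x. c * norm x powr (- varpi1 \<rho> lam \<tau>))) \<and>
     (case_N2 \<rho> lam \<tau> \<and> \<beta> < varpi1 \<rho> lam \<tau> \<longrightarrow>
        u \<sim>[at_infinity] (\<lambda>x. c * Psi \<rho> lam \<tau> (norm x))) \<and>
     (case_N0_log \<rho> lam \<tau> \<longrightarrow>
        u \<sim>[at_infinity] (\<lambda>x. c * ln (norm x))) \<and>
     (case_N0 \<rho> lam \<tau> \<and> \<not> case_N0_log \<rho> lam \<tau> \<or> N2_between \<rho> lam \<tau> \<beta> \<longrightarrow>
        u \<sim>[at_infinity] (\<lambda>x. c))"

definition is_u_infty ::
  "real \<Rightarrow> real \<Rightarrow> real \<Rightarrow> real \<Rightarrow> real \<Rightarrow> real \<Rightarrow> (real^'n \<Rightarrow> real) \<Rightarrow> bool" where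
  "is_u_infty \<rho> lam \<tau> \<theta> q c u \<longleftrightarrow>
     positive_solution \<rho> lam \<tau> \<theta> q u \<and> u \<sim>[at 0] U_sol \<rho> lam \<tau> \<theta> q \<and>
     behaviour_at_infinity \<rho> lam \<tau> (beta_exp \<theta> q) c u"

definition is_u_b ::
  "real \<Rightarrow> real \<Rightarrow> real \<Rightarrow> real \<Rightarrow> real \<Rightarrow> real \<Rightarrow> (real^'n \<Rightarrow> real) \<Rightarrow> bool" where
  "is_u_b \<rho> lam \<tau> \<theta> q b u \<longleftrightarrow>
     positive_solution \<rho> lam \<tau> \<theta> q u \<and> u \<sim>[at 0] (\<lambda>x. b * Phi \<rho> lam \<tau> (norm x)) \<and>
     u \<sim>[at_infinity] U_sol \<rho> lam \<tau> \<theta> q"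

definition is_u_b_infty ::
  "real \<Rightarrow> real \<Rightarrow> real \<Rightarrow> real \<Rightarrow> real \<Rightarrow> real \<Rightarrow> real \<Rightarrow> (real^'n \<Rightarrow> real) \<Rightarrow> bool" where
  "is_u_b_infty \<rho> lam \<tau> \<theta> q b c u \<longleftrightarrow>
     positive_solution \<rho> lam \<tau> \<theta> q u \<and> u \<sim>[at 0] (\<lambda>x. b * Phi \<rho> lam \<tau> (norm x)) \<and>
     u \<sim>[at_infinity] (\<lambda>x. c)"

definition u_infty ::
  "real \<Rightarrow> real \<Rightarrow> real \<Rightarrow> real \<Rightarrow> real \<Rightarrow> real \<Rightarrow> real^'n \<Rightarrow> real" where
  "u_infty \<rho> lam \<tau> \<theta> q c = (THE u. is_u_infty \<rho> lam \<tau> \<theta> q c u)"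

definition u_b ::
  "real \<Rightarrow> real \<Rightarrow> real \<Rightarrow> real \<Rightarrow> real \<Rightarrow> real \<Rightarrow> real^'n \<Rightarrow> real" where
  "u_b \<rho> lam \<tau> \<theta> q b = (THE u. is_u_b \<rho> lam \<tau> \<theta> q b u)"

definition u_b_infty ::
  "real \<Rightarrow> real \<Rightarrow> real \<Rightarrow> real \<Rightarrow> real \<Rightarrow> real \<Rightarrow> real \<Rightarrow> real^'n \<Rightarrow> real" where
  "u_b_infty \<rho> lam \<tau> \<theta> q b c = (THE u. is_u_b_infty \<rho> lam \<tau> \<theta> q b c u)"

end

theory Submission
  imports Defs
begin

text \<open>With \<open>t = ln (norm x)\<close> and \<open>z = ln u\<close> the equation becomes \<open>xi'' + F xi' = exp ((q - 1) * (xi - gm * t))\<close>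
 for radial solutions, where \<open>gm\<close> is minus the critical exponent and \<open>F gm = f_rho rho lam tau (- gm)\<close>. This system is
 autonomous in \<open>(xi - gm * t, xi')\<close>, has the equilibrium \<open>xi' = gm\<close> (the power solution) if and only if \<open>F gm > 0\<close>, and
 otherwise no global orbit.

 Radial symmetry: by comparison the oscillation of \<open>z\<close> over the spheres is a quasiconvex function of \<open>t\<close>, and
 the Keller-Osserman bound and Harnack's inequality bound it. If it is not zero, it is nearly constant and positive
 on some window of fixed length; rescaling the window to the origin, the strong maximum principle excludes that.

 For radial solutions, every orbit other than the equilibrium leaves it at one end along its one-dimensional stable or
 unstable curve and tends to a zero of \<open>F\<close> at the other, or connects two zeros of \<open>F\<close>. The speed of
 convergence depends on whether the zero is simple or double (the logarithm in \<open>Psi\<close> and \<open>Phi\<close>). The orbits into the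
 equilibrium are limits of half orbits started at it with a perturbed first coordinate; the comparison
 principle gives uniqueness for prescribed asymptotics.\<close>

section \<open>Weak Laplacians of continuously differentiable functions\<close>

text \<open>For \<open>tau > 0\<close> the gradient term is not Lipschitz where the gradient
  vanishes, so two solutions cannot simply be subtracted to obtain a linear inequality. For
  comparison the logarithm helps: its equation contains the unknown only in a strictly increasing
  term, and at a maximum point of a difference the gradients agree, so nothing has to be known about
  the dependence on the gradient. For the strong maximum principle a linear inequality is
  unavoidable. There a solution is compared with a radial one whose slope stays away from 0; when
  the maxima over the spheres are nearly constant, the sign of \<open>lam\<close> decides which
  one-sided inequality takes its place. The solutions are only C^1, so their Laplacians are always
  tested. No limit of solutions in several variables is formed: the estimates have constants that
  are uniform in the solution and in the factor \<open>mu\<close>, which is all that dilations and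
  multiplication of \<open>u\<close> by constants change in the equation.\<close>

definition C1_test :: "'a::euclidean_space set => ('a => real) => ('a => 'a) => bool" where
 "C1_test Om phi H \<longleftrightarrow> (\<forall>x. GDERIV phi x :> H x) & continuous_on UNIV H &
  (\<exists>K. compact K & K \<subseteq> Om & (\<forall>x. x \<notin> K --> phi x = 0 & H x = 0))"

text \<open>\<open>g\<close> is a continuous representative of the distributional Laplacian of
  \<open>v\<close>, and \<open>G\<close> is its gradient. Since both are continuous on
  \<open>Om\<close>, every tested integrand is continuous with compact support, and integrability is
  never an issue.\<close>

definition weak_lap :: "'a::euclidean_space set => ('a => real) => ('a => 'a) => ('a => real) => bool" where
 "weak_lap Om v G g \<longleftrightarrow> open Om & (\<forall>x\<in>Om. GDERIV v x :> G x) & continuous_on Om G &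
  continuous_on Om g &
  (\<forall>phi H. C1_test Om phi H --> (LINT x|lborel. G x \<bullet> H x + g x * phi x) = 0)"

lemma gderiv_continuous_on: "(!!x. x \<in> S ==> GDERIV f x :> G x) ==> continuous_on S f"
 unfolding gderiv_def by (meson has_derivative_at_withinI has_derivative_continuous_on)

lemma gderiv_transform:
 assumes "GDERIV f x :> D" "open S" "x \<in> S" "!!y. y \<in> S ==> f y = g y"
 shows "GDERIV g x :> D"
 using assms unfolding gderiv_def by (rule has_derivative_transform_within_open)

lemma gderiv_unique:
 assumes "GDERIV f x :> D" "GDERIV f x :> E"
 shows "D = E"
proof -
 have "(%h. h \<bullet> D) = (%h. h \<bullet> E)"
  using assms unfolding gderiv_def by (rule has_derivative_unique)
 then have "(D - E) \<bullet> D = (D - E) \<bullet> E" by (rule fun_cong)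
 then have "(D - E) \<bullet> (D - E) = 0" by (simp add: inner_diff_right)
 then show ?thesis by simp
qed

lemma gderiv_chain:
 assumes "GDERIV v x :> G" "DERIV eta (v x) :> d"
 shows "GDERIV (%x. eta (v x)) x :> d *\<^sub>R G"
proof -
 have "((%x. eta (v x)) has_derivative (%h. d * (h \<bullet> G))) (at x)"
  using assms diff_chain_at[of v "%h. h \<bullet> G" x eta "(*) d"]
  unfolding gderiv_def has_field_derivative_def by (simp add: o_def)
 then show ?thesis by (simp add: gderiv_def)
qed

lemma gderiv_max_zero:
 assumes "GDERIV s x :> G" "open U" "x \<in> U" "!!y. y \<in> U ==> s y <= s x"
 shows "G = 0"
proof -
 have "(%h. h \<bullet> G) = (%h. 0)"
  using assms unfolding gderiv_def by (intro differential_zero_maxmin[of x U s]) auto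
 then have "G \<bullet> G = 0" by metis
 then show ?thesis by simp
qed

lemma C1_testE:
 assumes "C1_test Om phi H"
 obtains K where "compact K" "K \<subseteq> Om" "!!x. x \<notin> K ==> phi x = 0" "!!x. x \<notin> K ==> H x = 0"
  "!!x. GDERIV phi x :> H x" "continuous_on UNIV H" "continuous_on UNIV phi"
 using assms gderiv_continuous_on[of UNIV phi H] unfolding C1_test_def by blast

lemma integrable_compact_support:
 fixes f :: "'a::euclidean_space => real"
 assumes "compact K" "continuous_on K f" "!!x. x \<notin> K ==> f x = 0"
 shows "integrable lborel f"
proof -
 have "integrable lborel (%x. indicator K x *\<^sub>R f x)"
  by (rule borel_integrable_compact[OF assms(1,2)])
 moreover have "(%x. indicator K x *\<^sub>R f x) = f"
  using assms(3) by (auto simp: indicator_def fun_eq_iff)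
 ultimately show ?thesis by simp
qed

lemma integrable_test:
 assumes "C1_test Om phi H" "continuous_on Om G" "continuous_on Om g"
 shows "integrable lborel (%x. G x \<bullet> H x + g x * phi x)"
  "integrable lborel (%x. G x \<bullet> H x)" "integrable lborel (%x. g x * phi x)"
proof -
 obtain K where K: "compact K" "K \<subseteq> Om" "!!x. x \<notin> K ==> phi x = 0" "!!x. x \<notin> K ==> H x = 0"
  "continuous_on UNIV H" "continuous_on UNIV phi" using assms(1) by (elim C1_testE) blast
 have c: "continuous_on K G" "continuous_on K g" "continuous_on K H" "continuous_on K phi"
  using K assms(2,3) by (meson continuous_on_subset subset_UNIV)+
 show "integrable lborel (%x. G x \<bullet> H x + g x * phi x)"
  "integrable lborel (%x. G x \<bullet> H x)" "integrable lborel (%x. g x * phi x)"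
  using c K by (auto intro!: integrable_compact_support[OF K(1)] continuous_intros)
qed

text \<open>The factor \<open>a\<close> is controlled on \<open>Om\<close> only. Outside the compact
  set \<open>K\<close> the product vanishes identically, and the open sets \<open>Om\<close> and
  \<open>- K\<close> cover the space.\<close>

lemma C1_test_mult:
 assumes "C1_test Om phi H" "open Om" "!!x. x \<in> Om ==> GDERIV a x :> A x" "continuous_on Om A"
 shows "C1_test Om (%x. a x * phi x) (%x. a x *\<^sub>R H x + phi x *\<^sub>R A x)"
proof -
 obtain K where K: "compact K" "K \<subseteq> Om" "!!x. x \<notin> K ==> phi x = 0" "!!x. x \<notin> K ==> H x = 0"
  "!!x. GDERIV phi x :> H x" "continuous_on UNIV H" "continuous_on UNIV phi"
  using assms(1) by (elim C1_testE) blast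
 have op: "open (- K)" using K(1) compact_imp_closed by blast
 have un: "UNIV = Om \<union> - K" using K(2) by auto
 have "GDERIV (%x. a x * phi x) x :> a x *\<^sub>R H x + phi x *\<^sub>R A x" for x
 proof (cases "x \<in> Om")
  case True
  then show ?thesis using GDERIV_mult[OF assms(3)[OF True] K(5)[of x]] by (simp add: add.commute)
 next
  case False
  then have x: "x \<in> - K" using K by auto
  have "GDERIV (%x. a x * phi x) x :> 0"
   by (rule gderiv_transform[OF GDERIV_const[of 0] op x]) (use K in auto)
  then show ?thesis using x K by auto
 qed
 moreover have "continuous_on UNIV (%x. a x *\<^sub>R H x + phi x *\<^sub>R A x)"
  unfolding un
 proof (rule continuous_on_open_Un[OF assms(2) op])
  show "continuous_on Om (%x. a x *\<^sub>R H x + phi x *\<^sub>R A x)"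
   using gderiv_continuous_on[OF assms(3)] assms(4) K(6,7)
   by (intro continuous_intros) (auto intro: continuous_on_subset)
  show "continuous_on (- K) (%x. a x *\<^sub>R H x + phi x *\<^sub>R A x)"
   by (rule continuous_on_eq[of _ "%_. 0"]) (use K in auto)
 qed
 ultimately show ?thesis unfolding C1_test_def using K by (intro conjI allI exI[of _ K]) auto
qed

lemma C1_test_mono: "C1_test Om' phi H ==> Om' \<subseteq> Om ==> C1_test Om phi H"
 unfolding C1_test_def by blast

lemma weak_lap_subset: "weak_lap Om v G g ==> open Om' ==> Om' \<subseteq> Om ==> weak_lap Om' v G g"
 unfolding weak_lap_def by (meson C1_test_mono continuous_on_subset subsetD)

lemma weak_lap_cong:
 assumes "weak_lap Om v G g" "!!x. x \<in> Om ==> v x = v' x" "!!x. x \<in> Om ==> G x = G' x"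
  "!!x. x \<in> Om ==> g x = g' x"
 shows "weak_lap Om v' G' g'"
proof -
 have op: "open Om" using assms(1) by (auto simp: weak_lap_def)
 have "(LINT x|lborel. G' x \<bullet> H x + g' x * phi x) = 0" if t: "C1_test Om phi H" for phi H
 proof -
  have "G' x \<bullet> H x + g' x * phi x = G x \<bullet> H x + g x * phi x" for x
  proof (cases "x \<in> Om")
   case False
   then have "phi x = 0" "H x = 0" using t unfolding C1_test_def by blast+
   then show ?thesis by simp
  qed (use assms(3,4) in auto)
  then show ?thesis using assms(1) t by (simp add: weak_lap_def)
 qed
 moreover have "GDERIV v' x :> G' x" if "x \<in> Om" for x
 proof -
  have "GDERIV v x :> G' x" using assms(1,3) that by (auto simp: weak_lap_def)
  then show ?thesis by (rule gderiv_transform[OF _ op that assms(2)])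
 qed
 moreover have "continuous_on Om G'" "continuous_on Om g'"
  using assms by (auto simp: weak_lap_def intro: continuous_on_eq)
 ultimately show ?thesis using op unfolding weak_lap_def by blast
qed

lemma weak_lap_lincomb:
 assumes "weak_lap Om v G g" "weak_lap Om v' G' g'"
 shows "weak_lap Om (%x. a * v x + b * v' x) (%x. a *\<^sub>R G x + b *\<^sub>R G' x) (%x. a * g x + b * g' x)"
proof -
 have "(LINT x|lborel. (a *\<^sub>R G x + b *\<^sub>R G' x) \<bullet> H x + (a * g x + b * g' x) * phi x) = 0"
  if t: "C1_test Om phi H" for phi H
 proof -
  have i: "integrable lborel (%x. G x \<bullet> H x + g x * phi x)"
   "integrable lborel (%x. G' x \<bullet> H x + g' x * phi x)"
   using integrable_test[OF t] assms by (auto simp: weak_lap_def)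
  have "(LINT x|lborel. (a *\<^sub>R G x + b *\<^sub>R G' x) \<bullet> H x + (a * g x + b * g' x) * phi x)
   = (LINT x|lborel. a * (G x \<bullet> H x + g x * phi x) + b * (G' x \<bullet> H x + g' x * phi x))"
   by (intro Bochner_Integration.integral_cong refl) (simp add: inner_add_left algebra_simps)
  also have "... = a * (LINT x|lborel. G x \<bullet> H x + g x * phi x) + b * (LINT x|lborel. G' x \<bullet> H x + g' x * phi x)"
   using i by (subst Bochner_Integration.integral_add) auto
  finally show ?thesis using assms t by (simp add: weak_lap_def)
 qed
 moreover have "GDERIV (%x. a * v x + b * v' x) x :> a *\<^sub>R G x + b *\<^sub>R G' x" if "x \<in> Om" for x
 proof -
  have d: "GDERIV v x :> G x" "GDERIV v' x :> G' x" using assms that by (auto simp: weak_lap_def)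
  have m: "((*) k has_real_derivative k) (at t)" for k t :: real
   by (auto intro!: derivative_eq_intros)
  show ?thesis by (rule GDERIV_add[OF gderiv_chain[OF d(1) m] gderiv_chain[OF d(2) m]])
 qed
 ultimately show ?thesis using assms unfolding weak_lap_def by (auto intro!: continuous_intros)
qed

lemma weak_lap_const: "open Om ==> weak_lap Om (%x. c) (%x. 0) (%x. 0)"
 by (auto simp: weak_lap_def GDERIV_const)

lemma weak_lap_diff:
 assumes "weak_lap Om v G g" "weak_lap Om v' G' g'"
 shows "weak_lap Om (%x. v x - v' x) (%x. G x - G' x) (%x. g x - g' x)"
 using weak_lap_lincomb[OF assms, of 1 "-1"] by simp

lemma weak_lap_add_const:
 assumes "weak_lap Om v G g"
 shows "weak_lap Om (%x. v x + c) G g"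
 using weak_lap_lincomb[OF assms weak_lap_const[of Om c], of 1 1] assms by (simp add: weak_lap_def)

text \<open>Testing the equation of \<open>v\<close> with \<open>eta1 (v x) * phi x\<close>
  suffices: the derivative of the factor \<open>eta1 (v x)\<close> produces the quadratic gradient
  term.\<close>

lemma weak_lap_chain:
 assumes v: "weak_lap Om v G g"
  and d1: "!!x. x \<in> Om ==> DERIV eta (v x) :> eta1 (v x)"
  and d2: "!!x. x \<in> Om ==> DERIV eta1 (v x) :> eta2 (v x)"
  and c2: "continuous_on (v ` Om) eta2"
 shows "weak_lap Om (%x. eta (v x)) (%x. eta1 (v x) *\<^sub>R G x)
  (%x. eta1 (v x) * g x + eta2 (v x) * (G x \<bullet> G x))"
proof -
 have op: "open Om" and dv: "!!x. x \<in> Om ==> GDERIV v x :> G x" and cG: "continuous_on Om G"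
  and cg: "continuous_on Om g" using v by (auto simp: weak_lap_def)
 have cv: "continuous_on Om v" by (rule gderiv_continuous_on[OF dv])
 have cn2: "continuous_on Om (%x. eta2 (v x))" by (rule continuous_on_compose2[OF c2 cv]) auto
 have dn1: "GDERIV (%x. eta1 (v x)) x :> eta2 (v x) *\<^sub>R G x" if "x \<in> Om" for x
  by (rule gderiv_chain[OF dv[OF that] d2[OF that]])
 have cn1: "continuous_on Om (%x. eta1 (v x))" by (rule gderiv_continuous_on[OF dn1])
 have "(LINT x|lborel. (eta1 (v x) *\<^sub>R G x) \<bullet> H x + (eta1 (v x) * g x + eta2 (v x) * (G x \<bullet> G x)) * phi x) = 0"
  if t: "C1_test Om phi H" for phi H
 proof -
  have t': "C1_test Om (%x. eta1 (v x) * phi x) (%x. eta1 (v x) *\<^sub>R H x + phi x *\<^sub>R (eta2 (v x) *\<^sub>R G x))"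
   by (rule C1_test_mult[OF t op dn1]) (auto intro!: continuous_intros cn2 cG)
  have "(LINT x|lborel. G x \<bullet> (eta1 (v x) *\<^sub>R H x + phi x *\<^sub>R (eta2 (v x) *\<^sub>R G x)) + g x * (eta1 (v x) * phi x)) = 0"
   using v t' by (simp add: weak_lap_def)
  then show ?thesis by (simp add: inner_add_right algebra_simps)
 qed
 moreover have "continuous_on Om (%x. eta1 (v x) *\<^sub>R G x)"
  "continuous_on Om (%x. eta1 (v x) * g x + eta2 (v x) * (G x \<bullet> G x))"
  using cn1 cn2 cG cg by (auto intro!: continuous_intros)
 ultimately show ?thesis unfolding weak_lap_def using op gderiv_chain[OF dv d1] by blast
qed

section \<open>The maximum principle for weak Laplacians\<close>

text \<open>The positive part itself has a corner at 0; its square is continuously differentiable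
  and thus yields an admissible test function.\<close>

lemma DERIV_pos_part_square: "DERIV (%t::real. (max 0 t)^2) t :> 2 * max 0 t"
proof (cases t "0::real" rule: linorder_cases)
 case less
 have "DERIV (%t::real. 0) t :> 2 * max 0 t" using less by (simp add: max_def)
 then show ?thesis
  by (rule has_field_derivative_transform_within_open[of _ _ _ "{..<0}"]) (use less in auto)
next
 case greater
 have "DERIV (%t::real. t\<^sup>2) t :> 2 * max 0 t"
  using greater by (auto intro!: derivative_eq_intros)
 then show ?thesis
  by (rule has_field_derivative_transform_within_open[of _ _ _ "{0<..}"]) (use greater in auto)
next
 case equal
 have "((%h. ((max 0 (0 + h))^2 - (max 0 0)^2) / h) \<longlongrightarrow> 0) (at (0::real))"
 proof (rule Lim_null_comparison[of _ "%h. abs h"])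
  show "\<forall>\<^sub>F h in at 0. norm (((max 0 (0 + h))^2 - (max 0 0)^2) / h) <= abs (h::real)"
   by (auto simp: eventually_at_filter max_def power2_eq_square)
  show "((%h::real. abs h) \<longlongrightarrow> 0) (at 0)" by (auto intro!: tendsto_eq_intros)
 qed
 then show ?thesis using equal by (simp add: DERIV_def)
qed

lemma continuous_nonneg_integral_zero:
 fixes f :: "'a::euclidean_space => real"
 assumes "continuous_on UNIV f" "!!x. f x >= 0" "integrable lborel f" "(LINT x|lborel. f x) = 0"
 shows "f x = 0"
proof (rule ccontr)
 assume "f x ~= 0"
 have op: "open {x. f x ~= 0}"
  using open_Collect_neq[OF assms(1) continuous_on_const] by simp
 have "AE x in lborel. f x = 0" using assms by (subst (asm) integral_nonneg_eq_0_iff_AE) auto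
 then have "{x. f x ~= 0} \<in> null_sets lborel"
  using op AE_iff_null_sets[of "{x. f x ~= 0}" lborel] by simp
 then have "negligible {x. f x ~= 0}"
  using negligible_iff_null_sets null_sets_completionI by blast
 then show False using open_not_negligible[OF op] \<open>f x ~= 0\<close> by auto
qed

text \<open>Only the maximum points of \<open>s\<close> matter: testing with the square of the positive part of
 \<open>s - l\<close>, for \<open>l\<close> slightly below the maximum, uses \<open>g\<close> only where it is still positive.\<close>

lemma max_principle:
 assumes s: "weak_lap Om s G g" and K: "compact K" "K \<subseteq> Om" and x0: "x0 \<in> K"
  and bd: "!!x. x \<in> K ==> x \<notin> interior K ==> s x < s x0"
  and pos: "!!x. x \<in> interior K ==> s x >= s x0 ==> G x = 0 ==> g x > 0"
 shows False
proof -
 have ds: "!!x. x \<in> Om ==> GDERIV s x :> G x" and cG: "continuous_on Om G"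
  and cg: "continuous_on Om g" using s by (auto simp: weak_lap_def)
 have cs: "continuous_on Om s" by (rule gderiv_continuous_on[OF ds])
 obtain x1 where x1: "x1 \<in> K" "!!x. x \<in> K ==> s x <= s x1"
  using continuous_attains_sup[OF K(1) _ continuous_on_subset[OF cs K(2)]] x0 by blast
 \<comment> \<open>\<open>C\<close> collects the points where the sign of \<open>g\<close> cannot be
   used. The maximum is not attained on \<open>C\<close>, so by compactness a level \<open>l\<close>
   below the maximum separates \<open>C\<close> from the maximum points.\<close>
 define C where "C = (K - interior K) \<union> (K \<inter> {x\<in>K. g x <= 0})"
 have "closed {x\<in>K. g x <= 0}"
  using continuous_closed_preimage[OF continuous_on_subset[OF cg K(2)], of "{..0}"] K(1)
  by (simp add: compact_imp_closed vimage_def Int_def)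
 then have C: "compact C" unfolding C_def
  using K(1) by (intro compact_Un compact_diff compact_Int_closed) auto
 have lt: "s x < s x1" if "x \<in> C" for x
 proof (cases "x \<in> interior K")
  case False
  then show ?thesis using that bd[of x] x1(2)[OF x0] by (auto simp: C_def)
 next
  case True
  then have "g x <= 0" "x \<in> K" using that by (auto simp: C_def)
  have "s x ~= s x1"
  proof
   assume eq: "s x = s x1"
   have "G x = 0"
    by (rule gderiv_max_zero[of s x "G x" "interior K"])
     (use \<open>x \<in> K\<close> True ds K(2) x1(2) eq interior_subset in \<open>auto dest: subsetD[OF interior_subset]\<close>)
   then show False using pos[OF True] x1(2)[OF x0] eq \<open>g x <= 0\<close> by auto
  qed
  then show ?thesis using x1(2)[OF \<open>x \<in> K\<close>] by auto
 qed
 obtain l where l: "l < s x1" "!!x. x \<in> C ==> s x < l"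
 proof (cases "C = {}")
  case True
  then show ?thesis using that[of "s x1 - 1"] by auto
 next
  case False
  have "C \<subseteq> Om" using K(2) by (auto simp: C_def)
  then obtain y where "y \<in> C" "!!x. x \<in> C ==> s x <= s y"
   using continuous_attains_sup[OF C False continuous_on_subset[OF cs]] by blast
  then have "(s y + s x1) / 2 < s x1" "!!x. x \<in> C ==> s x < (s y + s x1) / 2"
   using lt[of y] by (force simp: field_simps)+
  then show ?thesis using that by blast
 qed
 define L where "L = {x\<in>K. l <= s x}"
 have clL: "closed L" unfolding L_def
  using continuous_closed_preimage[OF continuous_on_subset[OF cs K(2)], of "{l..}"] K(1)
  by (simp add: compact_imp_closed vimage_def Int_def)
 have "K \<inter> L = L" by (auto simp: L_def)
 then have L1: "compact L" using compact_Int_closed[OF K(1) clL] by simp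
 have nC: "x \<notin> C" if "x \<in> L" for x using l(2)[of x] that by (auto simp: L_def)
 have L2: "L \<subseteq> interior K" "!!x. x \<in> L ==> g x > 0"
  using nC by (auto simp: L_def C_def not_le)
 note L = L1 L2
 \<comment> \<open>Both functions are cut off to \<open>L\<close>. They stay continuous because
   \<open>L\<close> lies in the interior of \<open>K\<close>, where \<open>s < l\<close> outside
   \<open>L\<close>, so the formula without cut-off is already zero there.\<close>
 define phi where "phi x = (if x \<in> L then (max 0 (s x - l))^2 else 0)" for x
 define H where "H x = (if x \<in> L then (2 * max 0 (s x - l)) *\<^sub>R G x else 0)" for x
 have opL: "open (- L)" using clL by auto
 have un: "UNIV = interior K \<union> - L" using L by auto
 have KO: "interior K \<subseteq> Om" using K(2) interior_subset by blast
 have phi1: "phi x = (max 0 (s x - l))^2" "H x = (2 * max 0 (s x - l)) *\<^sub>R G x" if "x \<in> interior K" for x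
  using that interior_subset[of K] by (auto simp: phi_def H_def L_def max_def)
 have "GDERIV phi x :> H x" for x
 proof (cases "x \<in> interior K")
  case True
  have "GDERIV (%x. s x - l) x :> G x"
   using GDERIV_diff[OF ds[of x] GDERIV_const[of l x]] True KO by auto
  from gderiv_chain[OF this DERIV_pos_part_square]
  have "GDERIV (%x. (max 0 (s x - l))^2) x :> (2 * max 0 (s x - l)) *\<^sub>R G x" .
  then have "GDERIV phi x :> (2 * max 0 (s x - l)) *\<^sub>R G x"
   by (rule gderiv_transform[OF _ open_interior True]) (simp add: phi1)
  then show ?thesis by (simp add: phi1[OF True])
 next
  case False
  then have "x \<in> - L" using L by auto
  have "GDERIV phi x :> 0"
   by (rule gderiv_transform[OF GDERIV_const[of 0] opL \<open>x \<in> - L\<close>]) (auto simp: phi_def)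
  then show ?thesis using \<open>x \<in> - L\<close> by (simp add: H_def)
 qed
 moreover have cH: "continuous_on UNIV H" unfolding un
 proof (rule continuous_on_open_Un[OF open_interior opL])
  have "continuous_on (interior K) (%x. (2 * max 0 (s x - l)) *\<^sub>R G x)"
   using continuous_on_subset[OF cs KO] continuous_on_subset[OF cG KO]
   by (intro continuous_intros)
  then show "continuous_on (interior K) H" by (rule continuous_on_eq) (simp add: phi1)
  show "continuous_on (- L) H" by (rule continuous_on_eq[of _ "%_. 0"]) (auto simp: H_def)
 qed
 ultimately have t: "C1_test Om phi H" unfolding C1_test_def
  using L K(2) interior_subset[of K] by (intro conjI allI exI[of _ L]) (auto simp: phi_def H_def)
 \<comment> \<open>The gradient part of the integrand is a nonnegative multiple of
   \<open>G x \<bullet> G x\<close>, and \<open>g > 0\<close> on \<open>L\<close>. A continuous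
   nonnegative function with integral 0 vanishes, but this one is positive at the maximum point
   \<open>x1\<close>.\<close>
 define f where "f x = G x \<bullet> H x + g x * phi x" for x
 have "f x = 0" for x
 proof (rule continuous_nonneg_integral_zero[where f = f])
  show "integrable lborel f" unfolding f_def by (rule integrable_test(1)[OF t cG cg])
  show "(LINT x|lborel. f x) = 0" unfolding f_def using s t by (simp add: weak_lap_def)
  show "f x >= 0" for x using L(3)[of x] by (auto simp: f_def phi_def H_def)
  show "continuous_on UNIV f" unfolding un
  proof (rule continuous_on_open_Un[OF open_interior opL])
   have "continuous_on (interior K) phi"
    using t gderiv_continuous_on[of UNIV phi H] by (auto simp: C1_test_def intro: continuous_on_subset)
   then show "continuous_on (interior K) f" unfolding f_def
    using cG cg cH KO by (intro continuous_intros) (auto intro: continuous_on_subset)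
   show "continuous_on (- L) f"
    by (rule continuous_on_eq[of _ "%_. 0"]) (auto simp: H_def phi_def f_def)
  qed
 qed
 moreover have "x1 \<in> L" using x1 l by (auto simp: L_def)
 then have "g x1 * phi x1 > 0" using L(3) l by (auto simp: phi_def max_def)
 then have "f x1 > 0" using \<open>x1 \<in> L\<close> by (auto simp: f_def H_def intro: add_nonneg_pos)
 ultimately show False by auto
qed

section \<open>Weak Laplacians of classical and of radial functions\<close>

lemma integral_translate:
 fixes f :: "'a::euclidean_space => real"
 assumes "f \<in> borel_measurable borel"
 shows "(LINT x|lborel. f (a + x)) = (LINT x|lborel. f x)"
proof -
 have "(LINT x|lborel. f x) = (LINT x|distr lborel borel ((+) a). f x)"
  by (simp add: lborel_distr_plus)
 also have "... = (LINT x|lborel. f (a + x))"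
  using assms by (subst integral_distr) auto
 finally show ?thesis by simp
qed

lemma gderiv_line:
 assumes "!!x. GDERIV f x :> H x"
 shows "DERIV (%t. f (x + t *\<^sub>R e)) t :> H (x + t *\<^sub>R e) \<bullet> e"
proof -
 have "((%t. x + t *\<^sub>R e) has_derivative (%h. h *\<^sub>R e)) (at t)"
  by (auto intro!: derivative_eq_intros)
 from diff_chain_at[OF this, of f "%h. h \<bullet> H (x + t *\<^sub>R e)"] assms[of "x + t *\<^sub>R e"]
 show ?thesis unfolding gderiv_def has_field_derivative_def
  by (simp add: o_def inner_commute mult_commute_abs)
qed

text \<open>By translation invariance the difference quotients of \<open>f\<close> in direction
  \<open>e\<close> have integral 0. They are bounded by the mean value theorem, live on a fixed
  ball, and converge to the directional derivative, so dominated convergence applies.\<close>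

lemma integral_gradient_zero:
 fixes f :: "'a::euclidean_space => real"
 assumes "C1_test UNIV f H"
 shows "(LINT x|lborel. H x \<bullet> e) = 0"
proof -
 obtain K where K: "compact K" "!!x. x \<notin> K ==> f x = 0" "!!x. x \<notin> K ==> H x = 0"
  "!!x. GDERIV f x :> H x" "continuous_on UNIV H" "continuous_on UNIV f"
  using assms by (elim C1_testE) blast
 have fm: "f \<in> borel_measurable borel" using K(6) by (rule borel_measurable_continuous_onI)
 have fi: "integrable lborel f"
  by (rule integrable_compact_support[OF K(1)]) (use K in \<open>auto intro: continuous_on_subset\<close>)
 define s where "s n x = real (Suc n) * (f (x + (1 / real (Suc n)) *\<^sub>R e) - f x)" for n x
 have "bounded (H ` K)" using K(1,5) by (meson compact_continuous_image compact_imp_bounded continuous_on_subset subset_UNIV)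
 then obtain B where B: "!!x. x \<in> K ==> norm (H x) <= B" "B > 0" by (auto simp: bounded_pos)
 have B': "norm (H x) <= B" for x using B K(3)[of x] by (cases "x \<in> K") auto
 obtain R where R: "R > 0" "!!x. x \<in> K ==> norm x <= R"
  using compact_imp_bounded[OF K(1)] by (auto simp: bounded_pos)
 have zero: "f y = 0" if "norm y > R" for y using that R(2)[of y] K(2)[of y] by force
 have sb: "norm (s n x) <= indicator (cball 0 (R + norm e)) x *\<^sub>R (B * norm e)" for n x
 proof (cases "norm x <= R + norm e")
  case False
  have "norm x <= norm (x + (1 / real (Suc n)) *\<^sub>R e) + norm ((1 / real (Suc n)) *\<^sub>R e)"
   by (metis add_diff_cancel norm_triangle_sub norm_minus_commute diff_add_cancel norm_triangle_ineq4)
  also have "norm ((1 / real (Suc n)) *\<^sub>R e) <= 1 * norm e"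
   unfolding norm_scaleR by (intro mult_right_mono) auto
  finally have "norm (x + (1 / real (Suc n)) *\<^sub>R e) > R" using False by simp
  moreover have "norm x > R" using False norm_ge_zero[of e] by linarith
  ultimately have "s n x = 0" by (simp add: s_def zero)
  then show ?thesis using B(2) by (simp add: indicator_def)
 next
  case True
  define d where "d = 1 / real (Suc n)"
  have d: "d > 0" by (simp add: d_def)
  obtain t where t: "0 < t" "t < d" "f (x + d *\<^sub>R e) - f (x + 0 *\<^sub>R e) = (d - 0) * (H (x + t *\<^sub>R e) \<bullet> e)"
   using MVT2[OF d, of "%t. f (x + t *\<^sub>R e)", OF gderiv_line[OF K(4)]] by blast
  then have "s n x = H (x + t *\<^sub>R e) \<bullet> e" by (simp add: s_def d_def field_simps)
  then have "norm (s n x) <= norm (H (x + t *\<^sub>R e)) * norm e" by (simp add: Cauchy_Schwarz_ineq2)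
  also have "... <= B * norm e" by (intro mult_right_mono B') auto
  finally show ?thesis using True by (simp add: indicator_def)
 qed
 have lim: "(%n. s n x) \<longlonglongrightarrow> H x \<bullet> e" for x
 proof -
  have "DERIV (%t. f (x + t *\<^sub>R e)) 0 :> H x \<bullet> e"
   using gderiv_line[OF K(4), of x e 0] by simp
  then have "((%h. (f (x + h *\<^sub>R e) - f x) / h) \<longlongrightarrow> H x \<bullet> e) (at 0)" by (simp add: DERIV_def)
  moreover have "filterlim (%n. 1 / real (Suc n)) (at 0) sequentially"
   by (intro filterlim_atI LIMSEQ_Suc lim_1_over_n) auto
  ultimately have "(%n. (f (x + (1 / real (Suc n)) *\<^sub>R e) - f x) / (1 / real (Suc n))) \<longlonglongrightarrow> H x \<bullet> e"
   by (rule filterlim_compose)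
  then show ?thesis by (simp add: s_def field_simps)
 qed
 have "(%n. LINT x|lborel. s n x) \<longlonglongrightarrow> (LINT x|lborel. H x \<bullet> e)"
 proof (rule integral_dominated_convergence)
  show "(%x. H x \<bullet> e) \<in> borel_measurable lborel"
   using K(5) by (auto intro!: borel_measurable_continuous_onI continuous_intros)
  show "!!n. s n \<in> borel_measurable lborel" unfolding s_def
   using K(6) by (auto intro!: borel_measurable_continuous_onI continuous_intros
     continuous_on_compose2[of UNIV f])
  show "integrable lborel (%x. indicator (cball 0 (R + norm e)) x *\<^sub>R (B * norm e))"
   by (rule borel_integrable_compact) auto
 qed (use lim sb in auto)
 moreover have "(LINT x|lborel. s n x) = 0" for n
 proof -
  have "(LINT x|lborel. f (x + (1 / real (Suc n)) *\<^sub>R e)) = (LINT x|lborel. f x)"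
   using integral_translate[OF fm, of "(1 / real (Suc n)) *\<^sub>R e"] by (simp add: add.commute)
  moreover have "integrable lborel (%x. f (x + (1 / real (Suc n)) *\<^sub>R e))"
   using fi lborel_distr_plus[of "(1 / real (Suc n)) *\<^sub>R e"] fm
   by (subst (asm) lborel_distr_plus[of "(1 / real (Suc n)) *\<^sub>R e", symmetric])
    (subst (asm) integrable_distr_eq, auto simp: add.commute)
  ultimately show ?thesis unfolding s_def using fi by simp
 qed
 ultimately show ?thesis by (simp add: LIMSEQ_const_iff)
qed

text \<open>Integration by parts in each coordinate: the product of \<open>phi\<close> with a
  component of \<open>G\<close> is again a test function, so its partial derivative has integral 0.
  Summing over the basis gives the weak identity.\<close>

lemma weak_lap_C2:
 fixes v :: "'a::euclidean_space => real"
 assumes op: "open Om" and dv: "!!x. x \<in> Om ==> GDERIV v x :> G x"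
  and dG: "!!x i. i \<in> Basis ==> x \<in> Om ==> GDERIV (%x. G x \<bullet> i) x :> D i x"
  and cD: "!!i. i \<in> Basis ==> continuous_on Om (D i)"
  and g: "!!x. x \<in> Om ==> g x = (\<Sum>i\<in>Basis. D i x \<bullet> i)"
 shows "weak_lap Om v G g"
proof -
 have cGi: "continuous_on Om (%x. G x \<bullet> i)" if "i \<in> Basis" for i
  by (rule gderiv_continuous_on[OF dG[OF that]])
 have cG: "continuous_on Om G" by (rule continuous_on_componentwise[THEN iffD2]) (use cGi in auto)
 have "continuous_on Om (%x. \<Sum>i\<in>Basis. D i x \<bullet> i)" using cD by (intro continuous_intros)
 then have cg: "continuous_on Om g" by (rule continuous_on_eq) (simp add: g)
 have "(LINT x|lborel. G x \<bullet> H x + g x * phi x) = 0" if t: "C1_test Om phi H" for phi H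
 proof -
  have ti: "C1_test Om (%x. (G x \<bullet> i) * phi x) (%x. (G x \<bullet> i) *\<^sub>R H x + phi x *\<^sub>R D i x)"
   if "i \<in> Basis" for i
   by (rule C1_test_mult[OF t op dG[OF that] cD[OF that]])
  have eq: "G x \<bullet> H x + g x * phi x = (\<Sum>i\<in>Basis. ((G x \<bullet> i) *\<^sub>R H x + phi x *\<^sub>R D i x) \<bullet> i)" for x
  proof (cases "x \<in> Om")
   case True
   have "(\<Sum>i\<in>Basis. ((G x \<bullet> i) *\<^sub>R H x + phi x *\<^sub>R D i x) \<bullet> i)
    = (\<Sum>i\<in>Basis. (G x \<bullet> i) * (H x \<bullet> i)) + phi x * (\<Sum>i\<in>Basis. D i x \<bullet> i)"
    by (simp add: inner_add_left sum.distrib sum_distrib_left)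
   then show ?thesis using g[OF True] by (simp add: euclidean_inner[of "G x" "H x"])
  next
   case False
   then have "phi x = 0" "H x = 0" using t unfolding C1_test_def by blast+
   then show ?thesis by simp
  qed
  have int: "integrable lborel (%x. ((G x \<bullet> i) *\<^sub>R H x + phi x *\<^sub>R D i x) \<bullet> i)" if "i \<in> Basis" for i
   using integrable_test(2)[OF ti[OF that], of "%_. i" "%_. 0"] by (simp add: inner_commute)
  have "(LINT x|lborel. ((G x \<bullet> i) *\<^sub>R H x + phi x *\<^sub>R D i x) \<bullet> i) = 0" if "i \<in> Basis" for i
   by (rule integral_gradient_zero[OF C1_test_mono[OF ti[OF that]]]) auto
  then show ?thesis unfolding eq using int by (subst Bochner_Integration.integral_sum) auto
 qed
 then show ?thesis unfolding weak_lap_def using op dv cG cg by blast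
qed

lemma gderiv_ln_norm:
 fixes x :: "'a::euclidean_space"
 assumes "x ~= 0"
 shows "GDERIV (%x. ln (norm x)) x :> (1 / (norm x)^2) *\<^sub>R x"
proof -
 have "DERIV ln (norm x) :> 1 / norm x"
  using assms by (auto intro!: derivative_eq_intros)
 from gderiv_chain[OF GDERIV_norm[OF assms] this] show ?thesis
  by (simp add: sgn_div_norm power2_eq_square divide_inverse)
qed

text \<open>The parameters are logarithms of the radii, so that dilations become translations and
  the radial equation becomes autonomous up to a linear term.\<close>

definition annulus :: "real => real => 'a::euclidean_space set" where
 "annulus a b = {x. exp a < norm x & norm x < exp b}"

lemma annulus_iff: "x \<in> annulus a b \<longleftrightarrow> x ~= 0 & a < ln (norm x) & ln (norm x) < b"
proof (cases "x = 0")
 case False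
 then have "norm x = exp (ln (norm x))" by simp
 then show ?thesis using False unfolding annulus_def by (metis (mono_tags) exp_less_cancel_iff mem_Collect_eq)
qed (auto simp: annulus_def)

lemma open_annulus [simp]: "open (annulus a b :: 'a::euclidean_space set)"
proof -
 have "annulus a b = {x::'a. exp a < norm x} \<inter> {x. norm x < exp b}" by (auto simp: annulus_def)
 then show ?thesis by (simp add: open_Int open_Collect_less continuous_on_norm_id)
qed

lemma annulus_nonzero: "annulus a b \<subseteq> - {0}" by (auto simp: annulus_iff)

text \<open>In the variable \<open>t = ln (norm x)\<close> the Laplacian of a radial function is
  \<open>(xi'' + (N - 2) xi') / (norm x)^2\<close>, where N is the dimension. Writing the gradient
  as \<open>psi t\<close> times \<open>x\<close> with \<open>psi t = xi1 t * exp (- 2 * t)\<close>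
  makes its components products of a radial function and a linear one.\<close>

lemma weak_lap_radial:
 fixes xi xi1 xi2 :: "real => real"
 assumes d1: "!!t. a < t ==> t < b ==> DERIV xi t :> xi1 t"
  and d2: "!!t. a < t ==> t < b ==> DERIV xi1 t :> xi2 t"
  and c2: "continuous_on {a<..<b} xi2"
 shows "weak_lap (annulus a b :: 'a::euclidean_space set) (%x. xi (ln (norm x)))
  (%x. (xi1 (ln (norm x)) / (norm x)^2) *\<^sub>R x)
  (%x. (xi2 (ln (norm x)) + (real DIM('a) - 2) * xi1 (ln (norm x))) / (norm x)^2)"
proof -
 let ?A = "annulus a b :: 'a set"
 define psi where "psi t = xi1 t * exp (- 2 * t)" for t
 define psi1 where "psi1 t = (xi2 t - 2 * xi1 t) * exp (- 2 * t)" for t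
 have ex: "exp (- 2 * ln (norm x)) = 1 / (norm x)^2" if "x ~= 0" for x :: 'a
  using that by (simp add: exp_minus inverse_eq_divide exp_double)
 have dp: "DERIV psi t :> psi1 t" if "a < t" "t < b" for t
  unfolding psi_def psi1_def using d2[OF that] by (auto intro!: derivative_eq_intros simp: algebra_simps)
 have c1: "continuous_on {a<..<b} xi1"
  by (rule DERIV_continuous_on[of _ _ xi2]) (auto intro: has_field_derivative_at_within d2)
 have cp: "continuous_on {a<..<b} psi1" unfolding psi1_def using c1 c2 by (intro continuous_intros)
 have cl: "continuous_on ?A (%x. ln (norm x))"
  by (intro continuous_intros) (auto simp: annulus_iff)
 have cpl: "continuous_on ?A (%x. psi1 (ln (norm x)))"
  by (rule continuous_on_compose2[OF cp cl]) (auto simp: annulus_iff)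
 have dpl: "GDERIV (%x. psi (ln (norm x))) x :> (psi1 (ln (norm x)) / (norm x)^2) *\<^sub>R x" if "x \<in> ?A" for x
  using gderiv_chain[OF gderiv_ln_norm dp] that by (auto simp: annulus_iff)
 have cpl0: "continuous_on ?A (%x. psi (ln (norm x)))" by (rule gderiv_continuous_on[OF dpl])
 define D where "D i x = (x \<bullet> i) *\<^sub>R ((psi1 (ln (norm x)) / (norm x)^2) *\<^sub>R x) + psi (ln (norm x)) *\<^sub>R i"
  for i x :: 'a
 have Gi: "GDERIV (%x. psi (ln (norm x)) *\<^sub>R x \<bullet> i) x :> D i x" if "x \<in> ?A" for x i
 proof -
  have "GDERIV (%x. x \<bullet> i) x :> i" unfolding gderiv_def by (auto intro!: derivative_eq_intros)
  from GDERIV_mult[OF dpl[OF that] this] show ?thesis unfolding D_def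
   by (simp add: add.commute)
 qed
 have "weak_lap ?A (%x. xi (ln (norm x))) (%x. psi (ln (norm x)) *\<^sub>R x)
  (%x. (xi2 (ln (norm x)) + (real DIM('a) - 2) * xi1 (ln (norm x))) / (norm x)^2)"
 proof (rule weak_lap_C2[where D = D])
  show "GDERIV (%x. xi (ln (norm x))) x :> psi (ln (norm x)) *\<^sub>R x" if "x \<in> ?A" for x
   using gderiv_chain[OF gderiv_ln_norm d1] that ex[of x] by (auto simp: annulus_iff psi_def)
  show "continuous_on ?A (D i)" for i unfolding D_def
   using cpl cpl0 by (intro continuous_intros) (auto simp: annulus_iff)
  show "(xi2 (ln (norm x)) + (real DIM('a) - 2) * xi1 (ln (norm x))) / (norm x)^2 = (\<Sum>i\<in>Basis. D i x \<bullet> i)"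
   if "x \<in> ?A" for x
  proof -
   have x: "x ~= 0" using that by (simp add: annulus_iff)
   have "(\<Sum>i\<in>Basis. D i x \<bullet> i) = psi1 (ln (norm x)) / (norm x)^2 * (\<Sum>i\<in>Basis. (x \<bullet> i) * (x \<bullet> i))
    + psi (ln (norm x)) * (\<Sum>i\<in>Basis. i \<bullet> (i::'a))"
    unfolding D_def sum_distrib_left sum.distrib[symmetric]
    by (intro sum.cong refl) (simp add: inner_add_left)
   also have "(\<Sum>i\<in>Basis. (x \<bullet> i) * (x \<bullet> i)) = (norm x)^2"
    by (simp add: euclidean_inner[of x x, symmetric] power2_norm_eq_inner)
   also have "(\<Sum>i\<in>Basis. i \<bullet> (i::'a)) = real DIM('a)" by simp
   finally show ?thesis using x ex[OF x] by (simp add: psi_def psi1_def field_simps)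
  qed
 qed (use Gi in auto)
 then show ?thesis
  by (rule weak_lap_cong) (use ex in \<open>auto simp: annulus_iff psi_def\<close>)
qed

section \<open>Invariance under similarities\<close>

lemma nn_integral_affine:
 fixes t :: "'a::euclidean_space"
 assumes f: "f \<in> borel_measurable borel" and c: "abs c = 1"
 shows "(\<integral>\<^sup>+x. f (t + c *\<^sub>R x) \<partial>lborel) = (\<integral>\<^sup>+x. f x \<partial>lborel)"
proof -
 have "c ~= 0" using c by auto
 then have "(\<integral>\<^sup>+x. f x \<partial>lborel) = (\<integral>\<^sup>+x. f x \<partial>distr lborel borel (%x. t + c *\<^sub>R x))"
  using lborel_affine[of c t] c by (simp add: density_1)
 also have "... = (\<integral>\<^sup>+x. f (t + c *\<^sub>R x) \<partial>lborel)"
  using f by (subst nn_integral_distr) auto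
 finally show ?thesis by simp
qed

text \<open>Uniqueness of Haar measure, comparing Lebesgue measure and its image on a ball, which is
 invariant under \<open>T\<close>.\<close>

lemma distr_orthogonal_transformation:
 fixes T :: "'a::euclidean_space => 'a"
 assumes T: "orthogonal_transformation T"
 shows "distr lborel borel T = lborel"
proof -
 have lin: "linear T" using T by (rule orthogonal_transformation_linear)
 have cT: "continuous_on UNIV T" using lin by (simp add: linear_continuous_on linear_conv_bounded_linear)
 have [measurable]: "T \<in> borel_measurable borel" by (rule borel_measurable_continuous_onI[OF cT])
 have surj: "T (inv T y) = y" for y by (rule surj_f_inv_f[OF orthogonal_transformation_surj[OF T]])
 have "(\<integral>\<^sup>+x. f (T x) \<partial>lborel) = (\<integral>\<^sup>+x. f x \<partial>lborel)"
  if [measurable]: "f \<in> borel_measurable borel" for f :: "'a => ennreal"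
 proof -
  \<comment> \<open>The double integral of \<open>f (T x) * g (T x + y)\<close> is evaluated in two
    ways. Integrating over \<open>y\<close> first gives the volume \<open>c\<close> of the ball.
    Exchanging the order and translating \<open>x\<close> by the preimage of \<open>y\<close>
    replaces it by \<open>f (T x - y) * g (T x)\<close>, where \<open>g (T x) = g x\<close>, and
    integrating over \<open>y\<close> now leaves the integral of \<open>f\<close>.\<close>
  define g :: "'a => ennreal" where "g = indicator (ball 0 1)"
  have [measurable]: "g \<in> borel_measurable borel" unfolding g_def by (rule borel_measurable_indicator) simp
  have gT: "g (T x) = g x" for x
   using orthogonal_transformation_norm[OF T, of x] by (simp add: g_def indicator_def)
  define c where "c = (\<integral>\<^sup>+x. g x \<partial>(lborel::'a measure))"
  have "c = emeasure lborel (ball (0::'a) 1)" by (simp add: c_def g_def)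
  moreover have "emeasure lborel (ball (0::'a) 1) ~= 0"
  proof
   assume "emeasure lborel (ball (0::'a) 1) = 0"
   then have "ball (0::'a) 1 \<in> null_sets lborel" by (simp add: null_sets_def)
   then have "negligible (ball (0::'a) 1)" using negligible_iff_null_sets null_sets_completionI by blast
   then show False using open_not_negligible[of "ball (0::'a) 1"] by simp
  qed
  ultimately have c: "c ~= 0" "c ~= \<infinity>" using emeasure_lborel_ball_finite[of "0::'a" 1] by auto
  have "(\<integral>\<^sup>+x. f (T x) \<partial>lborel) * c = (\<integral>\<^sup>+x. f (T x) * c \<partial>lborel)"
   by (simp add: nn_integral_multc)
  also have "... = (\<integral>\<^sup>+x. f (T x) * (\<integral>\<^sup>+y. g (T x + 1 *\<^sub>R y) \<partial>lborel) \<partial>lborel)"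
   unfolding c_def by (subst nn_integral_affine) auto
  also have "... = (\<integral>\<^sup>+x. \<integral>\<^sup>+y. f (T x) * g (T x + y) \<partial>lborel \<partial>lborel)"
   by (simp add: nn_integral_cmult)
  also have "... = (\<integral>\<^sup>+y. \<integral>\<^sup>+x. f (T x) * g (T x + y) \<partial>lborel \<partial>lborel)"
   by (rule lborel_pair.Fubini') measurable
  also have "... = (\<integral>\<^sup>+y. \<integral>\<^sup>+x. f (T x - y) * g (T x) \<partial>lborel \<partial>lborel)"
  proof (rule nn_integral_cong)
   fix y
   have "T (- inv T y + 1 *\<^sub>R x) = T x - y" for x
    using linear_add[OF lin, of "- inv T y" x] linear_neg[OF lin, of "inv T y"] surj[of y] by simp
   then show "(\<integral>\<^sup>+x. f (T x) * g (T x + y) \<partial>lborel) = (\<integral>\<^sup>+x. f (T x - y) * g (T x) \<partial>lborel)"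
    using nn_integral_affine[of "%x. f (T x) * g (T x + y)" 1 "- inv T y"] by simp
  qed
  also have "... = (\<integral>\<^sup>+x. \<integral>\<^sup>+y. f (T x - y) * g (T x) \<partial>lborel \<partial>lborel)"
   by (rule lborel_pair.Fubini') measurable
  also have "... = (\<integral>\<^sup>+x. (\<integral>\<^sup>+y. f (T x + (-1) *\<^sub>R y) \<partial>lborel) * g x \<partial>lborel)"
   by (simp add: nn_integral_multc gT)
  also have "... = (\<integral>\<^sup>+x. f x \<partial>lborel) * c"
   by (subst nn_integral_affine) (auto simp: nn_integral_cmult c_def)
  finally show ?thesis using c mult_divide_eq_ennreal[of c] by (metis infinity_ennreal_def)
 qed
 note inv = this
 show ?thesis
 proof (rule measure_eqI)
  fix A assume "A \<in> sets (distr lborel borel T)"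
  then have A[measurable]: "A \<in> sets borel" by simp
  have "emeasure (distr lborel borel T) A = (\<integral>\<^sup>+x. indicator A (T x) \<partial>lborel)"
  proof -
   have "emeasure (distr lborel borel T) A = (\<integral>\<^sup>+x. indicator A x \<partial>distr lborel borel T)" by simp
   also have "... = (\<integral>\<^sup>+x. indicator A (T x) \<partial>lborel)" by (rule nn_integral_distr) auto
   finally show ?thesis .
  qed
  also have "... = emeasure lborel A" using inv[of "indicator A"] by simp
  finally show "emeasure (distr lborel borel T) A = emeasure lborel A" .
 qed simp
qed

lemma integral_similarity:
 fixes F :: "'a::euclidean_space => real" and T :: "'a => 'a"
 assumes F: "F \<in> borel_measurable borel" and c: "c > 0" and T: "orthogonal_transformation T"
 shows "(LINT x|lborel. F x) = c ^ DIM('a) * (LINT x|lborel. F (x0 + c *\<^sub>R T x))"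
proof -
 have lin: "linear T" using T by (rule orthogonal_transformation_linear)
 have "continuous_on UNIV T" using lin by (simp add: linear_continuous_on linear_conv_bounded_linear)
 then have [measurable]: "T \<in> borel_measurable borel" by (rule borel_measurable_continuous_onI)
 note [measurable] = F
 have "(LINT x|lborel. F x) = (LINT x|density (distr lborel borel (%x. x0 + c *\<^sub>R x)) (%_. abs c^DIM('a)). F x)"
  using lborel_affine[of c x0] c by simp
 also have "... = c ^ DIM('a) * (LINT x|lborel. F (x0 + c *\<^sub>R x))"
  using c by (subst integral_density) (auto simp: integral_distr)
 also have "(LINT x|lborel. F (x0 + c *\<^sub>R x)) = (LINT x|distr lborel borel T. F (x0 + c *\<^sub>R x))"
  by (simp add: distr_orthogonal_transformation[OF T])
 also have "... = (LINT x|lborel. F (x0 + c *\<^sub>R T x))" by (subst integral_distr) auto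
 finally show ?thesis .
qed

lemma gderiv_similarity:
 fixes v :: "'a::euclidean_space => real" and T :: "'a => 'a"
 assumes "GDERIV v (x0 + c *\<^sub>R T x) :> G" "orthogonal_transformation T"
 shows "GDERIV (%x. v (x0 + c *\<^sub>R T x)) x :> c *\<^sub>R inv T G"
proof -
 have T: "linear T" "!!x y. T x \<bullet> T y = x \<bullet> y" using assms(2) by (auto simp: orthogonal_transformation_def)
 have surj: "T (inv T y) = y" for y by (rule surj_f_inv_f[OF orthogonal_transformation_surj[OF assms(2)]])
 have bl: "bounded_linear T" using T(1) by (simp add: linear_conv_bounded_linear)
 have "((%x. x0 + c *\<^sub>R T x) has_derivative (%h. c *\<^sub>R T h)) (at x)"
  by (auto intro!: derivative_eq_intros bounded_linear.has_derivative[OF bl])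
 from diff_chain_at[OF this, of v "%h. h \<bullet> G"] assms(1)
 have "((%x. v (x0 + c *\<^sub>R T x)) has_derivative (%h. c *\<^sub>R T h \<bullet> G)) (at x)"
  by (simp add: gderiv_def o_def)
 moreover have "(%h. c *\<^sub>R T h \<bullet> G) = (%h. h \<bullet> (c *\<^sub>R inv T G))"
  using T(2)[of _ "inv T G"] surj[of G] by (simp add: fun_eq_iff)
 ultimately show ?thesis unfolding gderiv_def by simp
qed

text \<open>A test function for the transformed problem is pulled back by the inverse similarity
  \<open>S'\<close>. The Jacobian is harmless because the tested integral is 0. The gradient of the
  pulled back function carries \<open>1 / c\<close> and that of the transformed function
  \<open>c\<close>, which accounts for the factor \<open>c^2\<close> in front of
  \<open>g\<close>.\<close>

lemma weak_lap_similarity: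
 fixes v :: "'a::euclidean_space => real" and T :: "'a => 'a"
 assumes v: "weak_lap Om v G g" and c: "c > 0" and T: "orthogonal_transformation T"
 shows "weak_lap ((%x. x0 + c *\<^sub>R T x) -` Om) (%x. v (x0 + c *\<^sub>R T x))
  (%x. c *\<^sub>R inv T (G (x0 + c *\<^sub>R T x))) (%x. c\<^sup>2 * g (x0 + c *\<^sub>R T x))"
proof -
 define S where "S x = x0 + c *\<^sub>R T x" for x
 define S' where "S' y = - (1/c) *\<^sub>R inv T x0 + (1/c) *\<^sub>R inv T y" for y
 have T': "orthogonal_transformation (inv T)" by (rule orthogonal_transformation_inv[OF T])
 have lin: "linear T" "linear (inv T)" using T T' by (auto intro: orthogonal_transformation_linear)
 have cont: "continuous_on A T" "continuous_on A (inv T)" for A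
  using lin by (simp_all add: linear_continuous_on linear_conv_bounded_linear)
 have surj: "T (inv T y) = y" for y by (rule surj_f_inv_f[OF orthogonal_transformation_surj[OF T]])
 have inj: "inv T (T y) = y" for y by (rule inv_f_f[OF orthogonal_transformation_inj[OF T]])
 have iinv: "inv (inv T) = T" by (rule inv_inv_eq[OF orthogonal_transformation_bij[OF T]])
 have SS': "S (S' y) = y" for y
  using c by (simp add: S_def S'_def linear_add[OF lin(1)] linear_diff[OF lin(1)] linear_cmul[OF lin(1)]
    linear_neg[OF lin(1)] surj scaleR_diff_right)
 have S'S: "S' (S x) = x" for x
  using c by (simp add: S_def S'_def linear_add[OF lin(2)] linear_cmul[OF lin(2)] inj algebra_simps)
 have cS: "continuous_on A S" "continuous_on A S'" for A
  unfolding S_def S'_def by (intro continuous_intros cont)+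
 have op: "open Om" and dv: "!!x. x \<in> Om ==> GDERIV v x :> G x" and cG: "continuous_on Om G"
  and cg: "continuous_on Om g" using v by (auto simp: weak_lap_def)
 have zero: "(LINT x|lborel. c *\<^sub>R inv T (G (S x)) \<bullet> H x + c^2 * g (S x) * phi x) = 0"
  if t: "C1_test (S -` Om) phi H" for phi H
 proof -
  obtain K where K: "compact K" "K \<subseteq> S -` Om" "!!x. x \<notin> K ==> phi x = 0" "!!x. x \<notin> K ==> H x = 0"
   "!!x. GDERIV phi x :> H x" "continuous_on UNIV H" "continuous_on UNIV phi"
   using t by (elim C1_testE) blast
  define H' where "H' y = (1/c) *\<^sub>R T (H (S' y))" for y
  have "GDERIV (%y. phi (S' y)) y :> H' y" for y
  proof -
   have "GDERIV (%y. phi (- (1/c) *\<^sub>R inv T x0 + (1/c) *\<^sub>R inv T y)) y :> (1/c) *\<^sub>R inv (inv T) (H (S' y))"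
    by (rule gderiv_similarity[OF _ T']) (use K(5)[of "S' y"] in \<open>simp add: S'_def\<close>)
   then show ?thesis by (simp add: H'_def S'_def iinv)
  qed
  moreover have "continuous_on UNIV H'" unfolding H'_def
   by (intro continuous_intros continuous_on_compose2[OF cont(1)[of UNIV]] continuous_on_compose2[OF K(6)] cS) auto
  moreover have "compact (S ` K)" by (rule compact_continuous_image[OF cS(1) K(1)])
  moreover have "S ` K \<subseteq> Om" using K(2) by auto
  moreover have "phi (S' y) = 0 & H' y = 0" if "y \<notin> S ` K" for y
  proof -
   have "S' y \<notin> K" using that SS'[of y] by (metis imageI)
   then show ?thesis using K(3,4) linear_0[OF lin(1)] by (simp add: H'_def)
  qed
  ultimately have t': "C1_test Om (%y. phi (S' y)) H'" unfolding C1_test_def by blast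
  define F where "F y = G y \<bullet> H' y + g y * phi (S' y)" for y
  have "integrable lborel F" unfolding F_def by (rule integrable_test(1)[OF t' cG cg])
  then have "F \<in> borel_measurable borel" by (simp add: borel_measurable_integrable)
  then have "(LINT x|lborel. F (S x)) = 0"
   using integral_similarity[of F c T x0] c T v t' unfolding F_def S_def weak_lap_def by auto
  moreover have "c\<^sup>2 * F (S x) = c *\<^sub>R inv T (G (S x)) \<bullet> H x + c^2 * g (S x) * phi x" for x
  proof -
   have "G (S x) \<bullet> T (H x) = inv T (G (S x)) \<bullet> H x"
    using T surj[of "G (S x)"] unfolding orthogonal_transformation_def by metis
   then show ?thesis using c by (simp add: F_def H'_def S'S power2_eq_square algebra_simps)
  qed
  moreover from calculation(1) have "(LINT x|lborel. c\<^sup>2 * F (S x)) = 0" by simp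
  ultimately show ?thesis by simp
 qed
 have "open (S -` Om)" by (rule open_vimage[OF op cS(1)])
 moreover have "GDERIV (%x. v (S x)) x :> c *\<^sub>R inv T (G (S x))" if "x \<in> S -` Om" for x
  using gderiv_similarity[OF _ T, of v x0 c x] dv that by (simp add: S_def)
 moreover have "continuous_on (S -` Om) (%x. c *\<^sub>R inv T (G (S x)))"
  by (intro continuous_intros continuous_on_compose2[OF cont(2)[of UNIV]] continuous_on_compose2[OF cG] cS) auto
 moreover have "continuous_on (S -` Om) (%x. c\<^sup>2 * g (S x))"
  by (intro continuous_intros continuous_on_compose2[OF cg] cS) auto
 ultimately show ?thesis using zero unfolding weak_lap_def S_def by blast
qed

section \<open>The equation for the logarithm of a solution\<close>

locale params =
 fixes rho lam tau th q :: real
 assumes q: "q > 1" and tau: "0 <= tau" "tau < 1"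
begin

text \<open>This is \<open>f_rho\<close> reflected, \<open>F y = f_rho rho lam tau (- y)\<close>:
  the argument \<open>y\<close> is the exponent of a power of \<open>norm x\<close>, not its
  negative.\<close>

definition F :: "real => real" where
 "F y = y^2 - 2 * rho * y + lam * abs y powr (1 - tau)"

definition gm :: real where "gm = - beta_exp th q"

lemma f_rho_beta: "f_rho rho lam tau (beta_exp th q) = F gm"
 by (simp add: f_rho_def F_def gm_def power2_eq_square algebra_simps)

lemma theta: "th + 2 = - (q - 1) * gm"
 using q by (simp add: gm_def beta_exp_def field_simps)

lemma F_0 [simp]: "F 0 = 0" by (simp add: F_def)

lemma continuous_F [continuous_intros]:
 assumes "continuous_on S f" shows "continuous_on S (%x. F (f x))"
 unfolding F_def using tau assms by (intro continuous_intros continuous_on_powr') auto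

text \<open>With \<open>u = exp z\<close> and \<open>p\<close> the gradient of \<open>z\<close>, the value prescribed by the equation for the
 Laplacian of \<open>z\<close>. The positive factor \<open>mu\<close> in front of the nonlinearity appears under scaling.\<close>

definition log_rhs :: "real => 'a::euclidean_space => real => 'a => real" where
 "log_rhs mu x z p = (mu * norm x powr (th + 2) * exp ((q - 1) * z) - (norm x * norm p)^2
  + (real DIM('a) - 2 + 2 * rho) * (x \<bullet> p) - lam * (norm x * norm p) powr (1 - tau)) / (norm x)^2"

definition log_sol :: "real => 'a::euclidean_space set => ('a => real) => ('a => 'a) => bool" where
 "log_sol mu Om z G \<longleftrightarrow> Om \<subseteq> - {0} & weak_lap Om z G (%x. log_rhs mu x (z x) (G x))"

lemma log_solD:
 assumes "log_sol mu Om z G"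
 shows "open Om" "!!x. x \<in> Om ==> x ~= 0" "!!x. x \<in> Om ==> GDERIV z x :> G x"
  "continuous_on Om G" "continuous_on Om z" "weak_lap Om z G (%x. log_rhs mu x (z x) (G x))"
 using assms gderiv_continuous_on[of Om z G] unfolding log_sol_def weak_lap_def by auto

lemma log_sol_subset: "log_sol mu Om z G ==> open Om' ==> Om' \<subseteq> Om ==> log_sol mu Om' z G"
 unfolding log_sol_def by (meson order.trans weak_lap_subset)

lemma log_rhs_diff:
 "log_rhs mu x z p - log_rhs mu x z' p
  = mu * norm x powr (th + 2) * (exp ((q - 1) * z) - exp ((q - 1) * z')) / (norm x)^2"
 by (simp add: log_rhs_def diff_divide_distrib[symmetric] algebra_simps)

lemma log_rhs_less:
 assumes "mu > 0" "x ~= 0" "z' < z"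
 shows "log_rhs mu x z' p < log_rhs mu x z p"
proof -
 have "exp ((q - 1) * z') < exp ((q - 1) * z)" using assms q by simp
 then have "log_rhs mu x z p - log_rhs mu x z' p > 0"
  unfolding log_rhs_diff using assms by (intro divide_pos_pos mult_pos_pos) auto
 then show ?thesis by simp
qed

lemma log_rhs_radial:
 fixes x :: "'a::euclidean_space"
 assumes "x ~= 0"
 shows "log_rhs mu x z ((y / (norm x)^2) *\<^sub>R x)
  = (mu * exp ((q - 1) * (z - gm * ln (norm x))) - F y + (real DIM('a) - 2) * y) / (norm x)^2"
proof -
 have 1: "norm x * norm ((y / (norm x)^2) *\<^sub>R x) = abs y"
  using assms by (simp add: power2_eq_square)
 have 2: "x \<bullet> ((y / (norm x)^2) *\<^sub>R x) = y" using assms by (simp add: power2_norm_eq_inner)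
 have "norm x powr (th + 2) = exp (- (q - 1) * gm * ln (norm x))"
  using assms by (simp add: theta powr_def)
 then have "mu * norm x powr (th + 2) * exp ((q - 1) * z) = mu * exp ((q - 1) * (z - gm * ln (norm x)))"
  by (simp add: exp_add[symmetric] algebra_simps)
 then show ?thesis unfolding log_rhs_def 1 2 F_def by (simp add: algebra_simps)
qed

lemma radial_log_sol:
 assumes d1: "!!t. a < t ==> t < b ==> DERIV xi t :> xi1 t"
  and d2: "!!t. a < t ==> t < b ==>
   DERIV xi1 t :> mu * exp ((q - 1) * (xi t - gm * t)) - F (xi1 t)"
 shows "log_sol mu (annulus a b :: 'a::euclidean_space set) (%x. xi (ln (norm x)))
  (%x. (xi1 (ln (norm x)) / (norm x)^2) *\<^sub>R x)"
proof -
 have c0: "continuous_on {a<..<b} xi"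
  by (rule DERIV_continuous_on[of _ _ xi1]) (auto intro: has_field_derivative_at_within d1)
 have c1: "continuous_on {a<..<b} xi1"
  by (rule DERIV_continuous_on[OF has_field_derivative_at_within[OF d2]]) auto
 have c2: "continuous_on {a<..<b} (%t. mu * exp ((q - 1) * (xi t - gm * t)) - F (xi1 t))"
  using c0 c1 by (intro continuous_intros)
 show ?thesis unfolding log_sol_def
  using weak_lap_radial[OF d1 d2 c2, where 'a = 'a] annulus_nonzero
  by (auto elim!: weak_lap_cong simp: annulus_iff log_rhs_radial)
qed

text \<open>All gradient terms are invariant under rotation, dilation and the addition of constants
  to \<open>z\<close>. Only the nonlinearity changes, and only by a constant factor, which
  \<open>mu\<close> absorbs.\<close>

lemma log_sol_similarity:
 fixes z :: "'a::euclidean_space => real" and T :: "'a => 'a"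
 assumes z: "log_sol mu Om z G" and c: "c > 0" and T: "orthogonal_transformation T"
 shows "log_sol (mu * c powr (th + 2) * exp ((q - 1) * k)) ((%x. c *\<^sub>R T x) -` Om)
  (%x. z (c *\<^sub>R T x) - k) (%x. c *\<^sub>R inv T (G (c *\<^sub>R T x)))"
proof -
 let ?Om = "(%x. c *\<^sub>R T x) -` Om"
 have T': "orthogonal_transformation (inv T)" by (rule orthogonal_transformation_inv[OF T])
 have surj: "T (inv T y) = y" for y by (rule surj_f_inv_f[OF orthogonal_transformation_surj[OF T]])
 have sub: "?Om \<subseteq> - {0}"
  using z linear_0[OF orthogonal_transformation_linear[OF T]] unfolding log_sol_def by auto
 have eq: "c\<^sup>2 * log_rhs mu (c *\<^sub>R T x) (z (c *\<^sub>R T x)) (G (c *\<^sub>R T x))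
  = log_rhs (mu * c powr (th + 2) * exp ((q - 1) * k)) x (z (c *\<^sub>R T x) - k) (c *\<^sub>R inv T (G (c *\<^sub>R T x)))"
  if "x ~= 0" for x
 proof -
  define P where "P = G (c *\<^sub>R T x)"
  have 1: "norm (c *\<^sub>R T x) = c * norm x" "norm (c *\<^sub>R inv T P) = c * norm P"
   using c orthogonal_transformation_norm[OF T] orthogonal_transformation_norm[OF T'] by auto
  have "T x \<bullet> P = x \<bullet> inv T P"
   using T surj[of P] unfolding orthogonal_transformation_def by metis
  then have 2: "c *\<^sub>R T x \<bullet> P = x \<bullet> c *\<^sub>R inv T P" by simp
  have 3: "(c * norm x) powr (th + 2) = c powr (th + 2) * norm x powr (th + 2)"
   using c by (simp add: powr_mult)
  have 4: "exp ((q - 1) * z (c *\<^sub>R T x)) = exp ((q - 1) * k) * exp ((q - 1) * (z (c *\<^sub>R T x) - k))"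
   by (simp add: exp_add[symmetric] algebra_simps)
  have 5: "c * norm x * norm P = norm x * (c * norm P)" by simp
  have 6: "c\<^sup>2 * (A / (c * norm x)^2) = A / (norm x)^2" for A
   using c by (simp add: power_mult_distrib)
  have 7: "mu * (a * b) * (d * e) = mu * a * d * b * e" for a b d e by simp
  show ?thesis unfolding log_rhs_def P_def[symmetric] 1 2 3 4 5 6 7 ..
 qed
 have w: "weak_lap Om z G (%x. log_rhs mu x (z x) (G x))" using z by (simp add: log_sol_def)
 have "weak_lap ?Om (%x. z (c *\<^sub>R T x) - k) (%x. c *\<^sub>R inv T (G (c *\<^sub>R T x)))
  (%x. c\<^sup>2 * log_rhs mu (c *\<^sub>R T x) (z (c *\<^sub>R T x)) (G (c *\<^sub>R T x)))"
  using weak_lap_add_const[OF weak_lap_similarity[OF w c T, of 0], of "- k"] by simp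
 then show ?thesis unfolding log_sol_def using sub
  by (auto elim!: weak_lap_cong simp: eq subset_iff)
qed

lemma annulus_max_principle:
 fixes s :: "'a::euclidean_space => real"
 assumes w: "weak_lap Om s G g" and sub: "!!x. exp a <= norm x ==> norm x <= exp b ==> x \<in> Om"
  and bd: "!!x. norm x = exp a \<or> norm x = exp b ==> s x <= M"
  and pos: "!!x. x \<in> annulus a b ==> s x > M ==> G x = 0 ==> g x > 0"
  and x: "exp a <= norm x" "norm x <= exp b"
 shows "s x <= M"
proof (rule ccontr)
 assume n: "\<not> s x <= M"
 define K where "K = {x::'a. exp a <= norm x} \<inter> cball 0 (exp b)"
 have K: "compact K" unfolding K_def
  by (intro closed_Int_compact closed_Collect_le continuous_intros) auto
 have int: "y \<in> annulus a b" if "y \<in> interior K" "s y >= s x" for y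
 proof -
  have "y \<in> K" using that interior_subset by blast
  then show ?thesis using bd[of y] that(2) n unfolding K_def annulus_def by fastforce
 qed
 have "annulus a b \<subseteq> interior K"
  by (rule interior_maximal[OF _ open_annulus]) (auto simp: K_def annulus_def)
 show False
 proof (rule max_principle[OF w K])
  show "x \<in> K" "K \<subseteq> Om" using x sub by (auto simp: K_def)
  show "s y < s x" if "y \<in> K" "y \<notin> interior K" for y
  proof -
   have "y \<notin> annulus a b" using that \<open>annulus a b \<subseteq> interior K\<close> by blast
   then have "s y <= M" using bd[of y] that(1) by (auto simp: K_def annulus_def)
   then show ?thesis using n by simp
  qed
  show "0 < g y" if "y \<in> interior K" "s x <= s y" "G y = 0" for y
   using pos[OF int[OF that(1,2)]] that n by simp
 qed
qed

text \<open>Where the gradients agree the two right-hand sides differ only in the exponential term.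
  Since \<open>M >= 0\<close>, a difference above \<open>M\<close> means \<open>z' < z\<close>, so
  the Laplacian of the difference is positive there and the maximum principle applies.\<close>

lemma log_sol_comparison:
 fixes z z' :: "'a::euclidean_space => real"
 assumes z: "log_sol mu Om z G" and z': "log_sol mu Om z' G'" and mu: "mu > 0"
  and sub: "!!x. exp a <= norm x ==> norm x <= exp b ==> x \<in> Om"
  and bd: "!!x. norm x = exp a \<or> norm x = exp b ==> z x - z' x <= M" and M: "M >= 0"
  and x: "exp a <= norm x" "norm x <= exp b"
 shows "z x - z' x <= M"
proof (rule annulus_max_principle[OF weak_lap_diff[OF log_solD(6)[OF z] log_solD(6)[OF z']] sub bd _ x])
 show "log_rhs mu x (z x) (G x) - log_rhs mu x (z' x) (G' x) > 0"
  if "x \<in> annulus a b" "M < z x - z' x" "G x - G' x = 0" for x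
  using log_rhs_less[OF mu, of x "z' x" "z x" "G x"] that M by (auto simp: annulus_iff)
qed auto

section \<open>Positive solutions and their logarithms\<close>

lemma grad_eq: "GDERIV f x :> D ==> grad f x = D"
 unfolding grad_def by (rule the_equality) (auto dest: gderiv_unique)

lemma C1_onD:
 assumes "C1_on S u"
 shows "x \<in> S ==> GDERIV u x :> grad u x" "continuous_on S (grad u)"
 using assms grad_eq unfolding C1_on_def by metis+

lemma C1_test_test_function: "C1_test (- {0}) phi H ==> test_function phi & grad phi = H"
proof
 assume t: "C1_test (- {0}) phi H"
 then have g: "!!x. GDERIV phi x :> H x" by (simp add: C1_test_def)
 then show eq: "grad phi = H" using grad_eq by blast
 show "test_function phi"
  using t g eq unfolding C1_test_def test_function_def C1_on_def by blast
qed

lemma test_function_C1_test: "test_function phi ==> C1_test (- {0}) phi (grad phi)"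
proof -
 assume t: "test_function phi"
 then obtain K where K: "compact K" "K \<subseteq> - {0}" "!!x. x \<notin> K ==> phi x = 0"
  unfolding test_function_def by blast
 have "grad phi x = 0" if "x \<notin> K" for x
  by (rule grad_eq[OF gderiv_transform[OF GDERIV_const[of 0], of "- K"]])
   (use K that in \<open>auto simp: compact_imp_closed open_Compl\<close>)
 then show ?thesis using K t C1_onD[of UNIV phi] unfolding C1_test_def test_function_def by blast
qed

lemma test_function_all:
 "(\<forall>phi. test_function phi --> Q phi (grad phi)) \<longleftrightarrow> (\<forall>phi H. C1_test (- {0}) phi H --> Q phi H)"
 using C1_test_test_function test_function_C1_test by metis

text \<open>Test functions and their gradients vanish at the origin, so integrals over the punctured
  space are integrals over the whole space. The two sides may be combined since each is integrable
  by the continuity of its coefficient away from the origin.\<close>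

lemma distributional_solution_iff:
 fixes u :: "real^'n => real"
 assumes u: "C1_on (- {0}) u" and pos: "!!x. x ~= 0 ==> u x > 0"
 shows "distributional_solution rho lam tau th q u \<longleftrightarrow>
  weak_lap (- {0}) u (grad u) (%x. norm x powr th * u x powr q - lower_order_terms rho lam tau u x)"
proof -
 let ?L = "lower_order_terms rho lam tau u" and ?R = "%x. norm x powr th * u x powr q"
 have op: "open (- {0::real^'n})" by auto
 have cu: "continuous_on (- {0}) u" by (rule gderiv_continuous_on[OF C1_onD(1)[OF u]])
 have un: "u x ~= 0" if "x ~= 0" for x using pos[OF that] by simp
 have c1: "continuous_on (- {0}) (%x. u x powr a)" for a
  by (rule continuous_on_powr[OF cu continuous_on_const]) (use un in auto)
 have c2: "continuous_on (- {0}) (%x. norm (grad u x) powr (1 - tau))"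
  using tau by (intro continuous_on_powr' continuous_intros C1_onD(2)[OF u]) auto
 have c3: "continuous_on (- {0}) (%x::real^'n. norm x powr a)" for a
  by (rule continuous_on_powr[OF _ continuous_on_const]) (auto intro!: continuous_intros)
 have cL: "continuous_on (- {0}) ?L" unfolding lower_order_terms_def
  by (intro continuous_on_add continuous_on_divide continuous_on_mult continuous_on_const continuous_on_inner
    continuous_on_power continuous_on_norm continuous_on_id C1_onD(2)[OF u] c1 c2 c3) auto
 have cR: "continuous_on (- {0}) ?R" by (intro continuous_on_mult c1 c3)
 have "(LINT x:-{0}|lborel. - (grad u x \<bullet> H x) + ?L x * phi x) = (LINT x:-{0}|lborel. ?R x * phi x)
  \<longleftrightarrow> (LINT x|lborel. grad u x \<bullet> H x + (?R x - ?L x) * phi x) = 0" if t: "C1_test (- {0}) phi H" for phi H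
 proof -
  have z: "phi 0 = 0" "H 0 = 0" using t by (auto simp: C1_test_def)
  have 1: "(LINT x:-{0}|lborel. - (grad u x \<bullet> H x) + ?L x * phi x)
   = (LINT x|lborel. (- grad u x) \<bullet> H x + ?L x * phi x)"
   unfolding set_lebesgue_integral_def
   by (intro Bochner_Integration.integral_cong refl) (auto simp: z indicator_def)
  have 2: "(LINT x:-{0}|lborel. ?R x * phi x) = (LINT x|lborel. ?R x * phi x)"
   unfolding set_lebesgue_integral_def
   by (intro Bochner_Integration.integral_cong refl) (auto simp: z indicator_def)
  have i1: "integrable lborel (%x. (- grad u x) \<bullet> H x + ?L x * phi x)"
   by (rule integrable_test(1)[OF t _ cL]) (intro continuous_intros C1_onD(2)[OF u])
  have i2: "integrable lborel (%x. ?R x * phi x)"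
   by (rule integrable_test(3)[OF t C1_onD(2)[OF u] cR])
  have "(LINT x|lborel. grad u x \<bullet> H x + (?R x - ?L x) * phi x)
   = (LINT x|lborel. ?R x * phi x - ((- grad u x) \<bullet> H x + ?L x * phi x))"
   by (intro Bochner_Integration.integral_cong refl) (auto simp: algebra_simps)
  also have "... = (LINT x|lborel. ?R x * phi x) - (LINT x|lborel. (- grad u x) \<bullet> H x + ?L x * phi x)"
   by (rule Bochner_Integration.integral_diff[OF i2 i1])
  finally show ?thesis unfolding 1 2 by auto
 qed
 note eq = this
 have "distributional_solution rho lam tau th q u \<longleftrightarrow> (\<forall>phi H. C1_test (- {0}) phi H -->
   (LINT x:-{0}|lborel. - (grad u x \<bullet> H x) + ?L x * phi x) = (LINT x:-{0}|lborel. ?R x * phi x))"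
  unfolding distributional_solution_def by (rule test_function_all)
 also have "... \<longleftrightarrow> (\<forall>phi H. C1_test (- {0}) phi H -->
   (LINT x|lborel. grad u x \<bullet> H x + (?R x - ?L x) * phi x) = 0)"
  using eq by (intro iff_allI imp_cong refl)
 finally have "distributional_solution rho lam tau th q u \<longleftrightarrow> (\<forall>phi H. C1_test (- {0}) phi H -->
   (LINT x|lborel. grad u x \<bullet> H x + (?R x - ?L x) * phi x) = 0)" .
 then show ?thesis unfolding weak_lap_def using op C1_onD[OF u] cL cR
  by (auto intro!: continuous_on_diff)
qed

text \<open>The gradient term is homogeneous of degree one in \<open>u\<close>: divided by
  \<open>u\<close> it becomes a power of the norm of the gradient of \<open>ln u\<close>. This is
  why the logarithm leaves the unknown in the nonlinearity only.\<close>

lemma log_rhs_exp: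
 fixes x :: "real^'n"
 assumes x: "x ~= 0" and u: "u x > 0"
 shows "log_rhs 1 x (ln (u x)) ((1 / u x) *\<^sub>R grad u x)
  = (norm x powr th * u x powr q - lower_order_terms rho lam tau u x) / u x
   - (grad u x \<bullet> grad u x) / (u x)^2"
proof -
 define r where "r = norm x"
 define w where "w = u x"
 define p where "p = norm (grad u x)"
 have r: "r > 0" and w: "w > 0" and p: "p >= 0" using x u by (auto simp: r_def w_def p_def)
 have n: "norm ((1 / w) *\<^sub>R grad u x) = p / w" using w by (simp add: p_def)
 have pp: "grad u x \<bullet> grad u x = p^2" by (simp add: p_def power2_norm_eq_inner)
 have 1: "r powr (th + 2) = r powr th * r^2" using r by (simp add: powr_add)
 have 2: "exp ((q - 1) * ln w) = w powr q / w"
  using w by (simp add: powr_def exp_diff left_diff_distrib)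
 have 3: "(r * (p / w)) powr (1 - tau) = r^2 * (w powr tau * p powr (1 - tau)) / r powr (1 + tau) / w"
 proof -
  have "(r * (p / w)) powr (1 - tau) = r powr (1 - tau) * (p powr (1 - tau) / w powr (1 - tau))"
   using r w p by (simp add: powr_mult powr_divide)
  also have "w powr (1 - tau) = w / w powr tau" using w by (simp add: powr_diff)
  also have "r powr (1 - tau) = r^2 / r powr (1 + tau)"
  proof -
   have "r powr (1 - tau) * r powr (1 + tau) = r powr 2" by (simp add: powr_add[symmetric])
   then show ?thesis using r by (simp add: field_simps)
  qed
  finally show ?thesis using w by (simp add: field_simps)
 qed
 have 4: "x \<bullet> (1 / w) *\<^sub>R grad u x = (x \<bullet> grad u x) / w" by simp
 have 5: "(a * r^2 * (b / w) - (r * (p / w))^2 + k * (d / w) - lam * (r^2 * e / h / w)) / r^2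
  = (a * b - (- k * d / r^2 + lam * e / h)) / w - p\<^sup>2 / w^2" for a b d e h k
 proof -
  have "(a * r^2 * (b / w) - (r * (p / w))^2 + k * (d / w) - lam * (r^2 * e / h / w)) / r^2
   = a * r^2 * (b / w) / r^2 - (r * (p / w))^2 / r^2 + k * (d / w) / r^2 - lam * (r^2 * e / h / w) / r^2"
   by (simp add: add_divide_distrib diff_divide_distrib)
  also have "... = a * b / w - p\<^sup>2 / w^2 + k * d / r^2 / w - lam * e / h / w"
   using r by (simp add: power_mult_distrib power_divide)
  finally show ?thesis by (simp add: add_divide_distrib diff_divide_distrib)
 qed
 have 6: "lower_order_terms rho lam tau u x = - (real DIM(real^'n) - 2 + 2 * rho) * (x \<bullet> grad u x) / r^2
  + lam * (w powr tau * p powr (1 - tau)) / r powr (1 + tau)"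
  by (simp add: lower_order_terms_def r_def w_def p_def)
 show ?thesis unfolding log_rhs_def 6 unfolding r_def[symmetric] w_def[symmetric] n 1 2 3 pp 4 mult_1
  by (rule 5)
qed

lemma positive_solution_log_sol:
 fixes u :: "real^'n => real"
 assumes "positive_solution rho lam tau th q u"
 shows "log_sol 1 (- {0}) (%x. ln (u x)) (%x. (1 / u x) *\<^sub>R grad u x)"
proof -
 have c: "C1_on (- {0}) u" and pos: "!!x. x ~= 0 ==> u x > 0" and d: "distributional_solution rho lam tau th q u"
  using assms by (auto simp: positive_solution_def)
 have w: "weak_lap (- {0}) u (grad u) (%x. norm x powr th * u x powr q - lower_order_terms rho lam tau u x)"
  using distributional_solution_iff[OF c] pos d by blast
 have "weak_lap (- {0}) (%x. ln (u x)) (%x. (1 / u x) *\<^sub>R grad u x)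
  (%x. (1 / u x) * (norm x powr th * u x powr q - lower_order_terms rho lam tau u x)
   + (- 1 / (u x)^2) * (grad u x \<bullet> grad u x))"
 proof (rule weak_lap_chain[OF w])
  show "DERIV ln (u x) :> 1 / u x" if "x \<in> - {0}" for x
   using pos[of x] that by (auto intro!: derivative_eq_intros)
  show "DERIV (%t. 1 / t) (u x) :> - 1 / (u x)^2" if "x \<in> - {0}" for x
   using pos[of x] that by (auto intro!: derivative_eq_intros simp: power2_eq_square)
  show "continuous_on (u ` (- {0})) (%t. - 1 / t^2)"
   using pos by (intro continuous_intros) force
 qed
 then have "weak_lap (- {0}) (%x. ln (u x)) (%x. (1 / u x) *\<^sub>R grad u x)
  (%x. log_rhs 1 x (ln (u x)) ((1 / u x) *\<^sub>R grad u x))"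
 proof (rule weak_lap_cong)
  fix x :: "real^'n" assume "x \<in> - {0}"
  then show "(1 / u x) * (norm x powr th * u x powr q - lower_order_terms rho lam tau u x)
   + (- 1 / (u x)^2) * (grad u x \<bullet> grad u x) = log_rhs 1 x (ln (u x)) ((1 / u x) *\<^sub>R grad u x)"
   using log_rhs_exp[of x u] pos[of x] by simp
 qed auto
 then show ?thesis unfolding log_sol_def by simp
qed

lemma log_sol_positive_solution:
 fixes z :: "real^'n => real"
 assumes "log_sol 1 (- {0}) z G"
 shows "positive_solution rho lam tau th q (restrict (%x. exp (z x)) (- {0}))"
proof -
 define u where "u = restrict (%x. exp (z x)) (- {0})"
 have u: "u x = exp (z x)" if "x ~= 0" for x using that by (simp add: u_def)
 have w: "weak_lap (- {0}) (%x. exp (z x)) (%x. exp (z x) *\<^sub>R G x)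
  (%x. exp (z x) * log_rhs 1 x (z x) (G x) + exp (z x) * (G x \<bullet> G x))"
  using log_solD(6)[OF assms] by (rule weak_lap_chain) (auto intro!: derivative_eq_intros continuous_intros)
 have g: "GDERIV u x :> exp (z x) *\<^sub>R G x" if "x \<in> - {0}" for x
 proof (rule gderiv_transform[of "%x. exp (z x)" _ _ "- {0}"])
  show "GDERIV (%x. exp (z x)) x :> exp (z x) *\<^sub>R G x" using w that by (auto simp: weak_lap_def)
 qed (use that u in auto)
 have gr: "grad u x = exp (z x) *\<^sub>R G x" if "x \<in> - {0}" for x using grad_eq[OF g[OF that]] .
 have "continuous_on (- {0}) (grad u)"
  by (rule continuous_on_eq[of _ "%x. exp (z x) *\<^sub>R G x"]) (use w gr in \<open>auto simp: weak_lap_def\<close>)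
 then have c: "C1_on (- {0}) u" unfolding C1_on_def using g by blast
 have pos: "u x > 0" if "x ~= 0" for x using u[OF that] by simp
 have "exp (z x) * log_rhs 1 x (z x) (G x) + exp (z x) * (G x \<bullet> G x)
  = norm x powr th * u x powr q - lower_order_terms rho lam tau u x" if "x ~= 0" for x
 proof -
  have "log_rhs 1 x (z x) (G x) = log_rhs 1 x (ln (u x)) ((1 / u x) *\<^sub>R grad u x)"
   using u[OF that] gr[of x] that by simp
  also have "... = (norm x powr th * u x powr q - lower_order_terms rho lam tau u x) / u x - (grad u x \<bullet> grad u x) / (u x)^2"
   by (rule log_rhs_exp[where u = u, OF that pos[OF that]])
  finally show ?thesis using u[OF that] gr[of x] that by (simp add: field_simps power2_eq_square)
 qed
 then have "weak_lap (- {0}) u (grad u) (%x. norm x powr th * u x powr q - lower_order_terms rho lam tau u x)"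
  by (intro weak_lap_cong[OF w]) (auto simp: u gr)
 then have "distributional_solution rho lam tau th q u"
  using distributional_solution_iff[OF c] pos by blast
 then show ?thesis using c pos unfolding positive_solution_def u_def[symmetric]
  by (auto simp: u_def)
qed

end

section \<open>The Keller-Osserman bound and the existence criterion\<close>

context params
begin

lemma powr_le_one_plus: "0 <= y ==> y powr (1 - tau) <= 1 + y" for y :: real
proof (cases "y <= 1")
 case True
 assume "0 <= y"
 then have "y powr (1 - tau) <= 1 powr (1 - tau)" using True tau by (intro powr_mono2) auto
 then show ?thesis using \<open>0 <= y\<close> by simp
next
 case False
 then have "y powr (1 - tau) <= y powr 1" using tau by (intro powr_mono) auto
 then show ?thesis using False by simp
qed

lemma F_growth: obtains C where "C > 0" "!!y. abs (F y) <= C * (1 + y^2)"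
proof
 show "1 + 2 * abs rho + 3 * abs lam > 0" by (intro add_pos_nonneg) auto
 fix y :: real
 have 1: "abs y <= 1 + y^2"
 proof -
  have "0 <= (abs y - 1)^2" by simp
  then have "2 * abs y <= 1 + y^2" by (simp add: power2_eq_square algebra_simps)
  then show ?thesis by simp
 qed
 have 2: "abs y powr (1 - tau) <= 3 * (1 + y^2)"
  using powr_le_one_plus[OF abs_ge_zero, of y] 1 zero_le_power2[of y] unfolding distrib_left by linarith
 have "abs (F y) <= y^2 + 2 * abs rho * abs y + abs lam * abs y powr (1 - tau)"
  unfolding F_def using abs_triangle_ineq4[of "y\<^sup>2" "2 * rho * y"]
   abs_triangle_ineq[of "y\<^sup>2 - 2 * rho * y" "lam * abs y powr (1 - tau)"] by (simp add: abs_mult)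
 also have "... <= (1 + y^2) + 2 * abs rho * (1 + y^2) + abs lam * (3 * (1 + y^2))"
  using 1 2 by (intro add_mono mult_left_mono) auto
 also have "... = (1 + 2 * abs rho + 3 * abs lam) * (1 + y^2)" by (simp add: algebra_simps)
 finally show "abs (F y) <= (1 + 2 * abs rho + 3 * abs lam) * (1 + y^2)" .
qed

text \<open>The strict inequality \<open>sup\<close> is the supersolution property written in
  \<open>t = ln (norm x)\<close>; the dimension cancels. The barrier is required on a slightly
  larger interval because weak Laplacians live on open sets, which have to contain the closed
  annulus.\<close>

lemma radial_supersolution_comparison:
 fixes z :: "'a::euclidean_space => real"
 assumes z: "log_sol mu Om z G" and mu: "mu >= 0"
  and sub: "!!x. exp a <= norm x ==> norm x <= exp b ==> x \<in> Om"
  and ab: "a0 < a" "b < b0"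
  and d1: "!!t. a0 < t ==> t < b0 ==> DERIV xi t :> xi1 t"
  and d2: "!!t. a0 < t ==> t < b0 ==> DERIV xi1 t :> xi2 t"
  and c2: "continuous_on {a0<..<b0} xi2"
  and sup: "!!t. a < t ==> t < b ==> xi2 t + F (xi1 t) < mu * exp ((q - 1) * (xi t - gm * t))"
  and bd: "!!x. norm x = exp a ==> z x <= xi a" "!!x. norm x = exp b ==> z x <= xi b"
  and x: "exp a <= norm x" "norm x <= exp b"
 shows "z x <= xi (ln (norm x))"
proof -
 let ?A = "annulus a0 b0 :: 'a set"
 have op: "open (Om \<inter> ?A)" using log_solD(1)[OF z] by auto
 have w1: "weak_lap (Om \<inter> ?A) z G (%x. log_rhs mu x (z x) (G x))"
  using weak_lap_subset[OF log_solD(6)[OF z] op] by auto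
 have w2: "weak_lap (Om \<inter> ?A) (%x. xi (ln (norm x))) (%x. (xi1 (ln (norm x)) / (norm x)^2) *\<^sub>R x)
  (%x. (xi2 (ln (norm x)) + (real DIM('a) - 2) * xi1 (ln (norm x))) / (norm x)^2)"
  using weak_lap_subset[OF weak_lap_radial[OF d1 d2 c2] op] by auto
 have "z x - xi (ln (norm x)) <= 0"
 proof (rule annulus_max_principle[OF weak_lap_diff[OF w1 w2] _ _ _ x])
  show "y \<in> Om \<inter> ?A" if "exp a <= norm y" "norm y <= exp b" for y
  proof -
   have "exp a0 < norm y" "norm y < exp b0" using that ab exp_less_mono[of a0 a] exp_less_mono[of b b0] by linarith+
   then show ?thesis using sub[OF that] by (simp add: annulus_def)
  qed
  show "z y - xi (ln (norm y)) <= 0" if "norm y = exp a \<or> norm y = exp b" for y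
   using that bd[of y] by auto
  show "log_rhs mu y (z y) (G y) - (xi2 (ln (norm y)) + (real DIM('a) - 2) * xi1 (ln (norm y))) / (norm y)^2 > 0"
   if y: "y \<in> annulus a b" "0 < z y - xi (ln (norm y))" "G y - (xi1 (ln (norm y)) / (norm y)^2) *\<^sub>R y = 0" for y
  proof -
   define t where "t = ln (norm y)"
   have t: "y ~= 0" "a < t" "t < b" using y(1) by (auto simp: annulus_iff t_def)
   have G: "G y = (xi1 t / (norm y)^2) *\<^sub>R y" using y(3) by (simp add: t_def)
   have "mu * exp ((q - 1) * (xi t - gm * t)) <= mu * exp ((q - 1) * (z y - gm * t))"
    using y(2) q mu by (intro mult_left_mono) (auto simp: t_def)
   then have "xi2 t + (real DIM('a) - 2) * xi1 t
    < mu * exp ((q - 1) * (z y - gm * t)) - F (xi1 t) + (real DIM('a) - 2) * xi1 t"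
    using sup[OF t(2,3)] by linarith
   then have "(xi2 t + (real DIM('a) - 2) * xi1 t) / (norm y)^2 < log_rhs mu y (z y) (G y)"
    unfolding G log_rhs_radial[OF t(1)] t_def[symmetric] using t(1) by (intro divide_strict_right_mono) auto
   then show ?thesis by (simp add: t_def)
  qed
 qed
 then show ?thesis by simp
qed

text \<open>The bound for the nonlinearity along a solution. The maximum with 0 lets one estimate
  cover both signs of \<open>F gm\<close>; if \<open>F gm <= 0\<close> it leaves no room for a
  solution.\<close>

definition W0 :: real where "W0 = max (F gm) 0"

text \<open>The growth condition on the barrier: \<open>T\<close> is a tangent and \<open>1 + T^2\<close> the square of the secant.\<close>

lemma F_tangent_bound:
 assumes "eta > 0"
 obtains ep where "ep > 0" "!!T. k * ep^2 * (1 + T^2) + F (gm + k * ep * T) < (W0 + eta) * (1 + T^2)"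
proof -
 have "isCont F gm" using continuous_F[of UNIV "%x. x"] by (simp add: continuous_on_eq_continuous_at)
 then have ev: "\<forall>\<^sub>F y in at gm. F y < F gm + eta / 3"
  using assms unfolding isCont_def by (intro order_tendstoD) auto
 obtain dl where dl: "dl > 0" "!!y. abs (y - gm) < dl ==> F y <= F gm + eta / 3"
  
 proof -
  obtain d where d: "d > 0" "\<forall>y. y ~= gm & dist y gm < d --> F y < F gm + eta / 3"
   using ev unfolding eventually_at by auto
  have "F y <= F gm + eta / 3" if "abs (y - gm) < d" for y
   using d(2) that assms by (cases "y = gm") (auto simp: dist_real_def less_imp_le)
  then show ?thesis using that d(1) by blast
 qed
 obtain C where C: "C > 0" "!!y. abs (F y) <= C * (1 + y^2)" using F_growth by blast
 \<comment> \<open>Away from \<open>gm\<close>, that is for displacements \<open>h\<close> with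
   \<open>abs h >= dl\<close>, the constant part of the quadratic growth bound is at most a multiple
   of \<open>h^2\<close>, because \<open>1 <= h^2 / dl^2\<close>. Thus
   \<open>F (gm + h) <= B * h^2\<close> there.\<close>
 define B where "B = C * ((1 + 2 * gm^2) / dl^2 + 2)"
 have B: "B > 0" unfolding B_def using C(1) dl(1) by (intro mult_pos_pos add_nonneg_pos) auto
 define D where "D = 1 + abs k + B * k^2"
 have D: "D > 0" unfolding D_def using B by (intro add_pos_nonneg) auto
 \<comment> \<open>\<open>D * ep^2 = eta / 3\<close>. The curvature term costs
   \<open>eta / 3\<close>, the bound for \<open>F\<close> costs another \<open>eta / 3\<close>
   either by continuity near \<open>gm\<close> or by \<open>B\<close> away from it, and the last
   third gives strictness.\<close>
 define ep where "ep = sqrt (eta / (3 * D))"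
 have e: "ep > 0" "ep\<^sup>2 = eta / (3 * D)" using assms D by (auto simp: ep_def)
 have "B * k^2 >= 0" using B by simp
 then have "k <= D" "B * k^2 <= D" using abs_ge_self[of k] unfolding D_def by linarith+
 then have "k * ep^2 <= D * ep^2" "B * k^2 * ep^2 <= D * ep^2" by (intro mult_right_mono; simp)+
 then have e3: "k * ep^2 <= eta / 3" "B * k^2 * ep^2 <= eta / 3" using D e(2) by auto
 have "k * ep^2 * (1 + T^2) + F (gm + k * ep * T) < (W0 + eta) * (1 + T^2)" for T
 proof -
  define h where "h = k * ep * T"
  have T: "1 + T^2 >= 1" by simp
  have F: "F (gm + h) <= (W0 + eta / 3) * (1 + T^2)"
  proof (cases "abs h < dl")
   case True
   then have "F (gm + h) <= F gm + eta / 3" using dl(2)[of "gm + h"] by simp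
   also have "... <= (W0 + eta / 3) * 1" by (simp add: W0_def)
   also have "... <= (W0 + eta / 3) * (1 + T^2)"
    using T assms by (intro mult_left_mono) (auto simp: W0_def)
   finally show ?thesis .
  next
   case False
   then have "dl\<^sup>2 <= abs h^2" using dl(1) by (intro power_mono) auto
   then have h: "1 <= h^2 / dl^2" using dl(1) by simp
   have "0 <= (gm - h)^2" by simp
   then have "(gm + h)^2 <= 2 * gm^2 + 2 * h^2" by (simp add: power2_eq_square algebra_simps)
   then have "1 + (gm + h)^2 <= (1 + 2 * gm^2) * 1 + 2 * h^2" by simp
   also have "... <= (1 + 2 * gm^2) * (h^2 / dl^2) + 2 * h^2"
    using h by (intro add_mono mult_left_mono) auto
   also have "... = ((1 + 2 * gm^2) / dl^2 + 2) * h^2" by (simp add: distrib_right)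
   finally have "C * (1 + (gm + h)^2) <= B * h^2"
    using C(1) by (simp add: B_def mult.assoc)
   then have "F (gm + h) <= B * h^2" using C(2)[of "gm + h"] by linarith
   also have "B * h^2 = (B * k^2 * ep^2) * T^2" by (simp add: h_def power_mult_distrib)
   also have "... <= eta / 3 * T^2" using e3(2) by (intro mult_right_mono) auto
   also have "... <= (W0 + eta / 3) * (1 + T^2)"
    using assms by (intro mult_mono) (auto simp: W0_def)
   finally show ?thesis .
  qed
  have "k * ep^2 * (1 + T^2) <= eta / 3 * (1 + T^2)" using e3(1) T by (intro mult_right_mono) auto
  then have "k * ep^2 * (1 + T^2) + F (gm + h) <= (eta / 3 + (W0 + eta / 3)) * (1 + T^2)"
   unfolding distrib_right[of "eta / 3"] using F by linarith
  also have "eta / 3 + (W0 + eta / 3) = W0 + 2 * eta / 3" by simp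
  also have "(W0 + 2 * eta / 3) * (1 + T^2) < (W0 + eta) * (1 + T^2)"
   using T assms by (intro mult_strict_right_mono) linarith+
  finally show ?thesis by (simp add: h_def)
 qed
 then show ?thesis using that[OF e(1)] by blast
qed

text \<open>The barrier \<open>gm * t + A - k * ln (cos (ep * (t - t0)))\<close> is infinite at both
  ends of an interval around \<open>t0 = ln (norm x)\<close> and equals \<open>gm * t0 + A\<close>
  at its centre. With \<open>(q - 1) * k = 2\<close> the nonlinearity on the barrier is
  \<open>(W0 + eta)\<close> times one plus the squared tangent, which is the form of
  \<open>F_tangent_bound\<close>. Letting \<open>eta\<close> tend to 0 gives the claim.\<close>

lemma keller_osserman:
 fixes z :: "'a::euclidean_space => real"
 assumes z: "log_sol mu (- {0}) z G" and mu: "mu > 0" and x: "x ~= 0"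
 shows "mu * exp ((q - 1) * (z x - gm * ln (norm x))) <= W0"
proof (rule field_le_epsilon)
 fix eta :: real assume "eta > 0"
 define k where "k = 2 / (q - 1)"
 have k: "(q - 1) * k = 2" using q by (simp add: k_def field_simps)
 obtain ep where e: "ep > 0" "!!T. k * ep^2 * (1 + T^2) + F (gm + k * ep * T) < (W0 + eta) * (1 + T^2)"
  using F_tangent_bound[OF \<open>eta > 0\<close>] by metis
 define t0 where "t0 = ln (norm x)"
 define A where "A = ln ((W0 + eta) / mu) / (q - 1)"
 have W0: "W0 >= 0" by (simp add: W0_def)
 have A: "mu * exp ((q - 1) * A) = W0 + eta"
  using q mu W0 \<open>eta > 0\<close> by (simp add: A_def)
 define R where "R = pi / (2 * ep)"
 have R: "R > 0" "ep * R = pi / 2" using e(1) by (auto simp: R_def)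
 define xi where "xi t = gm * t + A - k * ln (cos (ep * (t - t0)))" for t
 define xi1 where "xi1 t = gm + k * ep * tan (ep * (t - t0))" for t
 define xi2 where "xi2 t = k * ep^2 * (1 + (tan (ep * (t - t0)))^2)" for t
 have cp: "cos (ep * (t - t0)) > 0" if "t0 - R < t" "t < t0 + R" for t
 proof (rule cos_gt_zero_pi)
  have "ep * (t - t0) < ep * R" "ep * (- R) < ep * (t - t0)" using that e(1) by (intro mult_strict_left_mono; linarith)+
  then show "ep * (t - t0) < pi / 2" "- (pi / 2) < ep * (t - t0)" using R(2) by simp_all
 qed
 have d1: "DERIV xi t :> xi1 t" if "t0 - R < t" "t < t0 + R" for t
  unfolding xi_def xi1_def using cp[OF that]
  by (auto intro!: derivative_eq_intros simp: tan_def field_simps)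
 have d2: "DERIV xi1 t :> xi2 t" if "t0 - R < t" "t < t0 + R" for t
 proof -
  have "cos (ep * (t - t0)) ~= 0" using cp[OF that] by simp
  then show ?thesis unfolding xi1_def xi2_def using tan_sec[of "ep * (t - t0)"]
   by (auto intro!: derivative_eq_intros simp: power2_eq_square)
 qed
 have c2: "continuous_on {t0 - R<..<t0 + R} xi2"
  unfolding xi2_def tan_def using cp by (intro continuous_intros) force
 have ex: "mu * exp ((q - 1) * (xi t - gm * t)) = (W0 + eta) * (1 + (tan (ep * (t - t0)))^2)"
  if "t0 - R < t" "t < t0 + R" for t
 proof -
  let ?c = "cos (ep * (t - t0))"
  have "(q - 1) * (xi t - gm * t) = (q - 1) * A - ((q - 1) * k) * ln ?c"
   by (simp add: xi_def algebra_simps)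
  then have "exp ((q - 1) * (xi t - gm * t)) = exp ((q - 1) * A) / exp (2 * ln ?c)"
   unfolding k by (simp add: exp_diff)
  also have "exp (2 * ln ?c) = ?c\<^sup>2" using cp[OF that] by (simp add: exp_double)
  finally have "mu * exp ((q - 1) * (xi t - gm * t)) = (W0 + eta) * inverse (?c\<^sup>2)"
   using A by (simp add: divide_inverse mult.assoc[symmetric])
  moreover have "?c ~= 0" using cp[OF that] by simp
  ultimately show ?thesis using tan_sec[of "ep * (t - t0)"] by (simp add: power_inverse)
 qed
 have cz: "continuous_on (- {0}) z" by (rule log_solD(5)[OF z])
 have K: "compact ({x::'a. exp (t0 - R) <= norm x} \<inter> cball 0 (exp (t0 + R)))"
  by (intro closed_Int_compact closed_Collect_le continuous_intros) auto
 have "bounded (z ` ({x. exp (t0 - R) <= norm x} \<inter> cball 0 (exp (t0 + R))))"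
 proof (intro compact_imp_bounded compact_continuous_image[OF continuous_on_subset[OF cz] K])
  show "{x. exp (t0 - R) <= norm x} \<inter> cball 0 (exp (t0 + R)) \<subseteq> - {0}" by (auto simp: not_le)
 qed
 then obtain B0 where "!!y. y \<in> {x. exp (t0 - R) <= norm x} \<inter> cball 0 (exp (t0 + R)) ==> abs (z y) <= B0"
  unfolding bounded_iff by (metis imageI real_norm_def)
 then have B0: "z y <= B0" if "exp (t0 - R) <= norm y" "norm y <= exp (t0 + R)" for y
  using that by force
 \<comment> \<open>\<open>B\<close> is the size of \<open>- ln (cos _)\<close> at which the barrier
   exceeds the bound \<open>B0\<close> of \<open>z\<close> on the closed annulus. It is reached at a
   distance \<open>r < R\<close> from \<open>t0\<close>, so comparison takes place where the barrier
   is still finite.\<close>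
 define B where "B = (B0 + abs gm * (abs t0 + R) - A) / k"
 have "k > 0" using q by (simp add: k_def)
 have "((%r. cos (ep * r)) \<longlongrightarrow> 0) (at R)"
 proof -
  have "cos (ep * R) = 0" unfolding R(2) by simp
  then show ?thesis by (auto intro!: tendsto_eq_intros)
 qed
 then have "\<forall>\<^sub>F r in at R. abs (cos (ep * r)) < exp (- B)"
  using order_tendstoD(2)[of "%r. abs (cos (ep * r))" 0 "at R" "exp (- B)"] tendsto_rabs_zero by fastforce
 then obtain d where d: "d > 0" "!!r. r ~= R ==> dist r R < d ==> abs (cos (ep * r)) < exp (- B)"
  unfolding eventually_at by blast
 define r where "r = max (R / 2) (R - d / 2)"
 have r: "0 < r" "r < R" "abs (cos (ep * r)) < exp (- B)"
  using R(1) d(1) d(2)[of r] by (auto simp: r_def dist_real_def)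
 have big: "B0 <= xi t" if "abs (t - t0) = r" for t
 proof -
  have tr: "t0 - R < t" "t < t0 + R" using that r by auto
  have "cos (ep * (t - t0)) = cos (ep * r)"
   using that cos_minus[of "ep * (t - t0)"] by (cases "t >= t0") (auto simp: abs_if algebra_simps)
  then have "ln (cos (ep * (t - t0))) < - B"
   using cp[OF tr] r(3) ln_less_cancel_iff[of "cos (ep * (t - t0))" "exp (- B)"] by simp
  then have "k * B < - (k * ln (cos (ep * (t - t0))))" using mult_strict_left_mono[OF _ \<open>k > 0\<close>, of "ln (cos (ep * (t - t0)))" "- B"] by simp
  moreover have "abs (gm * t) <= abs gm * (abs t0 + R)" unfolding abs_mult using tr by (intro mult_left_mono) auto
  moreover have "k * B = B0 + abs gm * (abs t0 + R) - A" using \<open>k > 0\<close> by (simp add: B_def)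
  ultimately show ?thesis unfolding xi_def by linarith
 qed
 have "z x <= xi (ln (norm x))"
 proof (rule radial_supersolution_comparison[OF z _ _ _ _ d1 d2 c2, of "t0 - r" "t0 + r"])
  show "xi2 t + F (xi1 t) < mu * exp ((q - 1) * (xi t - gm * t))" if "t0 - r < t" "t < t0 + r" for t
   using e(2) ex[of t] r(2) that by (simp add: xi1_def xi2_def)
  show "z y <= xi (t0 - r)" if "norm y = exp (t0 - r)" for y
   using order.trans[OF B0[of y] big[of "t0 - r"]] r that by auto
  show "z y <= xi (t0 + r)" if "norm y = exp (t0 + r)" for y
   using order.trans[OF B0[of y] big[of "t0 + r"]] r that by auto
  have "norm x = exp t0" using x by (simp add: t0_def)
  then show "exp (t0 - r) <= norm x" "norm x <= exp (t0 + r)" using r by auto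
 qed (use r mu in \<open>auto simp: not_le\<close>)
 then have "z x - gm * ln (norm x) <= A" by (simp add: xi_def t0_def)
 then have "mu * exp ((q - 1) * (z x - gm * ln (norm x))) <= mu * exp ((q - 1) * A)"
  using q mu by (intro mult_left_mono) auto
 then show "mu * exp ((q - 1) * (z x - gm * ln (norm x))) <= W0 + eta" using A by simp
qed

text \<open>The compact support of a test function is covered by finitely many, hence contained in
  one, of the increasing annuli.\<close>

lemma log_sol_exhaust:
 assumes "!!n. log_sol mu (annulus (- real n) (real n) :: 'a::euclidean_space set) z G"
 shows "log_sol mu (- {0}) z G"
proof -
 let ?g = "%x. log_rhs mu x (z x) (G x)"
 have w: "weak_lap (annulus (- real n) (real n)) z G ?g" for n
  using assms[of n] by (simp add: log_sol_def)
 have ex: "\<exists>n. x \<in> annulus (- real n) (real n)" if "x ~= 0" for x :: 'a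
 proof -
  obtain n where "abs (ln (norm x)) < real n" using reals_Archimedean2 by blast
  then have "x \<in> annulus (- real n) (real n)" using that by (auto simp: annulus_iff)
  then show ?thesis ..
 qed
 have un: "- {0} = (\<Union>n. annulus (- real n) (real n) :: 'a set)"
 proof (rule set_eqI)
  fix x :: 'a
  show "x \<in> - {0} \<longleftrightarrow> x \<in> (\<Union>n. annulus (- real n) (real n))"
   using ex[of x] by (cases "x = 0") (simp_all add: annulus_iff)
 qed
 have "GDERIV z x :> G x" if "x \<in> - {0}" for x
  using ex[of x] that w by (auto simp: weak_lap_def)
 moreover have "continuous_on (- {0}) G" "continuous_on (- {0}) ?g"
  unfolding un using w by (intro continuous_on_open_UN; auto simp: weak_lap_def)+
 moreover have "(LINT x|lborel. G x \<bullet> H x + ?g x * phi x) = 0" if t: "C1_test (- {0}) phi H" for phi H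
 proof -
  obtain K where K: "compact K" "K \<subseteq> - {0}" "\<forall>x. x \<notin> K --> phi x = 0 & H x = 0"
   using t unfolding C1_test_def by blast
  have "\<exists>n. K \<subseteq> annulus (- real n) (real n)"
  proof -
   have "K \<subseteq> (\<Union>n\<in>UNIV. annulus (- real n) (real n))" using K(2) unfolding un .
   then obtain I where I: "finite I" "K \<subseteq> (\<Union>n\<in>I. annulus (- real n) (real n))"
    using compactE_image[OF K(1), of UNIV "%n. annulus (- real n) (real n)"] open_annulus by metis
   obtain m where m: "!!n. n \<in> I ==> n <= m" using I(1) by (meson finite_nat_set_iff_bounded_le)
   have "annulus (- real n) (real n) \<subseteq> (annulus (- real m) (real m) :: 'a set)" if "n \<in> I" for n
    using m[OF that] by (force simp: annulus_iff)
   then show ?thesis using I(2) by blast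
  qed
  then obtain n where "K \<subseteq> annulus (- real n) (real n)" by blast
  then have "C1_test (annulus (- real n) (real n)) phi H" using t K unfolding C1_test_def by blast
  then show ?thesis using w[of n] by (simp add: weak_lap_def)
 qed
 ultimately show ?thesis unfolding log_sol_def weak_lap_def by blast
qed

lemma radial_log_sol_UNIV:
 assumes "!!t. DERIV xi t :> xi1 t"
  and "!!t. DERIV xi1 t :> mu * exp ((q - 1) * (xi t - gm * t)) - F (xi1 t)"
 shows "log_sol mu (- {0} :: 'a::euclidean_space set) (%x. xi (ln (norm x)))
  (%x. (xi1 (ln (norm x)) / (norm x)^2) *\<^sub>R x)"
 by (rule log_sol_exhaust) (rule radial_log_sol; rule assms)

lemma U_sol_eq:
 fixes x :: "real^'n"
 assumes "F gm > 0" "x ~= 0"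
 shows "U_sol rho lam tau th q x = exp (gm * ln (norm x) + ln (F gm) / (q - 1))"
proof -
 have b: "beta_exp th q = - gm" by (simp add: gm_def)
 show ?thesis using assms unfolding U_sol_def f_rho_beta
  by (simp add: b powr_def exp_add[symmetric] add.commute)
qed

lemma U_sol_positive_solution:
 assumes "F gm > 0"
 shows "positive_solution rho lam tau th q (U_sol rho lam tau th q :: real^'n => real)"
proof -
 define xi where "xi t = gm * t + ln (F gm) / (q - 1)" for t
 have "log_sol 1 (- {0} :: (real^'n) set) (%x. xi (ln (norm x))) (%x. (gm / (norm x)^2) *\<^sub>R x)"
  unfolding xi_def by (rule radial_log_sol_UNIV[of _ "%_. gm" 1])
   (use assms q in \<open>auto intro!: derivative_eq_intros simp: xi_def\<close>)
 from log_sol_positive_solution[OF this]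
 have "positive_solution rho lam tau th q (restrict (%x::real^'n. exp (xi (ln (norm x)))) (- {0}))" .
 also have "restrict (%x::real^'n. exp (xi (ln (norm x)))) (- {0}) = U_sol rho lam tau th q"
 proof
  fix x :: "real^'n"
  show "restrict (%x. exp (xi (ln (norm x)))) (- {0}) x = U_sol rho lam tau th q x"
   by (cases "x = 0") (simp_all add: U_sol_eq[OF assms] xi_def, simp add: U_sol_def)
 qed
 finally show ?thesis .
qed

text \<open>A solution makes the exponential bounded by \<open>W0\<close> positive, which forces
  \<open>F gm > 0\<close>. Any nonzero point serves for this; here it is the vector with all entries
  1.\<close>

lemma existence_iff:
 "(\<exists>u :: real^'n => real. positive_solution rho lam tau th q u) \<longleftrightarrow> F gm > 0"
proof
 assume "\<exists>u :: real^'n => real. positive_solution rho lam tau th q u"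
 then obtain u :: "real^'n => real" where "positive_solution rho lam tau th q u" by blast
 from keller_osserman[OF positive_solution_log_sol[OF this], of 1]
 have "1 * exp ((q - 1) * (ln (u (1::real^'n)) - gm * ln (norm (1::real^'n)))) <= W0" by auto
 then have "W0 > 0" using less_le_trans[OF exp_gt_zero] by fastforce
 then show "F gm > 0" by (simp add: W0_def)
qed (use U_sol_positive_solution in blast)

end

section \<open>Mean values and Harnack inequalities\<close>

text \<open>The weight is chosen such that \<open>- bump x *\<^sub>R x\<close> is the gradient of
  \<open>(bump x)^2 / 4\<close>, a C^1 function with compact support. The derivative of a weighted
  mean in the radius is therefore a tested Laplacian, without boundary integrals.\<close>

definition bump :: "'a::euclidean_space => real" where "bump x = max 0 (1 - (norm x)^2)"

text \<open>Rescaling to the unit ball keeps the weight independent of \<open>r\<close> and defines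
  the mean down to \<open>r = 0\<close>. It is not normalised: its value there is
  \<open>v x0\<close> times \<open>bump_mass\<close>.\<close>

definition mean :: "('a::euclidean_space => real) => 'a => real => real" where
 "mean v x0 r = (LINT x|lborel. v (x0 + r *\<^sub>R x) * bump x)"

definition bump_mass :: "'a::euclidean_space itself => real" where
 "bump_mass _ = (LINT x|(lborel :: 'a measure). bump x)"

lemma bump_bounds: "0 <= bump x" "bump x <= 1" by (auto simp: bump_def)

lemma bump_outside: "x \<notin> cball 0 1 ==> bump x = 0"
 using power_mono[of 1 "norm x" 2] by (auto simp: bump_def)

lemma continuous_on_bump [continuous_intros]: "continuous_on S bump"
 unfolding bump_def by (intro continuous_intros)

lemma integrable_bump:
 fixes f :: "'a::euclidean_space => real"
 assumes "continuous_on (cball 0 1) f"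
 shows "integrable lborel (%x. f x * bump x)"
 by (rule integrable_compact_support[of "cball 0 1"]) (auto intro!: continuous_intros assms simp: bump_outside)

lemma continuous_on_affine_ball:
 fixes f :: "'a::euclidean_space => 'b::real_normed_vector"
 assumes "continuous_on (cball x0 r) f" "r >= 0"
 shows "continuous_on (cball 0 1) (%x. f (x0 + r *\<^sub>R x))"
proof (rule continuous_on_compose2[OF assms(1)])
 show "(%x. x0 + r *\<^sub>R x) ` cball 0 1 \<subseteq> cball x0 r"
  using assms(2) by (auto simp: dist_norm mult_left_le)
qed (intro continuous_intros)

lemma bump_mass_pos: "bump_mass TYPE('a::euclidean_space) > 0"
proof -
 have i: "integrable lborel (bump :: 'a => real)" using integrable_bump[of "%_. 1"] by simp
 have "bump_mass TYPE('a) >= 0" unfolding bump_mass_def using bump_bounds by (intro Bochner_Integration.integral_nonneg) auto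
 moreover have "bump_mass TYPE('a) ~= 0"
 proof
  assume "bump_mass TYPE('a) = 0"
  then have "bump (0::'a) = 0"
   using continuous_nonneg_integral_zero[OF continuous_on_bump bump_bounds(1) i] by (simp add: bump_mass_def)
  then show False by (simp add: bump_def)
 qed
 ultimately show ?thesis by simp
qed

lemma mean_mono:
 fixes v w :: "'a::euclidean_space => real"
 assumes "continuous_on (cball x0 r) v" "continuous_on (cball x0 r) w" "r >= 0"
  "!!x. x \<in> cball x0 r ==> v x <= w x"
 shows "mean v x0 r <= mean w x0 r"
 unfolding mean_def
proof (rule integral_mono)
 show "v (x0 + r *\<^sub>R x) * bump x <= w (x0 + r *\<^sub>R x) * bump x" for x
 proof (cases "x \<in> cball 0 1")
  case True
  then have "x0 + r *\<^sub>R x \<in> cball x0 r" using assms(3) by (auto simp: dist_norm mult_left_le)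
  then show ?thesis using assms(4) bump_bounds by (intro mult_right_mono) auto
 qed (simp add: bump_outside)
qed (use assms integrable_bump[OF continuous_on_affine_ball] in auto)

lemma mean_const: "mean (%_. c) (x0 :: 'a::euclidean_space) r = c * bump_mass TYPE('a)"
 by (simp add: mean_def bump_mass_def)

lemma mean_add:
 fixes v w :: "'a::euclidean_space => real"
 assumes "continuous_on (cball x0 r) v" "continuous_on (cball x0 r) w" "r >= 0"
 shows "mean (%x. v x + w x) x0 r = mean v x0 r + mean w x0 r"
 unfolding mean_def distrib_right
 by (rule Bochner_Integration.integral_add) (use assms integrable_bump[OF continuous_on_affine_ball] in auto)

lemma mean_cmult: "mean (%x. c * v x) x0 r = c * mean v x0 r"
 by (simp add: mean_def mult.assoc)

lemma mean_0: "mean v (x0 :: 'a::euclidean_space) 0 = v x0 * bump_mass TYPE('a)"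
 by (simp add: mean_def bump_mass_def)

lemma C1_test_bump_square:
 assumes "cball 0 1 \<subseteq> Om"
 shows "C1_test Om (%x::'a::euclidean_space. (bump x)^2 / 4) (%x. (- bump x) *\<^sub>R x)"
proof -
 have "GDERIV (%x. (bump x)^2 / 4) x :> (- bump x) *\<^sub>R x" for x :: 'a
 proof -
  have "GDERIV (%x. 1 - x \<bullet> x) x :> - 2 *\<^sub>R x"
   unfolding gderiv_def by (auto intro!: derivative_eq_intros simp: inner_commute)
  have q: "DERIV (%t. t / 4) s :> 1/4" for s :: real
   by (auto intro!: derivative_eq_intros)
  have "GDERIV (%x. 1 - x \<bullet> x) x :> - 2 *\<^sub>R x" by fact
  from gderiv_chain[OF gderiv_chain[OF this DERIV_pos_part_square] q]
  have "GDERIV (%x. (max 0 (1 - x \<bullet> x))^2 / 4) x :> (1/4) *\<^sub>R (2 * max 0 (1 - x \<bullet> x)) *\<^sub>R - 2 *\<^sub>R x" .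
  then show ?thesis by (simp add: bump_def power2_norm_eq_inner)
 qed
 then show ?thesis unfolding C1_test_def using assms
  by (intro conjI allI exI[of _ "cball 0 1"] continuous_intros) (auto simp: bump_outside)
qed

lemma norm_le_DIM_cbox:
 fixes x :: "'a::euclidean_space"
 assumes "x \<in> cbox (- One) One"
 shows "norm x <= real DIM('a)"
proof -
 have "norm x <= (\<Sum>b\<in>Basis. abs (x \<bullet> b))" by (rule norm_le_l1)
 also have "... <= (\<Sum>b\<in>(Basis::'a set). 1)"
 proof (rule sum_mono)
  fix b :: 'a assume b: "b \<in> Basis"
  have "One \<bullet> b = 1" using b by (simp add: inner_sum_left inner_Basis)
  then show "abs (x \<bullet> b) <= 1" using assms b by (force simp: mem_box abs_le_iff)
 qed
 finally show ?thesis by simp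
qed

text \<open>The ball is enlarged by the dimension so that the whole cube containing the support of the
 bump function is mapped into the domain.\<close>

lemma mean_derivative:
 fixes v :: "'a::euclidean_space => real"
 assumes w: "weak_lap Om v G g" and ball: "cball x0 (real DIM('a) * R) \<subseteq> Om" and R: "R > 0"
 shows "continuous_on {0..R} (mean v x0)"
  and "0 < r ==> r < R ==>
   (mean v x0 has_real_derivative r * (LINT x|lborel. g (x0 + r *\<^sub>R x) * ((bump x)^2 / 4))) (at r)"
proof -
 let ?C = "cbox (- One) One :: 'a set"
 have dv: "!!x. x \<in> Om ==> GDERIV v x :> G x" and cG: "continuous_on Om G" using w by (auto simp: weak_lap_def)
 have cv: "continuous_on Om v" by (rule gderiv_continuous_on[OF dv])
 have inO: "x0 + r *\<^sub>R x \<in> Om" if "0 <= r" "r <= R" "x \<in> ?C" for r x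
 proof -
  have "norm (r *\<^sub>R x) <= R * real DIM('a)"
   using that norm_le_DIM_cbox[OF that(3)] R by (auto intro!: mult_mono)
  then have "x0 + r *\<^sub>R x \<in> cball x0 (real DIM('a) * R)" by (simp add: dist_norm mult.commute)
  then show ?thesis using ball by blast
 qed
 have bC: "cball 0 1 \<subseteq> ?C"
 proof
  fix x :: 'a assume "x \<in> cball 0 1"
  then have "abs (x \<bullet> i) <= 1" if "i \<in> Basis" for i using Basis_le_norm[OF that, of x] by simp
  moreover have "One \<bullet> i = 1" if "i \<in> Basis" for i :: 'a using that by (simp add: inner_sum_left inner_Basis)
  ultimately show "x \<in> ?C" by (auto simp: mem_box abs_le_iff)
 qed
 define f where "f r x = v (x0 + r *\<^sub>R x) * bump x" for r x
 define fx where "fx r x = (G (x0 + r *\<^sub>R x) \<bullet> x) * bump x" for r x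
 \<comment> \<open>Differentiation under the integral takes place over the cube; since the
   integrands vanish outside the unit ball, the integral over the cube is that over the whole
   space.\<close>
 have eqC: "integral ?C h = (LINT x|lborel. h x)"
  if "continuous_on ?C h" "!!x. x \<notin> cball 0 1 ==> h x = 0" for h :: "'a => real"
 proof -
  have "integrable lborel h"
   by (rule integrable_compact_support[of "cball 0 1"]) (use that bC in \<open>auto intro: continuous_on_subset\<close>)
  then have "(h has_integral (LINT x|lborel. h x)) UNIV" by (rule has_integral_integral_lborel)
  then have "(h has_integral (LINT x|lborel. h x)) ?C"
  proof -
   have "(%x. if x \<in> ?C then h x else 0) = h"
   proof
    fix x show "(if x \<in> ?C then h x else 0) = h x"
     using that(2)[of x] subsetD[OF bC, of x] by (cases "x \<in> cball 0 1") simp_all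
   qed
   then show ?thesis using \<open>(h has_integral _) UNIV\<close> has_integral_restrict_UNIV[of ?C h] by simp
  qed
  then show ?thesis by (rule integral_unique)
 qed
 have cf: "continuous_on ?C (f r)" if "0 <= r" "r <= R" for r
  unfolding f_def using inO[OF that] by (intro continuous_intros continuous_on_compose2[OF cv]) auto
 have cfx: "continuous_on ({0..R} \<times> ?C) (%(r, x). fx r x)"
  unfolding fx_def case_prod_beta using inO
  by (intro continuous_intros continuous_on_compose2[OF cG] continuous_on_compose2[OF continuous_on_bump[of UNIV]]) auto
 have der: "((%r. integral ?C (f r)) has_field_derivative integral ?C (fx r)) (at r within {0..R})"
  if "r \<in> {0..R}" for r
 proof (rule leibniz_rule_field_derivative[OF _ _ cfx that])
  show "f r integrable_on ?C" if "r \<in> {0..R}" for r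
   using cf[of r] that by (intro integrable_continuous) auto
  show "((%r. f r x) has_field_derivative fx r x) (at r within {0..R})" if "r \<in> {0..R}" "x \<in> ?C" for r x
  proof -
   have "((%r. x0 + r *\<^sub>R x) has_derivative (%h. h *\<^sub>R x)) (at r within {0..R})"
    by (auto intro!: derivative_eq_intros)
   moreover have "(v has_derivative (%h. h \<bullet> G (x0 + r *\<^sub>R x))) (at (x0 + r *\<^sub>R x))"
    using dv[OF inO, of r x] that by (simp add: gderiv_def)
   ultimately have "((%r. v (x0 + r *\<^sub>R x)) has_derivative (%h. h *\<^sub>R x \<bullet> G (x0 + r *\<^sub>R x))) (at r within {0..R})"
    by (rule has_derivative_compose)
   then have "((%r. v (x0 + r *\<^sub>R x)) has_real_derivative (G (x0 + r *\<^sub>R x) \<bullet> x)) (at r within {0..R})"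
    unfolding has_field_derivative_def by (simp add: inner_commute mult_commute_abs)
   then show ?thesis unfolding f_def fx_def by (rule DERIV_cmult_right)
  qed
 qed auto
 have m: "mean v x0 r = integral ?C (f r)" if "r \<in> {0..R}" for r
  using eqC[OF cf, of r] that by (simp add: mean_def f_def bump_outside)
 have "continuous_on {0..R} (%r. integral ?C (f r))" by (rule DERIV_continuous_on[OF der])
 then show "continuous_on {0..R} (mean v x0)" by (rule continuous_on_eq) (simp add: m)
 assume r: "0 < r" "r < R"
 have "((%r. integral ?C (f r)) has_field_derivative integral ?C (fx r)) (at r)"
  using der[of r] r at_within_interior[of r "{0..R}"] by simp
 then have d: "(mean v x0 has_real_derivative integral ?C (fx r)) (at r)"
  by (rule has_field_derivative_transform_within_open[of _ _ _ "{0<..<R}"]) (use r m in auto)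
 have "continuous_on ?C (%x. fx r x)"
  unfolding fx_def using inO[of r] r by (intro continuous_intros continuous_on_compose2[OF cG]) auto
 then have 1: "integral ?C (fx r) = (LINT x|lborel. fx r x)"
  by (rule eqC) (simp add: fx_def bump_outside)
 have id: "orthogonal_transformation (%x::'a. x)" by simp
 have inv: "inv (%x::'a. x) = (%x. x)" by (rule inv_equality) auto
 have sub: "cball 0 1 \<subseteq> (%x. x0 + r *\<^sub>R x) -` Om" using inO[of r] bC r by auto
 \<comment> \<open>The Laplacian of the rescaled function is tested with
   \<open>(bump x)^2 / 4\<close>. The gradient part is, up to sign and a factor \<open>r\<close>,
   the derivative of the mean.\<close>
 have "(LINT x|lborel. r *\<^sub>R G (x0 + r *\<^sub>R x) \<bullet> ((- bump x) *\<^sub>R x) + (r^2 * g (x0 + r *\<^sub>R x)) * ((bump x)^2 / 4)) = 0"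
  using weak_lap_similarity[OF w r(1) id, of x0] C1_test_bump_square[OF sub] unfolding weak_lap_def inv by blast
 moreover have "r *\<^sub>R G (x0 + r *\<^sub>R x) \<bullet> ((- bump x) *\<^sub>R x) + (r^2 * g (x0 + r *\<^sub>R x)) * ((bump x)^2 / 4)
  = r * (r * (g (x0 + r *\<^sub>R x) * ((bump x)^2 / 4)) - fx r x)" for x
  by (simp add: fx_def power2_eq_square algebra_simps)
 ultimately have 2: "(LINT x|lborel. r * (g (x0 + r *\<^sub>R x) * ((bump x)^2 / 4)) - fx r x) = 0" using r by simp
 have cg: "continuous_on Om g" using w by (simp add: weak_lap_def)
 have "continuous_on (cball 0 1) (%x. g (x0 + r *\<^sub>R x) * (bump x / 4))"
  "continuous_on (cball 0 1) (%x. G (x0 + r *\<^sub>R x) \<bullet> x)"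
  using sub by (auto intro!: continuous_intros continuous_on_compose2[OF cg] continuous_on_compose2[OF cG])
 then have "integrable lborel (%x. g (x0 + r *\<^sub>R x) * ((bump x)^2 / 4))" "integrable lborel (%x. fx r x)"
  using integrable_bump[of "%x. g (x0 + r *\<^sub>R x) * (bump x / 4)"] integrable_bump[of "%x. G (x0 + r *\<^sub>R x) \<bullet> x"]
  by (simp_all add: fx_def power2_eq_square mult.assoc)
 then have "(LINT x|lborel. r * (g (x0 + r *\<^sub>R x) * ((bump x)^2 / 4)) - fx r x)
  = r * (LINT x|lborel. g (x0 + r *\<^sub>R x) * ((bump x)^2 / 4)) - (LINT x|lborel. fx r x)"
  by (subst Bochner_Integration.integral_diff) (intro integrable_mult_right | assumption | simp only: integral_mult_right_zero)+
 then have e: "(LINT x|lborel. fx r x) = r * (LINT x|lborel. g (x0 + r *\<^sub>R x) * ((bump x)^2 / 4))"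
  using 2 by linarith
 show "(mean v x0 has_real_derivative r * (LINT x|lborel. g (x0 + r *\<^sub>R x) * ((bump x)^2 / 4))) (at r)"
  using d unfolding 1 e .
qed

text \<open>Gronwall's argument in the radius, for supersolutions (\<open>sig = 1\<close>) and
  subsolutions (\<open>sig = -1\<close>) at once. The derivative of the mean is \<open>r\<close>
  times an integral of \<open>g\<close> with weight \<open>(bump x)^2 / 4 <= bump x\<close>, so the
  linear bound makes \<open>sig * mean v x0 r * exp (- sig * (K * r^2 / 2))\<close>
  nonincreasing.\<close>

lemma sub_mean:
 fixes v :: "'a::euclidean_space => real"
 assumes w: "weak_lap Om v G g" and ball: "cball x0 (real DIM('a) * R) \<subseteq> Om" and R: "R > 0" and K: "K >= 0"
  and v: "!!x. x \<in> cball x0 R ==> v x >= 0" and g: "!!x. x \<in> cball x0 R ==> sig * g x <= K * v x"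
  and sig: "sig = 1 \<or> sig = -1"
 shows "sig * mean v x0 R <= sig * (exp (sig * (K * R^2 / 2)) * (v x0 * bump_mass TYPE('a)))"
proof -
 have "1 <= real DIM('a)" using DIM_positive[where 'a='a] by linarith
 then have "R <= real DIM('a) * R" using R by simp
 then have sub: "cball x0 R \<subseteq> Om" using ball subset_cball by blast
 have cv: "continuous_on Om v" using w gderiv_continuous_on[of Om v G] by (auto simp: weak_lap_def)
 have cg: "continuous_on Om g" using w by (simp add: weak_lap_def)
 define h where "h r = sig * (mean v x0 r * exp (- sig * (K * r^2 / 2)))" for r
 have s2: "sig * sig = 1" using sig by auto
 have "h R <= h 0"
 proof (rule DERIV_nonpos_imp_decreasing_open[of 0 R])
  show "continuous_on {0..R} h" unfolding h_def by (intro continuous_intros mean_derivative(1)[OF w ball R]) simp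
  fix r assume r: "0 < r" "r < R"
  define I where "I = (LINT x|lborel. g (x0 + r *\<^sub>R x) * ((bump x)^2 / 4))"
  have d: "(mean v x0 has_real_derivative r * I) (at r)"
   unfolding I_def by (rule mean_derivative(2)[OF w ball R r])
  have sub_r: "cball x0 r \<subseteq> cball x0 R" using r by (simp add: subset_cball)
  have inb: "x0 + r *\<^sub>R x \<in> cball x0 R" if "x \<in> cball 0 1" for x
  proof -
   have "norm (r *\<^sub>R x) <= R * 1" unfolding norm_scaleR using that r by (intro mult_mono) auto
   then show ?thesis by (simp add: dist_norm)
  qed
  have "sig * I <= K * mean v x0 r"
  proof -
   have i: "integrable lborel (%x. g (x0 + r *\<^sub>R x) * (bump x / 4) * bump x)"
    "integrable lborel (%x. v (x0 + r *\<^sub>R x) * bump x)"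
    by (intro integrable_bump continuous_intros continuous_on_affine_ball continuous_on_subset[OF cv]
      continuous_on_subset[OF cg]; use r sub sub_r in auto)+
   have "sig * I = (LINT x|lborel. sig * (g (x0 + r *\<^sub>R x) * (bump x / 4) * bump x))"
    by (simp add: I_def power2_eq_square mult.assoc)
   also have "... <= (LINT x|lborel. K * (v (x0 + r *\<^sub>R x) * bump x))"
   proof (rule integral_mono)
    show "sig * (g (x0 + r *\<^sub>R x) * (bump x / 4) * bump x) <= K * (v (x0 + r *\<^sub>R x) * bump x)" for x
    proof (cases "x \<in> cball 0 1")
     case True
     have b: "(bump x)^2 / 4 <= bump x"
      using bump_bounds[of x] mult_left_le[of "bump x" "bump x"] by (simp add: power2_eq_square)
     have "sig * (g (x0 + r *\<^sub>R x) * (bump x / 4) * bump x) = (sig * g (x0 + r *\<^sub>R x)) * ((bump x)^2 / 4)"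
      by (simp add: power2_eq_square)
     also have "... <= (K * v (x0 + r *\<^sub>R x)) * ((bump x)^2 / 4)"
      using g[OF inb[OF True]] by (intro mult_right_mono) auto
     also have "... <= (K * v (x0 + r *\<^sub>R x)) * bump x"
      using v[OF inb[OF True]] K b by (intro mult_left_mono) auto
     finally show ?thesis by (simp add: mult.assoc)
    qed (simp add: bump_outside)
   qed (intro integrable_mult_right i)+
   finally show ?thesis by (simp add: mean_def)
  qed
  then have le: "r * (sig * I) <= r * (K * mean v x0 r)" using r by (intro mult_left_mono) auto
  have "(h has_real_derivative sig * (r * I * exp (- sig * (K * r^2 / 2))
   + mean v x0 r * (exp (- sig * (K * r^2 / 2)) * (- sig * (K * r))))) (at r)"
   unfolding h_def by (rule derivative_eq_intros d refl | simp)+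
  moreover have "sig * (r * I * exp (- sig * (K * r^2 / 2))
   + mean v x0 r * (exp (- sig * (K * r^2 / 2)) * (- sig * (K * r))))
   = exp (- sig * (K * r^2 / 2)) * (r * (sig * I) - (sig * sig) * (r * (K * mean v x0 r)))"
   by (simp add: algebra_simps)
  moreover have "... <= 0" unfolding s2 using le by (intro mult_nonneg_nonpos) auto
  ultimately show "\<exists>y. DERIV h r :> y & y <= 0" by auto
 qed (use R in auto)
 then have "sig * (mean v x0 R * exp (- sig * (K * R^2 / 2))) <= sig * (v x0 * bump_mass TYPE('a))"
  by (simp add: h_def mean_0)
 then have "sig * (mean v x0 R * exp (- sig * (K * R^2 / 2))) * exp (sig * (K * R^2 / 2))
  <= sig * (v x0 * bump_mass TYPE('a)) * exp (sig * (K * R^2 / 2))" by (intro mult_right_mono) auto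
 moreover have E: "exp (- sig * (K * R^2 / 2)) * exp (sig * (K * R^2 / 2)) = 1" by (simp add: exp_add[symmetric])
 have "sig * (mean v x0 R * exp (- sig * (K * R^2 / 2))) * exp (sig * (K * R^2 / 2)) = sig * mean v x0 R"
  using arg_cong[OF E, of "%e. sig * mean v x0 R * e"] by (simp only: mult.assoc mult_1_right)
 ultimately show ?thesis by (simp only: mult.assoc mult.commute mult.left_commute)
qed

section \<open>Harnack inequalities for supersolutions and subsolutions\<close>

text \<open>Concavity of the root puts a negative multiple of the squared gradient into the
  Laplacian of \<open>sqrt w\<close>. By Young's inequality it absorbs the linear gradient term, and
  an inequality without gradient remains, to which \<open>sub_mean\<close> applies.\<close>

lemma sqrt_supersolution:
 fixes w :: "'a::euclidean_space => real"
 assumes w: "weak_lap Om w G g" and pos: "!!x. x \<in> Om ==> w x > 0"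
  and ball: "cball x0 (real DIM('a) * R) \<subseteq> Om" and R: "R > 0" and K: "K >= 0"
  and g: "!!x. x \<in> Om ==> g x <= K * norm (G x) + K * w x"
 shows "mean (%x. sqrt (w x)) x0 R <= exp ((2 * K + K^2) * R^2 / 2) * (sqrt (w x0) * bump_mass TYPE('a))"
proof -
 have "1 <= real DIM('a)" using DIM_positive[where 'a='a] by linarith
 then have "R <= real DIM('a) * R" using R by simp
 then have sub: "cball x0 R \<subseteq> Om" using ball subset_cball by blast
 have w': "weak_lap Om (%x. sqrt (w x)) (%x. (inverse (sqrt (w x)) / 2) *\<^sub>R G x)
  (%x. inverse (sqrt (w x)) / 2 * g x + (- (inverse (sqrt (w x)) ^ 3 / 4)) * (G x \<bullet> G x))"
 proof (rule weak_lap_chain[OF w])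
  show "DERIV sqrt (w x) :> inverse (sqrt (w x)) / 2" if "x \<in> Om" for x
   using pos[OF that] by (rule DERIV_real_sqrt)
  show "DERIV (%t. inverse (sqrt t) / 2) (w x) :> - (inverse (sqrt (w x)) ^ 3 / 4)" if "x \<in> Om" for x
  proof -
   note DERIV_real_sqrt[OF pos[OF that], derivative_intros]
   show ?thesis using pos[OF that]
    by (auto intro!: derivative_eq_intros simp: power3_eq_cube)
  qed
  show "continuous_on (w ` Om) (%t. - (inverse (sqrt t) ^ 3 / 4))"
   using pos by (intro continuous_intros) force+
 qed
 have "1 * mean (%x. sqrt (w x)) x0 R
  <= 1 * (exp (1 * ((2 * K + K^2) * R^2 / 2)) * (sqrt (w x0) * bump_mass TYPE('a)))"
 proof (rule sub_mean[OF w' ball R])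
  fix x assume "x \<in> cball x0 R"
  then have x: "x \<in> Om" using sub by blast
  define b where "b = sqrt (w x)"
  define s where "s = norm (G x) / b^2"
  have b: "b > 0" "w x = b^2" using pos[OF x] by (auto simp: b_def)
  have p: "norm (G x) = s * b^2" using b by (simp add: s_def)
  have "inverse b / 2 * g x <= inverse b / 2 * (K * (s * b^2) + K * b^2)"
   using g[OF x] b p by (intro mult_left_mono) auto
  also have "... = b * (K * s / 2 + K / 2)" using b(1) by (simp add: field_simps power2_eq_square)
  finally have 1: "inverse b / 2 * g x <= b * (K * s / 2 + K / 2)" .
  have 2: "- (inverse b ^ 3 / 4) * (G x \<bullet> G x) = b * (- (s^2 / 4))"
   using b(1) p unfolding dot_square_norm by (simp add: power2_eq_square power3_eq_cube field_simps)
  have "0 <= (K - s)^2" by simp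
  then have "K * s / 2 <= K^2 / 4 + s^2 / 4" by (simp add: power2_eq_square algebra_simps)
  then have "K * s / 2 + K / 2 + - (s^2 / 4) <= 2 * K + K^2"
   using K zero_le_power2[of K] by linarith
  then have "b * (K * s / 2 + K / 2 + - (s^2 / 4)) <= b * (2 * K + K^2)" using b by (intro mult_left_mono) auto
  then show "1 * (inverse (sqrt (w x)) / 2 * g x + - (inverse (sqrt (w x)) ^ 3 / 4) * (G x \<bullet> G x))
   <= (2 * K + K^2) * sqrt (w x)"
   using 1 2 unfolding b_def[symmetric] by (simp add: algebra_simps)
  show "0 <= sqrt (w x)" using pos[OF x] by simp
 qed (use K in auto)
 then show ?thesis by simp
qed

text \<open>The counterpart for lower bounds: convexity of the square adds twice the squared
  gradient to the Laplacian of \<open>w^2\<close>, and this absorbs the gradient term.\<close>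

lemma square_subsolution:
 fixes w :: "'a::euclidean_space => real"
 assumes w: "weak_lap Om w G g" and pos: "!!x. x \<in> Om ==> w x > 0"
  and ball: "cball x0 (real DIM('a) * R) \<subseteq> Om" and R: "R > 0" and K: "K >= 0"
  and g: "!!x. x \<in> Om ==> - (K * norm (G x) + K * w x) <= g x"
 shows "(w x0)^2 * bump_mass TYPE('a) <= exp ((2 * K + K^2) * R^2 / 2) * mean (%x. (w x)^2) x0 R"
proof -
 have "1 <= real DIM('a)" using DIM_positive[where 'a='a] by linarith
 then have "R <= real DIM('a) * R" using R by simp
 then have sub: "cball x0 R \<subseteq> Om" using ball subset_cball by blast
 have w': "weak_lap Om (%x. (w x)^2) (%x. (2 * w x) *\<^sub>R G x) (%x. (2 * w x) * g x + 2 * (G x \<bullet> G x))"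
  by (rule weak_lap_chain[OF w]) (auto intro!: derivative_eq_intros continuous_intros)
 have "- 1 * mean (%x. (w x)^2) x0 R
  <= - 1 * (exp (- 1 * ((2 * K + K^2) * R^2 / 2)) * ((w x0)^2 * bump_mass TYPE('a)))"
 proof (rule sub_mean[OF w' ball R])
  fix x assume "x \<in> cball x0 R"
  then have x: "x \<in> Om" using sub by blast
  define p where "p = norm (G x)"
  have "2 * w x * (- g x) <= 2 * w x * (K * p + K * w x)"
   using g[OF x] pos[OF x] by (intro mult_left_mono) (auto simp: p_def)
  moreover have "0 <= (K * w x - p)^2" by simp
  then have "2 * w x * (K * p) <= K^2 * (w x)^2 + p^2" by (simp add: power2_eq_square algebra_simps)
  moreover have "2 * w x * (K * p + K * w x) = 2 * w x * (K * p) + 2 * K * (w x)^2"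
   by (simp add: algebra_simps power2_eq_square)
  ultimately have "- (2 * w x * g x) - 2 * p^2 <= 2 * K * (w x)^2 + K^2 * (w x)^2"
   using zero_le_power2[of p] by linarith
  then show "- 1 * ((2 * w x) * g x + 2 * (G x \<bullet> G x)) <= (2 * K + K^2) * (w x)^2"
   unfolding dot_square_norm p_def by (simp add: algebra_simps)
 qed (use K in auto)
 then have "exp (- ((2 * K + K^2) * R^2 / 2)) * ((w x0)^2 * bump_mass TYPE('a)) <= mean (%x. (w x)^2) x0 R" by simp
 then have "exp ((2 * K + K^2) * R^2 / 2) * (exp (- ((2 * K + K^2) * R^2 / 2)) * ((w x0)^2 * bump_mass TYPE('a)))
  <= exp ((2 * K + K^2) * R^2 / 2) * mean (%x. (w x)^2) x0 R" by (intro mult_left_mono) auto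
 then show ?thesis unfolding mult.assoc[symmetric] exp_add[symmetric] by simp
qed

text \<open>The small ball lies within distance \<open>3 / 4 * R\<close> of \<open>y\<close>, where
  the large weight is at least \<open>1 - (3/4)^2 = 7/16\<close>. The power of \<open>r / R\<close>
  comes from undoing the rescaling of both means.\<close>

lemma mean_transfer:
 fixes b :: "'a::euclidean_space => real"
 assumes c: "continuous_on (cball y R) b" and b: "!!z. z \<in> cball y R ==> b z >= 0"
  and xy: "norm (y - x) <= R / 2" and r: "0 < r" "r <= R / 4"
 shows "7 / 16 * (r / R) ^ DIM('a) * mean b x r <= mean b y R"
proof -
 have R: "R > 0" using r by simp
 have in34: "norm (z - y) <= 3 / 4 * R" if "z \<in> cball x r" for z
  using norm_triangle_ineq[of "z - x" "x - y"] that xy r by (auto simp: dist_norm norm_minus_commute)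
 have sub: "cball x r \<subseteq> cball y R" using in34 R by (force simp: dist_norm norm_minus_commute)
 define F where "F c s z = b z * bump ((1/s) *\<^sub>R (z - c))" for c s z
 have Fout: "F c s z = 0" if "s > 0" "z \<notin> cball c s" for c s z
 proof -
  have "norm ((1/s) *\<^sub>R (z - c)) > 1"
   using that unfolding norm_scaleR by (simp add: dist_norm norm_minus_commute)
  then have "bump ((1/s) *\<^sub>R (z - c)) = 0" using bump_outside[of "(1/s) *\<^sub>R (z - c)"] by simp
  then show ?thesis by (simp add: F_def)
 qed
 have int: "integrable lborel (F c s)" if "s > 0" "cball c s \<subseteq> cball y R" for c s
  by (rule integrable_compact_support[of "cball c s"])
   (use that Fout c in \<open>auto simp: F_def intro!: continuous_intros continuous_on_compose2[OF continuous_on_bump[of UNIV]]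
    intro: continuous_on_subset\<close>)
 have id: "orthogonal_transformation (%x::'a. x)" by simp
 have mean: "(LINT z|lborel. F c s z) = s ^ DIM('a) * mean b c s" if "s > 0" "cball c s \<subseteq> cball y R" for c s
 proof -
  have "(LINT z|lborel. F c s z) = s ^ DIM('a) * (LINT x|lborel. F c s (c + s *\<^sub>R x))"
   by (rule integral_similarity[OF _ that(1) id]) (use int[OF that] in \<open>auto dest: borel_measurable_integrable\<close>)
  then show ?thesis using that(1) by (simp add: F_def mean_def)
 qed
 have "(LINT z|lborel. 7 / 16 * F x r z) <= (LINT z|lborel. F y R z)"
 proof (rule integral_mono)
  show "7 / 16 * F x r z <= F y R z" for z
  proof (cases "z \<in> cball x r")
   case True
   have "(norm ((1/R) *\<^sub>R (z - y)))^2 <= (3/4)^2"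
    unfolding norm_scaleR using in34[OF True] R by (intro power_mono) (auto simp: field_simps)
   also have "(3/4)^2 = (9/16::real)" by (simp add: power_divide)
   finally have 1: "7/16 <= bump ((1/R) *\<^sub>R (z - y))" unfolding bump_def le_max_iff_disj by linarith
   have "b z >= 0" using b sub True by blast
   then have "b z * (7/16) <= F y R z" unfolding F_def by (intro mult_left_mono 1)
   moreover have "F x r z <= b z" unfolding F_def
    using \<open>b z >= 0\<close> bump_bounds by (intro mult_left_le) auto
   ultimately show ?thesis by linarith
  next
   case False
   then have "F x r z = 0" using Fout r by blast
   moreover have "F y R z >= 0"
   proof (cases "z \<in> cball y R")
    case True
    then show ?thesis unfolding F_def by (intro mult_nonneg_nonneg bump_bounds(1) b)
   qed (simp add: Fout[OF R])
   ultimately show ?thesis by simp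
  qed
 qed (use int R r sub in auto)
 then have "7 / 16 * (r ^ DIM('a) * mean b x r) <= R ^ DIM('a) * mean b y R"
  using mean[of r x] mean[of R y] r R sub by simp
 then show ?thesis using R by (simp add: power_divide field_simps)
qed

text \<open>The points divide an arc of angle at most \<open>pi\<close> on a great circle into equal
  parts, and chords are not longer than arcs. If \<open>y\<close> is \<open>x\<close> or its
  antipode, any unit vector \<open>e\<close> orthogonal to \<open>x\<close> spans the plane of the
  circle; this is where the dimension enters.\<close>

lemma great_circle_chain:
 fixes x y :: "'a::euclidean_space"
 assumes d: "DIM('a) >= 2" and x: "norm x = 1" and y: "norm y = 1" and n: "n > 0"
 obtains p where "p 0 = x" "p n = y" "!!i. norm (p i) = 1" "!!i. norm (p (Suc i) - p i) <= pi / real n"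
proof -
 define c where "c = x \<bullet> y"
 define v where "v = y - c *\<^sub>R x"
 have c: "-1 <= c" "c <= 1" using Cauchy_Schwarz_ineq2[of x y] x y by (auto simp: c_def abs_le_iff)
 have xx: "x \<bullet> x = 1" "y \<bullet> y = 1" using x y by (simp_all add: dot_square_norm)
 have xv: "x \<bullet> v = 0" by (simp add: v_def inner_diff_right xx c_def)
 have "(norm v)^2 = 1 - c\<^sup>2"
  unfolding power2_norm_eq_inner v_def
  by (simp add: inner_diff_right inner_diff_left xx c_def inner_commute power2_eq_square)
 then have nv: "norm v = sqrt (1 - c\<^sup>2)" by (metis norm_ge_zero real_sqrt_unique)
 obtain e where e: "norm e = 1" "x \<bullet> e = 0" "v = norm v *\<^sub>R e"
 proof (cases "v = 0")
  case True
  obtain e where "e ~= 0" "orthogonal x e" using orthogonal_to_vector_exists[OF d, of x] by blast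
  then show ?thesis using True by (intro that[of "(1 / norm e) *\<^sub>R e"]) (auto simp: orthogonal_def)
 next
  case False
  then show ?thesis using xv by (intro that[of "(1 / norm v) *\<^sub>R v"]) auto
 qed
 have ee: "e \<bullet> e = 1" "e \<bullet> x = 0" using e by (auto simp: dot_square_norm inner_commute)
 define \<alpha> where "\<alpha> = arccos c"
 have al: "0 <= \<alpha>" "\<alpha> <= pi" using arccos[of c] c by (auto simp: \<alpha>_def)
 have yy: "y = cos \<alpha> *\<^sub>R x + sin \<alpha> *\<^sub>R e"
 proof -
  have "y = c *\<^sub>R x + v" by (simp add: v_def)
  also have "v = sin \<alpha> *\<^sub>R e" using e(3) nv c by (simp add: \<alpha>_def sin_arccos)
  finally show ?thesis using c by (simp add: \<alpha>_def cos_arccos)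
 qed
 define P where "P t = cos t *\<^sub>R x + sin t *\<^sub>R e" for t
 have in1: "P s \<bullet> P t = cos (s - t)" for s t
  by (simp add: P_def inner_add_left inner_add_right xx ee e(2) cos_diff)
 have nP: "norm (P t) = 1" for t using in1[of t t] by (simp add: norm_eq_1)
 have dP: "norm (P s - P t) <= abs (s - t)" for s t
 proof -
  have "(norm (P s - P t))^2 = 2 - 2 * cos (s - t)"
   using in1[of s s] in1[of t t] in1[of s t] in1[of t s] cos_minus[of "s - t"]
   by (simp add: power2_norm_eq_inner inner_diff_left inner_diff_right)
  also have "... = (2 * sin ((s - t) / 2))^2"
  proof -
   have e: "2 * ((s - t) / 2) = s - t" by simp
   show ?thesis using cos_double_sin[of "(s - t) / 2"] unfolding e by (simp add: power_mult_distrib)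
  qed
  finally have "norm (P s - P t) = abs (2 * sin ((s - t) / 2))" by (metis abs_norm_cancel power2_eq_iff abs_abs real_sqrt_abs)
  then show ?thesis using abs_sin_x_le_abs_x[of "(s - t) / 2"] by simp
 qed
 show ?thesis
 proof (rule that[of "%i. P (real i * \<alpha> / real n)"])
  show "norm (P (real (Suc i) * \<alpha> / real n) - P (real i * \<alpha> / real n)) <= pi / real n" for i
  proof -
   have "real (Suc i) * \<alpha> / real n - real i * \<alpha> / real n = \<alpha> / real n"
    using n by (simp add: field_simps)
   then have "norm (P (real (Suc i) * \<alpha> / real n) - P (real i * \<alpha> / real n)) <= abs (\<alpha> / real n)" using dP by metis
   also have "... <= pi / real n" using al n by (simp add: divide_right_mono)
   finally show ?thesis .
  qed
 qed (use n yy nP in \<open>auto simp: P_def\<close>)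
qed

text \<open>One step bounds \<open>sqrt w\<close> from below near a point of the unit sphere by the
  mean of \<open>sqrt w\<close> around that point. A chain of overlapping balls, whose length
  depends on \<open>R\<close> only, carries the bound over the whole sphere and to points at
  distance at most \<open>R / 4\<close> from it. The radius \<open>r\<close> of the starting mean is
  left free because it is fixed only later.\<close>

lemma weak_harnack_sphere:
 fixes K dl :: real
 assumes d: "DIM('a::euclidean_space) >= 2" and K: "K >= 0" and dl: "dl > 0"
 obtains R where "R > 0" "R <= 1"
  "!!x::'a. norm x = 1 ==> cball x ((real DIM('a) + 1) * R) \<subseteq> annulus (- dl) dl"
  "!!r. 0 < r ==> r <= R / 4 ==> \<exists>c>0. \<forall>(w::'a => real) G g. weak_lap (annulus (- dl) dl) w G g -->
   (\<forall>x\<in>annulus (- dl) dl. w x > 0 & g x <= K * norm (G x) + K * w x) -->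
   (\<forall>x y y'. norm x = 1 --> norm y' = 1 --> norm (y - y') <= R / 4 --> c * mean (%x. sqrt (w x)) x r <= sqrt (w y))"
proof -
 let ?A = "annulus (- dl) dl :: 'a set"
 define D where "D = real DIM('a)"
 have D: "D >= 2" using d by (simp add: D_def)
 \<comment> \<open>Balls of radius less than \<open>s0\<close> around points of the unit sphere stay
   in the annulus: \<open>1 - s0 = exp (- dl)\<close>, and \<open>1 + s0 <= exp dl\<close>.\<close>
 define s0 where "s0 = 1 - exp (- dl)"
 have s0: "0 < s0" "s0 < 1" using dl by (auto simp: s0_def)
 define R where "R = s0 / (2 * (D + 1))"
 have "(D + 1) * R = s0 / 2" using D by (simp add: R_def field_simps)
 then have R: "R > 0" "(D + 1) * R < s0" using s0 D by (simp_all add: R_def)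
 have R1: "R <= 1" using R s0 D by (smt (verit, best) mult_left_le_one_le mult_less_cancel_right1)
 have es: "1 + s0 <= exp dl"
 proof -
  have "0 <= (exp dl - 1)^2 / exp dl" by simp
  also have "(exp dl - 1)^2 / exp dl = exp dl - 2 + exp (- dl)"
   by (simp add: power2_eq_square field_simps exp_minus)
  finally show ?thesis by (simp add: s0_def)
 qed
 have inA: "y \<in> ?A" if "norm x = 1" "norm (y - x) < s0" for x y :: 'a
  using that es norm_triangle_ineq3[of y x] by (auto simp: annulus_def s0_def abs_le_iff)
 have ballA: "cball x ((D + 1) * R) \<subseteq> ?A" if "norm x = 1" for x :: 'a
  using inA[OF that] R(2) by (force simp: dist_norm norm_minus_commute)
 define E where "E = exp ((2 * K + K^2) * R^2 / 2)"
 define m where "m = bump_mass TYPE('a)"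
 have m: "m > 0" unfolding m_def by (rule bump_mass_pos)
 have E: "E > 0" by (simp add: E_def)
 define cr where "cr r = 7 / 16 * (r / R) ^ DIM('a) / (E * m)" for r
 have cr: "cr r > 0" if "r > 0" for r using that R m E by (simp add: cr_def)
 have step: "cr r * mean (%x. sqrt (w x)) x r <= sqrt (w y)"
  if w: "weak_lap ?A w G g" "\<forall>x\<in>?A. w x > 0 & g x <= K * norm (G x) + K * w x"
   and x: "norm x = 1" and xy: "norm (y - x) <= R / 2" and r: "0 < r" "r <= R / 4" for w G g x y r
 proof -
  have sub: "cball y (real DIM('a) * R) \<subseteq> ?A"
  proof -
   have "cball y (D * R) \<subseteq> cball x ((D + 1) * R)"
    using xy R(1) by (intro cball_subset_cball_iff[THEN iffD2] disjI1) (auto simp: dist_norm algebra_simps)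
   then show ?thesis using ballA[OF x] by (simp add: D_def)
  qed
  have "1 * R <= D * R" using D R by (intro mult_right_mono) auto
  then have sub1: "cball y R \<subseteq> ?A" using sub subset_cball[of R "D * R" y] by (auto simp: D_def)
  have cw: "continuous_on ?A (%x. sqrt (w x))"
   using w(1) gderiv_continuous_on[of ?A w G] by (auto simp: weak_lap_def intro!: continuous_intros)
  have "0 <= sqrt (w z)" if "z \<in> cball y R" for z
   using w(2) subsetD[OF sub1 that] by (simp add: less_imp_le)
  then have 1: "7 / 16 * (r / R) ^ DIM('a) * mean (%x. sqrt (w x)) x r <= mean (%x. sqrt (w x)) y R"
   by (rule mean_transfer[OF continuous_on_subset[OF cw sub1] _ xy r])
  have 2: "mean (%x. sqrt (w x)) y R <= E * (sqrt (w y) * m)"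
   unfolding E_def m_def by (rule sqrt_supersolution[OF w(1) _ sub R(1) K]) (use w(2) in auto)
  have "cr r * mean (%x. sqrt (w x)) x r = (7 / 16 * (r / R) ^ DIM('a) * mean (%x. sqrt (w x)) x r) / (E * m)"
   by (simp add: cr_def)
  also have "... <= (E * (sqrt (w y) * m)) / (E * m)"
   using 1 2 E m by (intro divide_right_mono) auto
  also have "... = sqrt (w y)" using E m by simp
  finally show ?thesis .
 qed
 show ?thesis
 proof (rule that[OF R(1) R1])
  show "cball x ((real DIM('a) + 1) * R) \<subseteq> ?A" if "norm x = 1" for x :: 'a
   using ballA[OF that] by (simp add: D_def)
  fix r :: real assume r: "0 < r" "r <= R / 4"
  obtain n :: nat where n: "pi / (R / 4) < real n" using reals_Archimedean2 by blast
  have n0: "n > 0" using n R by (metis divide_pos_pos gr0I less_asym of_nat_0 pi_gt_zero zero_less_numeral)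
  have pn: "pi / real n <= R / 4" using n n0 R by (simp add: field_simps)
  \<comment> \<open>The factor lost per link of the chain: a constant lower bound on a ball of
    radius \<open>R / 4\<close> has a mean equal to that constant times \<open>m\<close>, and one
    step multiplies it by \<open>cr (R / 4)\<close>.\<close>
  define c2 where "c2 = cr (R / 4) * m"
  have c2: "c2 > 0" using cr[of "R / 4"] R m by (simp add: c2_def)
  show "\<exists>c>0. \<forall>(w::'a => real) G g. weak_lap ?A w G g -->
   (\<forall>x\<in>?A. w x > 0 & g x <= K * norm (G x) + K * w x) -->
   (\<forall>x y y'. norm x = 1 --> norm y' = 1 --> norm (y - y') <= R / 4 --> c * mean (%x. sqrt (w x)) x r <= sqrt (w y))"
  proof (intro exI[of _ "c2 ^ n * cr r"] conjI allI impI)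
   show "0 < c2 ^ n * cr r" using c2 cr[OF r(1)] by simp
   fix w :: "'a => real" and G g and x y y' :: 'a
   assume w: "weak_lap ?A w G g" "\<forall>x\<in>?A. w x > 0 & g x <= K * norm (G x) + K * w x"
    and x: "norm x = 1" and y: "norm y' = 1" and yy: "norm (y - y') <= R / 4"
   define M where "M = mean (%x. sqrt (w x)) x r"
   obtain p where p: "p 0 = x" "p n = y'" "!!i. norm (p i) = 1" "!!i. norm (p (Suc i) - p i) <= pi / real n"
    using great_circle_chain[OF d x y n0] by metis
   have "\<forall>z\<in>cball (p i) (R / 4). c2 ^ i * cr r * M <= sqrt (w z)" for i
   proof (induction i)
    case 0
    then show ?case using step[OF w x _ r] R(1) by (auto simp: M_def p(1) dist_norm norm_minus_commute)
   next
    case (Suc i)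
    show ?case
    proof
     fix z assume z: "z \<in> cball (p (Suc i)) (R / 4)"
     have zi: "norm (z - p i) <= R / 2"
     proof -
      have "norm (z - p (Suc i)) <= R / 4" using z by (simp add: dist_norm norm_minus_commute)
      moreover have "norm (z - p i) <= norm (z - p (Suc i)) + norm (p (Suc i) - p i)"
       using norm_triangle_ineq[of "z - p (Suc i)" "p (Suc i) - p i"] by simp
      ultimately show ?thesis using p(4)[of i] pn by linarith
     qed
     have sub: "cball (p i) (R / 4) \<subseteq> ?A"
     proof -
      have "1 * R <= (D + 1) * R" using D R by (intro mult_right_mono) auto
      then have "R / 4 <= (D + 1) * R" using R by simp
      then show ?thesis using ballA[OF p(3)[of i]] subset_cball by blast
     qed
     have cw: "continuous_on ?A (%x. sqrt (w x))"
      using w(1) gderiv_continuous_on[of ?A w G] by (auto simp: weak_lap_def intro!: continuous_intros)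
     have "mean (%_. c2 ^ i * cr r * M) (p i) (R / 4) <= mean (%x. sqrt (w x)) (p i) (R / 4)"
      by (rule mean_mono) (use Suc R(1) in \<open>auto intro: continuous_on_subset[OF cw sub]\<close>)
     then have "cr (R / 4) * (c2 ^ i * cr r * M * m) <= cr (R / 4) * mean (%x. sqrt (w x)) (p i) (R / 4)"
      using cr[of "R / 4"] R(1) unfolding mean_const m_def by (intro mult_left_mono) auto
     also have "... <= sqrt (w z)" by (rule step[OF w p(3) zi]) (use R in auto)
     finally show "c2 ^ Suc i * cr r * M <= sqrt (w z)" by (simp add: c2_def mult_ac)
    qed
   qed
   from this[of n] show "c2 ^ n * cr r * mean (%x. sqrt (w x)) x r <= sqrt (w y)"
    using yy by (simp add: p(2) M_def dist_norm norm_minus_commute)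
  qed
 qed
qed

text \<open>The weighted supremum of \<open>sqrt w\<close> absorbs the power lost by using \<open>w^2\<close> as subsolution.\<close>

lemma local_sup:
 fixes K R :: real
 assumes K: "K >= 0" and R: "R > 0"
 obtains C where "C > 0" "!!Om w G g (x0::'a::euclidean_space). weak_lap Om w G g ==> (!!x. x \<in> Om ==> w x > 0) ==>
  cball x0 R \<subseteq> Om ==> (!!x. x \<in> Om ==> - (K * norm (G x) + K * w x) <= g x) ==>
  sqrt (w x0) <= C * mean (%x. sqrt (w x)) x0 R"
proof -
 define n where "n = DIM('a)"
 define D where "D = real n"
 have D: "D >= 1" using DIM_positive[where 'a='a] unfolding D_def n_def by linarith
 define m where "m = bump_mass TYPE('a)"
 have m: "m > 0" unfolding m_def by (rule bump_mass_pos)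
 define E where "E = exp ((2 * K + K^2) * R^2 / 2)"
 have E: "E > 0" by (simp add: E_def)
 define C where "C = E * 8 ^ n * (2 * D * R) ^ n * (16 / 7) / (m * (R / 2) ^ n)"
 have C: "C > 0" using E m R D by (simp add: C_def)
 show ?thesis
 proof (rule that[OF C])
  fix Om w G g and x0 :: 'a
  assume w: "weak_lap Om w G g" and pos: "!!x. x \<in> Om ==> w x > 0" and ball: "cball x0 R \<subseteq> Om"
   and g: "!!x. x \<in> Om ==> - (K * norm (G x) + K * w x) <= g x"
  define a where "a x = sqrt (w x)" for x
  have cw: "continuous_on Om w" using w gderiv_continuous_on[of Om w G] by (auto simp: weak_lap_def)
  have ca: "continuous_on Om a" unfolding a_def using cw by (intro continuous_intros)
  have ball2: "cball x0 (R / 2) \<subseteq> cball x0 R" using R by (simp add: subset_cball)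
  \<comment> \<open>The weight vanishes on the boundary of the half ball, so the maximum of
    \<open>f\<close> is attained at an interior point \<open>y\<close>, at distance
    \<open>dl\<close> from that boundary. Within \<open>dl / 2\<close> of \<open>y\<close> the
    function \<open>a\<close> is at most \<open>B = 2 ^ n * a y\<close>.\<close>
  define f where "f y = a y * (R / 2 - norm (y - x0)) ^ n" for y
  have "continuous_on (cball x0 (R / 2)) f" unfolding f_def
   using ball ball2 by (intro continuous_intros continuous_on_subset[OF ca]) auto
  then obtain y where y: "y \<in> cball x0 (R / 2)" "!!z. z \<in> cball x0 (R / 2) ==> f z <= f y"
   using continuous_attains_sup[of "cball x0 (R / 2)" f] R by force
  define S where "S = f y"
  define dl where "dl = R / 2 - norm (y - x0)"
  have posR: "w z > 0" if "z \<in> cball x0 R" for z using pos subsetD[OF ball that] by blast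
  have a0: "a x0 > 0" using posR[of x0] R by (simp add: a_def)
  have S0: "a x0 * (R / 2) ^ n <= S" using y(2)[of x0] R by (simp add: S_def f_def)
  moreover have "0 < a x0 * (R / 2) ^ n" using a0 R by simp
  ultimately have S: "S > 0" by linarith
  have "dl >= 0" using y(1) by (simp add: dl_def dist_norm norm_minus_commute)
  moreover have "dl ~= 0"
  proof
   assume "dl = 0"
   moreover have "S = a y * dl ^ n" by (simp add: S_def f_def dl_def)
   moreover have "n > 0" using D unfolding D_def by simp
   ultimately show False using S by (simp add: zero_power)
  qed
  ultimately have dl: "dl > 0" by simp
  \<comment> \<open>The ball enlarged by the dimension, as \<open>mean_derivative\<close> needs it,
    then has radius \<open>dl / 2\<close>.\<close>
  define rho where "rho = dl / (2 * D)"
  have rho: "rho > 0" "D * rho = dl / 2" using dl D by (auto simp: rho_def)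
  have "1 * rho <= D * rho" using D rho by (intro mult_right_mono) auto
  then have rho2: "rho <= dl / 2" using rho by simp
  have "dl <= R / 2" by (simp add: dl_def)
  then have rhoR: "rho <= R / 4" using rho2 by simp
  have near: "norm (z - x0) <= R / 2 - dl / 2" if "z \<in> cball y (dl / 2)" for z
  proof -
   have "norm (z - x0) <= norm (z - y) + norm (y - x0)" using norm_triangle_ineq[of "z - y" "y - x0"] by simp
   moreover have "norm (z - y) <= dl / 2" using that by (simp add: dist_norm norm_minus_commute)
   moreover have "norm (y - x0) = R / 2 - dl" by (simp add: dl_def)
   ultimately show ?thesis by linarith
  qed
  have sub: "cball y (dl / 2) \<subseteq> cball x0 (R / 2)"
   using near dl by (force simp: dist_norm norm_minus_commute)
  define B where "B = S * (2 / dl) ^ n"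
  have aB: "a z <= B" if "z \<in> cball y (dl / 2)" for z
  proof -
   have zz: "z \<in> cball x0 (R / 2)" using sub that by blast
   have "a z * (dl / 2) ^ n <= f z" unfolding f_def
    using near[OF that] dl posR[OF subsetD[OF ball2 zz]] by (intro mult_left_mono power_mono) (auto simp: a_def)
   then have "a z * (dl / 2) ^ n <= S" using y(2)[OF zz] by (simp add: S_def)
   then have "a z * ((dl / 2) ^ n * (2 / dl) ^ n) <= S * (2 / dl) ^ n"
    unfolding mult.assoc[symmetric] using dl by (intro mult_right_mono) auto
   also have "(dl / 2) ^ n * (2 / dl) ^ n = 1" using dl by (simp add: power_mult_distrib[symmetric])
   finally show ?thesis by (simp add: B_def)
  qed
  have subR: "cball y rho \<subseteq> cball y (dl / 2)" using rho2 by (simp add: subset_cball)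
  have suby: "cball y rho \<subseteq> Om" by (rule order.trans[OF subR order.trans[OF sub order.trans[OF ball2 ball]]])
  define M where "M = mean a x0 R"
  have "(w y)^2 * m <= exp ((2 * K + K^2) * rho^2 / 2) * mean (%x. (w x)^2) y rho"
   unfolding m_def
  proof (rule square_subsolution[OF w pos _ rho(1) K g])
   show "cball y (real DIM('a) * rho) \<subseteq> Om"
    unfolding rho(2)[unfolded D_def n_def] by (rule order.trans[OF order.trans[OF sub ball2] ball])
  qed
  also have "... <= E * mean (%x. (w x)^2) y rho"
  proof (rule mult_right_mono)
   have "rho\<^sup>2 <= R^2" using rho rhoR R by (intro power_mono) auto
   then have "(2 * K + K^2) * rho^2 <= (2 * K + K^2) * R^2" using K by (intro mult_left_mono) auto
   then show "exp ((2 * K + K^2) * rho^2 / 2) <= E" unfolding E_def by simp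
   have "mean (%_. 0) y rho <= mean (%x. (w x)^2) y rho"
    using rho(1) by (intro mean_mono continuous_intros continuous_on_subset[OF cw suby]) auto
   then show "0 <= mean (%x. (w x)^2) y rho" by (simp add: mean_const)
  qed
  also have "mean (%x. (w x)^2) y rho <= mean (%x. B ^ 3 * a x) y rho"
  proof (intro mean_mono continuous_intros continuous_on_subset[OF cw suby] continuous_on_subset[OF ca suby])
   fix z assume z: "z \<in> cball y rho"
   have wz: "w z > 0" using pos subsetD[OF suby z] by blast
   \<comment> \<open>Three of the four powers of \<open>a\<close> are replaced by the bound
     \<open>B\<close>; the remaining one is what the mean of \<open>sqrt w\<close> controls.\<close>
   have "(w z)^2 = a z ^ 3 * a z"
    using wz by (simp add: a_def power2_eq_square power3_eq_cube)
   also have "... <= B ^ 3 * a z"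
    using aB[of z] z subR wz by (intro mult_right_mono power_mono) (auto simp: a_def)
   finally show "(w z)^2 <= B ^ 3 * a z" .
  qed (use rho in auto)
  also have "mean (%x. B ^ 3 * a x) y rho = B ^ 3 * mean a y rho" by (rule mean_cmult)
  finally have 1: "(w y)^2 * m <= E * (B ^ 3 * mean a y rho)" using E by simp
  have "0 <= a z" if "z \<in> cball x0 R" for z using posR[OF that] by (simp add: a_def)
  then have 2: "7 / 16 * (rho / R) ^ n * mean a y rho <= M" unfolding M_def n_def
   by (rule mean_transfer[OF continuous_on_subset[OF ca ball]])
    (use y(1) rho rhoR in \<open>auto simp: dist_norm norm_minus_commute\<close>)
  have "w y > 0" by (rule posR[OF subsetD[OF ball2 y(1)]])
  then have 3: "(w y)^2 = (S / dl ^ n) ^ 4"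
   using dl by (simp add: S_def f_def dl_def[symmetric] a_def power4_eq_xxxx power2_eq_square)
  have B: "B > 0" using S dl by (simp add: B_def)
  have "(S / dl ^ n) ^ 4 * m * (7 / 16 * (rho / R) ^ n) <= E * (B ^ 3 * mean a y rho) * (7 / 16 * (rho / R) ^ n)"
   using 1 R rho(1) unfolding 3 by (intro mult_right_mono) auto
  also have "... = E * B ^ 3 * (7 / 16 * (rho / R) ^ n * mean a y rho)" by simp
  also have "... <= E * B ^ 3 * M" using 2 E B by (intro mult_left_mono) auto
  finally have 4: "(S / dl ^ n) ^ 4 * m * (7 / 16 * (rho / R) ^ n) <= E * B ^ 3 * M" .
  \<comment> \<open>Both sides contain \<open>S ^ 3 / dn ^ 3\<close>, and cancelling it leaves an
    inequality linear in \<open>S\<close>. The powers of \<open>dl\<close> match because the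
    exponent of the weight is the dimension, which is also the exponent lost in
    \<open>mean_transfer\<close>.\<close>
  define dn where "dn = dl ^ n"
  have dn: "dn > 0" using dl by (simp add: dn_def)
  have r1: "(rho / R) ^ n = dn / (2 * D * R) ^ n" by (simp add: rho_def dn_def power_divide)
  have r2: "B ^ 3 = S ^ 3 * 8 ^ n / dn ^ 3"
  proof -
   have "(2 ^ n) ^ 3 = (8::real) ^ n" by (simp add: power_mult[symmetric] mult.commute[of n 3] power_mult)
   then show ?thesis by (simp add: B_def dn_def power_divide power_mult_distrib)
  qed
  have DR: "(2 * D * R) ^ n > 0" using D R by simp
  have e1: "(S / dn) ^ 4 * m * (7 / 16 * (dn / (2 * D * R) ^ n)) = S ^ 3 / dn ^ 3 * (S * m * (7 / 16) / (2 * D * R) ^ n)"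
   using dn DR by (simp add: power_divide power4_eq_xxxx power3_eq_cube field_simps)
  have e2: "E * (S ^ 3 * 8 ^ n / dn ^ 3) * M = S ^ 3 / dn ^ 3 * (E * 8 ^ n * M)" by simp
  have "S ^ 3 / dn ^ 3 * (S * m * (7 / 16) / (2 * D * R) ^ n) <= S ^ 3 / dn ^ 3 * (E * 8 ^ n * M)"
   using 4 unfolding r1 r2 dn_def[symmetric] e1 e2 .
  then have "S * m * (7 / 16) / (2 * D * R) ^ n <= E * 8 ^ n * M"
   using S dn by (subst (asm) mult_le_cancel_left_pos) auto
  then have "S * m <= E * 8 ^ n * M * (2 * D * R) ^ n * (16 / 7)" using DR by (simp add: field_simps)
  moreover have "a x0 * (R / 2) ^ n * m <= S * m" using S0 m by (intro mult_right_mono) auto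
  ultimately have "a x0 * (m * (R / 2) ^ n) <= E * 8 ^ n * (2 * D * R) ^ n * (16 / 7) * M" by (simp add: mult_ac)
  then have "a x0 <= C * M" using m R unfolding C_def by (simp add: field_simps)
  then show "sqrt (w x0) <= C * mean (%x. sqrt (w x)) x0 R" by (simp add: M_def a_def[abs_def])
 qed
qed

text \<open>The local bound of \<open>sqrt w\<close> by its mean is joined with the lower bound by
  the same mean; squaring turns the constant into \<open>(C / c)^2\<close>. The point
  \<open>y\<close> off the sphere is compared with its radial projection \<open>y'\<close>.\<close>

lemma harnack_sphere:
 fixes K dl :: real
 assumes d: "DIM('a::euclidean_space) >= 2" and K: "K >= 0" and dl: "dl > 0"
 obtains C h where "C > 0" "h > 0" "!!(w::'a => real) G g x y. weak_lap (annulus (- dl) dl) w G g ==>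
   (!!x. x \<in> annulus (- dl) dl ==> w x > 0 & abs (g x) <= K * norm (G x) + K * w x) ==>
   norm x = 1 ==> abs (norm y - 1) <= h ==> w x <= C * w y"
proof -
 let ?A = "annulus (- dl) dl :: 'a set"
 obtain R where R: "R > 0" "R <= 1" "!!x::'a. norm x = 1 ==> cball x ((real DIM('a) + 1) * R) \<subseteq> ?A"
  and H: "!!r. 0 < r ==> r <= R / 4 ==> \<exists>c>0. \<forall>(w::'a => real) G g. weak_lap ?A w G g -->
   (\<forall>x\<in>?A. w x > 0 & g x <= K * norm (G x) + K * w x) -->
   (\<forall>x y y'. norm x = 1 --> norm y' = 1 --> norm (y - y') <= R / 4 --> c * mean (%x. sqrt (w x)) x r <= sqrt (w y))"
  by (rule weak_harnack_sphere[OF d K dl]) (rule that)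
 obtain c where c: "c > 0" "\<forall>(w::'a => real) G g. weak_lap ?A w G g -->
   (\<forall>x\<in>?A. w x > 0 & g x <= K * norm (G x) + K * w x) -->
   (\<forall>x y y'. norm x = 1 --> norm y' = 1 --> norm (y - y') <= R / 4 --> c * mean (%x. sqrt (w x)) x (R / 4) <= sqrt (w y))"
  using H[of "R / 4"] R(1) by auto
 have R4: "R / 4 > 0" using R(1) by simp
 obtain C where C: "C > 0" "!!Om w G g (x0::'a). weak_lap Om w G g ==> (!!x. x \<in> Om ==> w x > 0) ==>
  cball x0 (R / 4) \<subseteq> Om ==> (!!x. x \<in> Om ==> - (K * norm (G x) + K * w x) <= g x) ==>
  sqrt (w x0) <= C * mean (%x. sqrt (w x)) x0 (R / 4)"
 proof (rule local_sup[OF K R4, where 'a = 'a], goal_cases)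
  case (1 C)
  from 1(2,3) show ?case by (rule that)
 qed
 show ?thesis
 proof (rule that[of "(C / c)^2" "R / 4"])
  show "R / 4 > 0" by (rule R4)
  show "0 < (C / c)^2" using C(1) c(1) by simp
  fix w :: "'a => real" and G g and x y :: 'a
  assume w: "weak_lap ?A w G g" and b: "!!x. x \<in> ?A ==> w x > 0 & abs (g x) <= K * norm (G x) + K * w x"
   and x: "norm x = 1" and y: "abs (norm y - 1) <= R / 4"
  have Dpos: "real DIM('a) + 1 >= 1" by simp
  have R1: "R <= (real DIM('a) + 1) * R" using mult_right_mono[OF Dpos, of R] R(1) by simp
  have y0: "norm y > 0" using y R(1,2) by (auto simp: abs_le_iff)
  define y' where "y' = (1 / norm y) *\<^sub>R y"
  have y'1: "norm y' = 1" using y0 by (simp add: y'_def)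
  have "y - y' = (1 - 1 / norm y) *\<^sub>R y" by (simp add: y'_def algebra_simps)
  then have "norm (y - y') = abs ((1 - 1 / norm y) * norm y)" by (simp add: abs_mult)
  also have "(1 - 1 / norm y) * norm y = norm y - 1" using y0 by (simp add: field_simps)
  finally have yy: "norm (y - y') <= R / 4" using y by simp
  have "y \<in> cball y' R" using yy R(1) by (simp add: dist_norm norm_minus_commute)
  then have yA: "y \<in> ?A" using order.trans[OF subset_cball[OF R1] R(3)[OF y'1]] by blast
  have "R * 1 <= R * (4 * (real DIM('a) + 1))" using R(1) by (intro mult_left_mono) auto
  then have "R / 4 <= (real DIM('a) + 1) * R" by (simp add: mult_ac)
  then have sub: "cball x (R / 4) \<subseteq> ?A" using order.trans[OF subset_cball R(3)[OF x]] by blast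
  have b': "w z > 0 & g z <= K * norm (G z) + K * w z" "- (K * norm (G z) + K * w z) <= g z" if "z \<in> ?A" for z
   using b[OF that] by (auto simp: abs_le_iff)
  have "sqrt (w x) <= C * mean (%x. sqrt (w x)) x (R / 4)"
   by (rule C(2)[OF w _ sub]) (use b' in auto)
  moreover have "c * mean (%x. sqrt (w x)) x (R / 4) <= sqrt (w y)" using c(2) w b' x y'1 yy by blast
  then have "mean (%x. sqrt (w x)) x (R / 4) <= sqrt (w y) / c" using c(1) by (simp add: field_simps)
  then have "C * mean (%x. sqrt (w x)) x (R / 4) <= C * (sqrt (w y) / c)" using C(1) by (intro mult_left_mono) auto
  ultimately have le: "sqrt (w x) <= (C / c) * sqrt (w y)" by simp
  have p: "w x > 0" "w y > 0" using b yA x dl by (auto simp: annulus_def)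
  then have "(sqrt (w x))^2 <= ((C / c) * sqrt (w y))^2" using le by (intro power_mono) auto
  then show "w x <= (C / c)^2 * w y" unfolding power_mult_distrib using p by simp
 qed
qed

text \<open>A strong maximum principle in quantitative form. The lower bound on \<open>g\<close>
  turns \<open>\<l> <= w x\<close> into a lower bound \<open>m0\<close> for a mean of
  \<open>sqrt w\<close> near \<open>x\<close>; the weak Harnack inequality for \<open>w + ep\<close>
  carries it to \<open>y\<close>. The same \<open>ep\<close> serves as admissible error and as
  conclusion, because \<open>(c * m0)^2 = 2 * ep <= w y + ep\<close>.\<close>

lemma two_point:
 fixes K dl \<l> C0 :: real
 assumes d: "DIM('a::euclidean_space) >= 2" and K: "K >= 0" and dl: "dl > 0" and l: "\<l> > 0" and C0: "C0 >= 0"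
 obtains ep where "ep > 0" "!!(w::'a => real) G g x y. weak_lap (annulus (- dl) dl) w G g ==>
   (!!x. x \<in> annulus (- dl) dl ==> 0 <= w x & w x <= C0 & g x <= K * norm (G x) + K * (w x + ep)
    & - (K * (1 + norm (G x))) <= g x) ==>
   norm x = 1 ==> norm y = 1 ==> \<l> <= w x ==> ep <= w y"
proof -
 let ?A = "annulus (- dl) dl :: 'a set"
 obtain R where R: "R > 0" "R <= 1" "!!x::'a. norm x = 1 ==> cball x ((real DIM('a) + 1) * R) \<subseteq> ?A"
  and H: "!!r. 0 < r ==> r <= R / 4 ==> \<exists>c>0. \<forall>(w::'a => real) G g. weak_lap ?A w G g -->
   (\<forall>x\<in>?A. w x > 0 & g x <= K * norm (G x) + K * w x) -->
   (\<forall>x y y'. norm x = 1 --> norm y' = 1 --> norm (y - y') <= R / 4 --> c * mean (%x. sqrt (w x)) x r <= sqrt (w y))"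
  by (rule weak_harnack_sphere[OF d K dl]) (rule that)
 define m where "m = bump_mass TYPE('a)"
 have m: "m > 0" unfolding m_def by (rule bump_mass_pos)
 define C1 where "C1 = (C0 + 1) * sqrt (C0 + 1)"
 have C1: "C1 > 0" using C0 by (simp add: C1_def)
 \<comment> \<open>Shifting by \<open>kp\<close> makes the function positive and turns the bound
   with the constant 1 into a homogeneous one with \<open>K1\<close>. The price is the term with
   \<open>sqrt kp\<close>, kept below half of \<open>\<l>^2\<close>.\<close>
 define kp where "kp = min 1 ((\<l>^2 / (6 * C1))^2)"
 have kap: "kp > 0" "kp <= 1" using l C1 by (auto simp: kp_def)
 have "sqrt kp <= sqrt ((\<l>^2 / (6 * C1))^2)" by (rule real_sqrt_le_mono) (simp add: kp_def)
 also have "... = \<l>^2 / (6 * C1)" using C1 by (simp add: real_sqrt_abs abs_mult)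
 finally have kap3: "3 * C1 * sqrt kp <= \<l>^2 / 2" using C1 by (simp add: field_simps)
 define K1 where "K1 = K + K / kp"
 have K1: "K1 >= 0" "K <= K1" "K <= K1 * kp" using K kap by (auto simp: K1_def field_simps)
 define L where "L = 2 * K1 + K1^2"
 have L: "L >= 0" using K1 by (simp add: L_def)
 \<comment> \<open>\<open>L * r^2 <= 1\<close>, so that the exponential factor of the mean value
   inequality is at most 3. As \<open>L\<close> depends on \<open>kp\<close>, the radius is fixed
   only here, and so is \<open>c\<close>.\<close>
 define r where "r = min (R / 4) (1 / (1 + L))"
 have r: "r > 0" "r <= R / 4" "r <= 1 / (1 + L)" "r <= 1" using R L by (auto simp: r_def)
 have "L * r^2 <= L * r" using L r by (intro mult_left_mono) (auto simp: power2_eq_square mult_left_le)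
 also have "L * r <= L * (1 / (1 + L))" using L r by (intro mult_left_mono) auto
 also have "... <= 1" using L by simp
 finally have Lr: "exp (L * r^2 / 2) <= 3" using exp_le by (smt (verit) exp_le_cancel_iff field_sum_of_halves)
 obtain c where c: "c > 0" "\<forall>(w::'a => real) G g. weak_lap ?A w G g -->
   (\<forall>x\<in>?A. w x > 0 & g x <= K * norm (G x) + K * w x) -->
   (\<forall>x y y'. norm x = 1 --> norm y' = 1 --> norm (y - y') <= R / 4 --> c * mean (%x. sqrt (w x)) x r <= sqrt (w y))"
  using H[OF r(1,2)] by blast
 define m0 where "m0 = \<l>^2 * m / (6 * C1)"
 have m0: "m0 > 0" using l m C1 by (simp add: m0_def)
 define ep where "ep = (c * m0)^2 / 2"
 have eps: "ep > 0" using c(1) m0 by (simp add: ep_def)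
 show ?thesis
 proof (rule that[OF eps])
  fix w :: "'a => real" and G g and x y :: 'a
  assume w: "weak_lap ?A w G g" and x: "norm x = 1" and y: "norm y = 1" and lw: "\<l> <= w x"
   and b: "!!x. x \<in> ?A ==> 0 <= w x & w x <= C0 & g x <= K * norm (G x) + K * (w x + ep)
    & - (K * (1 + norm (G x))) <= g x"
  have rs: "(real DIM('a)) * r <= (real DIM('a) + 1) * R" "r <= (real DIM('a) + 1) * R"
   using r(1,2) R(1) mult_mono[of "real DIM('a)" "real DIM('a) + 1" r R] mult_mono[of 1 "real DIM('a) + 1" r R] by auto
  have subd: "cball x (real DIM('a) * r) \<subseteq> ?A" and sub: "cball x r \<subseteq> ?A"
   using order.trans[OF subset_cball[OF rs(1)] R(3)[OF x]] order.trans[OF subset_cball[OF rs(2)] R(3)[OF x]]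
   by simp_all
  have cw: "continuous_on ?A w" using w gderiv_continuous_on[of ?A w G] by (auto simp: weak_lap_def)
  have cr: "continuous_on (cball x r) w" by (rule continuous_on_subset[OF cw sub])
  define M where "M = mean (%x. sqrt (w x)) x r"
  have "(w x + kp)^2 * m <= exp ((2 * K1 + K1^2) * r^2 / 2) * mean (%x. (w x + kp)^2) x r"
   unfolding m_def
  proof (rule square_subsolution[OF weak_lap_add_const[OF w] _ subd r(1) K1(1)])
   fix z assume z: "z \<in> ?A"
   show "w z + kp > 0" using b[OF z] kap by linarith
   have "K * norm (G z) <= K1 * norm (G z)" using K1 by (intro mult_right_mono) auto
   moreover have "K1 * kp <= K1 * (w z + kp)" using K1 b[OF z] by (intro mult_left_mono) auto
   ultimately show "- (K1 * norm (G z) + K1 * (w z + kp)) <= g z"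
    using b[OF z] K1(3) by (simp add: algebra_simps)
  qed
  also have "... <= 3 * mean (%x. (w x + kp)^2) x r"
  proof (rule mult_right_mono)
   show "exp ((2 * K1 + K1^2) * r^2 / 2) <= 3" using Lr by (simp add: L_def)
   have "mean (%_. 0) x r <= mean (%x. (w x + kp)^2) x r"
    using r(1) by (intro mean_mono continuous_intros cr) auto
   then show "0 <= mean (%x. (w x + kp)^2) x r" by (simp add: mean_const)
  qed
  also have "mean (%x. (w x + kp)^2) x r <= mean (%x. C1 * (sqrt (w x) + sqrt kp)) x r"
  proof (intro mean_mono continuous_intros cr)
   fix z assume "z \<in> cball x r"
   then have bz: "0 <= w z" "w z <= C0" using b[of z] subsetD[OF sub, of z] by auto
   define s where "s = sqrt (w z + kp)"
   have s: "0 <= s" "s <= sqrt (C0 + 1)" "s <= sqrt (w z) + sqrt kp" "s * s = w z + kp"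
    using bz kap sqrt_add_le_add_sqrt[of "w z" kp] by (auto simp: s_def)
   have "(w z + kp)^2 = (w z + kp) * s * s" using s(4) by (simp add: power2_eq_square mult.assoc)
   also have "... <= ((C0 + 1) * sqrt (C0 + 1)) * (sqrt (w z) + sqrt kp)"
    using bz kap s C0 by (intro mult_mono) auto
   finally show "(w z + kp)^2 <= C1 * (sqrt (w z) + sqrt kp)" by (simp add: C1_def)
  qed (use r in auto)
  also have "mean (%x. C1 * (sqrt (w x) + sqrt kp)) x r = C1 * (M + sqrt kp * m)"
   unfolding mean_cmult M_def m_def mean_const[symmetric, of _ x r]
   by (subst mean_add) (use r in \<open>auto intro!: continuous_intros cr\<close>)
  finally have "(w x + kp)^2 * m <= 3 * (C1 * (M + sqrt kp * m))" by simp
  moreover have "\<l>\<^sup>2 * m <= (w x + kp)^2 * m"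
   using lw l kap m by (intro mult_right_mono power_mono) auto
  moreover have "3 * C1 * sqrt kp * m <= \<l>^2 / 2 * m" using kap3 m by (intro mult_right_mono) auto
  ultimately have "\<l>\<^sup>2 * m / 2 <= 3 * C1 * M" by (simp add: algebra_simps)
  then have m0M: "m0 <= M" using C1 by (simp add: m0_def field_simps)
  have "c * mean (%x. sqrt (w x + ep)) x r <= sqrt (w y + ep)"
  proof -
   have "\<forall>z\<in>?A. w z + ep > 0 & g z <= K * norm (G z) + K * (w z + ep)"
    using b eps by (auto intro: add_nonneg_pos)
   moreover have "norm (y - y) <= R / 4" using R(1) by simp
   ultimately show ?thesis using c(2) weak_lap_add_const[OF w, of ep] x y by blast
  qed
  moreover have "M <= mean (%x. sqrt (w x + ep)) x r"
   unfolding M_def using r(1) eps by (intro mean_mono continuous_intros cr) auto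
  ultimately have "c * m0 <= sqrt (w y + ep)"
   using m0M c(1) mult_left_mono[of m0 "mean (%x. sqrt (w x + ep)) x r" c] by linarith
  then have "(c * m0)^2 <= (sqrt (w y + ep))^2" using c(1) m0 by (intro power_mono) auto
  also have "... = w y + ep" using b[of y] y dl eps by (simp add: annulus_def)
  finally show "ep <= w y" by (simp add: ep_def)
 qed
qed

section \<open>Maximum, minimum and oscillation on spheres\<close>

definition hi :: "('a::euclidean_space => real) => real => real" where
 "hi z t = Sup (z ` sphere 0 (exp t))"

definition lo :: "('a::euclidean_space => real) => real => real" where
 "lo z t = Inf (z ` sphere 0 (exp t))"

lemma
 fixes z :: "'a::euclidean_space => real"
 assumes "continuous_on (- {0}) z"
 shows hi_attained: "\<exists>x. norm x = exp t & z x = hi z t"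
  and lo_attained: "\<exists>x. norm x = exp t & z x = lo z t"
  and hi_upper: "norm x = exp t ==> z x <= hi z t"
  and lo_lower: "norm x = exp t ==> lo z t <= z x"
proof -
 let ?S = "sphere (0::'a) (exp t)"
 have c: "continuous_on ?S z" using assms by (rule continuous_on_subset) auto
 have ne: "?S ~= {}" by simp
 obtain x where x: "x \<in> ?S" "!!y. y \<in> ?S ==> z y <= z x"
  using continuous_attains_sup[OF compact_sphere ne c] by blast
 have "hi z t = z x" unfolding hi_def by (rule cSup_eq_maximum) (use x in auto)
 then show "\<exists>x. norm x = exp t & z x = hi z t" "norm x' = exp t ==> z x' <= hi z t" for x'
  using x by (auto intro!: exI[of _ x])
 obtain x where x: "x \<in> ?S" "!!y. y \<in> ?S ==> z x <= z y"
  using continuous_attains_inf[OF compact_sphere ne c] by blast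
 have "lo z t = z x" unfolding lo_def by (rule cInf_eq_minimum) (use x in auto)
 then show "\<exists>x. norm x = exp t & z x = lo z t" "norm x' = exp t ==> lo z t <= z x'" for x'
  using x by (auto intro!: exI[of _ x])
qed

lemma
 fixes z :: "'a::euclidean_space => real"
 assumes c: "continuous_on (- {0}) z"
 shows hi_scale: "hi (%x. z (exp s *\<^sub>R x) - k) t = hi z (t + s) - k"
  and lo_scale: "lo (%x. z (exp s *\<^sub>R x) - k) t = lo z (t + s) - k"
proof -
 have c': "continuous_on (- {0}) (%x. z (exp s *\<^sub>R x) - k)"
  by (intro continuous_intros continuous_on_compose2[OF c]) auto
 have n: "norm (exp s *\<^sub>R x) = exp (t + s)" if "norm x = exp t" for x :: 'a
  using that by (simp add: exp_add)
 have n': "norm (exp (- s) *\<^sub>R x) = exp t" "exp s *\<^sub>R exp (- s) *\<^sub>R x = x" if "norm x = exp (t + s)" for x :: 'a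
  using that by (simp_all add: exp_add[symmetric])
 obtain x y where x: "norm x = exp t" "z (exp s *\<^sub>R x) - k = hi (%x. z (exp s *\<^sub>R x) - k) t"
  and y: "norm y = exp (t + s)" "z y = hi z (t + s)" using hi_attained[OF c'] hi_attained[OF c] by blast
 have "z (exp s *\<^sub>R exp (- s) *\<^sub>R y) - k <= hi (%x. z (exp s *\<^sub>R x) - k) t"
  by (rule hi_upper[OF c' n'(1)[OF y(1)]])
 then show "hi (%x. z (exp s *\<^sub>R x) - k) t = hi z (t + s) - k"
  using hi_upper[OF c n[OF x(1)]] x y n'(2)[OF y(1)] by simp
 obtain x y where x: "norm x = exp t" "z (exp s *\<^sub>R x) - k = lo (%x. z (exp s *\<^sub>R x) - k) t"
  and y: "norm y = exp (t + s)" "z y = lo z (t + s)" using lo_attained[OF c'] lo_attained[OF c] by blast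
 have "lo (%x. z (exp s *\<^sub>R x) - k) t <= z (exp s *\<^sub>R exp (- s) *\<^sub>R y) - k"
  by (rule lo_lower[OF c' n'(1)[OF y(1)]])
 then show "lo (%x. z (exp s *\<^sub>R x) - k) t = lo z (t + s) - k"
  using lo_lower[OF c n[OF x(1)]] x y n'(2)[OF y(1)] by simp
qed

section \<open>Uniform Harnack and Lipschitz estimates for solutions\<close>

context params
begin

lemma log_sol_scale:
 assumes "log_sol mu (- {0} :: 'a::euclidean_space set) z G" "mu > 0"
 obtains mu' G' where "mu' > 0" "log_sol mu' (- {0}) (%x. z (exp s *\<^sub>R x) - k) G'"
proof -
 have id: "orthogonal_transformation (%x::'a. x)" by simp
 have "(%x::'a. exp s *\<^sub>R x) -` (- {0}) = - {0}" by auto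
 then have "log_sol (mu * exp s powr (th + 2) * exp ((q - 1) * k)) (- {0}) (%x. z (exp s *\<^sub>R x) - k)
  (%x. exp s *\<^sub>R inv (%x. x) (G (exp s *\<^sub>R x)))"
  using log_sol_similarity[OF assms(1) exp_gt_zero[of s] id, of k] by simp
 then show ?thesis using assms(2) by (intro that) auto
qed

text \<open>A rotation \<open>T\<close> takes a minimum point on the sphere to a maximum point. The
  solutions \<open>z (T x)\<close> and \<open>z x\<close> are compared on the annulus; on each
  boundary sphere their difference is at most the oscillation there.\<close>

lemma osc_quasiconvex:
 fixes z :: "real^'n => real"
 assumes z: "log_sol mu (- {0}) z G" and mu: "mu > 0" and t: "a <= t" "t <= b"
 shows "hi z t - lo z t <= max (hi z a - lo z a) (hi z b - lo z b)"
proof -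
 let ?M = "max (hi z a - lo z a) (hi z b - lo z b)"
 have c: "continuous_on (- {0}) z" by (rule log_solD(5)[OF z])
 obtain x y where x: "norm x = exp t" "z x = hi z t" and y: "norm y = exp t" "z y = lo z t"
  using hi_attained[OF c] lo_attained[OF c] by blast
 have eq: "norm y = norm x" using x y by simp
 obtain T :: "real^'n => real^'n" where T: "orthogonal_transformation T" "T y = x"
  using orthogonal_transformation_exists[OF eq] by blast
 have nT: "norm (T v) = norm v" for v :: "real^'n" by (rule orthogonal_transformation_norm[OF T(1)])
 have "T v = 0 \<longleftrightarrow> v = 0" for v :: "real^'n" using nT[of v] norm_eq_zero[of v] norm_eq_zero[of "T v"] by simp
 then have "(%x. 1 *\<^sub>R T x) -` (- {0}) = - {0}" by auto
 then have zT: "log_sol mu (- {0}) (%x. z (T x)) (%x. inv T (G (T x)))"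
  using log_sol_similarity[OF z zero_less_one T(1), of 0] by simp
 have "hi z a >= lo z a" using hi_attained[OF c, of a] lo_lower[OF c, of _ a] by metis
 then have M: "?M >= 0" by simp
 have "z (T y) - z y <= ?M"
 proof (rule log_sol_comparison[OF zT z mu])
  fix v :: "real^'n" assume "norm v = exp a \<or> norm v = exp b"
  then show "z (T v) - z v <= ?M"
   using hi_upper[OF c, of "T v" a] lo_lower[OF c, of v a] hi_upper[OF c, of "T v" b] lo_lower[OF c, of v b]
   by (auto simp: nT)
 qed (use M y t in auto)
 then show ?thesis using T x y by simp
qed

text \<open>The Laplacian of \<open>exp z\<close>. Here the quadratic gradient term cancels, so the
  right-hand side grows at most linearly in the gradient, as the mean value estimates
  require.\<close>

definition exp_rhs :: "real => 'a::euclidean_space => real => 'a => real" where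
 "exp_rhs mu x z p = exp z * (log_rhs mu x z p + p \<bullet> p)"

lemma exp_rhs_eq:
 fixes x p :: "'a::euclidean_space"
 assumes "x ~= 0"
 shows "(norm x)^2 * exp_rhs mu x z p = exp z * (mu * norm x powr (th + 2) * exp ((q - 1) * z))
  + (real DIM('a) - 2 + 2 * rho) * (x \<bullet> (exp z *\<^sub>R p)) - lam * (exp z * (norm x * norm p) powr (1 - tau))"
proof -
 have "(norm x)^2 * (log_rhs mu x z p + p \<bullet> p) = mu * norm x powr (th + 2) * exp ((q - 1) * z)
  + (real DIM('a) - 2 + 2 * rho) * (x \<bullet> p) - lam * (norm x * norm p) powr (1 - tau)"
  using assms by (simp add: log_rhs_def dot_square_norm power_mult_distrib field_simps)
 from arg_cong[OF this, of "%y. exp z * y"] show ?thesis by (simp add: exp_rhs_def algebra_simps)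
qed

lemma weak_lap_exp:
 assumes "log_sol mu Om z G"
 shows "weak_lap Om (%x. exp (z x)) (%x. exp (z x) *\<^sub>R G x) (%x. exp_rhs mu x (z x) (G x))"
 unfolding exp_rhs_def distrib_left using log_solD(6)[OF assms]
 by (rule weak_lap_chain) (auto intro!: derivative_eq_intros continuous_intros)

lemma inverse_le_exp:
 fixes r :: real
 assumes "exp (- 1) <= r" shows "r > 0" "1 / r <= exp 1" "1 / r^2 <= exp 2"
proof -
 show r: "r > 0" using assms exp_gt_zero[of "- 1 :: real"] by linarith
 have "1 <= exp 1 * r" using mult_left_mono[OF assms, of "exp 1"] by (simp add: exp_minus)
 then show "1 / r <= exp 1" using r by (simp add: field_simps)
 then have "(1 / r)^2 <= (exp 1)^2" using r by (intro power_mono) auto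
 then show "1 / r^2 <= exp 2" by (simp add: power_divide exp_double[symmetric])
qed

text \<open>The Keller-Osserman bound replaces the coefficient of the zero order term by
  \<open>W0\<close>, whatever \<open>mu\<close> is; hence \<open>K\<close> depends on the parameters
  only.\<close>

lemma exp_lap_bound:
 fixes z :: "'a::euclidean_space => real"
 assumes z: "log_sol mu (- {0}) z G" and mu: "mu > 0" and x: "x \<in> annulus (- 1) 1"
  and K: "K = exp 2 * (W0 + abs (real DIM('a) - 2 + 2 * rho) + abs lam)"
 shows "abs (exp_rhs mu x (z x) (G x)) <= K * norm (exp (z x) *\<^sub>R G x) + K * exp (z x)"
proof -
 define r p e m where "r = norm x" and "p = norm (G x)" and "e = exp (z x)" and "m = abs (real DIM('a) - 2 + 2 * rho)"
 define X where "X = exp_rhs mu x (z x) (G x)"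
 have x0: "x ~= 0" using x by (simp add: annulus_iff)
 have "exp (- 1) <= r" using x by (simp add: annulus_def r_def)
 note i = inverse_le_exp[OF this]
 have p: "p >= 0" "e > 0" "m >= 0" "W0 >= 0" by (simp_all add: p_def e_def m_def W0_def)
 define W where "W = mu * r powr (th + 2) * exp ((q - 1) * z x)"
 have "r powr (th + 2) = exp (- (q - 1) * gm * ln r)" using i(1) by (simp add: theta powr_def)
 then have "W = mu * exp ((q - 1) * (z x - gm * ln (norm x)))" by (simp add: W_def r_def exp_add[symmetric] algebra_simps)
 then have W: "0 <= e * W" "e * W <= e * W0" using keller_osserman[OF z mu x0] mu p by (simp_all add: mult_left_mono)
 have "r^2 * X = e * W + (real DIM('a) - 2 + 2 * rho) * (x \<bullet> (e *\<^sub>R G x)) - lam * (e * (r * p) powr (1 - tau))"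
  using exp_rhs_eq[OF x0, of mu "z x" "G x"] by (simp add: X_def r_def p_def e_def W_def)
 moreover have "abs ((real DIM('a) - 2 + 2 * rho) * (x \<bullet> (e *\<^sub>R G x))) <= m * (r * (e * p))"
  unfolding abs_mult m_def[symmetric] using Cauchy_Schwarz_ineq2[of x "e *\<^sub>R G x"] p by (intro mult_left_mono) (auto simp: r_def p_def)
 moreover have "abs (lam * (e * (r * p) powr (1 - tau))) <= abs lam * (e * (1 + r * p))"
  unfolding abs_mult using powr_le_one_plus[of "r * p"] i(1) p by (intro mult_left_mono mult_mono) auto
 ultimately have "abs (r^2 * X) <= e * W0 + m * (r * (e * p)) + abs lam * (e * (1 + r * p))" using W by linarith
 then have "abs X <= (e * W0 + m * (r * (e * p)) + abs lam * (e * (1 + r * p))) / r^2" using i(1) by (simp add: abs_mult pos_le_divide_eq mult.commute)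
 also have "... = (W0 + abs lam) * e * (1 / r^2) + (m + abs lam) * (e * p) * (1 / r)" using i(1) by (simp add: field_simps power2_eq_square)
 also have "... <= (W0 + abs lam) * e * exp 2 + (m + abs lam) * (e * p) * exp 2"
  using p order.trans[OF i(2), of "exp 2"] by (intro add_mono mult_left_mono i) auto
 also have "... <= K * (e * p) + K * e"
 proof -
  have "0 <= m * e * exp 2" "0 <= W0 * (e * p) * exp 2" using p by auto
  then show ?thesis unfolding K m_def[symmetric] by (simp add: algebra_simps)
 qed
 finally show ?thesis by (simp add: X_def e_def p_def)
qed

text \<open>A dilation moves the sphere of radius \<open>exp t\<close> to the unit sphere and
  changes only \<open>mu\<close>, on which the constants do not depend.\<close>

lemma harnack_log_sol:
 assumes d: "DIM('a::euclidean_space) >= 2"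
 obtains C h where "C > 0" "h > 0" "!!mu (z::'a => real) G s t x y. log_sol mu (- {0}) z G ==> mu > 0 ==>
  abs (s - t) <= h ==> norm x = exp t ==> norm y = exp s ==> z x <= z y + C"
proof -
 define K where "K = exp 2 * (W0 + abs (real DIM('a) - 2 + 2 * rho) + abs lam)"
 have K: "K >= 0" by (simp add: K_def W0_def)
 obtain C h where C: "C > 0" "h > 0" "!!(w::'a => real) G g x y. weak_lap (annulus (- 1) 1) w G g ==>
   (!!x. x \<in> annulus (- 1) 1 ==> w x > 0 & abs (g x) <= K * norm (G x) + K * w x) ==>
   norm x = 1 ==> abs (norm y - 1) <= h ==> w x <= C * w y"
 proof (rule harnack_sphere[OF d K zero_less_one], goal_cases)
  case (1 C h) from 1(2,3,4) show ?case by (rule that)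
 qed
 have "isCont exp (0::real)" by simp
 then obtain h' where h': "h' > 0" "!!r. abs r < h' ==> abs (exp r - 1) < h"
  unfolding isCont_def LIM_def using C(2)
  by (metis (no_types, lifting) abs_0 diff_self dist_real_def diff_zero exp_zero)
 show ?thesis
 proof (rule that[of "abs (ln C) + 1" "h' / 2"])
  show "h' / 2 > 0" using h' by simp
  fix mu and z :: "'a => real" and G s t and x y :: 'a
  assume z: "log_sol mu (- {0}) z G" and mu: "mu > 0" and st: "abs (s - t) <= h' / 2"
   and x: "norm x = exp t" and y: "norm y = exp s"
  obtain mu' G' where z': "mu' > 0" "log_sol mu' (- {0}) (%x. z (exp t *\<^sub>R x) - 0) G'"
   using log_sol_scale[OF z mu] by blast
  have xy: "exp t *\<^sub>R exp (- t) *\<^sub>R x = x" "exp t *\<^sub>R exp (- t) *\<^sub>R y = y" by (simp_all add: exp_add[symmetric])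
  have "norm (exp (- t) *\<^sub>R y) = exp (s - t)" using y by (simp add: exp_diff exp_minus field_simps)
  moreover have "abs (exp (s - t) - 1) <= h" using h'(2)[of "s - t"] h'(1) st by simp
  ultimately have ny: "abs (norm (exp (- t) *\<^sub>R y) - 1) <= h" by simp
  have nx: "norm (exp (- t) *\<^sub>R x) = 1" using x by (simp add: exp_minus)
  have "exp (z (exp t *\<^sub>R exp (- t) *\<^sub>R x) - 0) <= C * exp (z (exp t *\<^sub>R exp (- t) *\<^sub>R y) - 0)"
   by (rule C(3)[OF weak_lap_exp[OF log_sol_subset[OF z'(2) open_annulus annulus_nonzero]] _ nx ny])
    (use exp_lap_bound[OF z'(2,1) _ K_def] in auto)
  then have "exp (z x) <= exp (z y + ln C)" unfolding xy using C(1) by (simp add: exp_add mult.commute)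
  then show "z x <= z y + (abs (ln C) + 1)" by simp
 qed auto
qed

text \<open>The barrier \<open>hi z t + 1/3 * ln (p r)\<close> satisfies
  \<open>xi2 = - 3 * xi1^2\<close>, and its slope is so steep that
  \<open>F (xi1) < 3 * xi1^2\<close>; it is a supersolution whatever the nonlinearity is. At
  distance \<open>h\<close> it lies above \<open>z\<close> by Harnack's inequality, and its initial
  slope \<open>b / 3\<close> is the Lipschitz constant.\<close>

lemma hi_lipschitz:
 assumes d: "DIM('a::euclidean_space) >= 2"
 obtains B h where "B > 0" "h > 0" "!!mu (z::'a => real) G s t. log_sol mu (- {0}) z G ==> mu > 0 ==>
  abs (s - t) <= h ==> abs (hi z s - hi z t) <= B * abs (s - t)"
proof -
 obtain C h0 where C: "C > 0" "h0 > 0" "!!mu (z::'a => real) G s t x y. log_sol mu (- {0}) z G ==> mu > 0 ==>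
  abs (s - t) <= h0 ==> norm x = exp t ==> norm y = exp s ==> z x <= z y + C"
 proof (rule harnack_log_sol[OF d], goal_cases)
  case (1 C h) from 1(2,3,4) show ?case by (rule that)
 qed
 define y0 where "y0 = 1 + abs rho + abs lam"
 have y0: "y0 >= 1" by (simp add: y0_def)
 have Fy: "F y < 3 * y^2" if "abs y >= y0" for y
 proof -
  have "abs y >= 1" using that y0 by simp
  have "F y <= y^2 + 2 * abs rho * abs y + abs lam * (1 + abs y)"
  proof -
   have "- (2 * rho * y) <= 2 * abs rho * abs y" using abs_ge_minus_self[of "2 * rho * y"] by (simp add: abs_mult)
   moreover have "lam * abs y powr (1 - tau) <= abs lam * (1 + abs y)"
    using powr_le_one_plus[of "abs y"] by (intro mult_mono) auto
   ultimately show ?thesis by (simp add: F_def)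
  qed
  also have "... < y^2 + 2 * (y0 * abs y)"
  proof -
   have "\<bar>lam\<bar> * 1 <= \<bar>lam\<bar> * \<bar>y\<bar>" using \<open>\<bar>y\<bar> >= 1\<close> by (intro mult_left_mono) auto
   then show ?thesis using \<open>\<bar>y\<bar> >= 1\<close> by (simp add: y0_def algebra_simps)
  qed
  also have "y0 * abs y <= abs y * abs y" using that by (intro mult_right_mono) auto
  finally show ?thesis by (simp add: power2_eq_square)
 qed
 \<comment> \<open>On an interval of length \<open>h\<close> one has
   \<open>p r <= 2 * (b * h)\<close>, so the slope of the barrier is at least
   \<open>1 / (6 * h)\<close> and hence at least \<open>y0\<close>. With
   \<open>b * h = exp (3 * C)\<close> the barrier has risen by at least \<open>C\<close> at distance
   \<open>h\<close>.\<close>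
 define h where "h = min h0 (1 / (6 * y0))"
 have h: "h > 0" "h <= h0" "y0 <= 1 / (6 * h)" using C(2) y0 by (auto simp: h_def field_simps min_def)
 define b where "b = exp (3 * C) / h"
 have b: "b > 0" "b * h = exp (3 * C)" using h by (auto simp: b_def)
 have bh1: "b * h >= 1" using b(2) C(1) by simp
 have one: "hi z s <= hi z t + b / 3 * abs (s - t)"
  if z: "log_sol mu (- {0}) z G" and mu: "mu > 0" and st: "abs (s - t) <= h" for mu and z :: "'a => real" and G s t
 proof -
  have c: "continuous_on (- {0}) z" by (rule log_solD(5)[OF z])
  define sig where "sig = (if s >= t then 1 else - 1 :: real)"
  have sg: "sig * sig = 1" "sig * (s - t) = abs (s - t)" "sig = 1 \<or> sig = -1" by (auto simp: sig_def)
  define p where "p r = 1 + b * (sig * (r - t))" for r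
  define xi where "xi r = hi z t + 1/3 * ln (p r)" for r
  define xi1 where "xi1 r = 1/3 * (b * sig) / p r" for r
  define xi2 where "xi2 r = - 3 * (xi1 r)^2" for r
  define a e where "a = (if s >= t then t else t - h)" and "e = (if s >= t then t + h else t)"
  \<comment> \<open>\<open>p\<close> remains positive on the interval enlarged by \<open>eta\<close>
    on both sides, which provides the open neighbourhood needed for comparison.\<close>
  define eta where "eta = 1 / (2 * b)"
  have eta: "eta > 0" "b * eta = 1/2" using b by (auto simp: eta_def)
  have rng: "a - eta < r ==> r < e + eta ==> - eta < sig * (r - t)" "a < r ==> r < e ==> 0 < sig * (r - t) & sig * (r - t) < h" for r
   by (auto simp: sig_def a_def e_def split: if_splits)
  have pp: "p r > 0" if "a - eta < r" "r < e + eta" for r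
   using mult_strict_left_mono[OF rng(1)[OF that] b(1)] eta by (simp add: p_def)
  have dp: "DERIV p r :> b * sig" for r
   unfolding p_def by (auto intro!: derivative_eq_intros)
  have d1: "DERIV xi r :> xi1 r" if "a - eta < r" "r < e + eta" for r
   unfolding xi_def xi1_def using pp[OF that] by (auto intro!: derivative_eq_intros dp)
  have d2: "DERIV xi1 r :> xi2 r" if "a - eta < r" "r < e + eta" for r
   unfolding xi2_def xi1_def using pp[OF that]
   by (auto intro!: derivative_eq_intros dp simp: power2_eq_square field_simps)
  have c2: "continuous_on {a - eta<..<e + eta} xi2"
   unfolding xi2_def by (intro continuous_intros DERIV_continuous_on[of _ xi1 xi2])
    (auto intro: has_field_derivative_at_within d2)
  have nx: "z x <= xi r" if "norm x = exp r" "r = t \<or> sig * (r - t) = h" for x r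
   using that(2)
  proof
   assume "r = t"
   then show ?thesis using hi_upper[OF c] that(1) by (simp add: xi_def p_def)
  next
   assume r: "sig * (r - t) = h"
   obtain y where y: "norm y = exp t" "z y = hi z t" using hi_attained[OF c] by blast
   have "abs (t - r) <= h0" using r sg(3) h by auto
   then have "z x <= z y + C" by (rule C(3)[OF z mu _ that(1) y(1)])
   moreover have "exp (3 * C) <= p r" using b(2) by (simp add: p_def r)
   then have "3 * C <= ln (p r)" using ln_mono[of "exp (3 * C)" "p r"] by simp
   ultimately show ?thesis using y by (simp add: xi_def)
  qed
  obtain x where x: "norm x = exp s" "z x = hi z s" using hi_attained[OF c] by blast
  have sae: "a <= s" "s <= e" using st by (auto simp: a_def e_def)
  have "z x <= xi (ln (norm x))"
  proof (rule radial_supersolution_comparison[OF z _ _ _ _ d1 d2 c2, of a e])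
   fix r assume r: "a < r" "r < e"
   have r': "a - eta < r" "r < e + eta" using r eta by auto
   have "p r <= 2 * (b * h)"
   proof -
    have "b * (sig * (r - t)) <= b * h" using rng(2)[OF r] b by (intro mult_left_mono) auto
    then show ?thesis unfolding p_def using bh1 by linarith
   qed
   then have "p r * y0 <= (2 * (b * h)) * (1 / (6 * h))"
    using pp[OF r'] h y0 b by (intro mult_mono) auto
   also have "... = b / 3" using h by simp
   finally have "y0 <= abs (xi1 r)" using pp[OF r'] b sg(3) by (auto simp: xi1_def field_simps abs_mult)
   then have "xi2 r + F (xi1 r) < 0" using Fy[of "xi1 r"] by (simp add: xi2_def)
   also have "0 <= mu * exp ((q - 1) * (xi r - gm * r))" using mu by simp
   finally show "xi2 r + F (xi1 r) < mu * exp ((q - 1) * (xi r - gm * r))" .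
  qed (use nx eta mu x sae in \<open>auto simp: a_def e_def sig_def split: if_splits\<close>)
  then have "hi z s <= hi z t + 1/3 * ln (p s)" using x by (simp add: xi_def)
  also have "ln (p s) <= b * abs (s - t)" unfolding p_def sg(2) using b by (intro ln_add_one_self_le_self) auto
  finally show ?thesis by simp
 qed
 show ?thesis
 proof (rule that[of "b / 3" h])
  fix mu and z :: "'a => real" and G s t
  assume a: "log_sol mu (- {0}) z G" "mu > 0" "abs (s - t) <= h"
  then have ts: "abs (t - s) <= h" by (simp add: abs_minus_commute)
  show "abs (hi z s - hi z t) <= b / 3 * abs (s - t)"
   using one[OF a] one[OF a(1,2) ts] unfolding abs_minus_commute[of t s] by linarith
 qed (use b h in auto)
qed

end

section \<open>Ordinary differential equations with a Lipschitz right-hand side\<close>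

text \<open>Picard iteration in the sup norm with weight \<open>exp (- 2 * K * t)\<close>, which
  makes the integral operator a contraction by 1/2 on the whole half line. The unknown
  \<open>V\<close> is the weighted integral term; it is bounded because \<open>g\<close> is. The use
  of \<open>max 0 t\<close> extends it continuously to negative times, so that it is a bounded
  continuous function on the real line.\<close>

lemma ode_forward:
 fixes g :: "'a::euclidean_space => 'a"
 assumes lip: "!!x y. norm (g x - g y) <= K * norm (x - y)" and K: "K > 0" and bdd: "!!x. norm (g x) <= B"
 obtains X where "X 0 = x0" "!!t. t >= 0 ==> (X has_vector_derivative g (X t)) (at t within {0..})"
proof -
 have B: "B >= 0" using bdd[of 0] norm_ge_zero order.trans by blast
 have "K-lipschitz_on UNIV g" using lip K by (auto simp: lipschitz_on_def dist_norm)
 then have cg: "continuous_on UNIV g" by (rule lipschitz_on_continuous_on)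
 define X where "X V t = x0 + exp (2 * K * t) *\<^sub>R apply_bcontfun V t" for V :: "real \<Rightarrow>\<^sub>C 'a" and t
 have cX: "continuous_on S (X V)" for V S unfolding X_def by (intro continuous_intros continuous_on_apply_bcontfun)
 have cgX: "continuous_on S (%t. g (X V t))" for V S
  by (rule continuous_on_compose2[OF cg cX]) auto
 define I where "I V t = integral {0..t} (%s. g (X V s))" for V t
 have dI: "(I V has_vector_derivative g (X V t)) (at t within {0..})" if "t >= 0" for V t
 proof -
  have "(I V has_vector_derivative g (X V t)) (at t within {0..t + 1})"
   unfolding I_def by (rule integral_has_vector_derivative[OF cgX]) (use that in auto)
  moreover have "at t within {0..} = at t within {0..t + 1}"
   by (rule at_within_nhd[of t "{..<t + 1}"]) auto
  ultimately show ?thesis by simp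
 qed
 have cI: "continuous_on {0..} (I V)" for V
  using dI has_vector_derivative_continuous by (fastforce simp: continuous_on_eq_continuous_within)
 define T where "T V = Bcontfun (%t. exp (- (2 * K * max 0 t)) *\<^sub>R I V (max 0 t))" for V
 have nI: "norm (I V t) <= B * t" if "t >= 0" for V t
 proof -
  have "norm (I V t) <= integral {0..t} (%s. B)" unfolding I_def
   by (rule integral_norm_bound_integral) (auto intro!: integrable_continuous_interval cgX bdd)
  then show ?thesis using that by (simp add: mult.commute)
 qed
 have tb: "(%t. exp (- (2 * K * max 0 t)) *\<^sub>R I V (max 0 t)) \<in> bcontfun" for V
 proof (rule bcontfun_normI)
  show "continuous_on UNIV (%t. exp (- (2 * K * max 0 t)) *\<^sub>R I V (max 0 t))"
   by (intro continuous_intros continuous_on_compose2[OF cI]) auto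
  show "norm (exp (- (2 * K * max 0 t)) *\<^sub>R I V (max 0 t)) <= B / (2 * K)" for t
  proof -
   define r where "r = max 0 t"
   have r: "r >= 0" by (simp add: r_def)
   have "2 * K * r <= exp (2 * K * r)" using exp_ge_add_one_self[of "2 * K * r"] by linarith
   then have "exp (- (2 * K * r)) * (2 * K * r) <= 1" by (simp add: exp_minus field_simps)
   then have "exp (- (2 * K * r)) * (2 * K * r) * (B / (2 * K)) <= 1 * (B / (2 * K))"
    using B K by (intro mult_right_mono) auto
   then have "exp (- (2 * K * r)) * (B * r) <= B / (2 * K)" using K by (simp add: mult.commute)
   moreover have "exp (- (2 * K * r)) * norm (I V r) <= exp (- (2 * K * r)) * (B * r)"
    using nI[OF r] by (intro mult_left_mono) auto
   ultimately have "exp (- (2 * K * r)) * norm (I V r) <= B / (2 * K)" by (rule order.trans[rotated])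
   then show ?thesis by (simp add: r_def)
  qed
 qed
 have appT: "apply_bcontfun (T V) t = exp (- (2 * K * max 0 t)) *\<^sub>R I V (max 0 t)" for V t
  unfolding T_def by (simp add: Bcontfun_inverse[OF tb])
 have "dist (T V) (T V') <= 1/2 * dist V V'" for V V'
 proof (rule dist_bound)
  fix t :: real
  define r where "r = max 0 t"
  define d where "d = dist V V'"
  have r: "r >= 0" by (simp add: r_def)
  have ex: "((%s. K * d * exp (2 * K * s)) has_integral (d / 2 * exp (2 * K * r) - d / 2 * exp (2 * K * 0))) {0..r}"
   by (rule fundamental_theorem_of_calculus[OF r])
    (auto intro!: derivative_eq_intros simp: has_real_derivative_iff_has_vector_derivative[symmetric])
  have "norm (I V r - I V' r) = norm (integral {0..r} (%s. g (X V s) - g (X V' s)))"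
   unfolding I_def by (subst integral_diff) (auto intro!: integrable_continuous_interval cgX)
  also have "... <= integral {0..r} (%s. K * d * exp (2 * K * s))"
  proof (rule integral_norm_bound_integral)
   show "norm (g (X V s) - g (X V' s)) <= K * d * exp (2 * K * s)" for s
   proof -
    have "norm (g (X V s) - g (X V' s)) <= K * norm (X V s - X V' s)" by (rule lip)
    also have "X V s - X V' s = exp (2 * K * s) *\<^sub>R (apply_bcontfun V s - apply_bcontfun V' s)"
     by (simp add: X_def scaleR_diff_right)
    also have "K * norm ... = K * exp (2 * K * s) * dist (apply_bcontfun V s) (apply_bcontfun V' s)" by (simp add: dist_norm)
    also have "... <= K * exp (2 * K * s) * d" unfolding d_def using K by (intro mult_left_mono dist_bounded) auto
    finally show ?thesis by (simp add: mult_ac)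
   qed
  qed (auto intro!: integrable_continuous_interval continuous_intros cgX)
  also have "... = d / 2 * exp (2 * K * r) - d / 2" using integral_unique[OF ex] by simp
  also have "... <= d / 2 * exp (2 * K * r)" by (simp add: d_def)
  finally have "exp (- (2 * K * r)) * norm (I V r - I V' r) <= exp (- (2 * K * r)) * (d / 2 * exp (2 * K * r))"
   by (intro mult_left_mono) auto
  also have "... = d / 2" by (simp add: exp_minus)
  finally show "dist (apply_bcontfun (T V) t) (apply_bcontfun (T V') t) <= 1/2 * dist V V'"
   unfolding appT r_def[symmetric] dist_norm[of "_ *\<^sub>R _"] scaleR_diff_right[symmetric] by (simp add: d_def)
 qed
 then obtain V where V: "T V = V" using banach_fix_type[of "1/2" T] by auto
 have XI: "X V t = x0 + I V t" if "t >= 0" for t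
 proof -
  have "X V t = x0 + exp (2 * K * t) *\<^sub>R (exp (- (2 * K * max 0 t)) *\<^sub>R I V (max 0 t))"
   unfolding X_def using appT[of V t] V by simp
  then show ?thesis using that by (simp add: exp_minus)
 qed
 show ?thesis
 proof (rule that)
  show "X V 0 = x0" using XI[of 0] by (simp add: I_def)
  show "(X V has_vector_derivative g (X V t)) (at t within {0..})" if "t >= 0" for t
  proof (rule has_vector_derivative_transform[of t "{0..}" "X V" "%t. x0 + I V t"])
   show "((%t. x0 + I V t) has_vector_derivative g (X V t)) (at t within {0..})"
    using dI[OF that] by (auto intro!: derivative_eq_intros)
  qed (use XI that in auto)
 qed
qed

lemma ode_global:
 fixes g :: "'a::euclidean_space => 'a"
 assumes lip: "!!x y. norm (g x - g y) <= K * norm (x - y)" and K: "K > 0" and bdd: "!!x. norm (g x) <= B"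
 obtains X where "X t0 = x0" "!!t. (X has_vector_derivative g (X t)) (at t)"
proof -
 obtain P where P: "P 0 = x0" "!!t. t >= 0 ==> (P has_vector_derivative g (P t)) (at t within {0..})"
  using ode_forward[OF lip K bdd] by metis
 have lip': "norm (- g x - - g y) <= K * norm (x - y)" for x y
  using lip[of y x] by (simp add: norm_minus_commute)
 have bdd': "norm (- g x) <= B" for x using bdd by simp
 obtain Q where Q: "Q 0 = x0" "!!t. t >= 0 ==> (Q has_vector_derivative - g (Q t)) (at t within {0..})"
  using ode_forward[OF lip' K bdd'] by metis
 define X where "X t = (if t >= 0 then P t else Q (- t))" for t
 have X0: "X t = Q (- t)" if "t <= 0" for t using that P(1) Q(1) by (cases "t = 0") (auto simp: X_def)
 have r: "(X has_vector_derivative g (X t)) (at t within {0..})" if "t >= 0" for t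
 proof (rule has_vector_derivative_transform[of t "{0..}" X P])
  show "(P has_vector_derivative g (X t)) (at t within {0..})" using P(2)[OF that] that by (simp add: X_def)
 qed (use that in \<open>auto simp: X_def\<close>)
 have l: "(X has_vector_derivative g (X t)) (at t within {..0})" if "t <= 0" for t
 proof -
  have img: "uminus ` {..0::real} = {0..}" by force
  have 1: "(uminus has_vector_derivative (-1)) (at t within {..0::real})"
   by (auto intro!: derivative_eq_intros)
  have 2: "(Q has_vector_derivative - g (Q (- t))) (at (- t) within uminus ` {..0})"
   unfolding img using Q(2)[of "- t"] that by simp
  have "((%t. Q (- t)) has_vector_derivative g (Q (- t))) (at t within {..0})"
   using vector_diff_chain_within[OF 1 2] by (simp add: o_def)
  then show ?thesis
   by (intro has_vector_derivative_transform[of t "{..0}" X "%t. Q (- t)"]) (use that X0 in auto)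
 qed
 have X: "(X has_vector_derivative g (X t)) (at t)" for t
 proof (cases t "0::real" rule: linorder_cases)
  case less
  then show ?thesis using l[of t] at_within_interior[of t "{..0}"] by simp
 next
  case greater
  then show ?thesis using r[of t] at_within_interior[of t "{0..}"] by simp
 next
  case equal
  have "{0..} \<union> {..0} = (UNIV :: real set)" by auto
  moreover have "(X has_derivative (%h. h *\<^sub>R g (X t))) (at t within {0..} \<union> {..0})"
   using r[of t] l[of t] equal
   unfolding has_vector_derivative_def has_derivative_within by (auto simp: at_within_union intro: filterlim_sup)
  ultimately show ?thesis by (simp add: has_vector_derivative_def)
 qed
 show ?thesis
 proof (rule that[of "%t. X (t - t0)"])
  show "X (t0 - t0) = x0" using P by (simp add: X_def)
  show "((%t. X (t - t0)) has_vector_derivative g (X (t - t0))) (at t)" for t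
  proof -
   have "((%t. t - t0) has_vector_derivative 1) (at t)" by (auto intro!: derivative_eq_intros)
   from vector_diff_chain_at[OF this X[of "t - t0"]] show ?thesis by (simp add: o_def)
  qed
 qed
qed

section \<open>Barriers and planar systems\<close>

text \<open>After the last time \<open>r\<close> before \<open>t\<close> at which
  \<open>f >= c\<close> the function is below \<open>c\<close>, hence nondecreasing up to
  \<open>t\<close>.\<close>

lemma barrier:
 fixes f :: "real => real"
 assumes d: "!!t. t \<in> {a..b} ==> (f has_real_derivative f' t) (at t within {a..b})" and a: "f a >= c"
  and up: "!!t. t \<in> {a..b} ==> f t < c ==> f' t >= 0" and t: "t \<in> {a..b}"
 shows "f t >= c"
proof (rule ccontr)
 assume n: "\<not> f t >= c"
 have cf: "continuous_on {a..b} f" by (rule DERIV_continuous_on[OF d])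
 have sub: "{a..t} \<subseteq> {a..b}" using t by auto
 define K where "K = {a..t} \<inter> f -` {c..}"
 have "closed K" unfolding K_def
  by (rule continuous_closed_preimage[OF continuous_on_subset[OF cf sub]]) auto
 moreover have "a \<in> K" using a t by (auto simp: K_def)
 moreover have "bdd_above K" by (auto simp: K_def intro!: bdd_aboveI[of _ t])
 ultimately have rK: "Sup K \<in> K" and ub: "!!v. v \<in> K ==> v <= Sup K"
  by (auto intro: closed_contains_Sup cSup_upper)
 define r where "r = Sup K"
 have r: "r \<in> {a..t}" "f r >= c" using rK by (auto simp: r_def K_def)
 have "f r <= f t"
 proof (rule DERIV_nonneg_imp_increasing_open[of r t f])
  show "continuous_on {r..t} f" by (rule continuous_on_subset[OF cf]) (use r t in auto)
  fix v assume v: "r < v" "v < t"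
  have "f v < c" using ub[of v] v r by (force simp: r_def K_def)
  moreover have "DERIV f v :> f' v"
   using d[of v] v r t at_within_interior[of v "{a..b}"] by simp
  ultimately show "\<exists>z. DERIV f v :> z & 0 <= z" using up[of v] v r t by auto
 qed (use r in auto)
 with r n show False by simp
qed

text \<open>The sum of squares \<open>D\<close> of the two differences is differentiable, unlike the
  sum of their absolute values. It satisfies \<open>D' <= 4 * K * D\<close>, which gives the factor
  \<open>exp (2 * K * (t - a))\<close> after taking the root.\<close>

lemma planar_gronwall:
 fixes s y s' y' :: "real => real"
 assumes d: "!!t. t \<in> {a..b} ==> (s has_real_derivative f t) (at t within {a..b})" "!!t. t \<in> {a..b} ==> (s' has_real_derivative f' t) (at t within {a..b})"
   "!!t. t \<in> {a..b} ==> (y has_real_derivative g t) (at t within {a..b})" "!!t. t \<in> {a..b} ==> (y' has_real_derivative g' t) (at t within {a..b})"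
  and lip: "!!t. t \<in> {a..b} ==> abs (f t - f' t) <= K * (abs (s t - s' t) + abs (y t - y' t))"
   "!!t. t \<in> {a..b} ==> abs (g t - g' t) <= K * (abs (s t - s' t) + abs (y t - y' t))"
  and K: "K >= 0" and t: "t \<in> {a..b}"
 shows "abs (s t - s' t) <= exp (2 * K * (t - a)) * (abs (s a - s' a) + abs (y a - y' a))"
  and "abs (y t - y' t) <= exp (2 * K * (t - a)) * (abs (s a - s' a) + abs (y a - y' a))"
proof -
 define D where "D t = (s t - s' t)^2 + (y t - y' t)^2" for t
 define D' where "D' t = 2 * (s t - s' t) * (f t - f' t) + 2 * (y t - y' t) * (g t - g' t)" for t
 define e where "e t = exp (- (4 * K * (t - a)))" for t
 have key: "2 * u * p + 2 * v * r <= 4 * K * (u^2 + v^2)" if "abs p <= K * (abs u + abs v)" "abs r <= K * (abs u + abs v)" for u v p r :: real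
 proof -
  have "u * p <= abs u * (K * (abs u + abs v))" "v * r <= abs v * (K * (abs u + abs v))"
   using that by (metis abs_ge_self abs_ge_zero abs_mult mult_left_mono order.trans)+
  moreover have "0 <= K * (abs u - abs v)^2" using K by simp
  ultimately show ?thesis by (simp add: power2_eq_square algebra_simps)
 qed
 have "- D a <= - (D t * e t)"
 proof (rule barrier[of a b "%t. - (D t * e t)" "%t. - ((D' t - 4 * K * D t) * e t)", OF _ _ _ t])
  fix r assume r: "r \<in> {a..b}"
  show "((%t. - (D t * e t)) has_real_derivative - ((D' r - 4 * K * D r) * e r)) (at r within {a..b})"
   unfolding D_def D'_def e_def by (rule derivative_eq_intros d[OF r] refl | simp add: algebra_simps)+
  have "D' r <= 4 * K * D r" unfolding D_def D'_def by (rule key[OF lip[OF r]])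
  then show "0 <= - ((D' r - 4 * K * D r) * e r)" by (simp add: e_def mult_nonpos_nonneg)
 qed (simp add: e_def)
 then have "D t * e t * exp (4 * K * (t - a)) <= D a * exp (4 * K * (t - a))" by (intro mult_right_mono) auto
 moreover have "exp (4 * K * (t - a)) = (exp (2 * K * (t - a)))^2" by (simp flip: exp_double)
 ultimately have "D t <= D a * (exp (2 * K * (t - a)))^2" by (simp add: e_def mult.assoc flip: exp_add)
 also have "D a <= (abs (s a - s' a) + abs (y a - y' a))^2" unfolding D_def by (simp add: power2_sum)
 finally have 2: "D t <= (exp (2 * K * (t - a)) * (abs (s a - s' a) + abs (y a - y' a)))^2" by (simp add: power_mult_distrib mult.commute)
 have le: "abs (s t - s' t)^2 <= D t" "abs (y t - y' t)^2 <= D t" by (simp_all add: D_def)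
 show "abs (s t - s' t) <= exp (2 * K * (t - a)) * (abs (s a - s' a) + abs (y a - y' a))"
  by (rule power2_le_imp_le[OF order.trans[OF le(1) 2]]) simp
 show "abs (y t - y' t) <= exp (2 * K * (t - a)) * (abs (s a - s' a) + abs (y a - y' a))"
  by (rule power2_le_imp_le[OF order.trans[OF le(2) 2]]) simp
qed

lemma planar_ode:
 fixes p a b :: "real => real"
 assumes L: "L > 0" and lip: "!!u v. abs (p u - p v) <= L * abs (u - v)" "!!u v. abs (a u - a v) <= L * abs (u - v)" "!!u v. abs (b u - b v) <= L * abs (u - v)"
  and B: "!!u. abs (p u) <= B" "!!u v. abs (a u - b v) <= B"
 obtains s y where "s t0 = s0" "y t0 = y0" "!!t. DERIV s t :> p (y t)" "!!t. DERIV y t :> a (s t) - b (y t)"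
proof -
 define g where "g X = (p (snd X), a (fst X) - b (snd X))" for X
 have n: "norm X <= abs (fst X) + abs (snd X)" "abs (fst X) <= norm X" "abs (snd X) <= norm X" for X :: "real \<times> real"
  using norm_Pair_le[of "fst X" "snd X"] norm_fst_le[of "fst X" "snd X"] norm_snd_le[of "snd X" "fst X"] by auto
 have lg: "norm (g X - g Y) <= (3 * L) * norm (X - Y)" for X Y
 proof -
  have "L * abs (fst X - fst Y) <= L * norm (X - Y)" "L * abs (snd X - snd Y) <= L * norm (X - Y)"
   using n(2,3)[of "X - Y"] L by (auto intro!: mult_left_mono)
  moreover have "norm (g X - g Y) <= abs (p (snd X) - p (snd Y)) + abs ((a (fst X) - a (fst Y)) - (b (snd X) - b (snd Y)))"
   using n(1)[of "g X - g Y"] by (simp add: g_def algebra_simps)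
  ultimately show ?thesis using lip(1)[of "snd X" "snd Y"] lip(2)[of "fst X" "fst Y"] lip(3)[of "snd X" "snd Y"] unfolding mult.assoc by linarith
 qed
 have bg: "norm (g X) <= 2 * B" for X using n(1)[of "g X"] B(1)[of "snd X"] B(2)[of "fst X" "snd X"] by (simp add: g_def)
 have "3 * L > 0" using L by simp
 then obtain X where X: "X t0 = (s0, y0)" "!!t. (X has_vector_derivative g (X t)) (at t)" using ode_global[OF lg _ bg] by metis
 show ?thesis
 proof (rule that[of "%t. fst (X t)" "%t. snd (X t)"])
  show "DERIV (%t. fst (X t)) t :> p (snd (X t))" "DERIV (%t. snd (X t)) t :> a (fst (X t)) - b (snd (X t))" for t
   using X(2)[of t] unfolding has_real_derivative_iff_has_vector_derivative has_vector_derivative_def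
   by (auto intro!: derivative_eq_intros simp: g_def)
 qed (use X in auto)
qed

text \<open>Truncation makes the vector fields bounded and globally Lipschitz; a priori bounds then
  show that it is inactive along the trajectory in question.\<close>

definition clamp_to :: "real => real => real => real" where "clamp_to l u x = max l (min u x)"

lemma clamp_to_lipschitz: "abs (clamp_to l u x - clamp_to l u y) <= abs (x - y)"
 by (auto simp: clamp_to_def max_def min_def)

lemma clamp_to_bounds: "l <= u ==> l <= clamp_to l u x & clamp_to l u x <= u"
 by (auto simp: clamp_to_def)

lemma clamp_to_id: "l <= x ==> x <= u ==> clamp_to l u x = x"
 by (auto simp: clamp_to_def)

section \<open>A two-point boundary value problem for the radial equation\<close>

context params
begin

lemma F_lipschitz:
 assumes a: "0 < a"
 obtains L where "L > 0" "!!sig x y. sig = 1 \<or> sig = -1 ==> x \<in> {a..b} ==> y \<in> {a..b} ==>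
  abs (F (sig * x) - F (sig * y)) <= L * abs (x - y)"
proof -
 define L where "L = 2 * abs b + 2 * abs rho + abs lam * a powr (- tau) + 1"
 have L: "L > 0" unfolding L_def by (intro add_nonneg_pos add_nonneg_nonneg mult_nonneg_nonneg) auto
 show ?thesis
 proof (rule that[OF L])
  fix sig x y :: real assume sg: "sig = 1 \<or> sig = -1" and xy: "x \<in> {a..b}" "y \<in> {a..b}"
  define f where "f y = y^2 - 2 * rho * sig * y + lam * y powr (1 - tau)" for y
  have f: "F (sig * y) = f y" if "y \<in> {a..b}" for y
   using that a sg by (auto simp: F_def f_def abs_mult)
  have "norm (f x - f y) <= L * norm (x - y)"
  proof (rule field_differentiable_bound[of "{a..b}" f "%y. 2 * y - 2 * rho * sig + lam * ((1 - tau) * y powr (- tau))"])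
   fix y assume y: "y \<in> {a..b}"
   show "(f has_field_derivative 2 * y - 2 * rho * sig + lam * ((1 - tau) * y powr (- tau))) (at y within {a..b})"
    unfolding f_def using y a by (auto intro!: derivative_eq_intros)
   have "y powr (- tau) <= a powr (- tau)" using y a tau by (intro powr_mono2') auto
   then have "abs lam * ((1 - tau) * y powr (- tau)) <= abs lam * (1 * a powr (- tau))"
    using tau by (intro mult_left_mono mult_mono) auto
   then have 1: "abs (lam * ((1 - tau) * y powr (- tau))) <= abs lam * a powr (- tau)" using tau by (simp add: abs_mult)
   have 2: "abs (2 * rho * sig) <= 2 * abs rho" using sg by (auto simp: abs_mult)
   show "norm (2 * y - 2 * rho * sig + lam * ((1 - tau) * y powr (- tau))) <= L"
    using 1 2 y a unfolding L_def real_norm_def by auto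
  qed (use xy in auto)
  then show "abs (F (sig * x) - F (sig * y)) <= L * abs (x - y)" using f xy by simp
 qed
qed

text \<open>Shooting: the initial slope varies in an interval around the mean slope \<open>p0\<close>. The
 right-hand side is truncated outside the range of the solution to make it globally Lipschitz.\<close>

lemma bvp:
 assumes c: "c > 0" and cB: "c <= B" and M0: "M0 >= 0"
 obtains dl0 where "dl0 > 0" "!!dl mu a p0. 0 < dl ==> dl <= dl0 ==> 0 <= mu ==> mu <= M0 ==> abs a <= B ==> c <= abs p0 ==> abs p0 <= B ==>
  \<exists>xi xi1. xi (- dl) = a & xi dl = a + 2 * dl * p0 &
   (\<forall>t. - 2 * dl < t --> t < 2 * dl --> DERIV xi t :> xi1 t &
    DERIV xi1 t :> mu * exp ((q - 1) * (xi t - gm * t)) - F (xi1 t) &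
    c / 2 <= abs (xi1 t) & abs (xi1 t) <= B + c & abs (xi t) <= 4 * B + 3 * c)"
proof -
 obtain L where L: "L > 0" "!!sig x y. sig = 1 \<or> sig = -1 ==> x \<in> {c/2..B + c} ==> y \<in> {c/2..B + c} ==>
  abs (F (sig * x) - F (sig * y)) <= L * abs (x - y)"
  using F_lipschitz[of "c / 2" "B + c"] c by (metis half_gt_zero)
 obtain CF where CF: "CF > 0" "!!y. abs (F y) <= CF * (1 + y^2)" using F_growth by blast
 define S0 where "S0 = 4 * B + 3 * c + 2 * abs gm"
 have S0: "S0 >= 0" using c cB by (simp add: S0_def)
 define E where "E = exp ((q - 1) * S0)"
 define B1 where "B1 = M0 * E + CF * (1 + (B + c)^2)"
 have "CF * (1 + (B + c)^2) > 0" using CF(1) by (intro mult_pos_pos add_pos_nonneg) auto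
 then have B1: "B1 > 0" unfolding B1_def E_def using M0 by (intro add_nonneg_pos) auto
 \<comment> \<open>\<open>B1\<close> bounds the derivative of the slope, so the slope moves by at
   most \<open>3 * B1 * dl <= c / 8\<close> over the interval considered. Initial slopes within
   \<open>c / 4\<close> of \<open>p0\<close> therefore stay within \<open>3 * c / 8\<close> of it,
   away from 0 and inside the truncation range.\<close>
 define dl0 where "dl0 = min 1 (c / (24 * B1))"
 show ?thesis
 proof (rule that[of dl0])
  show "dl0 > 0" using c B1 by (simp add: dl0_def)
  fix dl mu a p0 :: real
  assume del: "0 < dl" "dl <= dl0" and mu: "0 <= mu" "mu <= M0" and a: "abs a <= B" and p0: "c <= abs p0" "abs p0 <= B"
  have d1: "dl <= 1" "B1 * dl <= c / 24" using del B1 by (auto simp: dl0_def field_simps)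
  define sig where "sig = (if p0 >= 0 then 1 else - 1 :: real)"
  have sg: "sig = 1 \<or> sig = -1" "sig * sig = 1" "abs sig = 1" by (auto simp: sig_def)
  define cy where "cy y = clamp_to (c/2) (B + c) (sig * y)" for y
  define cS where "cS s = clamp_to (- S0) S0 s" for s
  have cyb: "cy y \<in> {c/2..B + c}" for y using clamp_to_bounds[of "c/2" "B + c"] c cB by (auto simp: cy_def)
  have cSb: "- S0 <= cS s" "cS s <= S0" for s using clamp_to_bounds[of "- S0" S0] S0 by (auto simp: cS_def)
  have cyl: "abs (cy y - cy y') <= abs (y - y')" for y y'
   using clamp_to_lipschitz[of "c/2" "B + c" "sig * y" "sig * y'"] sg(3)
   by (simp add: cy_def right_diff_distrib[symmetric] abs_mult)
  define K where "K = 1 + M0 * ((q - 1) * E) + L"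
  have K: "K > 0" "1 <= K" "M0 * ((q - 1) * E) <= K" "L <= K" unfolding K_def E_def using M0 q L by (auto intro!: add_pos_nonneg add_nonneg_nonneg mult_nonneg_nonneg)
  have expE: "exp ((q - 1) * cS s) <= E" for s unfolding E_def using cSb(2)[of s] q by simp
  have la: "abs (mu * exp ((q - 1) * cS u) - mu * exp ((q - 1) * cS v)) <= K * abs (u - v)" for u v
  proof -
   have "norm (exp ((q - 1) * cS u) - exp ((q - 1) * cS v)) <= ((q - 1) * E) * norm (cS u - cS v)"
   proof (rule field_differentiable_bound[of "{- S0..S0}" "%s. exp ((q - 1) * s)" "%s. (q - 1) * exp ((q - 1) * s)"])
    show "norm ((q - 1) * exp ((q - 1) * z)) <= (q - 1) * E" if "z \<in> {- S0..S0}" for z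
     using that q by (simp add: abs_mult E_def)
   qed (use cSb in \<open>auto intro!: derivative_eq_intros\<close>)
   also have "... <= ((q - 1) * E) * abs (u - v)"
    using clamp_to_lipschitz[of "- S0" S0 u v] q by (intro mult_left_mono) (auto simp: cS_def E_def)
   finally have "mu * abs (exp ((q - 1) * cS u) - exp ((q - 1) * cS v)) <= M0 * (((q - 1) * E) * abs (u - v))"
    using mu M0 by (intro mult_mono) auto
   also have "... <= K * abs (u - v)" unfolding mult.assoc[symmetric] using K(3) by (intro mult_right_mono) (auto simp: mult.assoc)
   finally show ?thesis using mu by (simp add: right_diff_distrib[symmetric] abs_mult)
  qed
  have lp: "abs ((sig * cy u - gm) - (sig * cy v - gm)) <= K * abs (u - v)" for u v
   using cyl[of u v] mult_right_mono[OF K(2), of "abs (u - v)"] sg(3) by (simp add: right_diff_distrib[symmetric] abs_mult)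
  have lb: "abs (F (sig * cy u) - F (sig * cy v)) <= K * abs (u - v)" for u v
   using L(2)[OF sg(1) cyb cyb, of u v] mult_mono[OF K(4) cyl[of u v]] K(1) by linarith
  have ybd: "abs (mu * exp ((q - 1) * cS s) - F (sig * cy y)) <= B1" for s y
  proof -
   have "mu * exp ((q - 1) * cS s) <= M0 * E" using mu expE[of s] by (intro mult_mono) auto
   moreover have "(sig * cy y)^2 <= (B + c)^2"
    using cyb[of y] c sg(2) by (simp add: power_mult_distrib power2_eq_square[of sig] power_mono)
   then have "CF * (1 + (sig * cy y)^2) <= CF * (1 + (B + c)^2)" using CF(1) by (intro mult_left_mono) auto
   then have "abs (F (sig * cy y)) <= CF * (1 + (B + c)^2)" using CF(2)[of "sig * cy y"] by linarith
   moreover have "0 <= mu * exp ((q - 1) * cS s)" using mu by simp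
   ultimately show ?thesis unfolding B1_def by linarith
  qed
  have cyB: "abs (sig * cy y) <= B + c" for y using cyb[of y] c sg(3) by (simp add: abs_mult)
  have "\<exists>s y. s (- dl) = a + gm * dl & y (- dl) = p & (\<forall>t. DERIV s t :> sig * cy (y t) - gm) &
   (\<forall>t. DERIV y t :> mu * exp ((q - 1) * cS (s t)) - F (sig * cy (y t)))" for p
  proof (rule planar_ode[OF K(1) lp la lb, of "B + c + abs gm + B1" "- dl" "a + gm * dl" p], goal_cases)
   case (1 u) then show ?case using cyB[of u] B1 by linarith
  next
   case (2 u v) then show ?case using ybd[of u v] c cB by linarith
  qed blast
  then obtain S y where X: "!!p. S p (- dl) = a + gm * dl" "!!p. y p (- dl) = p" "!!p t. DERIV (S p) t :> sig * cy (y p t) - gm"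
   and dy: "!!p t. DERIV (y p) t :> mu * exp ((q - 1) * cS (S p t)) - F (sig * cy (y p t))" by metis
  define xi where "xi p t = S p t + gm * t" for p t
  have dxi: "DERIV (xi p) t :> sig * cy (y p t)" for p t
   unfolding xi_def using X(3)[of p t] by (auto intro!: derivative_eq_intros)
  have ydiff: "abs (y p t - p) <= B1 * abs (t + dl)" for p t
  proof -
   have "norm (y p t - y p (- dl)) <= B1 * norm (t - (- dl))"
    by (rule field_differentiable_bound[of UNIV "y p"]) (use dy ybd in auto)
   then show ?thesis using X(2)[of p] by simp
  qed
  have xidiff: "abs (xi p t - a) <= (B + c) * abs (t + dl)" for p t
  proof -
   have "norm (xi p t - xi p (- dl)) <= (B + c) * norm (t - (- dl))"
    by (rule field_differentiable_bound[of UNIV "xi p"]) (use dxi cyB in auto)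
   then show ?thesis using X(1)[of p] by (simp add: xi_def)
  qed
  have yrange: "abs (y p t - p0) <= 3 * c / 8" if "abs (p - p0) <= c / 4" "- 2 * dl <= t" "t <= 2 * dl" for p t
  proof -
   have "B1 * abs (t + dl) <= B1 * (3 * dl)" using that del B1 by (intro mult_left_mono) auto
   then show ?thesis using ydiff[of p t] d1(2) that(1) by linarith
  qed
  have cyid: "sig * cy y' = y' & c / 2 <= abs y' & abs y' <= B + c" if "abs (y' - p0) <= 3 * c / 8" for y'
  proof -
   have "abs (sig * y' - abs p0) <= 3 * c / 8" using that sg(1) unfolding sig_def by (auto simp: abs_minus_commute)
   then have "c / 2 <= sig * y'" "sig * y' <= B + c" using p0 c by linarith+
   then have "cy y' = sig * y'" by (simp add: cy_def clamp_to_id)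
   then have "sig * cy y' = (sig * sig) * y'" by simp
   moreover have "abs y' = sig * y'" using \<open>c / 2 <= sig * y'\<close> c sg(1) by auto
   ultimately show ?thesis using \<open>c / 2 <= sig * y'\<close> \<open>sig * y' <= B + c\<close> sg(2) by simp
  qed
  have cont: "continuous_on UNIV (%p. xi p dl)"
  proof -
   have lipp: "abs (xi p dl - xi p' dl) <= exp (2 * (2 * K) * (2 * dl)) * abs (p - p')" for p p'
   proof -
    have K1: "K * abs u <= (2 * K) * (abs u + abs v)" "K * abs v <= (2 * K) * (abs u + abs v)" "K * abs u + K * abs v <= (2 * K) * (abs u + abs v)" for u v
     using K(1) mult_nonneg_nonneg[of K "abs u"] mult_nonneg_nonneg[of K "abs v"] unfolding distrib_left by linarith+
    have "abs (S p dl - S p' dl) <= exp (2 * (2 * K) * (dl - (- dl))) * (abs (S p (- dl) - S p' (- dl)) + abs (y p (- dl) - y p' (- dl)))"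
    proof (rule planar_gronwall(1)[OF has_field_derivative_at_within[OF X(3)] has_field_derivative_at_within[OF X(3)]
       has_field_derivative_at_within[OF dy] has_field_derivative_at_within[OF dy], where b = dl])
     show "abs (sig * cy (y p t) - gm - (sig * cy (y p' t) - gm)) <= 2 * K * (abs (S p t - S p' t) + abs (y p t - y p' t))" for t
      by (rule order.trans[OF lp K1(2)])
     show "abs (mu * exp ((q - 1) * cS (S p t)) - F (sig * cy (y p t)) - (mu * exp ((q - 1) * cS (S p' t)) - F (sig * cy (y p' t))))
      <= 2 * K * (abs (S p t - S p' t) + abs (y p t - y p' t))" for t
      using la[of "S p t" "S p' t"] lb[of "y p t" "y p' t"] K1(3)[of "S p t - S p' t" "y p t - y p' t"] by linarith
    qed (use del K in auto)
    then show ?thesis unfolding X(1,2) by (simp add: xi_def)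
   qed
   show ?thesis
    by (rule lipschitz_on_continuous_on[of "exp (2 * (2 * K) * (2 * dl))"])
     (use lipp in \<open>auto simp: lipschitz_on_def dist_real_def\<close>)
  qed
  have mvt: "\<exists>y'. abs (y' - p) <= c / 8 & xi p dl = a + 2 * dl * y'" if p: "abs (p - p0) <= c / 4" for p
  proof -
   obtain s where s: "- dl < s" "s < dl" "xi p dl - xi p (- dl) = (dl - (- dl)) * (sig * cy (y p s))"
    using MVT2[of "- dl" dl "xi p" "%t. sig * cy (y p t)"] dxi del by auto
   have "sig * cy (y p s) = y p s" using cyid[OF yrange[OF p, of s]] s del by simp
   moreover have "B1 * abs (s + dl) <= B1 * (2 * dl)" using s del B1 by (intro mult_left_mono) auto
   then have "abs (y p s - p) <= c / 8" using ydiff[of p s] d1(2) c by linarith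
   moreover have "xi p (- dl) = a" using X(1)[of p] by (simp add: xi_def)
   ultimately show ?thesis using s(3) by (intro exI[of _ "y p s"]) auto
  qed
  \<comment> \<open>The endpoint value depends continuously on the initial slope \<open>p\<close>,
    and the mean slope differs from \<open>p\<close> by at most \<open>c / 8\<close>. Hence the
    slopes \<open>p0 - c / 4\<close> and \<open>p0 + c / 4\<close> undershoot and overshoot the
    target.\<close>
  have ivt: "\<exists>p\<ge>p0 - c / 4. p <= p0 + c / 4 & xi p dl = a + 2 * dl * p0"
  proof (rule IVT')
   obtain y1 where "abs (y1 - (p0 - c / 4)) <= c / 8" "xi (p0 - c / 4) dl = a + 2 * dl * y1" using mvt[of "p0 - c/4"] c by auto
   moreover from this have "y1 <= p0" using c by linarith
   ultimately show "xi (p0 - c / 4) dl <= a + 2 * dl * p0" using del by simp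
   obtain y1 where "abs (y1 - (p0 + c / 4)) <= c / 8" "xi (p0 + c / 4) dl = a + 2 * dl * y1" using mvt[of "p0 + c/4"] c by auto
   moreover from this have "p0 <= y1" using c by linarith
   ultimately show "a + 2 * dl * p0 <= xi (p0 + c / 4) dl" using del by simp
  qed (use c cont in \<open>auto intro: continuous_on_subset\<close>)
  obtain p where p: "abs (p - p0) <= c / 4" "xi p dl = a + 2 * dl * p0"
  proof -
   obtain p where p: "p0 - c / 4 <= p" "p <= p0 + c / 4" "xi p dl = a + 2 * dl * p0" using ivt by blast
   then have "abs (p - p0) <= c / 4" by linarith
   then show ?thesis using that p(3) by blast
  qed
  show "\<exists>xi xi1. xi (- dl) = a & xi dl = a + 2 * dl * p0 &
   (\<forall>t. - 2 * dl < t --> t < 2 * dl --> DERIV xi t :> xi1 t &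
    DERIV xi1 t :> mu * exp ((q - 1) * (xi t - gm * t)) - F (xi1 t) &
    c / 2 <= abs (xi1 t) & abs (xi1 t) <= B + c & abs (xi t) <= 4 * B + 3 * c)"
  proof (rule exI[of _ "xi p"], rule exI[of _ "y p"], intro conjI allI impI)
   show "xi p (- dl) = a" using X(1)[of p] by (simp add: xi_def)
   show "xi p dl = a + 2 * dl * p0" by (rule p(2))
  next
   fix t assume t: "- 2 * dl < t" "t < 2 * dl"
   have id: "sig * cy (y p t) = y p t" "c / 2 <= abs (y p t)" "abs (y p t) <= B + c"
    using cyid[OF yrange[OF p(1), of t]] t by auto
   show "c / 2 <= abs (y p t)" "abs (y p t) <= B + c" by (rule id)+
   show "(xi p has_real_derivative y p t) (at t)" using dxi[of p t] id(1) by simp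
   have "(B + c) * abs (t + dl) <= (B + c) * 3" using t d1 c cB by (intro mult_left_mono) auto
   then have "abs (xi p t - a) <= (B + c) * 3" by (rule order.trans[OF xidiff])
   then show xb: "abs (xi p t) <= 4 * B + 3 * c" using a by (auto simp: abs_le_iff)
   have "abs (gm * t) <= abs gm * 2" unfolding abs_mult using t d1 by (intro mult_left_mono) auto
   then have "- S0 <= S p t" "S p t <= S0" using xb unfolding xi_def S0_def by linarith+
   then have "cS (S p t) = xi p t - gm * t" by (simp add: cS_def clamp_to_id xi_def)
   then show "(y p has_real_derivative mu * exp ((q - 1) * (xi p t - gm * t)) - F (y p t)) (at t)"
    using dy[of p t] id(1) by simp
  qed
 qed
qed

end

section \<open>Radial symmetry\<close>

lemma one_minus_powr:
 fixes s a :: real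
 assumes "0 <= s" "0 <= a" "a <= 1"
 shows "abs (1 - s powr a) <= abs (1 - s) \<or> (s = 0 & a = 0)" and "s > 0 ==> abs (1 - s powr a) <= abs (1 - s)"
proof -
 show pos: "abs (1 - s powr a) <= abs (1 - s)" if s: "s > 0"
 proof (cases "s <= 1")
  case True
  have "s powr 1 <= s powr a" "s powr a <= 1" using True s assms powr_mono'[of a 1 s] by (auto intro: powr_le1)
  then show ?thesis using True s by simp
 next
  case False
  have "s powr a <= s powr 1" "1 <= s powr a" using False assms powr_mono[of a 1 s] by (auto intro: ge_one_powr_ge_zero)
  then show ?thesis using False by simp
 qed
 show "abs (1 - s powr a) <= abs (1 - s) \<or> (s = 0 & a = 0)" using pos assms by (cases "s = 0") auto
qed

text \<open>Bernoulli's inequality: for an exponent at least 1 the power lies above its tangent at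
  1.\<close>

lemma one_minus_powr_ge_one:
 fixes s a :: real
 assumes "0 < s" "s <= 1" "1 <= a"
 shows "1 - s powr a <= a * (1 - s)"
proof -
 have "a * ln s <= a * (s - 1)" using assms ln_le_minus_one[of s] by (intro mult_left_mono) auto
 have "1 + a * (s - 1) <= s powr a"
 proof (cases "1 + a * (s - 1) > 0")
  case False
  then show ?thesis using powr_ge_zero[of s a] by linarith
 next
  case True
  define f where "f x = x powr a - a * (x - 1)" for x :: real
  have "f 1 <= f s"
  proof (rule DERIV_nonpos_imp_nonincreasing[OF assms(2)])
   fix x assume x: "s <= x" "x <= 1"
   have "DERIV f x :> a * x powr (a - 1) - a"
    unfolding f_def using x assms by (auto intro!: derivative_eq_intros)
   moreover have "x powr (a - 1) <= 1" using x assms by (intro powr_le1) auto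
   then have "a * x powr (a - 1) <= a * 1" using assms by (intro mult_left_mono) auto
   ultimately show "\<exists>y. DERIV f x :> y & y <= 0" by auto
  qed
  then show ?thesis by (simp add: f_def)
 qed
 then show ?thesis by (simp add: algebra_simps)
qed

section \<open>The difference between a solution and a steep radial solution\<close>

context params
begin

text \<open>The gradient term is compared multiplicatively. With \<open>S = Y / X\<close> and
  \<open>T = (Y * b) / (X * a)\<close> the quotient of the two values is
  \<open>S powr tau * T powr (1 - tau)\<close>, whose distance from 1 is at most
  \<open>(1 - S) + abs (1 - T)\<close>. Thus a lower bound \<open>s1\<close> for the first gradient
  suffices and the second may vanish. The nonlinearity is treated by Bernoulli's inequality with
  exponent \<open>q\<close>.\<close>

lemma exp_difference_bound:
 fixes x p p' :: "'a::euclidean_space"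
 assumes r: "exp (- 1) <= norm x" "norm x <= exp 1" and z: "z' <= z" and mu: "mu >= 0"
  and W: "mu * norm x powr (th + 2) * exp ((q - 1) * z) <= W1"
  and s: "0 < s1" "s1 <= 1" "s1 <= norm x * norm p" "norm x * norm p <= s2"
  and K: "K = exp 2 * (q * W1 + abs (real DIM('a) - 2 + 2 * rho) * exp 1 + abs lam * (1 + s2 + exp 1 / s1))"
 shows "abs (exp_rhs mu x z p - exp_rhs mu x z' p')
  <= K * norm (exp z *\<^sub>R p - exp z' *\<^sub>R p') + K * (exp z - exp z')"
proof -
 define R where "R = norm x"
 have R: "R > 0" "exp (- 1) <= R" "R <= exp 1" using r less_le_trans[OF exp_gt_zero] by (auto simp: R_def)
 have x0: "x ~= 0" using R(1) by (auto simp: R_def)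
 define X Y where "X = exp z" and "Y = exp z'"
 have XY: "0 < Y" "Y <= X" "0 < X" using z by (auto simp: X_def Y_def)
 define D where "D = norm (X *\<^sub>R p - Y *\<^sub>R p')"
 define W where "W = mu * R powr (th + 2) * exp ((q - 1) * z)"
 define m where "m = abs (real DIM('a) - 2 + 2 * rho)"
 define S where "S = Y / X"
 have S: "0 < S" "S <= 1" using XY by (auto simp: S_def)
 have XS: "X * (1 - S) = X - Y" using XY by (simp add: S_def field_simps)
 have W: "0 <= W" "W <= W1" using assms mu by (auto simp: W_def R_def)
 have nn: "0 <= X - Y" "0 <= D" using XY by (auto simp: D_def)
 have T1: "abs (X * W - Y * (mu * R powr (th + 2) * exp ((q - 1) * z'))) <= q * W1 * (X - Y)"
 proof -
  have "Y * exp ((q - 1) * z') = X * exp ((q - 1) * z) * S powr q"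
   unfolding X_def Y_def S_def powr_def by (simp add: exp_add[symmetric] exp_diff[symmetric] algebra_simps)
  then have "X * W - Y * (mu * R powr (th + 2) * exp ((q - 1) * z')) = X * W * (1 - S powr q)"
   by (simp add: W_def algebra_simps)
  moreover have "0 <= 1 - S powr q" using S q powr_le1[of q S] by simp
  moreover have "X * W * (1 - S powr q) <= X * W * (q * (1 - S))"
   using one_minus_powr_ge_one[of S q] S q W XY by (intro mult_left_mono) auto
  moreover have "X * W * (q * (1 - S)) = q * W * (X - Y)" using XS[symmetric] by simp
  moreover have "q * W * (X - Y) <= q * W1 * (X - Y)" using W q nn by (intro mult_right_mono mult_left_mono) auto
  ultimately show ?thesis using W XY by simp
 qed
 have T2: "abs ((real DIM('a) - 2 + 2 * rho) * (x \<bullet> (X *\<^sub>R p)) - (real DIM('a) - 2 + 2 * rho) * (x \<bullet> (Y *\<^sub>R p'))) <= m * exp 1 * D"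
 proof -
  have "abs (x \<bullet> (X *\<^sub>R p - Y *\<^sub>R p')) <= R * D" unfolding R_def D_def by (rule Cauchy_Schwarz_ineq2)
  also have "... <= exp 1 * D" using R nn by (intro mult_right_mono) auto
  finally have "m * abs (x \<bullet> (X *\<^sub>R p - Y *\<^sub>R p')) <= m * (exp 1 * D)" by (intro mult_left_mono) (auto simp: m_def)
  then show ?thesis
   unfolding right_diff_distrib[symmetric] inner_diff_right[symmetric] abs_mult m_def[symmetric] by (simp add: mult.assoc)
 qed
 have T3: "abs (X * (R * norm p) powr (1 - tau) - Y * (R * norm p') powr (1 - tau)) <= (1 + s2) * (X - Y) + exp 1 / s1 * D"
 proof -
  define a b where "a = R * norm p" and "b = R * norm p'"
  have ab: "s1 <= a" "a <= s2" "0 <= b" "0 < a" using s R by (auto simp: a_def b_def R_def)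
  define T where "T = (Y * b) / (X * a)"
  have T: "0 <= T" using XY ab by (simp add: T_def)
  have 1: "Y * b powr (1 - tau) = X * a powr (1 - tau) * (S powr tau * T powr (1 - tau))"
  proof -
   have "T powr (1 - tau) = S powr (1 - tau) * (b powr (1 - tau) / a powr (1 - tau))"
    unfolding T_def S_def using XY ab by (simp add: powr_mult powr_divide)
   then have "S powr tau * T powr (1 - tau) = S powr tau * S powr (1 - tau) * (b powr (1 - tau) / a powr (1 - tau))" by simp
   also have "S powr tau * S powr (1 - tau) = S" using S by (simp add: powr_add[symmetric])
   finally show ?thesis using XY ab by (simp add: S_def field_simps)
  qed
  have "abs (1 - S powr tau * T powr (1 - tau)) <= (1 - S) + abs (1 - T)"
  proof -
   have St: "abs (1 - S powr tau) <= abs (1 - S)" using one_minus_powr(2)[of S tau] S tau by auto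
   have "abs (1 - T powr (1 - tau)) <= abs (1 - T)" using one_minus_powr(1)[of T "1 - tau"] T tau by auto
   moreover have "0 <= S powr tau" "S powr tau <= 1" using S tau by (auto intro: powr_le1)
   then have "abs (S powr tau * (1 - T powr (1 - tau))) <= 1 * abs (1 - T powr (1 - tau))"
    unfolding abs_mult by (intro mult_right_mono) auto
   moreover have e: "1 - S powr tau * T powr (1 - tau) = (1 - S powr tau) + S powr tau * (1 - T powr (1 - tau))"
    by (simp add: algebra_simps)
   moreover have "abs (u + v) <= (1 - S) + t" if "abs u <= abs (1 - S)" "abs v <= 1 * w" "w <= t" for u v w t
    using that S by linarith
   ultimately show ?thesis unfolding e using St by blast
  qed
  then have "X * a powr (1 - tau) * abs (1 - S powr tau * T powr (1 - tau)) <= X * a powr (1 - tau) * ((1 - S) + abs (1 - T))"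
   using XY by (intro mult_left_mono) auto
  moreover have e: "X * a powr (1 - tau) - Y * b powr (1 - tau) = X * a powr (1 - tau) * (1 - S powr tau * T powr (1 - tau))"
   unfolding 1 by (simp add: algebra_simps)
  have "abs (X * a powr (1 - tau) - Y * b powr (1 - tau)) = X * a powr (1 - tau) * abs (1 - S powr tau * T powr (1 - tau))"
   unfolding e using XY by (simp add: abs_mult)
  moreover have "X * a powr (1 - tau) * ((1 - S) + abs (1 - T)) = a powr (1 - tau) * (X - Y) + X * a powr (1 - tau) * abs (1 - T)"
   unfolding XS[symmetric] by (simp add: algebra_simps)
  ultimately have 2: "abs (X * a powr (1 - tau) - Y * b powr (1 - tau)) <= a powr (1 - tau) * (X - Y) + X * a powr (1 - tau) * abs (1 - T)"
   by simp
  have "a powr (1 - tau) <= 1 + s2" using powr_le_one_plus[of a] ab by linarith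
  then have 3: "a powr (1 - tau) * (X - Y) <= (1 + s2) * (X - Y)" using nn by (intro mult_right_mono) auto
  have "X * a powr (1 - tau) * abs (1 - T) = a powr (- tau) * (X * a * abs (1 - T))"
   using ab powr_add[of a 1 "- tau"] by simp
  also have "X * a * abs (1 - T) = abs (X * a - Y * b)"
  proof -
   have "X * a * (1 - T) = X * a - Y * b" using XY ab by (simp add: T_def field_simps)
   moreover have "abs (X * a * (1 - T)) = X * a * abs (1 - T)" using XY ab by (simp add: abs_mult)
   ultimately show ?thesis by simp
  qed
  also have "abs (X * a - Y * b) <= exp 1 * D"
  proof -
   have "X * a - Y * b = R * (norm (X *\<^sub>R p) - norm (Y *\<^sub>R p'))"
    using XY by (simp add: a_def b_def algebra_simps)
   then have "abs (X * a - Y * b) <= R * D" unfolding D_def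
    using R norm_triangle_ineq3[of "X *\<^sub>R p" "Y *\<^sub>R p'"] by (simp add: abs_mult)
   also have "... <= exp 1 * D" using R nn by (intro mult_right_mono) auto
   finally show ?thesis .
  qed
  finally have "X * a powr (1 - tau) * abs (1 - T) <= a powr (- tau) * (exp 1 * D)" by (simp add: mult_left_mono)
  moreover have "a powr (- tau) <= 1 / s1"
  proof -
   have "a powr (- tau) <= s1 powr (- tau)" using ab s tau by (intro powr_mono2') auto
   also have "... <= s1 powr (- 1)" using s tau by (intro powr_mono') auto
   also have "... = 1 / s1" using s by (simp add: powr_minus inverse_eq_divide)
   finally show ?thesis .
  qed
  then have "a powr (- tau) * (exp 1 * D) <= 1 / s1 * (exp 1 * D)" using nn by (intro mult_right_mono) auto
  ultimately show ?thesis using 2 3 by (simp add: a_def b_def)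
 qed
 define A where "A = exp_rhs mu x z p - exp_rhs mu x z' p'"
 define k where "k = q * W1 + m * exp 1 + abs lam * (1 + s2 + exp 1 / s1)"
 have "R\<^sup>2 * A = (X * W - Y * (mu * R powr (th + 2) * exp ((q - 1) * z')))
  + ((real DIM('a) - 2 + 2 * rho) * (x \<bullet> (X *\<^sub>R p)) - (real DIM('a) - 2 + 2 * rho) * (x \<bullet> (Y *\<^sub>R p')))
  - lam * (X * (R * norm p) powr (1 - tau) - Y * (R * norm p') powr (1 - tau))"
  unfolding A_def right_diff_distrib[of "R\<^sup>2"] unfolding R_def exp_rhs_eq[OF x0] W_def X_def Y_def
  by (simp add: algebra_simps)
 moreover have "abs (lam * (X * (R * norm p) powr (1 - tau) - Y * (R * norm p') powr (1 - tau)))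
  <= abs lam * ((1 + s2) * (X - Y) + exp 1 / s1 * D)"
  unfolding abs_mult by (intro mult_left_mono T3) auto
 ultimately have "abs (R^2 * A) <= q * W1 * (X - Y) + m * exp 1 * D + abs lam * ((1 + s2) * (X - Y) + exp 1 / s1 * D)"
  using T1 T2 by linarith
 also have "... <= k * D + k * (X - Y)"
 proof -
  have s2: "s2 >= 0" using s by linarith
  have "0 <= q * W1 * D" "0 <= m * exp 1 * (X - Y)" "0 <= abs lam * ((1 + s2) * D)" "0 <= abs lam * (exp 1 / s1 * (X - Y))"
   using nn q W s s2 by (auto simp: m_def intro!: mult_nonneg_nonneg)
  then show ?thesis unfolding k_def by (simp add: algebra_simps)
 qed
 finally have 4: "abs A * R^2 <= k * (D + (X - Y))" by (simp add: abs_mult algebra_simps)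
 have "1 <= exp 2 * R^2" using inverse_le_exp(3)[OF R(2)] R(1) by (simp add: field_simps)
 then have "abs A * 1 <= abs A * (exp 2 * R^2)" by (intro mult_left_mono) auto
 also have "... = exp 2 * (abs A * R^2)" by simp
 also have "... <= exp 2 * (k * (D + (X - Y)))" using 4 by (intro mult_left_mono) auto
 finally have "abs A <= exp 2 * (k * (D + (X - Y)))" by simp
 moreover have "K = exp 2 * k" by (simp add: K k_def m_def)
 ultimately have "abs A <= K * D + K * (X - Y)" by (simp only: mult.assoc distrib_left)
 then show ?thesis unfolding A_def D_def X_def Y_def .
qed

end

context params
begin

lemma powr_theta_le: "exp (- 1) <= r ==> r <= exp 1 ==> r powr a <= exp (abs a)" for r a :: real
proof -
 assume r: "exp (- 1) <= r" "r <= exp (1::real)"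
 then have r0: "r > 0" using less_le_trans[OF exp_gt_zero] by blast
 have "- 1 <= ln r" "ln r <= 1" using r r0 ln_mono[of "exp (- 1)" r] ln_mono[of r "exp 1"] by auto
 then have "a * ln r <= abs a * 1" unfolding abs_mult[symmetric]
  using abs_ge_self[of "a * ln r"] mult_left_mono[of "abs (ln r)" 1 "abs a"] by (simp add: abs_mult abs_le_iff)
 then show ?thesis using r0 by (simp add: powr_def)
qed

text \<open>If the maximum changed with mean slope at least \<open>c\<close>, a radial solution
  \<open>Z\<close> with the same values as \<open>hi z\<close> at \<open>- dl\<close> and
  \<open>dl\<close> would exist, with slope away from 0. Comparison gives \<open>z <= Z\<close> and
  \<open>Z - z <= L + ep\<close>. So \<open>w = exp Z - exp z\<close> satisfies a linear inequality,
  is at least \<open>l\<close> at the minimum point \<open>xm\<close> of the unit sphere, but is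
  less than \<open>e0\<close> at the maximum point \<open>xM\<close>, against
  \<open>two_point\<close>.\<close>

lemma slope_bound:
 assumes d: "CARD('n::finite) >= 2" and L: "L > 0" and c: "c > 0" and dl1: "dl1 > 0"
 obtains dl ep where "dl > 0" "dl <= dl1" "ep > 0" "!!mu (z::real^'n => real) G. log_sol mu (- {0}) z G ==> mu > 0 ==>
  hi z 0 = 0 ==> (!!t. abs t <= 1 ==> abs (hi z t - lo z t - L) <= ep) ==> abs (hi z dl - hi z (- dl)) < 2 * dl * c"
proof -
 have d2: "DIM(real^'n) >= 2" using d by simp
 obtain B0 h where B0: "B0 > 0" "h > 0" "!!mu (z::real^'n => real) G s t. log_sol mu (- {0}) z G ==> mu > 0 ==>
  abs (s - t) <= h ==> abs (hi z s - hi z t) <= B0 * abs (s - t)"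
 proof (rule hi_lipschitz[OF d2], goal_cases)
  case (1 B h) from 1(2,3,4) show ?case by (rule that)
 qed
 define B where "B = max B0 c"
 have B: "B > 0" "c <= B" "B0 <= B" using B0 by (auto simp: B_def)
 have W0: "W0 >= 0" by (simp add: W0_def)
 obtain dl0 where dl0: "dl0 > 0" "!!dl mu a p0. 0 < dl ==> dl <= dl0 ==> 0 <= mu ==> mu <= W0 ==> abs a <= B ==> c <= abs p0 ==> abs p0 <= B ==>
  \<exists>xi xi1. xi (- dl) = a & xi dl = a + 2 * dl * p0 &
   (\<forall>t. - 2 * dl < t --> t < 2 * dl --> DERIV xi t :> xi1 t &
    DERIV xi1 t :> mu * exp ((q - 1) * (xi t - gm * t)) - F (xi1 t) &
    c / 2 <= abs (xi1 t) & abs (xi1 t) <= B + c & abs (xi t) <= 4 * B + 3 * c)"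
  using bvp[OF c B(2) W0] by metis
 define dl where "dl = min (min dl0 h) (min dl1 (1/2))"
 have dl: "dl > 0" "dl <= dl0" "dl <= h" "dl <= dl1" "dl <= 1/2" using dl0 B0 dl1 by (auto simp: dl_def)
 define C0 where "C0 = exp (4 * B + 3 * c)"
 define W1 where "W1 = W0 * exp (abs (th + 2)) * exp ((q - 1) * (4 * B + 3 * c))"
 define s1 where "s1 = min 1 (c / 2)"
 have s1: "0 < s1" "s1 <= 1" "s1 <= c / 2" using c by (auto simp: s1_def)
 define K where "K = exp 2 * (q * W1 + abs (real DIM(real^'n) - 2 + 2 * rho) * exp 1 + abs lam * (1 + (B + c) + exp 1 / s1))"
 have K: "K >= 0" unfolding K_def W1_def using W0 q B c s1
  by (intro mult_nonneg_nonneg add_nonneg_nonneg divide_nonneg_nonneg) auto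
 define K2 where "K2 = K * (1 + C0)"
 have K2: "K2 >= 0" "K <= K2" "K * C0 <= K2" using K by (auto simp: K2_def C0_def algebra_simps)
 define l where "l = 1 - exp (- L / 2)"
 have l: "l > 0" using L by (simp add: l_def)
 have C0: "C0 >= 0" by (simp add: C0_def)
 obtain e0 where e0: "e0 > 0" "!!(w::real^'n => real) G g x y. weak_lap (annulus (- dl) dl) w G g ==>
   (!!x. x \<in> annulus (- dl) dl ==> 0 <= w x & w x <= C0 & g x <= K2 * norm (G x) + K2 * (w x + e0)
    & - (K2 * (1 + norm (G x))) <= g x) ==>
   norm x = 1 ==> norm y = 1 ==> l <= w x ==> e0 <= w y"
 proof (rule two_point[OF d2 K2(1) dl(1) l C0], goal_cases)
  case (1 e) from 1(2,3) show ?case by (rule that)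
 qed
 \<comment> \<open>At the centre \<open>Z\<close> is at most \<open>2 * ep\<close>, so
   \<open>2 * ep < ln (1 + e0)\<close> gives the contradiction; \<open>ep <= L / 2\<close> keeps the
   minimum of \<open>z\<close> on the unit sphere below \<open>- L / 2\<close>.\<close>
 define ep where "ep = min (L / 2) (ln (1 + e0) / 3)"
 have eps: "ep > 0" "ep <= L / 2" "2 * ep < ln (1 + e0)"
  using L ln_gt_zero[of "1 + e0"] e0(1) by (auto simp: ep_def min_def)
 show ?thesis
 proof (rule that[OF dl(1,4) eps(1)])
  fix mu and z :: "real^'n => real" and G
  assume z: "log_sol mu (- {0}) z G" and mu: "mu > 0" and h0: "hi z 0 = 0"
   and D: "!!t. abs t <= 1 ==> abs (hi z t - lo z t - L) <= ep"
  have cz: "continuous_on (- {0}) z" by (rule log_solD(5)[OF z])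
  obtain xM xm where xM: "norm xM = 1" "z xM = 0" and xm: "norm xm = 1" "z xm = lo z 0"
   using hi_attained[OF cz, of 0] lo_attained[OF cz, of 0] h0 by auto
  have "xM ~= 0" using xM(1) by auto
  then have muW: "mu <= W0" using keller_osserman[OF z mu, of xM] xM by simp
  define p0 where "p0 = (hi z dl - hi z (- dl)) / (2 * dl)"
  have hd: "abs (hi z dl) <= B * dl" "abs (hi z (- dl)) <= B * dl"
  proof -
   have "B0 * dl <= B * dl" using B(3) dl(1) by (intro mult_right_mono) auto
   moreover have "abs (hi z dl) <= B0 * dl" "abs (hi z (- dl)) <= B0 * dl"
    using B0(3)[OF z mu, of dl 0] B0(3)[OF z mu, of "- dl" 0] h0 dl by auto
   ultimately show "abs (hi z dl) <= B * dl" "abs (hi z (- dl)) <= B * dl" by linarith+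
  qed
  have p0: "abs p0 <= B"
  proof -
   have "abs (hi z dl - hi z (- dl)) <= B * (2 * dl)" using hd by (auto simp: abs_le_iff)
   then show ?thesis using dl(1) by (simp add: p0_def abs_mult field_simps)
  qed
  have a: "abs (hi z (- dl)) <= B"
  proof -
   have "B * dl <= B * 1" using dl B by (intro mult_left_mono) auto
   then show ?thesis using hd(2) by linarith
  qed
  show "abs (hi z dl - hi z (- dl)) < 2 * dl * c"
  proof (rule ccontr)
   assume "\<not> abs (hi z dl - hi z (- dl)) < 2 * dl * c"
   then have cp: "c <= abs p0" using dl(1) by (simp add: p0_def abs_mult field_simps)
   obtain xi xi1 where xi: "xi (- dl) = hi z (- dl)" "xi dl = hi z (- dl) + 2 * dl * p0"
    and xi': "!!t. - 2 * dl < t ==> t < 2 * dl ==> DERIV xi t :> xi1 t &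
    DERIV xi1 t :> mu * exp ((q - 1) * (xi t - gm * t)) - F (xi1 t) &
    c / 2 <= abs (xi1 t) & abs (xi1 t) <= B + c & abs (xi t) <= 4 * B + 3 * c"
    using dl0(2)[OF dl(1,2) less_imp_le[OF mu] muW a cp p0] by blast
   have xid: "xi dl = hi z dl" using xi(2) dl(1) by (simp add: p0_def)
   let ?A = "annulus (- 2 * dl) (2 * dl) :: (real^'n) set"
   let ?a = "annulus (- dl) dl :: (real^'n) set"
   define Z where "Z x = xi (ln (norm x))" for x :: "real^'n"
   define P where "P x = (xi1 (ln (norm x)) / (norm x)^2) *\<^sub>R x" for x :: "real^'n"
   have sZ: "log_sol mu ?A Z P" unfolding Z_def P_def by (rule radial_log_sol) (use xi' in blast)+
   have sz: "log_sol mu ?A z G" by (rule log_sol_subset[OF z open_annulus annulus_nonzero])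
   have inA: "x \<in> ?A" if "exp (- dl) <= norm x" "norm x <= exp dl" for x :: "real^'n"
   proof -
    have "exp (- 2 * dl) < norm x" "norm x < exp (2 * dl)"
     using that dl(1) exp_less_mono[of "- 2 * dl" "- dl"] exp_less_mono[of dl "2 * dl"] by linarith+
    then show ?thesis by (simp add: annulus_def)
   qed
   have cmp1: "z x <= Z x" if "exp (- dl) <= norm x" "norm x <= exp dl" for x
   proof -
    have "z x - Z x <= 0"
     by (rule log_sol_comparison[OF sz sZ mu inA _ _ that])
      (use hi_upper[OF cz, of _ dl] hi_upper[OF cz, of _ "- dl"] xi(1) xid in \<open>auto simp: Z_def\<close>)
    then show ?thesis by simp
   qed
   have cmp2: "Z x - z x <= L + ep" if "exp (- dl) <= norm x" "norm x <= exp dl" for x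
   proof (rule log_sol_comparison[OF sZ sz mu inA _ _ that])
    fix y :: "real^'n" assume "norm y = exp (- dl) \<or> norm y = exp dl"
    then show "Z y - z y <= L + ep"
     using lo_lower[OF cz, of y dl] lo_lower[OF cz, of y "- dl"] xi(1) xid D[of dl] D[of "- dl"] dl
     by (auto simp: Z_def abs_le_iff)
   qed (use L eps in auto)
   define w where "w x = exp (Z x) - exp (z x)" for x
   define Q where "Q x = exp (Z x) *\<^sub>R P x - exp (z x) *\<^sub>R G x" for x
   define g where "g x = exp_rhs mu x (Z x) (P x) - exp_rhs mu x (z x) (G x)" for x
   have sub: "?a \<subseteq> ?A" using inA by (auto simp: annulus_def less_imp_le)
   have wl: "weak_lap ?a w Q g" unfolding w_def Q_def g_def
    by (intro weak_lap_diff weak_lap_exp log_sol_subset[OF sz open_annulus sub] log_sol_subset[OF sZ open_annulus sub])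
   have bnd: "0 <= w x & w x <= C0 & g x <= K2 * norm (Q x) + K2 * (w x + e0) & - (K2 * (1 + norm (Q x))) <= g x"
    if x: "x \<in> ?a" for x
   proof -
    have nx: "exp (- dl) <= norm x" "norm x <= exp dl" using x by (auto simp: annulus_def)
    have "exp (- 1) <= exp (- dl)" "exp dl <= exp 1" using dl(5) by auto
    then have nx1: "exp (- 1) <= norm x" "norm x <= exp 1" using nx by linarith+
    define t where "t = ln (norm x)"
    have t: "- 2 * dl < t" "t < 2 * dl" using inA[OF nx] by (auto simp: annulus_iff t_def)
    note X = xi'[OF t]
    have x0: "x ~= 0" using x by (simp add: annulus_iff)
    have ZC: "Z x <= 4 * B + 3 * c" using X by (simp add: Z_def t_def[symmetric] abs_le_iff)
    have w0: "0 <= w x" "w x <= C0"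
    proof -
     show "0 <= w x" using cmp1[OF nx] by (simp add: w_def)
     have "w x <= exp (Z x)" by (simp add: w_def)
     also have "... <= C0" unfolding C0_def using ZC by simp
     finally show "w x <= C0" .
    qed
    have nP: "norm x * norm (P x) = abs (xi1 t)" using x0 by (simp add: P_def t_def power2_eq_square)
    have "abs (g x) <= K * norm (Q x) + K * w x" unfolding g_def Q_def w_def
    proof (rule exp_difference_bound[OF nx1 cmp1[OF nx] less_imp_le[OF mu] _ s1(1,2)])
     have "mu * norm x powr (th + 2) * exp ((q - 1) * Z x) <= W0 * exp (abs (th + 2)) * exp ((q - 1) * (4 * B + 3 * c))"
      using mu muW W0 powr_theta_le[OF nx1] ZC q by (intro mult_mono mult_nonneg_nonneg) auto
     then show "mu * norm x powr (th + 2) * exp ((q - 1) * Z x) <= W1" by (simp add: W1_def)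
     show "s1 <= norm x * norm (P x)" "norm x * norm (P x) <= B + c" unfolding nP using X s1 by auto
    qed (simp add: K_def)
    moreover have "K * norm (Q x) <= K2 * norm (Q x)" "K * w x <= K2 * (w x + e0)"
     using K2 w0 e0(1) by (auto intro!: mult_right_mono mult_mono)
    moreover have "K * w x <= K2"
    proof -
     have "K * w x <= K * C0" using K w0 by (intro mult_left_mono) auto
     then show ?thesis using K2 by linarith
    qed
    ultimately show ?thesis using w0 unfolding distrib_left[of K2 1] by (auto simp: abs_le_iff)
   qed
   have n1: "exp (- dl) <= norm xM" "norm xM <= exp dl" "exp (- dl) <= norm xm" "norm xm <= exp dl"
    using xM xm dl(1) by auto
   have ZM: "Z xM = xi 0" "Z xm = xi 0" using xM xm by (simp_all add: Z_def)
   have x00: "0 <= xi 0" using cmp1[OF n1(1,2)] xM ZM by simp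
   have lo0: "lo z 0 <= - L + ep" "- L - ep <= lo z 0" using D[of 0] h0 by (auto simp: abs_le_iff)
   have "e0 <= w xM"
   proof (rule e0(2)[OF wl bnd xm(1) xM(1)])
    have "exp (lo z 0) <= exp (- L / 2)" using lo0(1) eps(2) by simp
    moreover have "1 <= exp (xi 0)" using x00 by simp
    ultimately show "l <= w xm" unfolding w_def l_def ZM xm(2) by linarith
   qed
   moreover have "xi 0 <= 2 * ep" using cmp2[OF n1(3,4)] lo0(1) xm ZM by simp
   then have "exp (xi 0) < exp (ln (1 + e0))" using eps(3) by simp
   then have "exp (xi 0) < 1 + e0" using e0(1) by simp
   ultimately show False using xM ZM by (simp add: w_def)
  qed
 qed
qed

end

section \<open>Windows on which the maxima are nearly constant\<close>

context params
begin

text \<open>If \<open>hi z\<close> stays near its value at \<open>0\<close>, comparison with a parabola shows that the zero order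
 term is small. Then, by the sign of \<open>lam\<close>, either \<open>exp z\<close> or \<open>- exp z\<close> is almost a supersolution of a
 linear inequality, without the gradient term that fails to be Lipschitz at \<open>0\<close>.\<close>

lemma almost_constant:
 assumes d: "CARD('n::finite) >= 2" and L: "L > 0"
 obtains c ep where "c > 0" "ep > 0" "!!mu (z::real^'n => real) G. log_sol mu (- {0}) z G ==> mu > 0 ==>
  hi z 0 = 0 ==> (!!t. abs t <= 1 ==> abs (hi z t - lo z t - L) <= ep) ==> (!!t. abs t <= 1 ==> abs (hi z t) <= c) ==> False"
proof -
 have d2: "DIM(real^'n) >= 2" using d by simp
 let ?A = "annulus (- 1) 1 :: (real^'n) set"
 define K where "K = exp 2 * (W0 + abs (real DIM(real^'n) - 2 + 2 * rho) + abs lam)"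
 have K: "K >= 0" by (simp add: K_def W0_def)
 define m where "m = abs (real DIM(real^'n) - 2 + 2 * rho)"
 define K2 where "K2 = 1 + K * exp 1 + K + m * exp 1"
 have "0 <= K * exp 1" "0 <= m * exp 1" using K by (simp_all add: m_def)
 then have K2: "K2 >= 1" "K <= K2" "K * exp 1 <= K2" "m * exp 1 <= K2" using K unfolding K2_def by linarith+
 define l where "l = 1 - exp (- L / 2)"
 have l: "l > 0" using L by (simp add: l_def)
 have K20: "K2 >= 0" using K2 by simp
 obtain e0 where e0: "e0 > 0" "!!(w::real^'n => real) G g x y. weak_lap ?A w G g ==>
   (!!x. x \<in> ?A ==> 0 <= w x & w x <= exp 1 & g x <= K2 * norm (G x) + K2 * (w x + e0)
    & - (K2 * (1 + norm (G x))) <= g x) ==>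
   norm x = 1 ==> norm y = 1 ==> l <= w x ==> e0 <= w y"
 proof (rule two_point[OF d2 K20 zero_less_one l exp_ge_zero[of 1]], goal_cases)
  case (1 e) from 1(2,3) show ?case by (rule that)
 qed
 define eta where "eta = e0 * exp (- 3)"
 have eta: "eta > 0" using e0 by (simp add: eta_def)
 \<comment> \<open>The zero order term can vary over the annulus by the factor
   \<open>exp (2 * (q - 1) * (1 + abs gm))\<close>. Smallness \<open>\<omega>\<close> at one radius
   therefore gives smallness \<open>eta\<close> everywhere.\<close>
 define \<omega> where "\<omega> = eta * exp (- (2 * (q - 1) * (1 + abs gm)))"
 have \<omega>: "\<omega> > 0" using eta by (simp add: \<omega>_def)
 have "isCont F 0" using continuous_F[of UNIV "%x. x"] by (simp add: continuous_on_eq_continuous_at)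
 then have "\<forall>\<^sub>F y in at 0. F y < \<omega> / 2"
  using \<omega> unfolding isCont_def by (intro order_tendstoD) auto
 then obtain d where d: "d > 0" "!!y. y ~= 0 ==> abs y < d ==> F y < \<omega> / 2"
  unfolding eventually_at by (auto simp: dist_real_def)
 have Fd: "F y < \<omega> / 2" if "abs y < d" for y using d(2)[of y] that \<omega> by (cases "y = 0") auto
 define c where "c = min (min (ln (1 + e0) / 2) (1/2)) (min (min (d / 8) (\<omega> / 16)) (e0 / 4))"
 have ln0: "ln (1 + e0) > 0" using ln_gt_zero[of "1 + e0"] e0(1) by simp
 have c: "c > 0" "c < ln (1 + e0)" "c <= 1" "4 * c < d" "4 * c < \<omega> / 2" "c < e0 / 2"
  using ln0 e0(1) d \<omega> by (auto simp: c_def min_def)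
 define ep where "ep = min (L / 2) (e0 / 4)"
 have eps: "ep > 0" "ep <= L / 2" "ep <= e0 / 4" using L e0(1) by (auto simp: ep_def)
 show ?thesis
 proof (rule that[OF c(1) eps(1)])
  fix mu and z :: "real^'n => real" and G
  assume z: "log_sol mu (- {0}) z G" and mu: "mu > 0" and h0: "hi z 0 = 0"
   and D: "!!t. abs t <= 1 ==> abs (hi z t - lo z t - L) <= ep" and hc: "!!t. abs t <= 1 ==> abs (hi z t) <= c"
  have cz: "continuous_on (- {0}) z" by (rule log_solD(5)[OF z])
  obtain xM xm where xM: "norm xM = 1" "z xM = 0" and xm: "norm xm = 1" "z xm = lo z 0"
   using hi_attained[OF cz, of 0] lo_attained[OF cz, of 0] h0 by auto
  \<comment> \<open>Otherwise the parabola \<open>- c + 2 * c * t^2\<close> is a strict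
    supersolution. It equals \<open>c\<close>, hence is at least \<open>z\<close>, on both boundary
    spheres, and comparison would give \<open>z xM <= - c\<close>, whereas
    \<open>z xM = 0\<close>.\<close>
  have "\<exists>t. abs t < 1 & mu * exp ((q - 1) * ((- c + 2 * c * t^2) - gm * t)) <= 4 * c + F (4 * c * t)"
  proof (rule ccontr)
   assume n: "\<not> ?thesis"
   have "z xM <= - c + 2 * c * (ln (norm xM))^2"
   proof (rule radial_supersolution_comparison[OF z less_imp_le[OF mu], of "- 1" 1 "- 2" 2 _ "%t. 4 * c * t" "%_. 4 * c"])
    show "4 * c + F (4 * c * t) < mu * exp ((q - 1) * ((- c + 2 * c * t^2) - gm * t))" if "- 1 < t" "t < 1" for t
     using n that by (auto simp: not_le abs_less_iff)
    show "z x <= - c + 2 * c * (- 1)^2" if "norm x = exp (- 1)" for x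
     using hi_upper[OF cz that] hc[of "- 1"] by simp
    show "z x <= - c + 2 * c * 1^2" if "norm x = exp 1" for x
     using hi_upper[OF cz that] hc[of 1] by simp
   qed (use xM in \<open>auto intro!: derivative_eq_intros simp: not_le\<close>)
   then show False using xM c(1) by simp
  qed
  then obtain t0 where t0: "abs t0 < 1" "mu * exp ((q - 1) * ((- c + 2 * c * t0^2) - gm * t0)) <= 4 * c + F (4 * c * t0)" by blast
  have "abs (4 * c * t0) <= 4 * c * 1" unfolding abs_mult using t0 c by (intro mult_mono) auto
  then have "F (4 * c * t0) < \<omega> / 2" using c(4) by (intro Fd) linarith
  then have t1: "mu * exp ((q - 1) * ((- c + 2 * c * t0^2) - gm * t0)) <= \<omega>" using t0(2) c(5) by linarith
  have gam: "abs (gm * t) <= abs gm" if "abs t <= 1" for t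
   using mult_left_mono[OF that, of "abs gm"] by (simp add: abs_mult)
  have W: "mu * exp ((q - 1) * (z x - gm * ln (norm x))) <= eta" if x: "x \<in> ?A" for x
  proof -
   have t: "abs (ln (norm x)) <= 1" "norm x = exp (ln (norm x))" using x by (auto simp: annulus_iff)
   have "z x <= c" using hi_upper[OF cz t(2)] hc[OF t(1)] by linarith
   then have "z x - gm * ln (norm x) <= ((- c + 2 * c * t0^2) - gm * t0) + 2 * (1 + abs gm)"
   proof -
    have "z x - a <= ((- c + e) - b) + 2 * (1 + g)" if "abs a <= g" "abs b <= g" "0 <= e" for a b e g
     using that c(1,3) \<open>z x <= c\<close> by (simp add: abs_le_iff)
    then show ?thesis using gam[OF t(1)] gam[OF less_imp_le[OF t0(1)]] c(1) by simp
   qed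
   then have "(q - 1) * (z x - gm * ln (norm x)) <= (q - 1) * (((- c + 2 * c * t0^2) - gm * t0) + 2 * (1 + abs gm))"
    using q by (intro mult_left_mono) auto
   then have "exp ((q - 1) * (z x - gm * ln (norm x)))
    <= exp ((q - 1) * ((- c + 2 * c * t0^2) - gm * t0)) * exp (2 * (q - 1) * (1 + abs gm))"
    by (simp add: exp_add[symmetric] algebra_simps)
   then have "mu * exp ((q - 1) * (z x - gm * ln (norm x)))
    <= mu * (exp ((q - 1) * ((- c + 2 * c * t0^2) - gm * t0)) * exp (2 * (q - 1) * (1 + abs gm)))"
    using mu by (intro mult_left_mono) auto
   also have "... <= \<omega> * exp (2 * (q - 1) * (1 + abs gm))"
    unfolding mult.assoc[symmetric, of mu] using t1 by (intro mult_right_mono) auto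
   also have "... = eta" by (simp add: \<omega>_def exp_minus)
   finally show ?thesis .
  qed
  define P where "P x = exp (z x) *\<^sub>R G x" for x
  define g where "g x = exp_rhs mu x (z x) (G x)" for x
  have wl: "weak_lap ?A (%x. exp (z x)) P g" unfolding P_def g_def by (rule weak_lap_exp[OF log_sol_subset[OF z open_annulus annulus_nonzero]])
  have gK: "abs (g x) <= K * norm (P x) + K * exp (z x)" if "x \<in> ?A" for x
   using exp_lap_bound[OF z mu that K_def] unfolding P_def g_def .
  have zr: "z x <= c" "- c - L - ep <= z x" "exp (z x) <= exp 1" if x: "x \<in> ?A" for x
  proof -
   have t: "abs (ln (norm x)) <= 1" "norm x = exp (ln (norm x))" using x by (auto simp: annulus_iff)
   show "z x <= c" using hi_upper[OF cz t(2)] hc[OF t(1)] by linarith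
   then show "exp (z x) <= exp 1" using c(3) by simp
   show "- c - L - ep <= z x" using lo_lower[OF cz t(2)] hc[OF t(1)] D[OF t(1)] by linarith
  qed
  have lower: "- (K2 * (1 + norm (P x))) <= - abs (g x)" if x: "x \<in> ?A" for x
  proof -
   have "K * exp (z x) <= K * exp 1" using zr[OF x] K by (intro mult_left_mono) auto
   moreover have "K * norm (P x) <= K2 * norm (P x)" using K2 by (intro mult_right_mono) auto
   ultimately show ?thesis using gK[OF x] K2 unfolding distrib_left by linarith
  qed
  have split: "g x = (exp (z x) * (mu * exp ((q - 1) * (z x - gm * ln (norm x)))) + (real DIM(real^'n) - 2 + 2 * rho) * (x \<bullet> P x)
   - lam * (exp (z x) * (norm x * norm (G x)) powr (1 - tau))) / (norm x)^2" if x: "x \<in> ?A" for x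
  proof -
   have x0: "x ~= 0" using x by (simp add: annulus_iff)
   have "norm x powr (th + 2) = exp (- (q - 1) * gm * ln (norm x))" using x0 by (simp add: theta powr_def)
   then have "mu * norm x powr (th + 2) * exp ((q - 1) * z x) = mu * exp ((q - 1) * (z x - gm * ln (norm x)))"
    by (simp add: exp_add[symmetric] algebra_simps)
   then show ?thesis using exp_rhs_eq[OF x0, of mu "z x" "G x"] x0
    unfolding g_def P_def by (simp add: field_simps)
  qed
  have mP: "abs ((real DIM(real^'n) - 2 + 2 * rho) * (x \<bullet> P x) / (norm x)^2) <= K2 * norm (P x)"
   and r3: "exp 3 * (norm x)^2 >= exp 1" if x: "x \<in> ?A" for x
  proof -
   have "exp (- 1) <= norm x" using x by (auto simp: annulus_def)
   note r = inverse_le_exp[OF this]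
   have "exp 1 * 1 <= exp 1 * (exp 2 * (norm x)^2)" using r(1,3) by (intro mult_left_mono) (simp_all add: field_simps)
   then show "exp 3 * (norm x)^2 >= exp 1" by (simp add: mult.assoc[symmetric] exp_add[symmetric])
   have "abs ((real DIM(real^'n) - 2 + 2 * rho) * (x \<bullet> P x) / (norm x)^2) <= m * (norm x * norm (P x)) / (norm x)^2"
    unfolding abs_divide abs_mult m_def by (simp add: divide_right_mono mult_left_mono Cauchy_Schwarz_ineq2)
   also have "... = m * norm (P x) * (1 / norm x)" using r by (simp add: power2_eq_square)
   also have "... <= m * norm (P x) * exp 1"
    using r(2) by (intro mult_left_mono) (auto simp: m_def)
   also have "... = (m * exp 1) * norm (P x)" by simp
   also have "... <= K2 * norm (P x)" using K2 by (intro mult_right_mono) auto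
   finally show "abs ((real DIM(real^'n) - 2 + 2 * rho) * (x \<bullet> P x) / (norm x)^2) <= K2 * norm (P x)" .
  qed
  have lo0: "lo z 0 <= - L + ep" using D[of 0] h0 by (auto simp: abs_le_iff)
  then have elo: "exp (lo z 0) <= exp (- L / 2)" using eps(2) by simp
  show False
  proof (cases "lam <= 0")
   case True
   \<comment> \<open>For \<open>lam <= 0\<close> the gradient power has the favourable sign for
     \<open>exp c - exp z\<close>. This function is large at the minimum point but smaller than
     \<open>e0\<close> at the maximum point.\<close>
   have wl': "weak_lap ?A (%x. exp c - exp (z x)) (%x. - P x) (%x. - g x)"
    using weak_lap_diff[OF weak_lap_const[OF open_annulus] wl, of "exp c"] by simp
   have "e0 <= exp c - exp (z xM)"
   proof (rule e0(2)[OF wl' _ xm(1) xM(1)])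
    show "l <= exp c - exp (z xm)" using elo xm c(1) unfolding l_def by (smt (verit) one_le_exp_iff)
    fix x assume x: "x \<in> ?A"
    have "0 <= exp (z x) * (mu * exp ((q - 1) * (z x - gm * ln (norm x)))) / (norm x)^2" using mu by simp
    moreover have "0 <= - lam * (exp (z x) * (norm x * norm (G x)) powr (1 - tau)) / (norm x)^2"
     using True by (intro divide_nonneg_nonneg mult_nonneg_nonneg) auto
    ultimately have "- g x <= K2 * norm (P x)"
     using mP[OF x] unfolding split[OF x] abs_le_iff by (simp add: add_divide_distrib diff_divide_distrib)
    moreover have w: "0 <= exp c - exp (z x)" using zr(1)[OF x] by simp
    moreover have "0 <= K2 * (exp c - exp (z x) + e0)" using w K2 e0(1) by (intro mult_nonneg_nonneg) auto
    moreover have "exp c <= exp 1" using c(3) by simp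
    then have "exp c - exp (z x) <= exp 1" using exp_gt_zero[of "z x"] by linarith
    ultimately show "0 <= exp c - exp (z x) & exp c - exp (z x) <= exp 1
     & - g x <= K2 * norm (- P x) + K2 * (exp c - exp (z x) + e0) & - (K2 * (1 + norm (- P x))) <= - g x"
     using lower[OF x] unfolding norm_minus_cancel by (intro conjI; linarith)
   qed
   moreover have "exp c < exp (ln (1 + e0))" using c(2) by simp
   ultimately show False using xM e0(1) by simp
  next
   case False
   \<comment> \<open>\<open>A\<close> bounds \<open>exp z\<close> from below on the annulus. For
     \<open>lam > 0\<close> the gradient power is favourable for \<open>exp z - A\<close>, and the
     nonlinearity costs at most \<open>e0\<close>; here the roles of the maximum and minimum points
     are exchanged.\<close>
   define A where "A = exp (- c - L - ep)"
   have A: "0 < A" "A <= exp (- L)" using c(1) eps(1) by (auto simp: A_def)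
   have wl': "weak_lap ?A (%x. exp (z x) - A) P g"
    using weak_lap_add_const[OF wl, of "- A"] by simp
   have "e0 <= exp (z xm) - A"
   proof (rule e0(2)[OF wl' _ xM(1) xm(1)])
    have "exp (- L) <= exp (- L / 2)" using L by simp
    then show "l <= exp (z xM) - A" using A(2) unfolding l_def xM(2) exp_zero by linarith
    fix x assume x: "x \<in> ?A"
    have x0: "norm x > 0" using x by (simp add: annulus_iff)
    have W0: "exp (z x) * (mu * exp ((q - 1) * (z x - gm * ln (norm x)))) / (norm x)^2 <= e0"
    proof -
     have "exp (z x) * (mu * exp ((q - 1) * (z x - gm * ln (norm x)))) <= exp 1 * eta"
      using zr(3)[OF x] W[OF x] mu by (intro mult_mono) auto
     also have "... <= (exp 3 * (norm x)^2) * eta" using r3[OF x] eta by (intro mult_right_mono) auto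
     also have "... = e0 * (norm x)^2" by (simp add: eta_def exp_minus)
     finally show ?thesis using x0 by (simp add: field_simps)
    qed
    moreover have "0 <= lam * (exp (z x) * (norm x * norm (G x)) powr (1 - tau)) / (norm x)^2"
     using False by (intro divide_nonneg_nonneg mult_nonneg_nonneg) auto
    ultimately have "g x <= K2 * norm (P x) + e0"
     using mP[OF x] unfolding split[OF x] abs_le_iff by (simp add: add_divide_distrib diff_divide_distrib)
    moreover have w: "0 <= exp (z x) - A" using zr(2)[OF x] by (simp add: A_def)
    moreover have "1 * e0 <= K2 * (exp (z x) - A + e0)" using w K2 e0(1) by (intro mult_mono) auto
    moreover have "exp (z x) - A <= exp 1" using A zr(3)[OF x] by linarith
    ultimately show "0 <= exp (z x) - A & exp (z x) - A <= exp 1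
     & g x <= K2 * norm (P x) + K2 * (exp (z x) - A + e0) & - (K2 * (1 + norm (P x))) <= g x"
     using lower[OF x] by (intro conjI; linarith)
   qed
   moreover have "exp (z xm) - A < e0"
   proof -
    have z1: "exp (z xm) <= exp (- L + ep)" using lo0 xm by simp
    have "exp (z xm) - A <= exp (- L + ep) - A" using z1 by (rule diff_right_mono)
    also have "exp (- L + ep) - A = exp (- L + ep) * (1 - exp (- c - 2 * ep))"
     by (simp add: A_def right_diff_distrib exp_add[symmetric])
    also have "... <= 1 * (c + 2 * ep)"
    proof (rule mult_mono)
     show "exp (- L + ep) <= 1" using eps L by simp
     show "1 - exp (- c - 2 * ep) <= c + 2 * ep" using exp_ge_add_one_self[of "- c - 2 * ep"] by linarith
     show "0 <= 1 - exp (- c - 2 * ep)" using c(1) eps(1) by simp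
    qed simp
    also have "1 * (c + 2 * ep) = c + 2 * ep" by simp
    also have "... < e0" using c(6) eps(3) by simp
    finally show ?thesis .
   qed
   ultimately show False by simp
  qed
 qed
qed

end

section \<open>Symmetry, and reduction to an ordinary differential equation\<close>

text \<open>From \<open>t0\<close> a quasiconvex function is nondecreasing in at least one
  direction: if it falls below \<open>D t0\<close> somewhere on the right, it is nondecreasing to
  the left. Being bounded, it converges in that direction to a limit
  \<open>L >= D t0 > 0\<close>.\<close>

lemma quasiconvex_window:
 fixes D :: "real => real"
 assumes qc: "!!a t b. a <= t ==> t <= b ==> D t <= max (D a) (D b)"
  and bd: "!!t. D t <= C" and pos: "D t0 > 0"
 obtains L where "L > 0" "!!ep. ep > 0 ==> \<exists>s. \<forall>t. abs (t - s) <= 2 --> abs (D t - L) <= ep"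
proof -
 have "\<exists>sig. (sig = 1 \<or> sig = -1) & (\<forall>r r'. 0 <= r --> r <= r' --> D (t0 + sig * r) <= D (t0 + sig * r'))"
 proof (cases "\<exists>b>t0. D b < D t0")
  case True
  then obtain b where b: "b > t0" "D b < D t0" by blast
  have "D (t0 - r) <= D (t0 - r')" if "0 <= r" "r <= r'" for r r'
  proof -
   have "D t0 <= max (D (t0 - r)) (D b)" using b that by (intro qc) auto
   then have "D b < D (t0 - r)" using b by linarith
   moreover have "D (t0 - r) <= max (D (t0 - r')) (D b)" using b that by (intro qc) auto
   ultimately show ?thesis by linarith
  qed
  then show ?thesis by (intro exI[of _ "-1"]) auto
 next
  case False
  have "D (t0 + r) <= D (t0 + r')" if "0 <= r" "r <= r'" for r r'
  proof (cases "r' = 0")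
   case True
   then show ?thesis using that by simp
  next
   case f: False
   have "D (t0 + r) <= max (D t0) (D (t0 + r'))" using that by (intro qc) auto
   moreover have "D t0 <= D (t0 + r')" using False f that by (meson less_add_same_cancel1 less_eq_real_def not_less order.trans)
   ultimately show ?thesis by linarith
  qed
  then show ?thesis by (intro exI[of _ 1]) auto
 qed
 then obtain sig where sg: "sig = 1 \<or> sig = (-1::real)"
  and mono: "!!r r'. 0 <= r ==> r <= r' ==> D (t0 + sig * r) <= D (t0 + sig * r')" by blast
 define L where "L = (SUP r\<in>{0..}. D (t0 + sig * r))"
 have ba: "bdd_above ((%r. D (t0 + sig * r)) ` {0..})" using bd by (auto intro!: bdd_aboveI2[of _ _ C])
 have up: "D (t0 + sig * r) <= L" if "r >= 0" for r unfolding L_def by (rule cSUP_upper[OF _ ba]) (use that in auto)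
 show ?thesis
 proof (rule that[of L])
  show "L > 0" using up[of 0] pos by simp
  fix ep :: real assume "ep > 0"
  then have "L - ep < L" by simp
  then obtain r0 where r0: "r0 >= 0" "L - ep < D (t0 + sig * r0)"
   unfolding L_def less_cSUP_iff[OF _ ba, simplified] by auto
  show "\<exists>s. \<forall>t. abs (t - s) <= 2 --> abs (D t - L) <= ep"
  \<comment> \<open>The centre lies 2 beyond \<open>r0\<close>, so that the whole window of radius 2
    is in the range where \<open>D\<close> is close to \<open>L\<close>.\<close>
  proof (intro exI[of _ "t0 + sig * (r0 + 2)"] allI impI)
   fix t assume t: "abs (t - (t0 + sig * (r0 + 2))) <= 2"
   define r where "r = sig * (t - t0)"
   have r: "t = t0 + sig * r" "r0 <= r" using sg t by (auto simp: r_def abs_le_iff)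
   then show "abs (D t - L) <= ep" using mono[OF r0(1) r(2)] r0 up[of r] by auto
  qed
 qed
qed

context params
begin

text \<open>A positive oscillation has a window of radius 2 on which it is nearly constant. There
  \<open>slope_bound\<close> applies around every point at distance at most 1 from the centre, and
  adding up steps of length \<open>2 * dl\<close> shows that \<open>hi z\<close> varies by at most
  \<open>c\<close>. This is the situation excluded by \<open>almost_constant\<close>.\<close>

theorem log_sol_radial:
 fixes z :: "real^'n => real"
 assumes d: "CARD('n) >= 2" and z: "log_sol mu (- {0}) z G" and mu: "mu > 0"
 shows "hi z t = lo z t"
proof (rule ccontr)
 assume ne: "hi z t ~= lo z t"
 have d2: "DIM(real^'n) >= 2" using d by simp
 have cz: "continuous_on (- {0}) z" by (rule log_solD(5)[OF z])
 define D where "D s = hi z s - lo z s" for s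
 obtain C h where C: "h > 0" "!!mu (z::real^'n => real) G s t x y. log_sol mu (- {0}) z G ==> mu > 0 ==>
  abs (s - t) <= h ==> norm x = exp t ==> norm y = exp s ==> z x <= z y + C"
 proof (rule harnack_log_sol[OF d2], goal_cases)
  case (1 C h) from 1(3,4) show ?case by (rule that)
 qed
 have bd: "D s <= C" for s
 proof -
  obtain x y where x: "norm x = exp s" "z x = hi z s" and y: "norm y = exp s" "z y = lo z s"
   using hi_attained[OF cz] lo_attained[OF cz] by blast
  show ?thesis using C(2)[OF z mu _ x(1) y(1)] C(1) x(2) y(2) by (simp add: D_def)
 qed
 have "lo z t <= hi z t" using hi_attained[OF cz, of t] lo_lower[OF cz, of _ t] by metis
 then have pos: "D t > 0" using ne by (simp add: D_def)
 obtain L where L: "L > 0" "!!ep. ep > 0 ==> \<exists>s. \<forall>t. abs (t - s) <= 2 --> abs (D t - L) <= ep"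
  using quasiconvex_window[of D C t, OF _ bd pos] osc_quasiconvex[OF z mu] unfolding D_def by blast
 obtain c e1 where c: "c > 0" "e1 > 0" "!!mu (z::real^'n => real) G. log_sol mu (- {0}) z G ==> mu > 0 ==>
  hi z 0 = 0 ==> (!!t. abs t <= 1 ==> abs (hi z t - lo z t - L) <= e1) ==> (!!t. abs t <= 1 ==> abs (hi z t) <= c) ==> False"
 proof (rule almost_constant[OF d L(1)], goal_cases)
  case (1 c e) from 1(2,3,4) show ?case by (rule that)
 qed
 obtain B h' where B: "B > 0" "h' > 0" "!!mu (z::real^'n => real) G s t. log_sol mu (- {0}) z G ==> mu > 0 ==>
  abs (s - t) <= h' ==> abs (hi z s - hi z t) <= B * abs (s - t)"
 proof (rule hi_lipschitz[OF d2], goal_cases)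
  case (1 B h) from 1(2,3,4) show ?case by (rule that)
 qed
 \<comment> \<open>A rest shorter than \<open>2 * dl\<close> remains after the full steps;
   \<open>dl <= c / (4 * B)\<close> makes its contribution at most \<open>c / 2\<close> by the
   Lipschitz bound. The full steps contribute the other \<open>c / 2\<close>.\<close>
 define dl1 where "dl1 = min (min (h' / 2) (c / (4 * B))) (1/4)"
 have dl1: "dl1 > 0" using B c by (simp add: dl1_def)
 have c2: "c / 2 > 0" using c by simp
 obtain dl e2 where e2: "dl > 0" "dl <= dl1" "e2 > 0" "!!mu (z::real^'n => real) G. log_sol mu (- {0}) z G ==> mu > 0 ==>
  hi z 0 = 0 ==> (!!t. abs t <= 1 ==> abs (hi z t - lo z t - L) <= e2) ==> abs (hi z dl - hi z (- dl)) < 2 * dl * (c / 2)"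
 proof (rule slope_bound[OF d L(1) c2 dl1], goal_cases)
  case (1 dl e) from 1(2,3,4,5) show ?case by (rule that)
 qed
 have del: "2 * dl <= h'" "2 * dl * B <= c / 2" "dl <= 1/4"
  using e2(1,2) B c by (auto simp: dl1_def field_simps)
 obtain s where s: "!!t. abs (t - s) <= 2 ==> abs (D t - L) <= min e1 e2" using L(2)[of "min e1 e2"] c(2) e2(3) by auto
 have scaled: "\<exists>mu' G'. mu' > 0 & log_sol mu' (- {0}) (%x. z (exp r *\<^sub>R x) - hi z r) G' &
   hi (%x. z (exp r *\<^sub>R x) - hi z r) 0 = 0 &
   (\<forall>t. abs t <= 1 --> abs (hi (%x. z (exp r *\<^sub>R x) - hi z r) t - lo (%x. z (exp r *\<^sub>R x) - hi z r) t - L) <= min e1 e2)"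
  if "abs (r - s) <= 1" for r
 proof -
  obtain mu' G' where "mu' > 0" "log_sol mu' (- {0}) (%x. z (exp r *\<^sub>R x) - hi z r) G'"
   using log_sol_scale[OF z mu] by blast
  moreover have "abs (hi z (t + r) - lo z (t + r) - L) <= min e1 e2" if "abs t <= 1" for t
   using s[of "t + r"] that \<open>\<bar>r - s\<bar> <= 1\<close> unfolding D_def by (simp add: abs_le_iff)
  ultimately show ?thesis by (intro exI[of _ mu'] exI[of _ G']) (auto simp: hi_scale[OF cz] lo_scale[OF cz])
 qed
 have slope: "abs (hi z (r + dl) - hi z (r - dl)) <= dl * c" if r: "abs (r - s) <= 1" for r
 proof -
  obtain mu' G' where z': "mu' > 0" "log_sol mu' (- {0}) (%x. z (exp r *\<^sub>R x) - hi z r) G'"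
   "hi (%x. z (exp r *\<^sub>R x) - hi z r) 0 = 0"
   "!!t. abs t <= 1 ==> abs (hi (%x. z (exp r *\<^sub>R x) - hi z r) t - lo (%x. z (exp r *\<^sub>R x) - hi z r) t - L) <= min e1 e2"
   using scaled[OF r] by blast
  have "abs (hi (%x. z (exp r *\<^sub>R x) - hi z r) dl - hi (%x. z (exp r *\<^sub>R x) - hi z r) (- dl)) < 2 * dl * (c / 2)"
   by (rule e2(4)[OF z'(2,1,3)]) (use z'(4) in fastforce)
  then show ?thesis by (simp add: hi_scale[OF cz] add.commute)
 qed
 have lip: "abs (hi z a - hi z b) <= c / 2" if "abs (a - b) <= 2 * dl" for a b
 proof -
  have "abs (hi z a - hi z b) <= B * abs (a - b)" using B(3)[OF z mu, of a b] that del by linarith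
  also have "... <= B * (2 * dl)" using that B by (intro mult_left_mono) auto
  finally show ?thesis using del(2) by (simp add: mult.commute)
 qed
 have osc: "abs (hi z (s + t) - hi z s) <= c" if t: "abs t <= 1" for t
 proof -
  define sig where "sig = (if t >= 0 then 1 else - 1 :: real)"
  have sg: "sig = 1 \<or> sig = -1" "t = sig * abs t" by (auto simp: sig_def)
  have step: "abs (hi z (s + sig * (2 * dl * real i)) - hi z s) <= dl * c * real i" if "2 * dl * real i <= 1" for i
   using that
  proof (induction i)
   case (Suc i)
   have e: "2 * dl * real (Suc i) = 2 * dl * real i + 2 * dl" by (simp add: algebra_simps)
   then have i: "2 * dl * real i + dl <= 1" "2 * dl * real i <= 1" using Suc.prems e2(1) by auto
   have "0 <= 2 * dl * real i" using e2(1) by simp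
   then have "abs ((s + sig * (2 * dl * real i + dl)) - s) <= 1"
   proof -
    have "abs (sig * x) <= 1" if "0 <= x" "x <= 1" for x using sg(1) that by auto
    from this[of "2 * dl * real i + dl"] show ?thesis using i(1) e2(1) \<open>0 <= 2 * dl * real i\<close> by simp
   qed
   from slope[OF this] have "abs (hi z (s + sig * (2 * dl * real (Suc i))) - hi z (s + sig * (2 * dl * real i))) <= dl * c"
    using sg(1) unfolding e by (auto simp: algebra_simps abs_minus_commute)
   then show ?case using Suc.IH[OF i(2)] unfolding of_nat_Suc distrib_left mult_1_right by linarith
  qed simp
  define i where "i = nat \<lfloor>\<bar>t\<bar> / (2 * dl)\<rfloor>"
  have i: "real i <= abs t / (2 * dl)" "abs t / (2 * dl) < real i + 1"
   unfolding i_def using e2(1) by (simp_all add: floor_le_iff)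
  then have i': "2 * dl * real i <= abs t" "abs t < 2 * dl * real i + 2 * dl" using e2(1) by (simp_all add: field_simps)
  have "abs ((s + t) - (s + sig * (2 * dl * real i))) <= 2 * dl" using i' sg by (auto simp: abs_le_iff)
  then have "abs (hi z (s + t) - hi z (s + sig * (2 * dl * real i))) <= c / 2" by (rule lip)
  moreover have "abs (hi z (s + sig * (2 * dl * real i)) - hi z s) <= dl * c * real i" using i'(1) t by (intro step) simp
  moreover have "dl * c * real i <= c / 2"
   using mult_left_mono[of "2 * dl * real i" 1 "c / 2"] i'(1) t c(1) by (simp add: mult_ac)
  ultimately show ?thesis by linarith
 qed
 obtain mu' G' where z': "mu' > 0" "log_sol mu' (- {0}) (%x. z (exp s *\<^sub>R x) - hi z s) G'"
  "hi (%x. z (exp s *\<^sub>R x) - hi z s) 0 = 0"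
  "!!t. abs t <= 1 ==> abs (hi (%x. z (exp s *\<^sub>R x) - hi z s) t - lo (%x. z (exp s *\<^sub>R x) - hi z s) t - L) <= min e1 e2"
  using scaled[of s] by auto
 show False
 proof (rule c(3)[OF z'(2,1,3)])
  show "abs (hi (%x. z (exp s *\<^sub>R x) - hi z s) t) <= c" if "abs t <= 1" for t
   using osc[OF that] by (simp add: hi_scale[OF cz] add.commute)
 qed (use z'(4) in fastforce)
qed

text \<open>A radial weak solution coincides on each annulus with the classical solution of the linear
 equation with the same right-hand side and the same boundary values.\<close>

theorem log_sol_ode:
 fixes z :: "real^'n => real"
 assumes d: "CARD('n) >= 2" and z: "log_sol mu (- {0}) z G" and mu: "mu > 0"
 obtains xi xi1 where "!!x. x ~= 0 ==> z x = xi (ln (norm x))"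
  "!!t. DERIV xi t :> xi1 t"
  "!!t. DERIV xi1 t :> mu * exp ((q - 1) * (xi t - gm * t)) - F (xi1 t)"
proof -
 have cz: "continuous_on (- {0}) z" by (rule log_solD(5)[OF z])
 define xi where "xi = hi z"
 have zxi: "z x = xi (ln (norm x))" if "x ~= 0" for x
 proof -
  have n: "norm x = exp (ln (norm x))" using that by simp
  show ?thesis using hi_upper[OF cz n] lo_lower[OF cz n] log_sol_radial[OF d z mu] unfolding xi_def by (metis order.antisym)
 qed
 obtain e :: "real^'n" where e: "norm e = 1" using vector_choose_size[of 1] by auto
 define xi1 where "xi1 t = exp t * (G (exp t *\<^sub>R e) \<bullet> e)" for t
 have ne: "exp t *\<^sub>R e ~= 0" for t using e by auto
 have xi1: "DERIV xi t :> xi1 t" for t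
 proof -
  have "((%t. exp t *\<^sub>R e) has_derivative (%h. (exp t * h) *\<^sub>R e)) (at t)"
   by (auto intro!: derivative_eq_intros)
  from diff_chain_at[OF this, of z "%h. h \<bullet> G (exp t *\<^sub>R e)"] log_solD(3)[OF z, of "exp t *\<^sub>R e"] ne
  have "((%t. z (exp t *\<^sub>R e)) has_derivative (%h. (exp t * h) *\<^sub>R e \<bullet> G (exp t *\<^sub>R e))) (at t)"
   by (simp add: o_def gderiv_def)
  then have "((%t. z (exp t *\<^sub>R e)) has_derivative (*) (xi1 t)) (at t)"
   by (rule has_derivative_eq_rhs) (simp add: xi1_def fun_eq_iff inner_commute)
  moreover have "(%t. z (exp t *\<^sub>R e)) = xi" using zxi[OF ne] e by (simp add: fun_eq_iff)
  ultimately show ?thesis by (simp add: has_field_derivative_def)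
 qed
 have Gx: "G x = (xi1 (ln (norm x)) / (norm x)^2) *\<^sub>R x" if "x ~= 0" for x
 proof (rule gderiv_unique[OF log_solD(3)[OF z]])
  show "GDERIV z x :> (xi1 (ln (norm x)) / (norm x)^2) *\<^sub>R x"
   by (rule gderiv_transform[of "%x. xi (ln (norm x))" _ _ "- {0}"])
    (use gderiv_chain[OF gderiv_ln_norm[OF that] xi1] zxi that in auto)
 qed (use that in auto)
 have cxi: "continuous_on S xi" for S by (rule DERIV_continuous_on[OF has_field_derivative_at_within[OF xi1]])
 have cxi1: "continuous_on S xi1" for S unfolding xi1_def
  by (intro continuous_intros continuous_on_compose2[OF log_solD(4)[OF z]]) (use ne in auto)
 define k where "k t = mu * exp ((q - 1) * (xi t - gm * t)) - F (xi1 t)" for t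
 have ck: "continuous_on S k" for S unfolding k_def by (intro continuous_intros cxi cxi1)
 define n2 where "n2 = real DIM(real^'n) - 2"
 have main: "DERIV xi1 t :> k t" for t
 proof -
  define a b where "a = t - 1" and "b = t + 1"
  define k2 where "k2 s = k s + n2 * xi1 s" for s
  have ck2: "continuous_on S k2" for S unfolding k2_def by (intro continuous_intros ck cxi1)
  text \<open>\<open>\<zeta>'' + n2 \<zeta>' = k2\<close> by variation of constants, with \<open>\<zeta> = xi\<close> at \<open>a\<close> and \<open>b\<close>\<close>
  define I where "I s = integral {a - 1..s} (%r. exp (n2 * r) * k2 r)" for s
  have dI: "DERIV I s :> exp (n2 * s) * k2 s" if "a - 1 < s" "s < b + 1" for s
  proof -
   have "(I has_vector_derivative exp (n2 * s) * k2 s) (at s within {a - 1..b + 1})" unfolding I_def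
    by (rule integral_has_vector_derivative) (use that ck2 in \<open>auto intro!: continuous_intros\<close>)
   then show ?thesis using that at_within_interior[of s "{a - 1..b + 1}"]
    by (simp add: has_real_derivative_iff_has_vector_derivative)
  qed
  have cI: "continuous_on {a - 1..b + 1} I" unfolding I_def
   by (intro indefinite_integral_continuous_1 integrable_continuous_interval continuous_intros ck2)
  define H0 where "H0 s = integral {a - 1..s} (%r. exp (- n2 * r) * I r)" for s
  define H1 where "H1 s = integral {a - 1..s} (%r. exp (- n2 * r))" for s
  have dH: "DERIV H0 s :> exp (- n2 * s) * I s" "DERIV H1 s :> exp (- n2 * s)"
   if "a - 1 < s" "s < b + 1" for s
  proof -
   have "(H0 has_vector_derivative exp (- n2 * s) * I s) (at s within {a - 1..b + 1})" unfolding H0_def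
    by (rule integral_has_vector_derivative) (use that cI in \<open>auto intro!: continuous_intros\<close>)
   moreover have "(H1 has_vector_derivative exp (- n2 * s)) (at s within {a - 1..b + 1})" unfolding H1_def
    by (rule integral_has_vector_derivative) (use that in \<open>auto intro!: continuous_intros\<close>)
   ultimately show "DERIV H0 s :> exp (- n2 * s) * I s" "DERIV H1 s :> exp (- n2 * s)"
    using that at_within_interior[of s "{a - 1..b + 1}"]
    by (simp_all add: has_real_derivative_iff_has_vector_derivative)
  qed
  have "H1 a < H1 b"
   by (rule DERIV_pos_imp_increasing_open[of a b]) (auto simp: a_def b_def intro!: exI[of _ "exp (- n2 * _)"] dH(2)[unfolded a_def b_def]
    DERIV_continuous_on[OF has_field_derivative_at_within[OF dH(2)[unfolded a_def b_def]]])
  define A where "A = ((xi b - xi a) - (H0 b - H0 a)) / (H1 b - H1 a)"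
  define \<zeta> where "\<zeta> s = xi a + (H0 s - H0 a) + A * (H1 s - H1 a)" for s
  define \<zeta>1 where "\<zeta>1 s = exp (- n2 * s) * (I s + A)" for s
  define \<zeta>2 where "\<zeta>2 s = k2 s - n2 * \<zeta>1 s" for s
  have za: "\<zeta> a = xi a" by (simp add: \<zeta>_def)
  have zb: "\<zeta> b = xi b" using \<open>H1 a < H1 b\<close> by (simp add: \<zeta>_def A_def)
  have d1: "DERIV \<zeta> s :> \<zeta>1 s" if "a - 1 < s" "s < b + 1" for s
   unfolding \<zeta>_def \<zeta>1_def by (rule derivative_eq_intros dH that refl | simp add: algebra_simps)+
  have d2: "DERIV \<zeta>1 s :> \<zeta>2 s" if "a - 1 < s" "s < b + 1" for s
  proof -
   have "DERIV \<zeta>1 s :> exp (- n2 * s) * (- n2) * (I s + A) + exp (- n2 * s) * (exp (n2 * s) * k2 s)"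
    unfolding \<zeta>1_def using dI[OF that] by (auto intro!: derivative_eq_intros simp: algebra_simps)
   moreover have e: "exp (- n2 * s) * (exp (n2 * s) * k2 s) = k2 s"
    by (simp add: mult.assoc[symmetric] exp_add[symmetric])
   have "exp (- n2 * s) * (- n2) * (I s + A) + exp (- n2 * s) * (exp (n2 * s) * k2 s) = \<zeta>2 s"
    unfolding e \<zeta>2_def \<zeta>1_def by (simp add: algebra_simps)
   ultimately show ?thesis by simp
  qed
  have c2: "continuous_on {a - 1<..<b + 1} \<zeta>2" unfolding \<zeta>2_def
   by (intro continuous_intros ck2 DERIV_continuous_on[OF has_field_derivative_at_within[OF d2]]) auto
  let ?A = "annulus (a - 1) (b + 1) :: (real^'n) set"
  have wz: "weak_lap ?A z G (%x. k2 (ln (norm x)) / (norm x)^2)"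
   using weak_lap_subset[OF log_solD(6)[OF z] open_annulus annulus_nonzero]
   by (rule weak_lap_cong) (auto simp: annulus_iff Gx log_rhs_radial zxi k2_def k_def n2_def)
  have "weak_lap ?A (%x. \<zeta> (ln (norm x))) (%x. (\<zeta>1 (ln (norm x)) / (norm x)^2) *\<^sub>R x)
   (%x. (\<zeta>2 (ln (norm x)) + (real DIM(real^'n) - 2) * \<zeta>1 (ln (norm x))) / (norm x)^2)"
   by (rule weak_lap_radial[OF d1 d2 c2])
  then have w\<zeta>: "weak_lap ?A (%x. \<zeta> (ln (norm x))) (%x. (\<zeta>1 (ln (norm x)) / (norm x)^2) *\<^sub>R x)
   (%x. k2 (ln (norm x)) / (norm x)^2)"
   by (rule weak_lap_cong) (auto simp: \<zeta>2_def n2_def)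
  text \<open>The difference has vanishing Laplacian; adding a small strictly subharmonic function makes the
   maximum principle applicable.\<close>
  define psi where "psi s = exp ((abs n2 + 1) * s)" for s
  have dpsi: "DERIV psi s :> (abs n2 + 1) * psi s" for s
   unfolding psi_def by (auto intro!: derivative_eq_intros)
  have cpsi: "continuous_on S psi" for S unfolding psi_def by (intro continuous_intros)
  have wpsi: "weak_lap ?A (%x. psi (ln (norm x))) (%x. ((abs n2 + 1) * psi (ln (norm x)) / (norm x)^2) *\<^sub>R x)
   (%x. ((abs n2 + 1)^2 * psi (ln (norm x)) + (real DIM(real^'n) - 2) * ((abs n2 + 1) * psi (ln (norm x)))) / (norm x)^2)"
   by (rule weak_lap_radial[where xi = psi])
    (auto intro!: derivative_eq_intros continuous_intros dpsi cpsi simp: power2_eq_square)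
  \<comment> \<open>The rate \<open>abs n2 + 1\<close> makes \<open>psi'' + n2 * psi'\<close> a
    positive multiple of \<open>psi\<close> whatever the sign of \<open>n2\<close>.\<close>
  have psipos: "((abs n2 + 1)^2 * psi s + (real DIM(real^'n) - 2) * ((abs n2 + 1) * psi s)) > 0" for s
  proof -
   have "(abs n2 + 1) * (abs n2 + 1 + n2) * psi s > 0" by (intro mult_pos_pos) (auto simp: psi_def)
   then show ?thesis by (simp add: n2_def power2_eq_square algebra_simps)
  qed
  have cmp: "sig * (z x - \<zeta> (ln (norm x))) <= 0" if x: "exp a <= norm x" "norm x <= exp b" and sg: "sig = 1 \<or> sig = (-1::real)" for x sig
  proof (rule field_le_epsilon)
   fix ep :: real assume "ep > 0"
   define kp where "kp = ep / psi b"
   have kp: "kp > 0" "kp * psi b = ep" using \<open>ep > 0\<close> by (auto simp: kp_def psi_def)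
   have psib: "0 < psi s" "s <= b ==> psi s <= psi b" for s by (auto simp: psi_def mult_left_mono)
   have "1 * (sig * z x + (- sig) * \<zeta> (ln (norm x))) + kp * psi (ln (norm x)) <= ep"
   proof (rule annulus_max_principle[OF weak_lap_lincomb[OF weak_lap_lincomb[OF wz w\<zeta>, of sig "- sig"] wpsi, of 1 kp] _ _ _ x])
    show "y \<in> ?A" if "exp a <= norm y" "norm y <= exp b" for y :: "real^'n"
    proof -
     have "exp (a - 1) < exp a" "exp b < exp (b + 1)" by simp_all
     then show ?thesis using that unfolding annulus_def by (auto simp del: exp_less_cancel_iff)
    qed
    show "1 * (sig * z y + (- sig) * \<zeta> (ln (norm y))) + kp * psi (ln (norm y)) <= ep" if "norm y = exp a \<or> norm y = exp b" for y
    proof -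
     have "norm y > 0" using that exp_gt_zero by metis
     then have l: "ln (norm y) = a \<or> ln (norm y) = b" "y ~= 0" using that by auto
     then have "\<zeta> (ln (norm y)) = z y" "ln (norm y) <= b" using za zb zxi[OF l(2)] by (auto simp: a_def b_def)
     then show ?thesis using kp mult_left_mono[OF psib(2)[of "ln (norm y)"], of kp] by simp
    qed
    show "1 * (sig * (k2 (ln (norm y)) / (norm y)^2) + - sig * (k2 (ln (norm y)) / (norm y)^2)) +
     kp * (((abs n2 + 1)^2 * psi (ln (norm y)) + (real DIM(real^'n) - 2) * ((abs n2 + 1) * psi (ln (norm y)))) / (norm y)^2) > 0"
     if "y \<in> annulus a b" for y
     using psipos[of "ln (norm y)"] kp(1) that by (simp add: annulus_iff)
   qed
   then show "sig * (z x - \<zeta> (ln (norm x))) <= 0 + ep"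
    using mult_pos_pos[OF kp(1) psib(1)[of "ln (norm x)"]] by (simp add: algebra_simps)
  qed
  have eq: "xi s = \<zeta> s" if "a < s" "s < b" for s
  proof -
   have n: "exp a <= norm (exp s *\<^sub>R e)" "norm (exp s *\<^sub>R e) <= exp b" using that e by auto
   have "z (exp s *\<^sub>R e) = \<zeta> s" using cmp[OF n, of 1] cmp[OF n, of "-1"] e by simp
   then show ?thesis using zxi[OF ne, of s] e by simp
  qed
  have eq1: "xi1 s = \<zeta>1 s" if "a < s" "s < b" for s
  proof (rule DERIV_unique[OF xi1])
   show "DERIV xi s :> \<zeta>1 s"
    by (rule has_field_derivative_transform_within_open[OF d1, of _ "{a<..<b}"]) (use that eq in auto)
  qed
  have ab: "a < t" "t < b" by (auto simp: a_def b_def)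
  have "DERIV xi1 t :> \<zeta>2 t"
   by (rule has_field_derivative_transform_within_open[OF d2, of _ "{a<..<b}"]) (use ab eq1 in auto)
  moreover have "\<zeta>2 t = k t" using eq1[OF ab] by (simp add: \<zeta>2_def k2_def)
  ultimately show ?thesis by simp
 qed
 show ?thesis by (rule that[OF zxi xi1 main[unfolded k_def]])
qed

end

section \<open>Asymptotics of the radial equation\<close>

text \<open>While \<open>y\<close> is above \<open>b\<close> it decreases at speed at least
  \<open>c\<close>; as it is bounded below it reaches \<open>b\<close>, and it cannot
  return.\<close>

lemma trap:
 fixes y y' :: "real => real"
 assumes d: "!!t. t >= T ==> (y has_real_derivative y' t) (at t within {T..})" and lb: "!!t. t >= T ==> m <= y t"
  and c: "c > 0" and neg: "!!t. t >= T ==> b <= y t ==> y' t <= - c"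
 shows "\<exists>T1\<ge>T. \<forall>t\<ge>T1. y t <= b"
proof -
 have ds: "!!t. t \<in> {a..b} ==> (y has_real_derivative y' t) (at t within {a..b})" if "T <= a" for a b
  using that by (auto intro!: has_field_derivative_subset[OF d])
 have "\<exists>T1\<ge>T. y T1 <= b"
 proof (rule ccontr)
  assume n: "\<not> ?thesis"
  define t where "t = T + (abs (y T - m) + 1) / c"
  have tT: "t > T" unfolding t_def using c by (simp add: add_nonneg_pos)
  have "- (y t + c * t) >= - (y T + c * T)"
  proof (rule barrier[of T t "%t. - (y t + c * t)" "%t. - (y' t + c)"])
   show "((%t. - (y t + c * t)) has_real_derivative - (y' r + c)) (at r within {T..t})" if "r \<in> {T..t}" for r
    using that by (auto intro!: derivative_eq_intros ds)
   show "- (y' r + c) >= 0" if "r \<in> {T..t}" "- (y r + c * r) < - (y T + c * T)" for r using neg[of r] n that by (auto simp: not_le dest!: spec[of _ r])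
  qed (use tT in auto)
  moreover have "c * (t - T) = abs (y T - m) + 1" using c by (simp add: t_def)
  ultimately show False using lb[of t] tT by (simp add: algebra_simps)
 qed
 then obtain T1 where T1: "T1 >= T" "y T1 <= b" by blast
 have "- y t >= - b" if "t >= T1" for t
 proof (rule barrier[of T1 t "%t. - y t" "%t. - y' t"])
  show "- y' r >= 0" if "r \<in> {T1..t}" "- y r < - b" for r using neg[of r] that T1 c by simp
 qed (use that T1 ds in \<open>auto intro!: DERIV_minus\<close>)
 then show ?thesis using T1 by (intro exI[of _ T1]) auto
qed

lemma increasing_bounded_tendsto:
 fixes f :: "real => real"
 assumes inc: "!!r t. T <= r ==> r <= t ==> f r <= f t" and bd: "!!t. T <= t ==> f t <= B"
 obtains l where "(f \<longlongrightarrow> l) at_top" "!!t. T <= t ==> f t <= l"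
proof -
 define l where "l = (SUP t\<in>{T..}. f t)"
 have ba: "bdd_above (f ` {T..})" using bd by (auto intro!: bdd_aboveI2[of _ _ B])
 have up: "f t <= l" if "T <= t" for t unfolding l_def by (rule cSUP_upper[OF _ ba]) (use that in auto)
 have "(f \<longlongrightarrow> l) at_top"
 proof (rule order_tendstoI)
  fix a assume "a < l"
  then obtain r where "r >= T" "a < f r" unfolding l_def less_cSUP_iff[OF _ ba, simplified] by auto
  then show "\<forall>\<^sub>F t in at_top. a < f t" unfolding eventually_at_top_linorder using inc by (meson less_le_trans)
 next
  fix a assume "l < a"
  then show "\<forall>\<^sub>F t in at_top. f t < a" unfolding eventually_at_top_linorder using up by (meson le_less_trans)
 qed
 then show ?thesis using that up by blast
qed

lemma deriv_nonneg_mono: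
 fixes f :: "real => real"
 assumes d: "!!t. t >= T ==> (f has_real_derivative f' t) (at t within {T..})" and "!!t. t > T ==> f' t >= 0"
  and "T <= r" "r <= t"
 shows "f r <= f t"
proof (rule DERIV_nonneg_imp_increasing_open[OF assms(4)])
 show "continuous_on {r..t} f"
  by (rule continuous_on_subset[OF DERIV_continuous_on[of "{T..}" f f']]) (use d assms in auto)
 fix v assume v: "r < v" "v < t"
 then have "DERIV f v :> f' v" using d[of v] assms at_within_interior[of v "{T..}"] by simp
 then show "\<exists>z. DERIV f v :> z & z >= 0" using assms v by auto
qed

section \<open>Trajectories tending to a zero of the nonlinearity\<close>

text \<open>Here \<open>y\<close> is the slope, \<open>s\<close> the deviation of
  \<open>ln u\<close> from \<open>gm * t\<close>, and \<open>k\<close> stands for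
  \<open>q - 1\<close>. \<open>Ph\<close> is \<open>F\<close>, or its reflection at
  \<open>gm\<close> when time is reversed. Derivatives are taken within the half line so that
  trajectories given only from time \<open>T\<close> on are included.\<close>

locale tail =
 fixes k gm e1 T :: real and Ph s y :: "real => real"
 assumes k: "k > 0" and e1: "e1 < gm" and cPh: "continuous_on {e1..gm} Ph" and pPh: "!!v. e1 < v ==> v <= gm ==> Ph v > 0"
  and ds: "!!t. t >= T ==> (s has_real_derivative y t - gm) (at t within {T..})"
  and dy: "!!t. t >= T ==> (y has_real_derivative exp (k * s t) - Ph (y t)) (at t within {T..})"
  and y: "!!t. t >= T ==> e1 < y t & y t < gm"
begin

lemma later: "T <= T' ==> tail k gm e1 T' Ph s y"
 using k e1 cPh pPh y by unfold_locales (auto intro: has_field_derivative_subset[OF ds] has_field_derivative_subset[OF dy])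

lemma s_decreasing: "T <= r ==> r <= t ==> s t <= s r"
 using deriv_nonneg_mono[of T "%t. - s t" "%t. - (y t - gm)" r t, OF DERIV_minus[OF ds]] y by (simp add: less_imp_le)

text \<open>Since \<open>s\<close> decreases, the nonlinearity stays below the equilibrium value
  \<open>Ph gm\<close>, and \<open>y\<close> is pushed down from a neighbourhood of
  \<open>gm\<close>. Once \<open>y <= gm - d / 2\<close>, the function \<open>s\<close> decreases at
  least linearly.\<close>

lemma s_to_minus_infinity:
 assumes W: "exp (k * s T) < Ph gm"
 shows "((%t. exp (k * s t)) \<longlongrightarrow> 0) at_top"
proof -
 define c where "c = (Ph gm - exp (k * s T)) / 2"
 have c: "c > 0" using W by (simp add: c_def)
 obtain d where d: "d > 0" "!!v. v \<in> {e1..gm} ==> abs (v - gm) < d ==> abs (Ph v - Ph gm) < c"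
  using cPh e1 c unfolding continuous_on_iff dist_real_def by (metis atLeastAtMost_iff less_eq_real_def)
 have "\<exists>T1\<ge>T. \<forall>t\<ge>T1. y t <= gm - d / 2"
 proof (rule trap[OF dy _ c])
  show "e1 <= y t" if "t >= T" for t using y[OF that] by simp
  fix t assume t: "t >= T" "gm - d / 2 <= y t"
  have 1: "exp (k * s t) <= exp (k * s T)" using s_decreasing[of T t] t k by simp
  have 2: "abs (Ph (y t) - Ph gm) < c" using t y[OF t(1)] d(1) by (intro d(2)) auto
  have "2 * c = Ph gm - exp (k * s T)" by (simp add: c_def)
  with 1 2 show "exp (k * s t) - Ph (y t) <= - c" by linarith
 qed
 then obtain T1 where T1: "T1 >= T" "!!t. t >= T1 ==> y t <= gm - d / 2" by blast
 interpret L: tail k gm e1 T1 Ph s y by (rule later[OF T1(1)])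
 have "s t <= s T1 - d / 2 * (t - T1)" if "t >= T1" for t
 proof -
  have "- s T1 - d / 2 * T1 <= - s t - d / 2 * t"
  proof (rule deriv_nonneg_mono[of T1 "%t. - s t - d / 2 * t" "%t. - (y t - gm) - d / 2"])
   show "((%t. - s t - d / 2 * t) has_real_derivative - (y t - gm) - d / 2) (at t within {T1..})" if "t >= T1" for t
    by (auto intro!: derivative_eq_intros L.ds that)
   show "0 <= - (y t - gm) - d / 2" if "t > T1" for t using T1(2)[of t] that by simp
  qed (use that in auto)
  then show ?thesis by (simp add: algebra_simps diff_divide_distrib)
 qed
 then have ev: "\<forall>\<^sub>F t in at_top. k * s t <= k * (s T1 - d / 2 * (t - T1))"
  using k by (auto simp: eventually_at_top_linorder intro!: exI[of _ T1])
 have "filterlim (%t. k * (s T1 - d / 2 * (t - T1))) at_bot at_top"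
 proof -
  have "filterlim (%t. - (k * (s T1 + d / 2 * T1)) + (k * d / 2) * t) at_top at_top"
   using k d(1) by (intro filterlim_tendsto_add_at_top[OF tendsto_const] filterlim_tendsto_pos_mult_at_top[OF tendsto_const _ filterlim_ident]) auto
  from filterlim_compose[OF filterlim_uminus_at_bot_at_top this] show ?thesis by (simp add: algebra_simps diff_divide_distrib)
 qed
 then have "filterlim (%t. k * s t) at_bot at_top" using ev by (rule filterlim_at_bot_mono)
 then show ?thesis by (rule filterlim_compose[OF exp_at_bot])
qed

lemma y_tendsto:
 assumes W: "((%t. exp (k * s t)) \<longlongrightarrow> 0) at_top" and b: "e1 < b"
 shows "\<exists>T1\<ge>T. \<forall>t\<ge>T1. y t <= b"
proof (cases "b <= gm")
 case False
 then show ?thesis using y by (intro exI[of _ T]) force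
next
 case True
 have "continuous_on {b..gm} Ph" using cPh b by (auto intro: continuous_on_subset)
 then obtain v where v: "v \<in> {b..gm}" "!!x. x \<in> {b..gm} ==> Ph v <= Ph x"
  using continuous_attains_inf[of "{b..gm}" Ph] True by auto
 define m where "m = Ph v / 2"
 have m: "m > 0" using pPh[of v] v(1) b by (simp add: m_def)
 obtain T' where T': "!!t. t >= T' ==> exp (k * s t) < m"
  using order_tendstoD(2)[OF W m] unfolding eventually_at_top_linorder by blast
 interpret L: tail k gm e1 "max T T'" Ph s y by (rule later) simp
 have "\<exists>T1\<ge>max T T'. \<forall>t\<ge>T1. y t <= b"
 proof (rule trap[OF L.dy _ m])
  show "e1 <= y t" if "t >= max T T'" for t using L.y[OF that] by simp
  show "exp (k * s t) - Ph (y t) <= - m" if "t >= max T T'" "b <= y t" for t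
   using T'[of t] v(2)[of "y t"] that L.y[of t] by (simp add: m_def)
 qed
 then show ?thesis by (meson max.boundedE order.trans)
qed

text \<open>The excess \<open>s t + (gm - e1) t\<close> has the derivative \<open>y - e1\<close>. At a simple zero of \<open>Ph\<close> it is
 bounded, at a double zero it is compared with a logarithm.\<close>

lemma W_derivative:
 "t >= T ==> ((%t. exp (k * s t)) has_real_derivative k * exp (k * s t) * (y t - gm)) (at t within {T..})"
 by (auto intro!: derivative_eq_intros ds)

text \<open>The excess is nondecreasing, so only a bound is needed. The sum
  \<open>y t + c * (s t + (gm - e1) * t) + exp (k * s t) / (k * kp)\<close> is nonincreasing: the
  growth of the excess is paid for by \<open>c * (y - e1) <= Ph y\<close>, and the nonlinearity by
  its own decay at rate at least \<open>k * kp\<close>.\<close>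

lemma asymptotics_simple:
 assumes W: "((%t. exp (k * s t)) \<longlongrightarrow> 0) at_top"
  and c: "c > 0" "d > 0" and Ph: "!!e. 0 <= e ==> e <= d ==> c * e <= Ph (e1 + e)"
 obtains l where "((%t. s t + (gm - e1) * t) \<longlongrightarrow> l) at_top"
proof -
 define kp where "kp = (gm - e1) / 2"
 have kap: "kp > 0" using e1 by (simp add: kp_def)
 obtain T1 where T1: "T1 >= T" "!!t. t >= T1 ==> y t <= e1 + min d kp"
  using y_tendsto[OF W, of "e1 + min d kp"] c kap by auto
 interpret L: tail k gm e1 T1 Ph s y by (rule later[OF T1(1)])
 define B where "B t = - (y t + c * (s t + (gm - e1) * t) + exp (k * s t) / (k * kp))" for t
 have dec: "B T1 <= B t" if "t >= T1" for t
 proof (rule deriv_nonneg_mono[of T1 B])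
  show "(B has_real_derivative - ((exp (k * s t) - Ph (y t)) + c * (y t - gm + (gm - e1)) + k * exp (k * s t) * (y t - gm) / (k * kp)))
   (at t within {T1..})" if "t >= T1" for t
   unfolding B_def using that k kap by (auto intro!: derivative_eq_intros L.ds L.dy L.W_derivative)
  fix t assume t: "t > T1"
  have "c * (y t - e1) <= Ph (y t)" using Ph[of "y t - e1"] T1(2)[of t] L.y[of t] t by simp
  moreover have "k * exp (k * s t) * (y t - gm) / (k * kp) <= - exp (k * s t)"
  proof -
   have "exp (k * s t) * (y t - gm) <= exp (k * s t) * (- kp)"
    using T1(2)[of t] t min.cobounded2[of d kp] by (intro mult_left_mono) (simp_all add: kp_def field_simps)
   then have "exp (k * s t) * (y t - gm) / kp <= - exp (k * s t)" using kap by (simp add: divide_le_eq)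
   then show ?thesis using k by simp
  qed
  ultimately show "0 <= - ((exp (k * s t) - Ph (y t)) + c * (y t - gm + (gm - e1)) + k * exp (k * s t) * (y t - gm) / (k * kp))"
   by simp
 qed (use that in auto)
 obtain l where "((%t. s t + (gm - e1) * t) \<longlongrightarrow> l) at_top"
 proof (rule increasing_bounded_tendsto[of T1 "%t. s t + (gm - e1) * t" "(- B T1 - e1) / c"])
  show "s r + (gm - e1) * r <= s t + (gm - e1) * t" if "T1 <= r" "r <= t" for r t
   using that L.y by (intro deriv_nonneg_mono[of T1 "%t. s t + (gm - e1) * t" "%t. y t - gm + (gm - e1)"])
    (auto intro!: derivative_eq_intros L.ds less_imp_le)
  fix t assume t: "T1 <= t"
  have "0 <= exp (k * s t) / (k * kp)" using k kap by simp
  then have "c * (s t + (gm - e1) * t) <= - B T1 - e1" using dec[OF t] L.y[OF t] unfolding B_def by linarith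
  then show "s t + (gm - e1) * t <= (- B T1 - e1) / c" using c by (simp add: field_simps)
 qed
 then show ?thesis by (rule that)
qed

text \<open>For \<open>E = y - e1\<close> the equation is nearly \<open>E' = - a * E^2\<close>, so
  \<open>t * E\<close> tends to \<open>1 / a\<close>. The function \<open>ln E\<close> plus
  \<open>a\<close> times the excess has a derivative of order \<open>E^2\<close>, hence of order
  \<open>1 / t^2\<close>, and converges. Since \<open>ln E\<close> is \<open>- ln t\<close> plus a
  convergent term, this gives the correction \<open>ln t / a\<close>.\<close>

lemma asymptotics_double:
 assumes W: "((%t. exp (k * s t)) \<longlongrightarrow> 0) at_top"
  and a: "a > 0" and d: "d > 0" and C: "C > 0" and Ph: "!!e. 0 <= e ==> e <= d ==> abs (Ph (e1 + e) - a * e^2) <= C * e ^ 3"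
 obtains l where "((%t. s t + (gm - e1) * t - ln t / a) \<longlongrightarrow> l) at_top"
proof -
 define kp where "kp = (gm - e1) / 2"
 have kap: "kp > 0" using e1 by (simp add: kp_def)
 \<comment> \<open>The bound \<open>C * ep <= a\<close> gives \<open>Ph y <= 2 * a * E^2\<close>;
   the bound \<open>6 * a * ep <= k * kp\<close> lets the exponential decay of \<open>w\<close>
   dominate the growth of \<open>1 / E ^ 3\<close>.\<close>
 define ep where "ep = min (min d kp) (min (a / C) (k * kp / (6 * a)))"
 have eps: "ep > 0" "ep <= d" "ep <= kp" "C * ep <= a" "6 * a * ep <= k * kp"
 proof -
  have "ep <= a / C" "ep <= k * kp / (6 * a)" by (simp_all add: ep_def)
  then show "C * ep <= a" "6 * a * ep <= k * kp" using a C by (simp_all add: field_simps)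
 qed (use a d C kap k in \<open>auto simp: ep_def\<close>)
 obtain T0 where T0: "T0 >= T" "!!t. t >= T0 ==> y t <= e1 + ep" using y_tendsto[OF W, of "e1 + ep"] eps by auto
 define T1 where "T1 = max T0 1"
 interpret L: tail k gm e1 T1 Ph s y by (rule later) (use T0 in \<open>simp add: T1_def\<close>)
 define E where "E t = y t - e1" for t
 define w where "w t = exp (k * s t)" for t
 have E: "0 < E t" "E t <= ep" if "t >= T1" for t using L.y[OF that] T0(2)[of t] that by (auto simp: E_def T1_def)
 have PhE: "abs (Ph (y t) - a * (E t)^2) <= C * E t ^ 3" if "t >= T1" for t
  using Ph[of "E t"] E[OF that] eps(2) by (simp add: E_def)
 have CE: "C * E t ^ 3 <= a * (E t)^2" if "t >= T1" for t
 proof -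
  have "C * E t <= a" using E[OF that] eps(4) C mult_left_mono[of "E t" ep C] by linarith
  then have "C * E t * (E t)^2 <= a * (E t)^2" by (intro mult_right_mono) auto
  then show ?thesis by (simp add: power3_eq_cube power2_eq_square mult.assoc)
 qed
 have w: "w t > 0" for t by (simp add: w_def)
 have dE: "(E has_real_derivative w t - Ph (y t)) (at t within {T1..})" if "t >= T1" for t
  unfolding E_def w_def using L.dy[OF that] by (auto intro!: derivative_eq_intros)
 have dw: "(w has_real_derivative k * w t * (y t - gm)) (at t within {T1..})" if "t >= T1" for t
  unfolding w_def by (rule L.W_derivative[OF that])
 have dp: "((%t. 1 / E t) has_real_derivative (Ph (y t) - w t) / (E t)^2) (at t within {T1..})" if "t >= T1" for t
  using E(1)[OF that] by (auto intro!: derivative_eq_intros dE[OF that] simp: power2_eq_square field_simps)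
 have p2: "(Ph (y t) - w t) / (E t)^2 <= 2 * a" if "t >= T1" for t
 proof -
  have "Ph (y t) - w t <= 2 * a * (E t)^2" using PhE[OF that] CE[OF that] w[of t] by linarith
  then show ?thesis using E(1)[OF that] by (simp add: field_simps)
 qed
 \<comment> \<open>\<open>w / E ^ 3\<close> is nonincreasing, so the nonlinearity \<open>w\<close>
   is of order \<open>E ^ 3\<close>, the order of the error in the expansion of
   \<open>Ph\<close>.\<close>
 define M where "M = w T1 / E T1 ^ 3"
 have wM: "w t <= M * E t ^ 3" if "t >= T1" for t
 proof -
  have "- (w T1 * (1 / E T1) ^ 3) <= - (w t * (1 / E t) ^ 3)"
  proof (rule deriv_nonneg_mono[of T1 "%t. - (w t * (1 / E t) ^ 3)"
     "%t. - (k * w t * (y t - gm) * (1 / E t) ^ 3 + w t * (3 * (1 / E t)^2 * ((Ph (y t) - w t) / (E t)^2)))"])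
   show "((%t. - (w t * (1 / E t) ^ 3)) has_real_derivative
    - (k * w t * (y t - gm) * (1 / E t) ^ 3 + w t * (3 * (1 / E t)^2 * ((Ph (y t) - w t) / (E t)^2)))) (at t within {T1..})"
    if "t >= T1" for t
    by (rule derivative_eq_intros dp[OF that] dw[OF that] refl | simp)+
   fix t assume t: "t > T1"
   then have t': "t >= T1" by simp
   have "w t * (3 * (1 / E t)^2 * ((Ph (y t) - w t) / (E t)^2)) <= w t * (3 * (1 / E t)^2 * (2 * a))"
    using p2[OF t'] w[of t] by (intro mult_left_mono) auto
   moreover have "k * w t * (y t - gm) * (1 / E t) ^ 3 <= - (w t * (3 * (1 / E t)^2 * (2 * a)))"
   proof -
    have "y t - gm <= - kp" using E(2)[OF t'] eps(3) by (simp add: E_def kp_def field_simps)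
    then have "k * (y t - gm) <= k * (- kp)" using k by (intro mult_left_mono) auto
    then have "k * (y t - gm) <= - (6 * a * E t)" using eps(5) E[OF t'] a mult_left_mono[of "E t" ep "6 * a"] by linarith
    then have "k * (y t - gm) * (w t * (1 / E t) ^ 3) <= - (6 * a * E t) * (w t * (1 / E t) ^ 3)"
     using w[of t] E(1)[OF t'] by (intro mult_right_mono) auto
    then show ?thesis using E(1)[OF t'] by (simp add: power3_eq_cube power2_eq_square field_simps)
   qed
   ultimately show "0 <= - (k * w t * (y t - gm) * (1 / E t) ^ 3 + w t * (3 * (1 / E t)^2 * ((Ph (y t) - w t) / (E t)^2)))"
    by linarith
  qed (use that in auto)
  then have "w t / E t ^ 3 <= M" by (simp add: M_def power_divide)
  then show ?thesis using E(1)[OF that] by (simp add: field_simps)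
 qed
 have M: "M > 0" using w E(1)[of T1] by (simp add: M_def)
 have plow: "a - (C + M) * E t <= (Ph (y t) - w t) / (E t)^2" and pup: "(Ph (y t) - w t) / (E t)^2 <= a + (C + M) * E t"
  if "t >= T1" for t
 proof -
  have "abs ((Ph (y t) - w t) - a * (E t)^2) <= (C + M) * E t ^ 3"
   using PhE[OF that] wM[OF that] w[of t] by (simp add: distrib_right)
  moreover have "E t ^ 3 = E t * (E t)^2" by (simp add: power3_eq_cube power2_eq_square)
  ultimately have "(a - (C + M) * E t) * (E t)^2 <= Ph (y t) - w t" "Ph (y t) - w t <= (a + (C + M) * E t) * (E t)^2"
   by (simp_all add: algebra_simps abs_le_iff)
  then show "a - (C + M) * E t <= (Ph (y t) - w t) / (E t)^2" "(Ph (y t) - w t) / (E t)^2 <= a + (C + M) * E t"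
   using E(1)[OF that] by (simp_all add: field_simps)
 qed
 have E0: "(E \<longlongrightarrow> 0) at_top"
 proof (rule order_tendstoI)
  fix b :: real assume b: "b < 0"
  show "\<forall>\<^sub>F t in at_top. b < E t" unfolding eventually_at_top_linorder using E(1) b by (meson less_trans)
 next
  fix b :: real assume b: "0 < b"
  obtain T2 where T2: "!!t. t >= T2 ==> y t <= e1 + b / 2" using y_tendsto[OF W, of "e1 + b / 2"] b by auto
  have "E t < b" if "t >= T2" for t using T2[OF that] b by (simp add: E_def)
  then show "\<forall>\<^sub>F t in at_top. E t < b" unfolding eventually_at_top_linorder by blast
 qed
 have "((%t. (Ph (y t) - w t) / (E t)^2) \<longlongrightarrow> a) at_top"
 proof (rule tendsto_sandwich)
  show "((%t. a - (C + M) * E t) \<longlongrightarrow> a) at_top" "((%t. a + (C + M) * E t) \<longlongrightarrow> a) at_top"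
   using E0 by (auto intro!: tendsto_eq_intros)
 qed (use plow pup in \<open>auto simp: eventually_at_top_linorder intro!: exI[of _ T1]\<close>)
 then have "((%t. (1 / E t) / t) \<longlongrightarrow> a) at_top"
 proof (intro lhospital_at_top_at_top[of "%t. t" "%_. 1" "%t. 1 / E t" "%t. (Ph (y t) - w t) / (E t)^2"])
  have "DERIV (%t. 1 / E t) t :> (Ph (y t) - w t) / (E t)^2" if "t > T1" for t
   using dp[of t] that at_within_interior[of t "{T1..}"] by simp
  then show "\<forall>\<^sub>F t in at_top. DERIV (%t. 1 / E t) t :> (Ph (y t) - w t) / (E t)^2"
   using eventually_gt_at_top[of T1] by (rule eventually_mono[rotated])
 qed (auto simp: filterlim_ident)
 then have Et: "((%t. t * E t) \<longlongrightarrow> 1 / a) at_top" using tendsto_inverse[of "%t. (1 / E t) / t" a] a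
  by (simp add: field_simps)
 have "\<forall>\<^sub>F t in at_top. t * E t < 2 / a" using order_tendstoD(2)[OF Et, of "2 / a"] a by (simp add: divide_strict_right_mono)
 then obtain T2 where T2: "T2 >= T1" "!!t. t >= T2 ==> t * E t < 2 / a"
  unfolding eventually_at_top_linorder by (metis max.bounded_iff max.cobounded1 order.refl)
 have T2p: "t > 0" if "t >= T2" for t using that T2(1) by (auto simp: T1_def)
 define C' where "C' = (C + M) * (4 / a^2)"
 define f where "f t = ln (E t) + a * (s t + (gm - e1) * t)" for t
 define f' where "f' t = (w t - Ph (y t)) / E t + a * (y t - gm + (gm - e1))" for t
 have df: "(f has_real_derivative f' t) (at t within {T2..})" if "t >= T2" for t
 proof -
  have "(f has_real_derivative f' t) (at t within {T1..})" unfolding f_def f'_def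
   using that T2(1) E(1)[of t] by (auto intro!: derivative_eq_intros dE L.ds simp: field_simps)
  then show ?thesis by (rule has_field_derivative_subset) (use T2(1) in auto)
 qed
 have f': "abs (f' t) <= C' / t^2" if "t >= T2" for t
 proof -
  have t: "t >= T1" "t > 0" using that T2 T2p by auto
  have "f' t = E t * (a - (Ph (y t) - w t) / (E t)^2)"
  proof -
   have "(w t - Ph (y t)) / x + a * x = x * (a - (Ph (y t) - w t) / x^2)" if "x > 0" for x
    using that by (simp add: power2_eq_square field_simps)
   from this[OF E(1)[OF t(1)]] show ?thesis by (simp add: f'_def E_def)
  qed
  moreover have "abs (a - (Ph (y t) - w t) / (E t)^2) <= (C + M) * E t" using plow[OF t(1)] pup[OF t(1)] by simp
  ultimately have "abs (f' t) <= E t * ((C + M) * E t)" using E(1)[OF t(1)] by (simp add: abs_mult)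
  also have "... = (C + M) * (t * E t)^2 / t^2" using t by (simp add: power2_eq_square)
  also have "... <= (C + M) * (2 / a)^2 / t^2"
   using T2(2)[OF that] t E(1)[OF t(1)] C M by (intro divide_right_mono mult_left_mono power_mono) auto
  finally show ?thesis by (simp add: C'_def power_divide)
 qed
 have d1t: "((%t. C' / t) has_real_derivative - C' / t^2) (at t within {T2..})" if "t >= T2" for t
  using T2p[OF that] by (auto intro!: derivative_eq_intros simp: power2_eq_square)
 have C': "C' >= 0" using C M by (simp add: C'_def)
 \<comment> \<open>From \<open>abs (f' t) <= C' / t^2\<close> it follows that
   \<open>f - C' / t\<close> is nondecreasing and \<open>f + C' / t\<close> nonincreasing, so the
   first of them is bounded and converges.\<close>
 obtain l where l: "((%t. f t - C' / t) \<longlongrightarrow> l) at_top"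
 proof (rule increasing_bounded_tendsto[of T2 "%t. f t - C' / t" "f T2 + C' / T2"])
  show "f r - C' / r <= f t - C' / t" if "T2 <= r" "r <= t" for r t
  proof (rule deriv_nonneg_mono[of T2 "%t. f t - C' / t" "%t. f' t - (- C' / t^2)"])
   show "((%t. f t - C' / t) has_real_derivative f' t - (- C' / t^2)) (at t within {T2..})" if "t >= T2" for t
    by (intro derivative_intros df[OF that] d1t[OF that])
   show "0 <= f' t - (- C' / t^2)" if "t > T2" for t using f'[of t] that by (simp add: abs_le_iff)
  qed (use that in auto)
  fix t assume t: "T2 <= t"
  have "- (f T2 + C' / T2) <= - (f t + C' / t)"
  proof (rule deriv_nonneg_mono[of T2 "%t. - (f t + C' / t)" "%t. - (f' t + (- C' / t^2))"])
   show "((%t. - (f t + C' / t)) has_real_derivative - (f' t + (- C' / t^2))) (at t within {T2..})" if "t >= T2" for t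
    by (intro derivative_intros df[OF that] d1t[OF that])
   show "0 <= - (f' t + (- C' / t^2))" if "t > T2" for t using f'[of t] that by (simp add: abs_le_iff)
  qed (use t in auto)
  moreover have "0 <= C' / t" using C' T2p[OF t] by simp
  ultimately show "f t - C' / t <= f T2 + C' / T2" by linarith
 qed
 have "((%t::real. C' / t) \<longlongrightarrow> 0) at_top" by (rule tendsto_divide_0[OF tendsto_const filterlim_at_top_imp_at_infinity[OF filterlim_ident]])
 from tendsto_add[OF l this] have lf: "(f \<longlongrightarrow> l) at_top" by simp
 have "((%t. (f t - ln (t * E t)) / a) \<longlongrightarrow> (l - ln (1 / a)) / a) at_top"
  using a by (intro tendsto_intros lf Et) auto
 then have "((%t. s t + (gm - e1) * t - ln t / a) \<longlongrightarrow> (l - ln (1 / a)) / a) at_top"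
 proof (rule Lim_transform_eventually)
  have "(f t - ln (t * E t)) / a = s t + (gm - e1) * t - ln t / a" if "t >= T2" for t
   using a E(1)[of t] T2(1) T2p[OF that] that by (simp add: f_def ln_mult field_simps)
  then show "\<forall>\<^sub>F t in at_top. (f t - ln (t * E t)) / a = s t + (gm - e1) * t - ln t / a"
   by (auto simp: eventually_at_top_linorder intro!: exI[of _ T2])
 qed
 then show ?thesis by (rule that)
qed

end

section \<open>Half orbits started on the line of slope \<open>gm\<close>\<close>

text \<open>The equilibrium is \<open>(s0, gm)\<close>, and \<open>e1\<close> is the next zero of
  \<open>Ph\<close> below \<open>gm\<close>. The convergence \<open>asym\<close> is an assumption,
  so that simple and double zeros are treated together, with \<open>corr\<close> equal to 0 or a
  multiple of the logarithm. The assumption on \<open>corr\<close> describes how asymptotic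
  constants behave under time shifts. Lipschitz bounds are required only away from
  \<open>e1\<close>, since \<open>F\<close> need not have one at 0.\<close>

locale half =
 fixes k gm e1 s0 :: real and Ph corr :: "real => real"
 assumes k: "k > 0" and e1: "e1 < gm" and cPh: "continuous_on {e1..gm} Ph" and Ph0: "Ph e1 = 0"
  and pPh: "!!v. e1 < v ==> v <= gm ==> Ph v > 0" and s0: "exp (k * s0) = Ph gm"
  and lip: "!!a. e1 < a ==> \<exists>L>0. \<forall>x\<in>{a..gm}. \<forall>y\<in>{a..gm}. abs (Ph x - Ph y) <= L * abs (x - y)"
  and asym: "!!T s y. tail k gm e1 T Ph s y ==> ((%t. exp (k * s t)) \<longlongrightarrow> 0) at_top ==>
   \<exists>l. ((%t. s t + (gm - e1) * t - corr t) \<longlongrightarrow> l) at_top"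
  and corr: "!!c. ((%t. corr (t + c) - corr t) \<longlongrightarrow> 0) at_top"
begin

definition orbit :: "real set => (real => real) => (real => real) => bool" where
 "orbit S s y \<longleftrightarrow> (\<forall>t\<in>S. (s has_real_derivative y t - gm) (at t within S) &
  (y has_real_derivative exp (k * s t) - Ph (y t)) (at t within S) & e1 < y t & y t <= gm & s t <= s0)"

lemma orbitD:
 assumes "orbit S s y" "t \<in> S"
 shows "(s has_real_derivative y t - gm) (at t within S)" "(y has_real_derivative exp (k * s t) - Ph (y t)) (at t within S)"
  "e1 < y t" "y t <= gm" "s t <= s0"
 using assms by (auto simp: orbit_def)

lemma orbit_subset: "orbit S s y ==> S' \<subseteq> S ==> orbit S' s y"
 unfolding orbit_def by (intro ballI conjI; drule bspec, erule (1) subsetD) (auto intro: has_field_derivative_subset)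

lemma orbit_shift:
 assumes "orbit {T..} s y"
 shows "orbit {T - c..} (%t. s (t + c)) (%t. y (t + c))"
 unfolding orbit_def
proof (intro ballI)
 fix t assume t: "t \<in> {T - c..}"
 have im: "(%t. t + c) ` {T - c..} = {T..}" by (auto simp: image_iff intro!: bexI[of _ "x - c" for x])
 have D: "((%t. f (t + c)) has_real_derivative D) (at t within {T - c..})" if "(f has_real_derivative D) (at (t + c) within {T..})" for f D
  using DERIV_image_chain[of f D "%t. t + c" t "{T - c..}" 1] that DERIV_add[OF DERIV_ident DERIV_const[of c], of t "{T - c..}"] unfolding im by (simp add: o_def)
 show "((%t. s (t + c)) has_real_derivative y (t + c) - gm) (at t within {T - c..}) &
  ((%t. y (t + c)) has_real_derivative exp (k * s (t + c)) - Ph (y (t + c))) (at t within {T - c..}) &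
  e1 < y (t + c) & y (t + c) <= gm & s (t + c) <= s0"
  using D orbitD[OF assms, of "t + c"] t by auto
qed

lemma near_root:
 assumes "m > 0" obtains a where "e1 < a" "a < gm" "!!v. e1 <= v ==> v <= a ==> Ph v < m"
proof -
 obtain d where d: "d > 0" "!!v. v \<in> {e1..gm} ==> abs (v - e1) < d ==> abs (Ph v - Ph e1) < m"
  using cPh e1 assms unfolding continuous_on_iff dist_real_def by (metis atLeastAtMost_iff less_eq_real_def)
 define dl where "dl = min (d / 2) ((gm - e1) / 2)"
 have dl: "dl > 0" "dl < d" "dl < gm - e1" using d(1) e1 by (auto simp: dl_def min_def)
 show ?thesis
 proof (rule that[of "e1 + dl"])
  fix v assume v: "e1 <= v" "v <= e1 + dl"
  with dl have "v <= gm" "abs (v - e1) < d" by linarith+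
  with d(2)[of v] v Ph0 show "Ph v < m" by auto
 qed (use dl in auto)
qed

lemma orbit_s:
 assumes o: "orbit {0..T} s y" and t: "0 <= t" "t <= T"
 shows "s 0 - (gm - e1) * t <= s t" "s t <= s 0"
proof -
 have "s 0 <= s t + (gm - e1) * t"
 proof (rule barrier[of 0 T "%t. s t + (gm - e1) * t" "%t. y t - gm + (gm - e1)"])
  show "((%t. s t + (gm - e1) * t) has_real_derivative y r - gm + (gm - e1)) (at r within {0..T})" if "r \<in> {0..T}" for r
   using orbitD(1)[OF o that] by (auto intro!: derivative_eq_intros)
  show "0 <= y r - gm + (gm - e1)" if "r \<in> {0..T}" for r using orbitD(3)[OF o that] by simp
 qed (use t in auto)
 then show "s 0 - (gm - e1) * t <= s t" by simp
 have "- s 0 <= - s t"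
 proof (rule barrier[of 0 T "%t. - s t", OF DERIV_minus[OF orbitD(1)[OF o]]])
  show "0 <= - (y r - gm)" if "r \<in> {0..T}" for r using orbitD(4)[OF o that] by simp
 qed (use t in auto)
 then show "s t <= s 0" by simp
qed

text \<open>Up to time \<open>T\<close> the value of \<open>s\<close> falls by at most
  \<open>(gm - e1) * T\<close>, so the nonlinearity exceeds \<open>Ph\<close> near \<open>e1\<close>
  and \<open>y\<close> cannot approach \<open>e1\<close>. This keeps all orbits with
  \<open>s 0 >= sig\<close> in a region where \<open>Ph\<close> is Lipschitz.\<close>

lemma orbit_y_lower:
 assumes T: "T >= 0"
 obtains a where "e1 < a" "a < gm" "!!s y t. orbit {0..T} s y ==> s 0 >= sig ==> y 0 = gm ==> 0 <= t ==> t <= T ==> a <= y t"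
proof -
 obtain a where a: "e1 < a" "a < gm" "!!v. e1 <= v ==> v <= a ==> Ph v < exp (k * (sig - (gm - e1) * T))"
  using near_root[of "exp (k * (sig - (gm - e1) * T))"] by auto
 show ?thesis
 proof (rule that[OF a(1,2)])
  fix s y t assume o: "orbit {0..T} s y" and h: "s 0 >= sig" "y 0 = gm" and t: "0 <= t" "t <= T"
  show "a <= y t"
  proof (rule barrier[of 0 T y "%t. exp (k * s t) - Ph (y t)"])
   fix r assume r: "r \<in> {0..T}" "y r < a"
   have "(gm - e1) * r <= (gm - e1) * T" using r e1 by (intro mult_left_mono) auto
   then have "sig - (gm - e1) * T <= s r" using orbit_s(1)[OF o, of r] r h by auto
   then have "exp (k * (sig - (gm - e1) * T)) <= exp (k * s r)" using k by simp
   moreover have "Ph (y r) < exp (k * (sig - (gm - e1) * T))" using r orbitD(3)[OF o, of r] by (intro a(3)) auto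
   ultimately show "0 <= exp (k * s r) - Ph (y r)" by linarith
  qed (use orbitD[OF o] h a t in auto)
 qed
qed

lemma exp_lipschitz:
 assumes "s <= s0" "s' <= s0" shows "abs (exp (k * s) - exp (k * s')) <= k * exp (k * s0) * abs (s - s')"
proof -
 have *: "exp (k * b) - exp (k * a) <= k * exp (k * s0) * (b - a)" if "a <= b" "b <= s0" for a b
 proof -
  have "exp (k * b) * (1 + (k * a - k * b)) <= exp (k * b) * exp (k * a - k * b)" by (intro mult_left_mono exp_ge_add_one_self) auto
  also have "... = exp (k * a)" by (simp flip: exp_add)
  finally have "exp (k * b) - exp (k * a) <= exp (k * b) * (k * (b - a))" by (simp add: algebra_simps)
  also have "... <= exp (k * s0) * (k * (b - a))" using k that by (intro mult_right_mono) auto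
  finally show ?thesis by (simp add: mult_ac)
 qed
 show ?thesis
 proof (cases "s <= s'")
  case True
  then have "exp (k * s) <= exp (k * s')" using k by simp
  with *[OF True] True assms show ?thesis by (simp add: abs_if)
 next
  case False
  then have "exp (k * s') <= exp (k * s)" using k by simp
  with *[of s' s] False assms show ?thesis by (simp add: abs_if)
 qed
qed

lemma dependence:
 assumes T: "T >= 0"
 obtains K where "K > 0" "!!s y s' y' t. orbit {0..T} s y ==> orbit {0..T} s' y' ==> s 0 >= sig ==> s' 0 >= sig ==>
  y 0 = gm ==> y' 0 = gm ==> 0 <= t ==> t <= T ==> abs (s t - s' t) <= K * abs (s 0 - s' 0) & abs (y t - y' t) <= K * abs (s 0 - s' 0)"
proof -
 obtain a where a: "e1 < a" "a < gm" "!!s y t. orbit {0..T} s y ==> s 0 >= sig ==> y 0 = gm ==> 0 <= t ==> t <= T ==> a <= y t"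
  by (rule orbit_y_lower[OF T, of sig]) blast
 obtain L where L: "L > 0" "!!x y. x \<in> {a..gm} ==> y \<in> {a..gm} ==> abs (Ph x - Ph y) <= L * abs (x - y)" using lip[OF a(1)] by blast
 define K where "K = 1 + k * exp (k * s0) + L"
 have K: "K > 0" "1 <= K" "k * exp (k * s0) <= K" "L <= K" using k L(1) by (auto simp: K_def intro!: add_pos_pos)
 have "abs (s t - s' t) <= exp (2 * K * T) * abs (s 0 - s' 0) & abs (y t - y' t) <= exp (2 * K * T) * abs (s 0 - s' 0)"
  if o: "orbit {0..T} s y" "orbit {0..T} s' y'" and h: "s 0 >= sig" "s' 0 >= sig" "y 0 = gm" "y' 0 = gm" and t: "0 <= t" "t <= T" for s y s' y' t
 proof -
  have l: "abs (y t - gm - (y' t - gm)) <= K * (abs (s t - s' t) + abs (y t - y' t))"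
   "abs (exp (k * s t) - Ph (y t) - (exp (k * s' t) - Ph (y' t))) <= K * (abs (s t - s' t) + abs (y t - y' t))" if t: "t \<in> {0..T}" for t
  proof -
   have gen: "abs (x - u - (x' - u')) <= A + B" if "abs (x - x') <= c" "c <= A" "abs (u - u') <= b" "b <= B" for x x' u u' A B b c :: real
    using that by linarith
   have 1: "abs (Ph (y t) - Ph (y' t)) <= L * abs (y t - y' t)"
    using a(3)[OF o(1) h(1,3)] a(3)[OF o(2) h(2,4)] orbitD(4)[OF o(1) t] orbitD(4)[OF o(2) t] t by (intro L(2)) auto
   have 2: "abs (exp (k * s t) - exp (k * s' t)) <= k * exp (k * s0) * abs (s t - s' t)"
    using orbitD(5)[OF o(1) t] orbitD(5)[OF o(2) t] by (rule exp_lipschitz)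
   show "abs (exp (k * s t) - Ph (y t) - (exp (k * s' t) - Ph (y' t))) <= K * (abs (s t - s' t) + abs (y t - y' t))"
    unfolding distrib_left by (rule gen[OF 2 mult_right_mono[OF K(3)] 1 mult_right_mono[OF K(4)]]) auto
   show "abs (y t - gm - (y' t - gm)) <= K * (abs (s t - s' t) + abs (y t - y' t))"
    using mult_mono[OF K(2), of "abs (y t - y' t)" "abs (s t - s' t) + abs (y t - y' t)"] K(1) by simp
  qed
  note g = planar_gronwall[OF orbitD(1)[OF o(1)] orbitD(1)[OF o(2)] orbitD(2)[OF o(1)] orbitD(2)[OF o(2)] l less_imp_le[OF K(1)], of t]
  have "exp (2 * K * (t - 0)) * abs (s 0 - s' 0) <= exp (2 * K * T) * abs (s 0 - s' 0)" using t K(1) by (intro mult_right_mono) auto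
  then show ?thesis using g t h(3,4) by auto
 qed
 then show ?thesis by (intro that[of "exp (2 * K * T)"]) auto
qed

text \<open>The system with \<open>s\<close> and \<open>y\<close> truncated is solved globally. Its
  solution stays in the truncation range: \<open>y\<close> is nondecreasing below \<open>a\<close>
  and nonincreasing above \<open>gm\<close>, because the truncated nonlinearity is at most
  \<open>Ph gm\<close>, and this in turn bounds \<open>s\<close>.\<close>

lemma orbit_exists_bounded:
 assumes sig: "sig <= s0" and T: "T >= 0"
 shows "\<exists>s y. orbit {0..T} s y & s 0 = sig & y 0 = gm"
proof -
 define l where "l = sig - (gm - e1) * T"
 have ls: "l <= s0" using sig T e1 by (simp add: l_def diff_le_eq add_increasing2)
 obtain a where a: "e1 < a" "a < gm" "!!v. e1 <= v ==> v <= a ==> Ph v < exp (k * l)" using near_root[of "exp (k * l)"] by auto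
 obtain L where L: "L > 0" "!!x y. x \<in> {a..gm} ==> y \<in> {a..gm} ==> abs (Ph x - Ph y) <= L * abs (x - y)" using lip[OF a(1)] by blast
 obtain B where B: "!!v. v \<in> {a..gm} ==> abs (Ph v) <= B"
 proof -
  have "compact (Ph ` {a..gm})" by (intro compact_continuous_image continuous_on_subset[OF cPh]) (use a in auto)
  then show ?thesis using that by (force dest!: compact_imp_bounded simp: bounded_iff)
 qed
 define cy cs where "cy = clamp_to a gm" and "cs = clamp_to l s0"
 have cy: "cy v \<in> {a..gm}" for v using clamp_to_bounds[of a gm v] a by (simp add: cy_def)
 have cs: "l <= cs v & cs v <= s0" for v using clamp_to_bounds[of l s0 v] ls by (simp add: cs_def)
 define K where "K = 1 + k * exp (k * s0) + L"
 have K: "K > 0" "1 <= K" "k * exp (k * s0) <= K" "L <= K" using k L(1) by (auto simp: K_def intro!: add_pos_pos)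
 have cl: "abs (cy u - cy v) <= abs (u - v)" "abs (cs u - cs v) <= abs (u - v)" for u v unfolding cy_def cs_def by (rule clamp_to_lipschitz)+
 have "\<exists>s y. s 0 = sig & y 0 = gm & (\<forall>t. DERIV s t :> cy (y t) - gm) & (\<forall>t. DERIV y t :> exp (k * cs (s t)) - Ph (cy (y t)))"
 proof (rule planar_ode[OF K(1), of "%v. cy v - gm" "%v. exp (k * cs v)" "%v. Ph (cy v)" "(gm - a) + (exp (k * s0) + B)" 0 sig gm], goal_cases)
  case (1 u v) show ?case using cl(1)[of u v] mult_right_mono[OF K(2), of "abs (u - v)"] by simp
 next
  case (2 u v) show ?case using exp_lipschitz[OF cs[THEN conjunct2] cs[THEN conjunct2], of u v] mult_mono[OF K(3) cl(2)[of u v]] K(1) by linarith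
 next
  case (3 u v) show ?case using L(2)[OF cy cy, of u v] mult_mono[OF K(4) cl(1)[of u v]] K(1) by linarith
 next
  case (4 u) show ?case using cy[of u] B[OF cy[of u]] exp_gt_zero[of "k * s0"] unfolding atLeastAtMost_iff by linarith
 next
  case (5 u v)
  have "exp (k * cs u) <= exp (k * s0)" using cs[of u] k by simp
  then show ?case using B[OF cy[of v]] exp_gt_zero[of "k * cs u"] a by linarith
 qed blast
 then obtain s y where X: "s 0 = sig" "y 0 = gm" "!!t. DERIV s t :> cy (y t) - gm" "!!t. DERIV y t :> exp (k * cs (s t)) - Ph (cy (y t))" by blast
 have ds: "(s has_real_derivative cy (y t) - gm) (at t within S)" and dy: "(y has_real_derivative exp (k * cs (s t)) - Ph (cy (y t))) (at t within S)" for t S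
  by (rule has_field_derivative_at_within, rule X)+
 have ya: "a <= y t" if "t \<in> {0..T}" for t
 proof (rule barrier[of 0 T y, OF dy _ _ that])
  fix r assume "y r < a"
  then have "cy (y r) = a" using a by (simp add: cy_def clamp_to_def)
  then have "Ph (cy (y r)) < exp (k * l)" using a(3)[of a] a(1) by simp
  moreover have "exp (k * l) <= exp (k * cs (s r))" using cs[of "s r"] k by simp
  ultimately show "0 <= exp (k * cs (s r)) - Ph (cy (y r))" by linarith
 qed (use X a in simp)
 have ygm: "y t <= gm" if "t \<in> {0..T}" for t
 proof -
  have "- gm <= - y t"
  proof (rule barrier[of 0 T "%t. - y t", OF DERIV_minus[OF dy] _ _ that])
   fix r assume "- y r < - gm"
   then have "cy (y r) = gm" using a by (simp add: cy_def clamp_to_def)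
   moreover have "exp (k * cs (s r)) <= exp (k * s0)" using cs[of "s r"] k by simp
   ultimately show "0 <= - (exp (k * cs (s r)) - Ph (cy (y r)))" using s0 by simp
  qed (use X in simp)
  then show ?thesis by simp
 qed
 have cyid: "cy (y t) = y t" if "t \<in> {0..T}" for t using ya[OF that] ygm[OF that] by (simp add: cy_def clamp_to_id)
 have s_up: "s t <= sig" if "t \<in> {0..T}" for t
  using barrier[of 0 T "%t. - s t", OF DERIV_minus[OF ds] _ _ that, of "- sig"] cy X(1) by auto
 have s_lo: "l <= s t" if "t \<in> {0..T}" for t
 proof -
  have "sig <= s t + (gm - e1) * t"
  proof (rule barrier[of 0 T "%t. s t + (gm - e1) * t" "%t. cy (y t) - gm + (gm - e1)", OF _ _ _ that])
   show "((%t. s t + (gm - e1) * t) has_real_derivative cy (y r) - gm + (gm - e1)) (at r within {0..T})" for r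
    by (auto intro!: derivative_eq_intros ds)
   show "0 <= cy (y r) - gm + (gm - e1)" for r using cy[of "y r"] a by auto
  qed (use X in simp)
  moreover have "(gm - e1) * t <= (gm - e1) * T" using that e1 by (intro mult_left_mono) auto
  ultimately show ?thesis by (simp add: l_def)
 qed
 have csid: "cs (s t) = s t" if "t \<in> {0..T}" for t using s_up[OF that] s_lo[OF that] sig by (simp add: cs_def clamp_to_id)
 have "orbit {0..T} s y" unfolding orbit_def
 proof (intro ballI conjI)
  fix t assume t: "t \<in> {0..T}"
  show "(s has_real_derivative y t - gm) (at t within {0..T})" using ds[of t "{0..T}"] cyid[OF t] by simp
  show "(y has_real_derivative exp (k * s t) - Ph (y t)) (at t within {0..T})" using dy[of t "{0..T}"] cyid[OF t] csid[OF t] by simp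
  show "e1 < y t" "y t <= gm" "s t <= s0" using ya[OF t] ygm[OF t] s_up[OF t] sig a(1) by auto
 qed
 with X(1,2) show ?thesis by blast
qed

lemma orbit_unique:
 assumes "orbit {0..T} s y" "orbit {0..T} s' y'" "s 0 = s' 0" "y 0 = gm" "y' 0 = gm" "0 <= t" "t <= T"
 shows "s t = s' t" "y t = y' t"
proof -
 have T: "T >= 0" using assms by simp
 obtain K where K: "abs (s t - s' t) <= K * abs (s 0 - s' 0) & abs (y t - y' t) <= K * abs (s 0 - s' 0)"
 proof (rule dependence[OF T, of "s' 0"], goal_cases)
  case (1 K)
  show ?case by (rule that[OF 1(3)[OF assms(1,2) _ _ assms(4-7)]]) (use assms(3) in auto)
 qed
 show "s t = s' t" "y t = y' t" using K assms(3) by auto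
qed

lemma orbit_exists:
 assumes sig: "sig <= s0"
 shows "\<exists>s y. orbit {0..} s y & s 0 = sig & y 0 = gm"
proof -
 have "\<forall>n::nat. \<exists>s y. orbit {0..real n} s y & s 0 = sig & y 0 = gm" using orbit_exists_bounded[OF sig] by simp
 then obtain s y where sy: "!!n::nat. orbit {0..real n} (s n) (y n)" "!!n. s n 0 = sig" "!!n. y n 0 = gm" by metis
 \<comment> \<open>\<open>N t\<close> is strictly larger than \<open>t\<close>, so near
   \<open>t\<close> the glued function agrees with a single orbit.\<close>
 define N where "N t = nat \<lceil>t\<rceil> + 1" for t :: real
 have N: "t < real (N t)" for t unfolding N_def by linarith
 have eq: "s m t = s n t" "y m t = y n t" if "0 <= t" "t <= real m" "t <= real n" for m n t
 proof -
  have "orbit {0..t} (s m) (y m)" "orbit {0..t} (s n) (y n)" using that by (auto intro: orbit_subset[OF sy(1)])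
  from orbit_unique[OF this] that sy(2,3) show "s m t = s n t" "y m t = y n t" by auto
 qed
 define s' y' where "s' t = s (N t) t" and "y' t = y (N t) t" for t
 have "orbit {0..} s' y'" unfolding orbit_def
 proof (intro ballI)
  fix t :: real assume t: "t \<in> {0..}"
  have o: "(s (N t) has_real_derivative y (N t) t - gm) (at t within {0..real (N t)})"
   "(y (N t) has_real_derivative exp (k * s (N t) t) - Ph (y (N t) t)) (at t within {0..real (N t)})"
   "e1 < y (N t) t" "y (N t) t <= gm" "s (N t) t <= s0"
   using orbitD[OF sy(1), of t "N t"] t N[of t] by auto
  have w: "at t within {0..real (N t)} = at t within {0..}"
   by (rule at_within_nhd[of _ "{..<real (N t)}"]) (use N t in auto)
  have ev: "r \<in> {0..} ==> dist r t < real (N t) - t ==> s (N t) r = s' r" "r \<in> {0..} ==> dist r t < real (N t) - t ==> y (N t) r = y' r" for r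
   unfolding s'_def y'_def using N[of r] by (auto intro!: eq simp: dist_real_def)
  have "(s' has_real_derivative y' t - gm) (at t within {0..})"
   using o(1) N[of t] t unfolding w by (intro has_field_derivative_transform_within[OF _ _ _ ev(1)]) (auto simp: y'_def)
  moreover have "(y' has_real_derivative exp (k * s' t) - Ph (y' t)) (at t within {0..})"
   using o(2) N[of t] t unfolding w by (intro has_field_derivative_transform_within[OF _ _ _ ev(2)]) (auto simp: y'_def s'_def)
  ultimately show "(s' has_real_derivative y' t - gm) (at t within {0..}) &
   (y' has_real_derivative exp (k * s' t) - Ph (y' t)) (at t within {0..}) & e1 < y' t & y' t <= gm & s' t <= s0"
   using o by (simp add: s'_def y'_def)
 qed
 moreover have "s' 0 = sig" "y' 0 = gm" using sy(2,3) by (auto simp: s'_def y'_def)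
 ultimately show ?thesis by blast
qed

text \<open>As long as \<open>y <= y'\<close> the gap \<open>s' - s\<close> does not shrink and
  stays positive. When \<open>y\<close> and \<open>y'\<close> touch, the terms with
  \<open>Ph\<close> cancel and \<open>y' - y\<close> has a positive derivative, so the order cannot
  be lost after the time \<open>r\<close>, the infimum of the times at which it fails.\<close>

lemma grow:
 assumes o: "orbit {m..} s y" "orbit {m..} s' y'" and h: "s m < s' m" "y m <= y' m" and t: "m <= t"
 shows "y t <= y' t"
proof (rule ccontr)
 assume n: "\<not> y t <= y' t"
 define v where "v t = y' t - y t" for t
 define r where "r = Inf {r\<in>{m..t}. v r < 0}"
 have ne: "t \<in> {r\<in>{m..t}. v r < 0}" using n t by (simp add: v_def)
 have bb: "bdd_below {r\<in>{m..t}. v r < 0}" by (auto intro!: bdd_belowI[of _ m])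
 have r: "m <= r" "r <= t" unfolding r_def using ne bb by (auto intro: cInf_lower cInf_greatest)
 have before: "v p >= 0" if "m <= p" "p < r" for p
  using cInf_lower[OF _ bb, of p] that r(2) unfolding r_def by force
 have dv: "(v has_real_derivative exp (k * s' p) - Ph (y' p) - (exp (k * s p) - Ph (y p))) (at p within {m..})" if "m <= p" for p
  unfolding v_def using that by (intro derivative_intros orbitD(2)[OF o(1)] orbitD(2)[OF o(2)]) auto
 have cv: "continuous_on {m..} v" by (rule DERIV_continuous_on[OF dv]) auto
 have vr: "v r >= 0"
 proof (cases "r = m")
  case True then show ?thesis using h by (simp add: v_def)
 next
  case False
  have "(v \<longlongrightarrow> v r) (at r within {m..<r})"
   using cv r(1) unfolding continuous_on_def by (metis atLeast_iff tendsto_within_subset atLeastLessThan_iff subsetI)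
  moreover have "\<forall>\<^sub>F p in at r within {m..<r}. 0 <= v p" using before by (auto simp: eventually_at_filter)
  moreover have "at r within {m..<r} ~= bot" using False r(1) by (simp add: at_within_eq_bot_iff)
  ultimately show ?thesis by (metis tendsto_lowerbound)
 qed
 have "0 <= (s' r - s r) - (s' m - s m)"
 proof -
  have "s' m - s m <= s' r - s r"
  proof (rule DERIV_nonneg_imp_increasing_open[OF r(1)])
   show "continuous_on {m..r} (%t. s' t - s t)"
    by (intro continuous_intros continuous_on_subset[OF DERIV_continuous_on[OF orbitD(1)[OF o(1)]]]
      continuous_on_subset[OF DERIV_continuous_on[OF orbitD(1)[OF o(2)]]]) auto
   fix p assume p: "m < p" "p < r"
   have "DERIV (%t. s' t - s t) p :> (y' p - gm) - (y p - gm)"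
    using orbitD(1)[OF o(1), of p] orbitD(1)[OF o(2), of p] p at_within_interior[of p "{m..}"] by (intro derivative_intros) auto
   then show "\<exists>z. DERIV (%t. s' t - s t) p :> z & 0 <= z" using before[of p] p
    by (intro exI[of _ "(y' p - gm) - (y p - gm)"]) (simp add: v_def)
  qed
  then show ?thesis by simp
 qed
 then have sr: "s r < s' r" using h by simp
 have "\<exists>d>0. \<forall>p. r < p & p < r + d --> v p >= 0"
 proof (cases "v r > 0")
  case True
  then obtain d where "d > 0" "!!p. p \<in> {m..} ==> dist p r < d ==> dist (v p) (v r) < v r"
   using cv r(1) unfolding continuous_on_iff by (metis atLeast_iff)
  then have "v p >= 0" if "r < p" "p < r + d" for p using that r(1) by (smt (verit) atLeast_iff dist_real_def)
  with \<open>d > 0\<close> show ?thesis by blast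
 next
  case False
  then have "y' r = y r" using vr by (simp add: v_def)
  then have "exp (k * s' r) - Ph (y' r) - (exp (k * s r) - Ph (y r)) > 0" using sr k by simp
  from has_real_derivative_pos_inc_right[OF dv[OF r(1)] this]
  obtain d where "d > 0" "!!h. 0 < h ==> r + h \<in> {m..} ==> h < d ==> v r < v (r + h)" by blast
  from this(1) this(2)[of "p - r" for p] show ?thesis using r(1) vr by (intro exI[of _ d]) (smt (verit) add_diff_cancel_left' atLeast_iff diff_add_cancel add.commute)
 qed
 then obtain d where d: "d > 0" "!!p. r < p ==> p < r + d ==> v p >= 0" by blast
 have "r + d <= r" unfolding r_def
 proof (rule cInf_greatest, use ne in blast)
  fix p assume p: "p \<in> {r \<in> {m..t}. v r < 0}"
  show "Inf {r \<in> {m..t}. v r < 0} + d <= p" using d(2)[of p] before[of p] vr p unfolding r_def[symmetric] by (metis (no_types, lifting) atLeastAtMost_iff leD linorder_cases linorder_not_less mem_Collect_eq)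
 qed
 with d(1) show False by simp
qed

end

text \<open>Backwards in time \<open>s\<close> increases to a limit \<open>l <= s0\<close>. If
  \<open>l < s0\<close>, then \<open>y\<close> decreases at a fixed rate wherever it is at least
  \<open>b\<close>; a value above \<open>b\<close> would lead backwards beyond \<open>gm\<close>. So
  \<open>y <= b < gm\<close> always, and \<open>s\<close> would grow linearly backwards.\<close>

lemma to_equilibrium:
 fixes s y Ph :: "real => real"
 assumes k: "k > 0" and e1: "e1 < gm" and cPh: "continuous_on {e1..gm} Ph" and s0: "exp (k * s0) = Ph gm"
  and ds: "!!t. DERIV s t :> y t - gm" and dy: "!!t. DERIV y t :> exp (k * s t) - Ph (y t)"
  and y: "!!t. e1 <= y t" "!!t. y t <= gm" and s: "!!t. s t <= s0"
 shows "(s \<longlongrightarrow> s0) at_bot"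
proof -
 have dec: "s t <= s r" if "r <= t" for r t
  using DERIV_nonpos_imp_nonincreasing[OF that, of s] ds y(2) by (metis diff_le_0_iff_le)
 obtain l where l: "((%r. s (- r)) \<longlongrightarrow> l) at_top" "!!r. 0 <= r ==> s (- r) <= l"
  by (rule increasing_bounded_tendsto[of 0 "%r. s (- r)" s0]) (use dec s in auto)
 have sl: "s t <= l" for t using l(2)[of "max 0 (- t)"] dec[of "- max 0 (- t)" t] by linarith
 have "l <= s0" by (rule tendsto_upperbound[OF l(1)]) (use s in auto)
 moreover have "\<not> l < s0"
 proof
  assume ls: "l < s0"
  define c where "c = (Ph gm - exp (k * l)) / 2"
  have c: "c > 0" using ls k by (simp add: c_def flip: s0)
  obtain d where d: "d > 0" "!!v. v \<in> {e1..gm} ==> abs (v - gm) < d ==> abs (Ph v - Ph gm) < c"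
   using cPh e1 c unfolding continuous_on_iff dist_real_def by (metis atLeastAtMost_iff less_eq_real_def)
  define b where "b = gm - d / 2"
  have y': "exp (k * s t) - Ph (y t) <= - c" if "b <= y t" for t
  proof -
   have "abs (Ph (y t) - Ph gm) < c" using y[of t] that d(1) by (intro d(2)) (auto simp: b_def)
   moreover have "exp (k * s t) <= exp (k * l)" using sl[of t] k by simp
   moreover have "2 * c = Ph gm - exp (k * l)" by (simp add: c_def)
   ultimately show ?thesis by linarith
  qed
  have yb: "y t0 <= b" for t0
  proof (rule ccontr)
   assume n: "\<not> y t0 <= b"
   have above: "y p > b" if "p <= t0" for p
   proof (rule ccontr)
    assume p: "\<not> y p > b"
    have "- b <= - y t0"
    proof (rule barrier[of p t0 "%t. - y t" "%t. - (exp (k * s t) - Ph (y t))"])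
     show "((%t. - y t) has_real_derivative - (exp (k * s t) - Ph (y t))) (at t within {p..t0})" for t
      by (intro derivative_intros has_field_derivative_at_within[OF dy])
     show "0 <= - (exp (k * s t) - Ph (y t))" if "- y t < - b" for t using y'[of t] that c by simp
    qed (use p that in auto)
    with n show False by simp
   qed
   define T where "T = t0 - ((gm - b) / c + 1)"
   have gb: "b <= gm" using d(1) by (simp add: b_def)
   have "0 <= (gm - b) / c" using c gb by simp
   then have T: "T <= t0" by (simp add: T_def)
   have "y t0 + c * t0 <= y T + c * T"
   proof (rule DERIV_nonpos_imp_nonincreasing[OF T])
    fix t assume t: "t <= t0"
    have "DERIV (%t. y t + c * t) t :> (exp (k * s t) - Ph (y t)) + c" by (auto intro!: derivative_eq_intros dy)
    moreover have "(exp (k * s t) - Ph (y t)) + c <= 0" using y'[of t] above[OF t] by simp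
    ultimately show "\<exists>v. DERIV (%t. y t + c * t) t :> v & v <= 0" by blast
   qed
   moreover have "c * (t0 - T) = gm - b + c" using c by (simp add: T_def distrib_left)
   ultimately show False using n y(2)[of T] c by (simp add: right_diff_distrib)
  qed
  define T where "T = - ((abs (s0 - s 0) + 1) * 2 / d)"
  have T: "T <= 0" using d(1) by (simp add: T_def)
  have "s 0 + d / 2 * 0 <= s T + d / 2 * T"
  proof (rule DERIV_nonpos_imp_nonincreasing[OF T])
   fix t
   have "DERIV (%t. s t + d / 2 * t) t :> (y t - gm) + d / 2" by (auto intro!: derivative_eq_intros ds)
   moreover have "(y t - gm) + d / 2 <= 0" using yb[of t] by (simp add: b_def)
   ultimately show "\<exists>v. DERIV (%t. s t + d / 2 * t) t :> v & v <= 0" by blast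
  qed
  moreover have "d / 2 * T = - (abs (s0 - s 0) + 1)" using d(1) by (simp add: T_def field_simps)
  ultimately show False using s[of T] by linarith
 qed
 ultimately have "l = s0" by simp
 with filterlim_compose[OF l(1) filterlim_uminus_at_top_at_bot] show ?thesis by simp
qed

text \<open>Dominated convergence in the integrated equation, so that pointwise convergence with
  bounded derivatives suffices. Continuity of the limit is the first conclusion, because in
  applications it yields the continuity of \<open>G\<close> required for the second.\<close>

lemma limit_derivative:
 fixes f g :: "nat => real => real"
 assumes d: "!!n t. t \<in> {a..b} ==> (f n has_real_derivative g n t) (at t within {a..b})"
  and M: "!!n t. t \<in> {a..b} ==> abs (g n t) <= M"
  and f: "!!t. t \<in> {a..b} ==> (%n. f n t) \<longlonglongrightarrow> F t" and g: "!!t. t \<in> {a..b} ==> (%n. g n t) \<longlonglongrightarrow> G t"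
 shows "continuous_on {a..b} F"
  and "continuous_on {a..b} G ==> t \<in> {a..b} ==> (F has_real_derivative G t) (at t within {a..b})"
proof -
 have ftc: "(g n has_integral f n t - f n a) {a..t}" if "t \<in> {a..b}" for n t
  using that by (intro fundamental_theorem_of_calculus)
   (auto simp: has_real_derivative_iff_has_vector_derivative[symmetric] intro: has_field_derivative_subset[OF d])
 have int: "G integrable_on {a..t} & F t = F a + integral {a..t} G" if t: "t \<in> {a..b}" for t
 proof -
  have 1: "g n integrable_on {a..t}" for n using ftc[OF t] by blast
  have 2: "(%_. M) integrable_on {a..t}" by (rule integrable_const_ivl)
  have 3: "norm (g n x) <= M" if "x \<in> {a..t}" for n x using M[of x n] that t by simp
  have 4: "(%n. g n x) \<longlonglongrightarrow> G x" if "x \<in> {a..t}" for x using g[of x] that t by simp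
  note dc = dominated_convergence[of g "{a..t}" "%_. M" G, OF 1 2 3 4]
  have "integral {a..t} (g n) = f n t - f n a" for n using ftc[OF t, of n] by (rule integral_unique)
  with dc(2) have "(%n. f n t - f n a) \<longlonglongrightarrow> integral {a..t} G" by simp
  moreover have "(%n. f n t - f n a) \<longlonglongrightarrow> F t - F a" using f[OF t] f[of a] t by (intro tendsto_diff) auto
  ultimately show ?thesis using dc(1) LIMSEQ_unique by fastforce
 qed
 have "continuous_on {a..b} (%t. F a + integral {a..t} G)"
 proof (cases "a <= b")
  case True
  with int[of b] show ?thesis by (intro continuous_intros indefinite_integral_continuous_1) auto
 qed auto
 moreover have eq: "F t = F a + integral {a..t} G" if "t \<in> {a..b}" for t using int[OF that] by simp
 ultimately show "continuous_on {a..b} F" using continuous_on_cong[OF refl eq, of "{a..b}" "%t. t"] by simp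
 assume G: "continuous_on {a..b} G" and t: "t \<in> {a..b}"
 have "((%t. F a + integral {a..t} G) has_real_derivative G t) (at t within {a..b})"
  using integral_has_real_derivative[OF G t] by (auto intro!: derivative_eq_intros)
 then show "(F has_real_derivative G t) (at t within {a..b})"
  by (rule has_field_derivative_transform_within[OF _ zero_less_one t]) (erule eq[symmetric])
qed

section \<open>The asymptotic constant as a function of the starting point\<close>

context half
begin

text \<open>Meaningful for \<open>sig <= s0\<close>, where the orbit exists; by
  \<open>orbit_unique\<close> the choice does not matter on nonnegative times.\<close>

definition S :: "real => real => real" where
 "S sig = (SOME s. \<exists>y. orbit {0..} s y & s 0 = sig & y 0 = gm)"

definition Y :: "real => real => real" where
 "Y sig = (SOME y. orbit {0..} (S sig) y & S sig 0 = sig & y 0 = gm)"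

lemma SY: assumes "sig <= s0" shows "orbit {0..} (S sig) (Y sig)" "S sig 0 = sig" "Y sig 0 = gm"
proof -
 have "\<exists>y. orbit {0..} (S sig) y & S sig 0 = sig & y 0 = gm"
  unfolding S_def by (rule someI_ex[of "%s. \<exists>y. orbit {0..} s y & s 0 = sig & y 0 = gm"]) (rule orbit_exists[OF assms])
 then have "orbit {0..} (S sig) (Y sig) & S sig 0 = sig & Y sig 0 = gm" unfolding Y_def by (rule someI_ex)
 then show "orbit {0..} (S sig) (Y sig)" "S sig 0 = sig" "Y sig 0 = gm" by auto
qed

lemma S_le: "sig <= s0 ==> 0 <= t ==> S sig t <= sig"
 using orbit_s(2)[OF orbit_subset[OF SY(1)], of sig t t] SY(2)[of sig] by auto

lemma Y_less:
 assumes "sig < s0" "t > 0" shows "Y sig t < gm"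
proof (rule ccontr)
 assume n: "\<not> Y sig t < gm"
 note o = SY(1)[OF less_imp_le[OF assms(1)]]
 have "Y sig t = gm" using orbitD(4)[OF o, of t] n assms by simp
 moreover have "exp (k * S sig t) < exp (k * s0)" using S_le[of sig t] assms k by simp
 ultimately have "exp (k * S sig t) - Ph (Y sig t) < 0" using s0 by simp
 from has_real_derivative_neg_dec_left[OF orbitD(2)[OF o] this]
 obtain d where d: "d > 0" "!!h. 0 < h ==> t - h \<in> {0..} ==> h < d ==> Y sig t < Y sig (t - h)" using assms by auto
 have "Y sig t < Y sig (t - min t (d / 2))" using d(1) assms by (intro d(2)) auto
 moreover have "Y sig (t - min t (d / 2)) <= gm" using orbitD(4)[OF o, of "t - min t (d / 2)"] by auto
 ultimately show False using n by simp
qed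

lemma SY_tail:
 assumes "sig < s0" shows "tail k gm e1 1 Ph (S sig) (Y sig)" "exp (k * S sig 1) < Ph gm"
proof -
 have o: "orbit {1..} (S sig) (Y sig)" using assms by (intro orbit_subset[OF SY(1)]) auto
 show "tail k gm e1 1 Ph (S sig) (Y sig)" using k e1 cPh pPh orbitD[OF o] Y_less[OF assms] by unfold_locales auto
 show "exp (k * S sig 1) < Ph gm" using S_le[of sig 1] assms k by (simp flip: s0)
qed

text \<open>The constant in the asymptotics of the half orbit from \<open>(sig, gm)\<close>. It
  increases with slope at least 1, is continuous and unbounded above, which is used to reach
  prescribed asymptotics.\<close>

definition C :: "real => real" where "C sig = Lim at_top (%t. S sig t + (gm - e1) * t - corr t)"

lemma C_lim:
 assumes "sig < s0" shows "((%t. S sig t + (gm - e1) * t - corr t) \<longlongrightarrow> C sig) at_top"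
proof -
 obtain l where "((%t. S sig t + (gm - e1) * t - corr t) \<longlongrightarrow> l) at_top"
  using asym[OF SY_tail(1)[OF assms] tail.s_to_minus_infinity[OF SY_tail[OF assms]]] by blast
 then show ?thesis unfolding C_def using tendsto_Lim[of at_top] by (metis trivial_limit_at_top_linorder)
qed

lemma S_diff_mono:
 assumes "sig <= sig'" "sig' <= s0" "0 <= r" "r <= t"
 shows "S sig' r - S sig r <= S sig' t - S sig t"
proof (cases "sig = sig'")
 case False
 then have "sig < sig'" "sig <= s0" using assms by auto
 note o = SY[OF this(2)] SY[OF assms(2)]
 show ?thesis
 proof (rule deriv_nonneg_mono[of 0 "%t. S sig' t - S sig t" "%t. (Y sig' t - gm) - (Y sig t - gm)"])
  show "((%t. S sig' t - S sig t) has_real_derivative (Y sig' t - gm) - (Y sig t - gm)) (at t within {0..})" if "0 <= t" for t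
   using that by (intro derivative_intros orbitD(1)[OF o(1)] orbitD(1)[OF o(4)]) auto
  show "0 <= (Y sig' t - gm) - (Y sig t - gm)" if "0 < t" for t
   using grow[OF o(1,4), of t] o that \<open>sig < sig'\<close> by simp
 qed (use assms in auto)
qed simp

lemma C_diff_lim:
 assumes "sig < s0" "sig' < s0" shows "((%t. S sig' t - S sig t) \<longlongrightarrow> C sig' - C sig) at_top"
 using tendsto_diff[OF C_lim[OF assms(2)] C_lim[OF assms(1)]] by (simp add: algebra_simps)

lemma C_diff_ge:
 assumes "sig <= sig'" "sig' < s0" "0 <= t" shows "S sig' t - S sig t <= C sig' - C sig"
proof (rule tendsto_lowerbound[OF C_diff_lim])
 show "\<forall>\<^sub>F r in at_top. S sig' t - S sig t <= S sig' r - S sig r"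
  unfolding eventually_at_top_linorder using S_diff_mono[of sig sig' t] assms by auto
qed (use assms in auto)

lemma C_increasing: "sig <= sig' ==> sig' < s0 ==> sig' - sig <= C sig' - C sig"
 using C_diff_ge[of sig sig' 0] SY(2)[of sig] SY(2)[of sig'] by simp

lemma S_dependence:
 assumes "T >= 0"
 obtains K where "K > 0" "!!sig sig'. sig1 <= sig ==> sig <= s0 ==> sig1 <= sig' ==> sig' <= s0 ==> abs (S sig T - S sig' T) <= K * abs (sig - sig')"
proof (rule dependence[OF assms, of sig1], goal_cases)
 case (1 K)
 have o: "orbit {0..T} (S sig) (Y sig)" if "sig <= s0" for sig by (rule orbit_subset[OF SY(1)[OF that]]) auto
 have "abs (S sig T - S sig' T) <= K * abs (sig - sig')" if "sig1 <= sig" "sig <= s0" "sig1 <= sig'" "sig' <= s0" for sig sig'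
  using 1(3)[OF o[OF that(2)] o[OF that(4)], of T] SY(2,3)[OF that(2)] SY(2,3)[OF that(4)] that assms by auto
 then show ?case by (rule that[OF 1(2)])
qed

lemma S_s0: assumes "0 <= T" shows "S s0 T = s0"
proof -
 have "orbit {0..T} (%_. s0) (%_. gm)" unfolding orbit_def using s0 e1 by auto
 from orbit_unique(1)[OF orbit_subset[OF SY(1)] this, of s0 T] show ?thesis using SY[of s0] assms by auto
qed

text \<open>Up to a fixed time a half orbit started close to \<open>s0\<close> stays near the
  equilibrium, while the one started at \<open>sig1\<close> has descended arbitrarily far. Their gap
  at that time is a lower bound for the difference of the constants.\<close>

lemma C_unbounded: obtains sig where "sig < s0" "C sig > B"
proof -
 define sig1 where "sig1 = s0 - 1"
 have lt: "sig1 < s0" by (simp add: sig1_def)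
 have "((%t. exp (k * S sig1 t)) \<longlongrightarrow> 0) at_top" by (rule tail.s_to_minus_infinity[OF SY_tail[OF lt]])
 from order_tendstoD(2)[OF this, of "exp (k * (s0 - 1 - (B - C sig1)))"]
 obtain T where "!!t. t >= T ==> exp (k * S sig1 t) < exp (k * (s0 - 1 - (B - C sig1)))" by (auto simp: eventually_at_top_linorder)
 from this[of "max T 0"] have T: "S sig1 (max T 0) < s0 - 1 - (B - C sig1)" using k by simp
 obtain K where K: "K > 0" "!!sig sig'. sig1 <= sig ==> sig <= s0 ==> sig1 <= sig' ==> sig' <= s0 ==> abs (S sig (max T 0) - S sig' (max T 0)) <= K * abs (sig - sig')"
  by (rule S_dependence[of "max T 0" sig1]) auto
 define sig where "sig = s0 - min 1 (1 / K)"
 have mK: "min 1 (1 / K) <= 1 / K" "min 1 (1 / K) > 0" "min 1 (1 / K) <= 1" using K(1) by auto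
 have sg: "sig < s0" "sig1 <= sig" unfolding sig_def sig1_def using mK by linarith+
 have "abs (S sig (max T 0) - s0) <= K * abs (sig - s0)" using K(2)[of sig s0] sg S_s0[of "max T 0"] by (simp add: sig1_def)
 also have "K * abs (sig - s0) <= K * (1 / K)" unfolding sig_def using mK K(1) by (intro mult_left_mono) auto
 finally have "S sig (max T 0) >= s0 - 1" using K(1) by simp
 with C_diff_ge[of sig1 sig "max T 0"] sg T have "C sig > B" by simp
 with sg show ?thesis using that by blast
qed

text \<open>Gaps between half orbits grow in time, so what the gap of \<open>sig\<close> and
  \<open>sig'\<close> gains after time \<open>t\<close> is at most what the gap of the extreme pair
  \<open>sig1\<close>, \<open>sig2\<close> gains, less than \<open>e / 2\<close>. Up to time
  \<open>t\<close> the dependence is Lipschitz.\<close>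

lemma C_continuous: "continuous_on {..<s0} C"
 unfolding continuous_on_iff
proof (intro ballI allI impI)
 fix sig0 e :: real assume "sig0 \<in> {..<s0}" and e: "0 < e"
 then have lt: "sig0 < s0" by simp
 define sig1 sig2 where "sig1 = sig0 - 1" and "sig2 = (sig0 + s0) / 2"
 have i: "sig1 < sig0" "sig0 < sig2" "sig2 < s0" using lt by (auto simp: sig1_def sig2_def)
 have "\<forall>\<^sub>F t in at_top. C sig2 - C sig1 - e / 2 < S sig2 t - S sig1 t"
  using order_tendstoD(1)[OF C_diff_lim[of sig1 sig2], of "C sig2 - C sig1 - e / 2"] i e by simp
 then obtain T where T: "!!t. t >= T ==> C sig2 - C sig1 - e / 2 < S sig2 t - S sig1 t" by (auto simp: eventually_at_top_linorder)
 define t where "t = max T 0"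
 obtain K where K: "K > 0" "!!sig sig'. sig1 <= sig ==> sig <= s0 ==> sig1 <= sig' ==> sig' <= s0 ==> abs (S sig t - S sig' t) <= K * abs (sig - sig')"
  by (rule S_dependence[of t sig1]) (auto simp: t_def)
 have main: "abs (C sig' - C sig) < K * abs (sig' - sig) + e / 2" if "sig1 <= sig" "sig <= sig'" "sig' <= sig2" for sig sig'
 proof -
  have "S sig t - S sig1 t <= C sig - C sig1" "S sig2 t - S sig' t <= C sig2 - C sig'" using that i by (auto intro!: C_diff_ge simp: t_def)
  moreover have "C sig2 - C sig1 - e / 2 < S sig2 t - S sig1 t" by (rule T) (simp add: t_def)
  moreover have "abs (S sig' t - S sig t) <= K * abs (sig' - sig)" using that i by (intro K(2)) auto
  moreover have "0 <= C sig' - C sig" using C_increasing[of sig sig'] that i by simp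
  ultimately show ?thesis by linarith
 qed
 define d where "d = min (min (sig0 - sig1) (sig2 - sig0)) (e / (2 * K))"
 have d: "d > 0" using i e K by (simp add: d_def)
 show "\<exists>d>0. \<forall>sig\<in>{..<s0}. dist sig sig0 < d --> dist (C sig) (C sig0) < e"
 proof (intro exI[of _ d] conjI d ballI impI)
  fix sig assume "dist sig sig0 < d"
  then have a: "abs (sig - sig0) < sig0 - sig1" "abs (sig - sig0) < sig2 - sig0" "abs (sig - sig0) < e / (2 * K)" by (auto simp: d_def dist_real_def)
  from a(3) have "K * abs (sig - sig0) < e / 2" using K(1) by (simp add: field_simps)
  moreover have "abs (C sig - C sig0) < K * abs (sig - sig0) + e / 2"
   using main[of sig0 sig] main[of sig sig0] a i by (cases "sig <= sig0") (auto simp: abs_minus_commute)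
  ultimately show "dist (C sig) (C sig0) < e" by (simp add: dist_real_def)
 qed
qed

end

section \<open>Global trajectories, time reversal and the connecting orbit\<close>

lemma first_crossing:
 fixes f :: "real => real"
 assumes cf: "continuous_on {a..b} f" and ab: "a <= b" "f a < c" "c <= f b"
 obtains p where "a < p" "p <= b" "f p = c" "!!r. a <= r ==> r < p ==> f r < c"
proof -
 define K where "K = {a..b} \<inter> f -` {c..}"
 have "closed K" unfolding K_def by (rule continuous_closed_preimage[OF cf]) auto
 moreover have "b \<in> K" using ab by (auto simp: K_def)
 moreover have "bdd_below K" by (auto simp: K_def intro!: bdd_belowI[of _ a])
 ultimately have pK: "Inf K \<in> K" and lb: "!!v. v \<in> K ==> Inf K <= v" by (auto intro: closed_contains_Inf cInf_lower)
 define p where "p = Inf K"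
 have p: "a < p" "p <= b" "f p >= c" using pK ab(2) by (auto simp: p_def K_def less_le)
 have below: "f r < c" if "a <= r" "r < p" for r using lb[of r] that p by (force simp: p_def K_def)
 obtain x where x: "a <= x" "x <= p" "f x = c"
  using IVT'[of f a c p] p ab continuous_on_subset[OF cf, of "{a..p}"] by auto
 then have "x = p" using below[of x] by force
 with x that[OF p(1,2) _ below] show ?thesis by simp
qed

text \<open>Because \<open>Ph e1 = 0\<close>, the line \<open>y = e1\<close> can only be crossed
  upwards. A trajectory on or below it was there at all earlier times, and then \<open>s\<close>
  grows at least linearly backwards, against its bound.\<close>

lemma above_root:
 fixes s y Ph :: "real => real"
 assumes e1: "e1 < gm" "Ph e1 = 0"
  and ds: "!!t. DERIV s t :> y t - gm" and dy: "!!t. DERIV y t :> exp (k * s t) - Ph (y t)"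
  and s: "!!t. s t <= s0"
 shows "e1 < y t0"
proof (rule ccontr)
 assume n: "\<not> e1 < y t0"
 have le: "y r <= e1" if r: "r <= t0" for r
 proof (rule ccontr)
  assume nr: "\<not> y r <= e1"
  have cy: "continuous_on {r..t0} (%t. - y t)" by (intro continuous_intros DERIV_continuous_on[OF has_field_derivative_at_within[OF dy]])
  obtain p where p: "r < p" "- y p = - e1" "!!v. r <= v ==> v < p ==> - y v < - e1"
  proof (rule first_crossing[OF cy r, of "- e1"], goal_cases)
   case (3 p) from 3(2,4,5) show ?case by (rule that)
  qed (use n nr in auto)
  from p(2) have "exp (k * s p) - Ph (y p) > 0" using e1 by simp
  from DERIV_pos_inc_left[OF dy this] obtain d where d: "d > 0" "!!h. 0 < h ==> h < d ==> y (p - h) < y p" by blast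
  define h where "h = min (d / 2) (p - r)"
  have "0 < h" "h < d" "h <= p - r" using p(1) d(1) by (auto simp: h_def)
  with d(2)[of h] p(3)[of "p - h"] p(2) show False by auto
 qed
 define T where "T = t0 - (s0 - s t0 + 1) / (gm - e1)"
 have T: "T <= t0" "(gm - e1) * (t0 - T) = s0 - s t0 + 1" using s[of t0] e1 by (auto simp: T_def)
 have "s t0 + (gm - e1) * t0 <= s T + (gm - e1) * T"
 proof (rule DERIV_nonpos_imp_nonincreasing[OF T(1)])
  fix t assume t: "t <= t0"
  have "DERIV (%t. s t + (gm - e1) * t) t :> (y t - gm) + (gm - e1)" by (auto intro!: derivative_eq_intros ds)
  then show "\<exists>v. DERIV (%t. s t + (gm - e1) * t) t :> v & v <= 0" using le[OF t] by force
 qed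
 with T(2) s[of T] show False by (simp add: right_diff_distrib)
qed

text \<open>Below \<open>gm\<close> the function \<open>s\<close> strictly decreases, so at a first
  return of \<open>y\<close> to \<open>gm\<close> its derivative would be negative, which is
  impossible when coming from below. Waiting one more unit of time makes the inequality for
  \<open>s\<close> strict.\<close>

lemma tail_from_below:
 fixes s y Ph :: "real => real"
 assumes k: "k > 0" and e1: "e1 < gm" and cPh: "continuous_on {e1..gm} Ph" and pPh: "!!v. e1 < v ==> v <= gm ==> Ph v > 0"
  and s0: "exp (k * s0) = Ph gm"
  and ds: "!!t. DERIV s t :> y t - gm" and dy: "!!t. DERIV y t :> exp (k * s t) - Ph (y t)"
  and y: "!!t. e1 < y t" and s: "!!t. s t <= s0" and T: "y T < gm"
 shows "\<exists>T'. tail k gm e1 T' Ph s y & exp (k * s T') < Ph gm"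
proof -
 have cy: "continuous_on A y" for A by (rule DERIV_continuous_on[OF has_field_derivative_at_within[OF dy]])
 have less: "s b < s a" if "a < b" "!!r. a < r ==> r < b ==> y r < gm" for a b
 proof (rule DERIV_neg_imp_decreasing_open[OF that(1)])
  fix r assume "a < r" "r < b"
  then show "\<exists>v. DERIV s r :> v & v < 0" using ds[of r] that(2)[of r] by (intro exI[of _ "y r - gm"]) simp
 next
  show "continuous_on {a..b} s" by (rule DERIV_continuous_on[OF has_field_derivative_at_within[OF ds]])
 qed
 have below: "y r < gm" if r: "T <= r" for r
 proof (rule ccontr)
  assume n: "\<not> y r < gm"
  obtain p where p: "T < p" "y p = gm" "!!v. T <= v ==> v < p ==> y v < gm"
  proof (rule first_crossing[OF cy[of "{T..r}"] r, of gm], goal_cases)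
   case (3 p) from 3(2,4,5) show ?case by (rule that)
  qed (use n T in auto)
  have "s p < s T" using p by (intro less) auto
  then have "exp (k * s p) < exp (k * s0)" using s[of T] k by simp
  then have "exp (k * s p) - Ph (y p) < 0" using p(2) s0 by simp
  from DERIV_neg_dec_left[OF dy this] obtain d where d: "d > 0" "!!h. 0 < h ==> h < d ==> y p < y (p - h)" by blast
  define h where "h = min (d / 2) (p - T)"
  have "0 < h" "h < d" "h <= p - T" using p(1) d(1) by (auto simp: h_def)
  with d(2)[of h] p(3)[of "p - h"] p(2) show False by auto
 qed
 have "s (T + 1) < s T" using below by (intro less) auto
 then have "exp (k * s (T + 1)) < exp (k * s0)" using s[of T] k by simp
 moreover have "tail k gm e1 (T + 1) Ph s y"
  using k e1 cPh pPh y below by unfold_locales (auto intro: has_field_derivative_at_within ds dy)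
 ultimately show ?thesis using s0 by metis
qed

text \<open>Reversing time and reflecting the slope at \<open>gm\<close> preserves the form of the
  system and reflects \<open>F\<close>. Behaviour at the origin thereby becomes behaviour at
  infinity.\<close>

lemma reflected_derivatives:
 fixes s y F :: "real => real"
 assumes ds: "!!t. DERIV s t :> y t - gm" and dy: "!!t. DERIV y t :> exp (k * s t) - F (y t)"
 shows "DERIV (%t. s (- t)) t :> (2 * gm - y (- t)) - gm"
  and "DERIV (%t. 2 * gm - y (- t)) t :> exp (k * s (- t)) - F (2 * gm - (2 * gm - y (- t)))"
 using DERIV_chain'[OF DERIV_minus[OF DERIV_ident] ds[of "- t"]] DERIV_diff[OF DERIV_const[of "2 * gm"] DERIV_chain'[OF DERIV_minus[OF DERIV_ident] dy[of "- t"]]]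
 by simp_all

context half
begin

text \<open>If the second orbit were ahead in both coordinates, \<open>grow\<close> would keep its
  gap in \<open>s\<close> from shrinking, so the gap could not tend to 0.\<close>

lemma no_crossing:
 assumes o: "orbit {T..} s y" "orbit {T..} s' y'" and lim: "((%t. s' t - s t) \<longlongrightarrow> 0) at_top" and h: "s T < s' T"
 shows "y' T < y T"
proof (rule ccontr)
 assume "\<not> y' T < y T"
 then have yy: "y t <= y' t" if "T <= t" for t using grow[OF o h _ that] by simp
 have "s' T - s T <= s' t - s t" if "T <= t" for t
 proof (rule deriv_nonneg_mono[of T "%t. s' t - s t" "%t. (y' t - gm) - (y t - gm)"])
  show "((%t. s' t - s t) has_real_derivative (y' t - gm) - (y t - gm)) (at t within {T..})" if "T <= t" for t
   using that by (intro derivative_intros orbitD(1)[OF o(1)] orbitD(1)[OF o(2)]) auto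
 qed (use yy that in auto)
 then have "s' T - s T <= 0" by (intro tendsto_lowerbound[OF lim]) (auto simp: eventually_at_top_linorder)
 with h show False by simp
qed

lemma ordered_orbits:
 assumes o: "orbit {T..} s y" "orbit {T..} s' y'" and lim: "((%t. s' t - s t) \<longlongrightarrow> 0) at_top" and yT: "y T = gm" and t: "T <= t"
 shows "s t <= s' t" "y' t <= y t"
proof -
 have lim': "((%t. s t - s' t) \<longlongrightarrow> 0) at_top" using tendsto_minus[OF lim] by simp
 have o': "orbit {r..} s y" "orbit {r..} s' y'" if "T <= r" for r using that by (auto intro: orbit_subset[OF o(1)] orbit_subset[OF o(2)])
 have d: "((%t. s' t - s t) has_real_derivative (y' r - gm) - (y r - gm)) (at r within {T..})" if "T <= r" for r
  using that by (intro derivative_intros orbitD(1)[OF o(1)] orbitD(1)[OF o(2)]) auto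
 have up: "y r < y' r" if "T <= r" "s' r < s r" for r using no_crossing[OF o'(2)[OF that(1)] o'(1)[OF that(1)] lim' that(2)] .
 have ge: "0 <= s' r - s r" if r: "T <= r" for r
 proof (rule barrier[of T r "%t. s' t - s t" "%r. (y' r - gm) - (y r - gm)"])
  show "((%t. s' t - s t) has_real_derivative (y' v - gm) - (y v - gm)) (at v within {T..r})" if "v \<in> {T..r}" for v
   using d[of v] that by (auto intro: has_field_derivative_subset)
  show "s' T - s T >= 0" using up[of T] yT orbitD(4)[OF o(2), of T] by force
  show "0 <= (y' v - gm) - (y v - gm)" if "v \<in> {T..r}" "s' v - s v < 0" for v using up[of v] that by simp
 qed (use r in auto)
 then show "s t <= s' t" using t by force
 show "y' t <= y t"
 proof (rule ccontr)
  assume n: "\<not> y' t <= y t"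
  then have "t ~= T" using yT orbitD(4)[OF o(2), of T] by auto
  have "s t = s' t" using no_crossing[OF o'[OF t] lim] n ge[OF t] by force
  moreover have "(y' t - gm) - (y t - gm) > 0" using n by simp
  from has_real_derivative_pos_inc_left[OF d[OF t] this]
  obtain e where e: "e > 0" "!!h. 0 < h ==> t - h \<in> {T..} ==> h < e ==> s' (t - h) - s (t - h) < s' t - s t" by blast
  define h where "h = min (e / 2) (t - T)"
  have "0 < h" "h < e" "h <= t - T" using e(1) t \<open>t ~= T\<close> by (auto simp: h_def)
  ultimately show False using e(2)[of h] ge[of "t - h"] by force
 qed
qed

text \<open>The half orbits starting at \<open>(sig, gm)\<close>, translated in time so that they have the same asymptotics,
 are monotone in \<open>sig\<close>; their limit for \<open>sig \<rightarrow> s0\<close> connects the equilibrium with the root \<open>e1\<close>.\<close>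

lemma connecting_orbit:
 obtains s y where "!!t. DERIV s t :> y t - gm" "!!t. DERIV y t :> exp (k * s t) - Ph (y t)"
  "!!t. e1 < y t" "!!t. y t < gm" "!!t. s t <= s0" "(s \<longlongrightarrow> s0) at_bot"
proof -
 define sig where "sig n = s0 - 1 / (real n + 1)" for n
 have sig: "sig n < s0" for n by (simp add: sig_def)
 have sigmono: "sig n <= sig m" if "n <= m" for n m using that by (simp add: sig_def frac_le)
 \<comment> \<open>Here \<open>tau n\<close> is a time shift, unrelated to the exponent: translating
   by it removes the asymptotic constant \<open>C (sig n)\<close>. As the constants are unbounded,
   the starting times \<open>- tau n\<close> tend to minus infinity.\<close>
 define tau where "tau n = C (sig n) / (gm - e1)" for n
 have tauC: "(gm - e1) * tau n = C (sig n)" for n using e1 by (simp add: tau_def)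
 have taumono: "tau n <= tau m" if "n <= m" for n m
  unfolding tau_def using C_increasing[OF sigmono[OF that] sig] sigmono[OF that] e1 by (intro divide_right_mono) auto
 have taularge: "\<exists>n. - tau n < a" for a
 proof -
  obtain sig' where s': "sig' < s0" "C sig' > - a * (gm - e1)" by (rule C_unbounded)
  obtain n where n: "1 / (s0 - sig') < real n" using reals_Archimedean2 by blast
  have "1 / (real n + 1) <= s0 - sig'" using n s'(1) by (simp add: field_simps)
  then have "C sig' <= C (sig n)" using C_increasing[of sig' "sig n"] sig by (simp add: sig_def)
  then have "- a * (gm - e1) < C (sig n)" using s'(2) by simp
  then show ?thesis using e1 by (intro exI[of _ n]) (simp add: tau_def field_simps)
 qed
 define z w where "z n t = S (sig n) (t + tau n)" and "w n t = Y (sig n) (t + tau n)" for n t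
 have orb: "orbit {- tau n..} (z n) (w n)" for n
  using orbit_shift[OF SY(1)[OF less_imp_le[OF sig]], of "tau n" n] unfolding z_def w_def by simp
 have zlim: "((%t. z n t + (gm - e1) * t - corr t) \<longlongrightarrow> 0) at_top" for n
 proof -
  have "filterlim (%t::real. t + tau n) at_top at_top" using filterlim_tendsto_add_at_top[OF tendsto_const[of "tau n"] filterlim_ident] by (simp add: add.commute)
  from tendsto_add[OF filterlim_compose[OF C_lim[OF sig] this] corr[of "tau n"]]
  have "((%t. (z n t + (gm - e1) * t - corr t) + C (sig n)) \<longlongrightarrow> C (sig n)) at_top"
   by (simp add: z_def algebra_simps flip: tauC)
  from tendsto_diff[OF this tendsto_const[of "C (sig n)"]] show ?thesis by simp
 qed
 have dlim: "((%t. z m t - z n t) \<longlongrightarrow> 0) at_top" for m n using tendsto_diff[OF zlim[of m] zlim[of n]] by simp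
 have mono: "z n t <= z m t & w m t <= w n t" if "n <= m" "- tau n <= t" for n m t
 proof -
  have "orbit {- tau n..} (z m) (w m)" by (rule orbit_subset[OF orb]) (use taumono[OF that(1)] in auto)
  moreover have "w n (- tau n) = gm" using SY(3)[of "sig n"] sig[of n] by (simp add: w_def)
  ultimately show ?thesis using ordered_orbits[OF orb[of n] _ dlim _ that(2), of m] by blast
 qed
 have b: "e1 < w n t" "w n t <= gm" "z n t <= s0" if "- tau n <= t" for n t using orbitD[OF orb, of t n] that by auto
 have "\<exists>x. (%n. z n t) \<longlonglongrightarrow> x" for t
 proof -
  obtain N where N: "- tau N < t" using taularge by blast
  have i: "- tau (n + N) <= t" for n using taumono[of N "n + N"] N by simp
  have "incseq (%n. z (n + N) t)" unfolding incseq_def using mono i by auto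
  then obtain x where "(%n. z (n + N) t) \<longlonglongrightarrow> x" using incseq_convergent[of _ s0] b(3)[OF i] by metis
  then show ?thesis using LIMSEQ_offset[of "%n. z n t" N x] by blast
 qed
 then obtain zz where zz: "!!t. (%n. z n t) \<longlonglongrightarrow> zz t" by metis
 have "\<exists>x. (%n. w n t) \<longlonglongrightarrow> x" for t
 proof -
  obtain N where N: "- tau N < t" using taularge by blast
  have i: "- tau (n + N) <= t" for n using taumono[of N "n + N"] N by simp
  have "decseq (%n. w (n + N) t)" unfolding decseq_def using mono i by auto
  then obtain x where "(%n. w (n + N) t) \<longlonglongrightarrow> x" using decseq_convergent[of _ e1] b(1)[OF i] by (metis less_imp_le)
  then show ?thesis using LIMSEQ_offset[of "%n. w n t" N x] by blast
 qed
 then obtain ww where ww: "!!t. (%n. w n t) \<longlonglongrightarrow> ww t" by metis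
 have bounds: "e1 <= ww t & ww t < gm & zz t <= s0" for t
 proof -
  obtain N where N: "- tau N < t" using taularge by blast
  have i: "- tau n <= t" if "n >= N" for n using taumono[OF that] N by simp
  have "e1 <= ww t" by (rule tendsto_lowerbound[OF ww]) (use b(1)[OF i] in \<open>auto simp: eventually_sequentially intro!: exI[of _ N] less_imp_le\<close>)
  moreover have "zz t <= s0" by (rule tendsto_upperbound[OF zz]) (use b(3)[OF i] in \<open>auto simp: eventually_sequentially intro!: exI[of _ N]\<close>)
  moreover have "ww t <= w N t" by (rule tendsto_upperbound[OF ww]) (use mono[OF _ less_imp_le[OF N]] in \<open>auto simp: eventually_sequentially intro!: exI[of _ N]\<close>)
  moreover have "w N t < gm" unfolding w_def using N by (intro Y_less sig) simp
  ultimately show ?thesis by simp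
 qed
 obtain B where B: "!!v. v \<in> {e1..gm} ==> abs (Ph v) <= B"
 proof -
  have "compact (Ph ` {e1..gm})" by (intro compact_continuous_image cPh) auto
  then show ?thesis using that by (force dest!: compact_imp_bounded simp: bounded_iff)
 qed
 have ode: "DERIV zz t :> ww t - gm" "DERIV ww t :> exp (k * zz t) - Ph (ww t)" for t
 proof -
  obtain N where N: "- tau N < t - 1" using taularge by blast
  let ?I = "{t - 1..t + 1}"
  have i: "- tau (n + N) <= r" if "r \<in> ?I" for n r using taumono[of N "n + N"] N that by simp
  have o: "orbit ?I (z (n + N)) (w (n + N))" for n by (rule orbit_subset[OF orb]) (use i in auto)
  have zN: "(%n. z (n + N) r) \<longlonglongrightarrow> zz r" and wN: "(%n. w (n + N) r) \<longlonglongrightarrow> ww r" for r using zz ww by (auto intro: LIMSEQ_ignore_initial_segment)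
  have 1: "(%n. w (n + N) r - gm) \<longlonglongrightarrow> ww r - gm" for r by (intro tendsto_intros wN)
  have M1: "abs (w (n + N) r - gm) <= gm - e1" if "r \<in> ?I" for n r using orbitD(3,4)[OF o that, of n] by simp
  have PhN: "(%n. Ph (w (n + N) r)) \<longlonglongrightarrow> Ph (ww r)" if r: "r \<in> ?I" for r
   by (rule continuous_on_tendsto_compose[OF cPh wN]) (use bounds[of r] orbitD(3,4)[OF o r] in \<open>auto intro!: always_eventually less_imp_le\<close>)
  have 2: "(%n. exp (k * z (n + N) r) - Ph (w (n + N) r)) \<longlonglongrightarrow> exp (k * zz r) - Ph (ww r)" if "r \<in> ?I" for r
   by (intro tendsto_intros zN PhN that)
  have M2: "abs (exp (k * z (n + N) r) - Ph (w (n + N) r)) <= exp (k * s0) + B" if "r \<in> ?I" for n r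
  proof -
   have "exp (k * z (n + N) r) <= exp (k * s0)" using orbitD(5)[OF o that, of n] k by simp
   then show ?thesis using B[of "w (n + N) r"] orbitD(3,4)[OF o that, of n] exp_gt_zero[of "k * z (n + N) r"] unfolding atLeastAtMost_iff by linarith
  qed
  note lz = limit_derivative[of "t - 1" "t + 1" "%n. z (n + N)" "%n r. w (n + N) r - gm", OF orbitD(1)[OF o] M1 zN 1]
  note lw = limit_derivative[of "t - 1" "t + 1" "%n. w (n + N)" "%n r. exp (k * z (n + N) r) - Ph (w (n + N) r)", OF orbitD(2)[OF o] M2 wN 2]
  have c: "continuous_on ?I zz" "continuous_on ?I ww" using lz(1) lw(1) by auto
  have "continuous_on ?I (%r. Ph (ww r))"
   by (rule continuous_on_compose2[OF cPh c(2)], rule image_subsetI) (use bounds[THEN conjunct1] bounds[THEN conjunct2, THEN conjunct1] in \<open>simp add: less_imp_le\<close>)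
  then have c': "continuous_on ?I (%r. ww r - gm)" "continuous_on ?I (%r. exp (k * zz r) - Ph (ww r))" using c by (auto intro!: continuous_intros)
  have at: "at t within ?I = at t" by (rule at_within_interior) simp
  show "DERIV zz t :> ww t - gm" using lz(2)[OF _ _ c'(1), of t] unfolding at by auto
  show "DERIV ww t :> exp (k * zz t) - Ph (ww t)" using lw(2)[OF _ _ _ c'(2), of t] unfolding at by auto
 qed
 \<comment> \<open>In the limit only the weak inequality survives; the strict one follows because
   the limit is a trajectory on the whole line.\<close>
 have "e1 < ww t" for t by (rule above_root[OF e1 Ph0 ode]) (use bounds in auto)
 moreover have "(zz \<longlongrightarrow> s0) at_bot"
  by (rule to_equilibrium[OF k e1 cPh s0 ode]) (use bounds in \<open>auto intro: less_imp_le\<close>)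
 ultimately show ?thesis using that[of zz ww] ode bounds by blast
qed

end

section \<open>The zeros of the nonlinearity\<close>

lemma half_simpleI:
 assumes "k > 0" "e1 < gm" "continuous_on {e1..gm} Ph" "Ph e1 = 0" "!!v. e1 < v ==> v <= gm ==> Ph v > 0" "exp (k * s0) = Ph gm"
  and "!!a. e1 < a ==> \<exists>L>0. \<forall>x\<in>{a..gm}. \<forall>y\<in>{a..gm}. abs (Ph x - Ph y) <= L * abs (x - y)"
  and cd: "c > 0" "d > 0" "!!e. 0 <= e ==> e <= d ==> c * e <= Ph (e1 + e)"
 shows "half k gm e1 s0 Ph (%_. 0)"
proof (unfold_locales)
 fix T s y assume "tail k gm e1 T Ph s y" "((%t. exp (k * s t)) \<longlongrightarrow> 0) at_top"
 from tail.asymptotics_simple[OF this cd] show "\<exists>l. ((%t. s t + (gm - e1) * t - 0) \<longlongrightarrow> l) at_top" by auto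
qed (use assms in auto)

lemma half_doubleI:
 assumes "k > 0" "e1 < gm" "continuous_on {e1..gm} Ph" "Ph e1 = 0" "!!v. e1 < v ==> v <= gm ==> Ph v > 0" "exp (k * s0) = Ph gm"
  and "!!a. e1 < a ==> \<exists>L>0. \<forall>x\<in>{a..gm}. \<forall>y\<in>{a..gm}. abs (Ph x - Ph y) <= L * abs (x - y)"
  and cd: "a > 0" "d > 0" "C > 0" "!!e. 0 <= e ==> e <= d ==> abs (Ph (e1 + e) - a * e^2) <= C * e ^ 3"
 shows "half k gm e1 s0 Ph (%t. ln t / a)"
proof (unfold_locales)
 fix T s y assume "tail k gm e1 T Ph s y" "((%t. exp (k * s t)) \<longlongrightarrow> 0) at_top"
 from tail.asymptotics_double[OF this cd] show "\<exists>l. ((%t. s t + (gm - e1) * t - ln t / a) \<longlongrightarrow> l) at_top" by auto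
next
 fix c :: real
 have "((%t. c / t) \<longlongrightarrow> 0) at_top" by (rule tendsto_divide_0[OF tendsto_const filterlim_at_top_imp_at_infinity[OF filterlim_ident]])
 then have "((%t. ln (1 + c / t) / a) \<longlongrightarrow> ln (1 + 0) / a) at_top" using cd(1) by (intro tendsto_intros) auto
 then have "((%t. ln (1 + c / t) / a) \<longlongrightarrow> 0) at_top" by simp
 then show "((%t. ln (t + c) / a - ln t / a) \<longlongrightarrow> 0) at_top"
 proof (rule Lim_transform_eventually)
  have "ln (1 + c / t) / a = ln (t + c) / a - ln t / a" if "max 1 (1 - c) <= t" for t
  proof -
   have "ln (1 + c / t) = ln ((t + c) / t)" using that by (simp add: field_simps)
   also have "... = ln (t + c) - ln t" using that by (intro ln_divide_pos) auto
   finally show ?thesis by (simp add: diff_divide_distrib)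
  qed
  then show "\<forall>\<^sub>F t in at_top. ln (1 + c / t) / a = ln (t + c) / a - ln t / a" unfolding eventually_at_top_linorder by blast
 qed
qed (use assms in auto)

context params
begin

text \<open>For \<open>y > 0\<close> this is \<open>f_tilde\<close> at \<open>- y\<close>, so its
  zeros are the negatives of the roots in the statement of the theorem.\<close>

definition h :: "real => real" where "h y = y - 2 * rho + lam * y powr (- tau)"

lemma F_h: "y > 0 ==> F y = y * h y"
proof -
 assume y: "y > 0"
 have "y powr (1 - tau) = y * y powr (- tau)" using y by (simp add: powr_diff powr_minus field_simps)
 then show ?thesis using y by (simp add: F_def h_def power2_eq_square algebra_simps)
qed

lemma h_pos_iff: "y > 0 ==> F y > 0 \<longleftrightarrow> h y > 0" by (simp add: F_h zero_less_mult_iff)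

text \<open>Negation reverses the order: \<open>varpi1\<close> belongs to the larger zero
  \<open>Y1\<close>, \<open>varpi2\<close> to the smaller one.\<close>

lemma varpi_eq:
 assumes "{y. 0 < y & h y = 0} = {Y2, Y1}" "Y2 <= Y1"
 shows "varpi1 rho lam tau = - Y1" "varpi2 rho lam tau = - Y2"
proof -
 have "{t. t < 0 & f_tilde rho lam tau t = 0} = uminus ` {y. 0 < y & h y = 0}"
  by (force simp: f_tilde_def h_def image_iff intro!: exI[of _ "- x" for x])
 also have "... = {- Y2, - Y1}" unfolding assms by simp
 finally have *: "{t. t < 0 & f_tilde rho lam tau t = 0} = {- Y2, - Y1}" .
 show "varpi1 rho lam tau = - Y1" "varpi2 rho lam tau = - Y2"
  unfolding varpi1_def varpi2_def * using assms(2) by auto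
qed

lemma continuous_h: "0 < a ==> continuous_on {a..b} h"
 unfolding h_def by (intro continuous_intros) auto

lemma small_powr:
 assumes "0 < tau" "0 < b" obtains y where "0 < y" "y <= b" "M <= y powr (- tau)"
proof -
 define M' where "M' = max M (b powr (- tau))"
 have M': "M' > 0" using assms by (auto simp: M'_def less_max_iff_disj)
 show ?thesis
 proof (rule that[of "M' powr (- 1 / tau)"])
  have "(M' powr (- 1 / tau)) <= (b powr (- tau)) powr (- 1 / tau)" using assms M' by (intro powr_mono2') (auto simp: M'_def)
  then show "M' powr (- 1 / tau) <= b" using assms by (simp add: powr_powr)
  show "M <= (M' powr (- 1 / tau)) powr (- tau)" using assms M' by (simp add: powr_powr) (simp add: M'_def)
 qed (use M' in auto)
qed

lemma h_affine: "tau = 0 \<or> lam = 0 ==> y > 0 ==> h y = y - (2 * rho - lam)"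
 by (auto simp: h_def)

text \<open>In this case the power term is constant or nondecreasing, so \<open>h\<close> increases
  with slope at least 1 and has a single zero.\<close>

lemma case_N1_root:
 assumes "case_N1 rho lam tau"
 obtains Y where "0 < Y" "{y. 0 < y & h y = 0} = {Y}" "\<forall>y\<ge>Y. y - Y <= h y" "\<forall>y. 0 < y & y < Y --> h y < 0"
proof -
 have steep: "y - x <= h y - h x" if "0 < x" "x <= y" for x y
 proof (cases "tau = 0 \<or> lam = 0")
  case True then show ?thesis using that by (simp add: h_affine)
 next
  case False
  then have "lam < 0" using assms by (auto simp: case_N1_def)
  then have "lam * x powr (- tau) <= lam * y powr (- tau)" using that tau by (intro mult_left_mono_neg powr_mono2') auto
  then show ?thesis by (simp add: h_def)
 qed
 obtain Y where Y: "0 < Y" "h Y = 0"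
 proof (cases "tau = 0 \<or> lam = 0")
  case True
  then have "2 * rho - lam > 0" using assms by (auto simp: case_N1_def)
  then show ?thesis using True by (intro that[of "2 * rho - lam"]) (auto simp: h_affine)
 next
  case False
  then have l: "lam < 0" "0 < tau" using assms by (auto simp: case_N1_def)
  obtain x where x: "0 < x" "x <= 1" "(2 * abs rho + 2) / (- lam) <= x powr (- tau)" using small_powr[OF l(2), of 1] by auto
  have "lam * x powr (- tau) <= - (2 * abs rho + 2)" using x(3) l(1) by (simp add: field_simps)
  then have hx: "h x <= 0" using x(2) by (simp add: h_def)
  define y where "y = 1 + x - h x"
  have "y - x <= h y - h x" using x hx by (intro steep) (auto simp: y_def)
  then have hy: "0 <= h y" by (simp add: y_def)
  obtain Y where "x <= Y" "Y <= y" "h Y = 0" using IVT'[of h x 0 y] hx hy continuous_h[OF x(1), of y] by (auto simp: y_def)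
  then show ?thesis using x(1) that[of Y] by auto
 qed
 have neg: "h y < 0" if "0 < y" "y < Y" for y using steep[of y Y] that Y by simp
 have pos: "y - Y <= h y" if "Y <= y" for y using steep[of Y y] that Y by simp
 have "y = Y" if "0 < y" "h y = 0" for y using neg[of y] pos[of y] that by (cases y Y rule: linorder_cases) auto
 with Y have "{y. 0 < y & h y = 0} = {Y}" by blast
 with Y(1) show ?thesis using pos neg by (intro that) auto
qed

text \<open>The minimum point of \<open>h\<close> for \<open>lam > 0\<close> and
  \<open>tau > 0\<close>. The minimum value is \<open>2 * (Upsilon lam tau - rho)\<close>, which is
  why \<open>Upsilon\<close> separates the cases.\<close>

definition ystar :: real where "ystar = (lam * tau) powr (1 / (tau + 1))"

lemma
 assumes l: "lam > 0" "0 < tau"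
 shows ystar_pos: "ystar > 0" and ystar_powr: "lam * tau = ystar powr (tau + 1)"
  and lam_ystar: "lam * ystar powr (- tau) = ystar / tau" and Upsilon_ystar: "2 * Upsilon lam tau = ystar * (tau + 1) / tau"
proof -
 show p: "ystar > 0" using l by (simp add: ystar_def)
 show e: "lam * tau = ystar powr (tau + 1)" using l by (simp add: ystar_def powr_powr)
 have "ystar powr (tau + 1) * ystar powr (- tau) = ystar" using p by (simp flip: powr_add)
 then have "lam * tau * ystar powr (- tau) = ystar" by (simp add: e)
 then show "lam * ystar powr (- tau) = ystar / tau" using l by (simp add: field_simps)
 show "2 * Upsilon lam tau = ystar * (tau + 1) / tau" using l by (simp add: Upsilon_def ystar_def)
qed

lemma h_ystar: "lam > 0 ==> 0 < tau ==> h ystar = 2 * (Upsilon lam tau - rho)"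
proof -
 assume l: "lam > 0" "0 < tau"
 have "ystar + ystar / tau = 2 * Upsilon lam tau" unfolding Upsilon_ystar[OF l] using l by (simp add: field_simps)
 then show ?thesis using lam_ystar[OF l] by (simp add: h_def)
qed

lemma h_derivative:
 assumes l: "lam > 0" "0 < tau" and y: "y > 0"
 shows "DERIV h y :> 1 - (ystar / y) powr (tau + 1)"
proof -
 have "DERIV h y :> 1 + lam * (- tau * y powr (- tau - 1))"
  unfolding h_def[abs_def] using y by (auto intro!: derivative_eq_intros has_real_derivative_powr)
 moreover have "lam * (- tau * y powr (- tau - 1)) = - ((ystar / y) powr (tau + 1))"
 proof -
  have "lam * (- tau * y powr (- tau - 1)) = - (lam * tau) * y powr (- (tau + 1))" by simp
  also have "... = - ((ystar / y) powr (tau + 1))" unfolding ystar_powr[OF l]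
   using y ystar_pos[OF l] by (simp only: powr_divide powr_minus_divide) simp
  finally show ?thesis .
 qed
 ultimately show ?thesis by simp
qed

lemma h_decreasing:
 assumes l: "lam > 0" "0 < tau" and y: "0 < x" "x < y" "y <= ystar" shows "h y < h x"
proof (rule DERIV_neg_imp_decreasing_open[OF y(2)])
 fix t assume t: "x < t" "t < y"
 have "1 < (ystar / t) powr (tau + 1)" using t y l by (intro gr_one_powr) auto
 then show "\<exists>v. DERIV h t :> v & v < 0" using h_derivative[OF l, of t] t y
  by (intro exI[of _ "1 - (ystar / t) powr (tau + 1)"] conjI) auto
qed (use continuous_h y in auto)

lemma h_increasing:
 assumes l: "lam > 0" "0 < tau" and y: "ystar <= x" "x < y" shows "h x < h y"
proof (rule DERIV_pos_imp_increasing_open[OF y(2)])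
 have x: "0 < x" using y ystar_pos[OF l] by simp
 fix t assume t: "x < t" "t < y"
 have "(ystar / t) powr (tau + 1) < 1 powr (tau + 1)" using t y x l ystar_pos[OF l] by (intro powr_less_mono2) auto
 then show "\<exists>v. DERIV h t :> v & v > 0" using h_derivative[OF l, of t] t x
  by (intro exI[of _ "1 - (ystar / t) powr (tau + 1)"] conjI) auto
next
 show "continuous_on {x..y} h" using y ystar_pos[OF l] by (intro continuous_h) auto
qed

lemma h_ge_ystar:
 assumes l: "lam > 0" "0 < tau" and y: "0 < y" shows "h ystar <= h y"
 using h_decreasing[OF l y, of ystar] h_increasing[OF l, of ystar y] by (cases y ystar rule: linorder_cases) auto

lemma case_N2_roots:
 assumes N2: "case_N2 rho lam tau"
 obtains Y2 Y1 where "0 < Y2" "Y2 <= ystar" "ystar <= Y1" "h Y2 = 0" "h Y1 = 0" "{y. 0 < y & h y = 0} = {Y2, Y1}"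
  "if rho = Upsilon lam tau then Y2 = ystar & Y1 = ystar else Y2 < ystar & ystar < Y1"
proof -
 have l: "lam > 0" "0 < tau" and r: "rho >= Upsilon lam tau" using N2 by (auto simp: case_N2_def)
 have ys: "ystar > 0" by (rule ystar_pos[OF l])
 have hs: "h ystar <= 0" using h_ystar[OF l] r by simp
 obtain x where x: "0 < x" "x <= ystar" "2 * abs rho / lam <= x powr (- tau)" using small_powr[OF l(2) ys] by metis
 have "2 * abs rho <= lam * x powr (- tau)" using x(3) l by (simp add: field_simps)
 then have hx: "0 <= h x" using x(1) by (simp add: h_def)
 obtain Y2 where Y2: "x <= Y2" "Y2 <= ystar" "h Y2 = 0" using IVT2'[of h ystar 0 x] hx hs x(2) continuous_h[OF x(1)] by auto
 define y where "y = ystar + 2 * abs rho"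
 have hy: "0 <= h y" using l ys by (simp add: h_def y_def)
 obtain Y1 where Y1: "ystar <= Y1" "Y1 <= y" "h Y1 = 0" using IVT'[of h ystar 0 y] hy hs continuous_h[OF ys, of y] by (auto simp: y_def)
 show ?thesis
 proof (rule that[OF _ Y2(2) Y1(1) Y2(3) Y1(3)])
  have "v = Y2 \<or> v = Y1" if "0 < v" "h v = 0" for v
  proof (cases "v <= ystar")
   case True
   then show ?thesis using h_decreasing[OF l, of v Y2] h_decreasing[OF l, of Y2 v] that Y2 x by (cases v Y2 rule: linorder_cases) auto
  next
   case False
   then show ?thesis using h_increasing[OF l, of v Y1] h_increasing[OF l, of Y1 v] that Y1 by (cases v Y1 rule: linorder_cases) auto
  qed
  then show "{y. 0 < y & h y = 0} = {Y2, Y1}" using Y1 Y2 x ys by auto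
  show "if rho = Upsilon lam tau then Y2 = ystar & Y1 = ystar else Y2 < ystar & ystar < Y1"
   using h_ystar[OF l] h_decreasing[OF l, of Y2 ystar] h_increasing[OF l, of ystar Y1] Y1 Y2 x by (auto simp: less_le)
 qed (use Y2 x in auto)
qed

lemma h_linear_above:
 assumes l: "lam > 0" "0 < tau" and Y: "ystar < Y" "Y <= y"
 shows "(1 - (ystar / Y) powr (tau + 1)) * (y - Y) <= h y - h Y"
proof (cases "Y = y")
 case False
 then have lt: "Y < y" using Y by simp
 have ys: "ystar > 0" by (rule ystar_pos[OF l])
 obtain z where z: "Y < z" "z < y" "h y - h Y = (y - Y) * (1 - (ystar / z) powr (tau + 1))"
  using MVT2[OF lt, of h "%z. 1 - (ystar / z) powr (tau + 1)"] h_derivative[OF l] Y ys by force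
 have "(ystar / z) powr (tau + 1) <= (ystar / Y) powr (tau + 1)" using z Y ys l by (intro powr_mono2) (auto simp: frac_le)
 then show ?thesis unfolding z(3) using lt by (simp add: mult.commute mult_left_mono)
qed simp

lemma h_linear_below:
 assumes l: "lam > 0" "0 < tau" and Y: "0 < y" "y <= Y" "Y < ystar"
 shows "((ystar / Y) powr (tau + 1) - 1) * (Y - y) <= h y - h Y"
proof (cases "Y = y")
 case False
 then have lt: "y < Y" using Y by simp
 have ys: "ystar > 0" by (rule ystar_pos[OF l])
 obtain z where z: "y < z" "z < Y" "h Y - h y = (Y - y) * (1 - (ystar / z) powr (tau + 1))"
  using MVT2[OF lt, of h "%z. 1 - (ystar / z) powr (tau + 1)"] h_derivative[OF l] Y ys by force
 have "(ystar / Y) powr (tau + 1) <= (ystar / z) powr (tau + 1)" using z Y ys l by (intro powr_mono2) (auto simp: frac_le)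
 then have "((ystar / Y) powr (tau + 1) - 1) * (Y - y) <= ((ystar / z) powr (tau + 1) - 1) * (Y - y)" using lt by (intro mult_right_mono) auto
 then show ?thesis using z(3) by (simp add: algebra_simps)
qed simp

text \<open>Taylor's formula of order three at \<open>ystar\<close>, where \<open>F\<close> and its
  derivative vanish and the second derivative is \<open>1 + tau\<close>. The coefficient
  \<open>(1 + tau) / 2\<close> is the origin of the exponent \<open>2 / (1 + tau)\<close> of the
  logarithms in \<open>Psi\<close> and \<open>Phi\<close>.\<close>

lemma F_double_root:
 assumes l: "lam > 0" "0 < tau" and r: "rho = Upsilon lam tau"
 obtains C where "C > 0" "\<forall>x. abs x <= ystar / 2 --> abs (F (ystar + x) - (1 + tau) / 2 * x^2) <= C * abs x ^ 3"
proof -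
 have ys: "ystar > 0" by (rule ystar_pos[OF l])
 define D where "D n y = (if n = 0 then y\<^sup>2 - 2 * rho * y + lam * y powr (1 - tau) else if n = 1 then 2 * y - 2 * rho + lam * ((1 - tau) * y powr (- tau))
  else if n = 2 then 2 + lam * ((1 - tau) * (- tau * y powr (- tau - 1))) else lam * ((1 - tau) * (- tau * ((- tau - 1) * y powr (- tau - 2)))))" for n :: nat and y
 have D: "(D m has_real_derivative D (Suc m) y) (at y)" if "m < 3" "y > 0" for m y
 proof -
  have "m = 0 \<or> m = 1 \<or> m = 2" using that by auto
  then show ?thesis using that(2) unfolding D_def[abs_def]
   by (elim disjE) (auto intro!: derivative_eq_intros simp: algebra_simps)
 qed
 have lp: "lam * ystar powr (- tau - 1) = 1 / tau"
  using lam_ystar[OF l] ys by (simp add: powr_diff field_simps)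
 have rr: "2 * rho * tau = ystar * (tau + 1)" using Upsilon_ystar[OF l] r l by (simp add: field_simps)
 have Fs: "F ystar = 0" using F_h[OF ys] h_ystar[OF l] by (simp flip: r)
 then have D0: "D 0 ystar = 0" using ys by (simp add: D_def F_def)
 have "tau * (2 * ystar - 2 * rho + (1 - tau) * (ystar / tau)) = 0" using l rr by (simp add: field_simps)
 then have D1: "D 1 ystar = 0" using l lam_ystar[OF l] by (simp add: D_def mult.left_commute[of lam])
 have "D 2 ystar = 2 - (1 - tau) * tau * (lam * ystar powr (- tau - 1))" by (simp add: D_def)
 then have D2: "D 2 ystar = 1 + tau" unfolding lp using l by simp
 \<comment> \<open>The third derivative is largest at the left end \<open>ystar / 2\<close> of the
   interval; the summand 1 makes the constant positive.\<close>
 define C where "C = lam * ((1 - tau) * (tau * ((tau + 1) * (ystar / 2) powr (- tau - 2)))) / 6 + 1"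
 have C: "C > 0" unfolding C_def using l tau ys by (intro add_nonneg_pos divide_nonneg_nonneg mult_nonneg_nonneg) auto
 show ?thesis
 proof (rule that[OF C], intro allI impI)
  fix x assume x: "abs x <= ystar / 2"
  show "abs (F (ystar + x) - (1 + tau) / 2 * x^2) <= C * abs x ^ 3"
  proof (cases "x = 0")
   case True then show ?thesis using Fs by simp
  next
   case False
   obtain t where t: "if ystar + x < ystar then ystar + x < t & t < ystar else ystar < t & t < ystar + x"
    "D 0 (ystar + x) = (\<Sum>m<3. D m ystar / fact m * (ystar + x - ystar) ^ m) + D 3 t / fact 3 * (ystar + x - ystar) ^ 3"
   proof -
    have "\<forall>m t. m < 3 & ystar / 2 <= t & t <= 3 * ystar / 2 --> (D m has_real_derivative D (Suc m) t) (at t)" using D ys by auto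
    moreover have "ystar / 2 <= ystar + x" "ystar + x <= 3 * ystar / 2" "ystar + x ~= ystar" using x False by (auto simp: abs_le_iff)
    ultimately show thesis using Taylor[of 3 D "D 0" "ystar / 2" "3 * ystar / 2" ystar "ystar + x"] ys that by auto
   qed
   have t2: "ystar / 2 <= t" using t(1) x by (auto simp: abs_le_iff split: if_splits)
   have "(\<Sum>m<3. D m ystar / fact m * x ^ m) = (1 + tau) / 2 * x^2"
    using D0 D1 D2 by (simp add: eval_nat_numeral)
   moreover have "F (ystar + x) = D 0 (ystar + x)" using x ys by (simp add: D_def F_def abs_le_iff)
   ultimately have "F (ystar + x) - (1 + tau) / 2 * x^2 = D 3 t / 6 * x ^ 3"
    using t(2) by (simp add: fact_numeral)
   then have "abs (F (ystar + x) - (1 + tau) / 2 * x^2) = abs (D 3 t / 6) * abs x ^ 3" by (simp only: abs_mult power_abs)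
   also have "... <= C * abs x ^ 3"
   proof (rule mult_right_mono)
    have "t powr (- tau - 2) <= (ystar / 2) powr (- tau - 2)" using t2 ys tau by (intro powr_mono2') auto
    then have "lam * ((1 - tau) * (tau * ((tau + 1) * t powr (- tau - 2)))) <= lam * ((1 - tau) * (tau * ((tau + 1) * (ystar / 2) powr (- tau - 2))))"
     using l tau by (intro mult_left_mono) auto
    moreover have "D 3 t = lam * ((1 - tau) * (tau * ((tau + 1) * t powr (- tau - 2))))" by (simp add: D_def algebra_simps)
    moreover have "0 <= lam * ((1 - tau) * (tau * ((tau + 1) * t powr (- tau - 2))))" using l tau by (intro mult_nonneg_nonneg) auto
    ultimately show "abs (D 3 t / 6) <= C" by (simp add: C_def)
   qed simp
   finally show ?thesis .
  qed
 qed
qed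

end

section \<open>The two ends of a trajectory in the cases of the theorem\<close>

context params
begin

definition level :: real where "level = ln (F gm) / (q - 1)"

lemma exp_level: "F gm > 0 ==> exp ((q - 1) * level) = F gm"
 using q by (simp add: level_def)

lemma F_lipschitz_above:
 assumes "0 < a"
 shows "\<exists>L>0. \<forall>x\<in>{a..b}. \<forall>y\<in>{a..b}. abs (F x - F y) <= L * abs (x - y)"
proof (rule F_lipschitz[OF assms, of b], goal_cases)
 case (1 L) from 1(1) 1(2)[of 1] show ?case by auto
qed

lemma half_F_simple:
 assumes "F gm > 0" "0 <= e1" "e1 < gm" "F e1 = 0" "!!v. e1 < v ==> v <= gm ==> F v > 0"
  and "c > 0" "d > 0" "!!e. 0 <= e ==> e <= d ==> c * e <= F (e1 + e)"
 shows "half (q - 1) gm e1 level F (%_. 0)"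
 by (rule half_simpleI[OF _ assms(3) _ assms(4,5) exp_level[OF assms(1)] _ assms(6-8)])
  (use assms q in \<open>auto intro!: continuous_intros F_lipschitz_above\<close>)

lemma half_F_double:
 assumes "F gm > 0" "0 <= e1" "e1 < gm" "F e1 = 0" "!!v. e1 < v ==> v <= gm ==> F v > 0"
  and "a > 0" "d > 0" "C > 0" "!!e. 0 <= e ==> e <= d ==> abs (F (e1 + e) - a * e^2) <= C * e ^ 3"
 shows "half (q - 1) gm e1 level F (%t. ln t / a)"
 by (rule half_doubleI[OF _ assms(3) _ assms(4,5) exp_level[OF assms(1)] _ assms(6-9)])
  (use assms q in \<open>auto intro!: continuous_intros F_lipschitz_above\<close>)

lemma case_N0_bound:
 assumes N0: "case_N0 rho lam tau" "\<not> case_N0_log rho lam tau"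
 obtains c where "c > 0" "!!y. 0 < y ==> c <= h y"
proof (cases "tau = 0 \<or> lam = 0")
 case True
 then have "lam - 2 * rho > 0" using N0 by (auto simp: case_N0_def case_N0_log_def)
 then show ?thesis by (rule that) (simp add: h_affine True)
next
 case False
 then have l: "lam > 0" "0 < tau" "rho < Upsilon lam tau" using N0 by (auto simp: case_N0_def)
 then have "h ystar > 0" by (simp add: h_ystar)
 then show ?thesis by (rule that) (rule h_ge_ystar[OF l(1,2)])
qed

text \<open>\<open>h\<close> decreases up to \<open>ystar\<close> and increases afterwards, so it is
  nonpositive between its zeros, while it is positive at \<open>gm\<close>.\<close>

lemma N2_location:
 assumes N2: "case_N2 rho lam tau" and gm: "gm > 0" "F gm > 0" and Y: "0 < Y2" "Y2 <= ystar" "ystar <= Y1" "h Y2 = 0" "h Y1 = 0"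
 shows "gm < Y2 \<or> Y1 < gm"
proof (rule ccontr)
 have l: "lam > 0" "0 < tau" using N2 by (auto simp: case_N2_def)
 have g: "0 < h gm" using gm by (simp add: h_pos_iff)
 assume n: "\<not> ?thesis"
 show False
 proof (cases "gm <= ystar")
  case True then show ?thesis using h_decreasing[OF l Y(1), of gm] n g Y by (cases "gm = Y2") auto
 next
  case False then show ?thesis using h_increasing[OF l, of gm Y1] n g Y by (cases "gm = Y1") auto
 qed
qed

lemma behaviour_cong:
 fixes u :: "real^'n => real"
 assumes "!!r. r > 1 ==> f r = g r"
 shows "u \<sim>[at_infinity] (%x. c * f (norm x)) \<longleftrightarrow> u \<sim>[at_infinity] (%x. c * g (norm x))"
proof (rule asymp_equiv_cong)
 have "f (norm x) = g (norm x)" if "2 <= norm x" for x :: "real^'n" using assms that by simp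
 then show "\<forall>\<^sub>F x::real^'n in at_infinity. c * f (norm x) = c * g (norm x)" unfolding eventually_at_infinity by (intro exI[of _ 2]) auto
qed simp

text \<open>All cases are reduced to a pair \<open>e1\<close>, \<open>corr\<close>. The number
  \<open>e1\<close> is the zero of \<open>F\<close> next below \<open>gm\<close>: the largest zero
  \<open>- varpi1\<close> of \<open>h\<close> if \<open>gm\<close> lies above it, and otherwise 0.
  The correction is a logarithm when the zero is double, with coefficient 1 for
  \<open>F e = e^2\<close> and \<open>(1 + tau) / 2\<close> at \<open>ystar\<close>.\<close>

lemma plus_end:
 assumes gm: "gm > 0" "F gm > 0"
 obtains e1 corr where "0 <= e1" "e1 < gm" "half (q - 1) gm e1 level F corr"
  "!!c (u :: real^'n => real). behaviour_at_infinity rho lam tau (- gm) c u \<longleftrightarrow>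
   u \<sim>[at_infinity] (%x. c * exp (e1 * ln (norm x) + corr (ln (norm x))))"
  "N2_between rho lam tau (- gm) ==> e1 = 0 & corr = (%_. 0)"
proof -
 note bd = behaviour_at_infinity_def case_N0_def case_N0_log_def case_N1_def case_N2_def
 have g: "h gm > 0" using gm by (simp add: h_pos_iff)
 have Fp: "F v > 0" if "0 <= e" "e < v" "h v > 0" for e v using that h_pos_iff[of v] by simp
 have Fc: "m * c * e <= F (y + e)" if "0 < y + e" "m <= y + e" "0 <= c * e" "c * e <= h (y + e)" for m c e y
  using mult_mono[OF that(2,4)] that by (simp add: F_h mult.assoc)
 consider "case_N0 rho lam tau" "\<not> case_N0_log rho lam tau" | "case_N0_log rho lam tau" | "case_N1 rho lam tau" | "case_N2 rho lam tau"
  using tau by (auto simp: bd) (metis antisym_conv3 not_le order_le_less)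
 then show ?thesis
 proof cases
  case 1
  obtain c where c: "c > 0" "!!y. 0 < y ==> c <= h y" using case_N0_bound[OF 1] by blast
  have "c * e <= F (0 + e)" if "0 <= e" for e using c(2)[of e] that by (cases "e = 0") (auto simp: F_h mult.commute)
  moreover have "h v > 0" if "0 < v" for v using c(1) c(2)[OF that] by simp
  ultimately have "half (q - 1) gm 0 level F (%_. 0)"
   by (intro half_F_simple[OF gm(2) order.refl gm(1) F_0 Fp c(1) zero_less_one]) auto
  then show ?thesis by (rule that[OF order.refl gm(1)]) (use 1 in \<open>auto simp: bd N2_between_def\<close>)
 next
  case 2
  have hy: "h y = y" if "y > 0" for y using 2 that h_affine[of y] unfolding case_N0_log_def by auto
  have Fy: "F (0 + e) = 1 * e^2" if "0 <= e" for e using F_h[of e] hy[of e] that by (cases "e = 0") (auto simp: power2_eq_square)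
  have hf: "half (q - 1) gm 0 level F (%t. ln t / 1)"
   by (rule half_F_double[OF gm(2) order.refl gm(1) F_0 Fp zero_less_one zero_less_one zero_less_one]) (auto simp: hy Fy[simplified])
  have bc: "u \<sim>[at_infinity] (%x. c * ln (norm x)) \<longleftrightarrow> u \<sim>[at_infinity] (%x. c * exp (0 * ln (norm x) + ln (ln (norm x)) / 1))"
   for c and u :: "real^'n => real" by (rule behaviour_cong) simp
  have n: "\<not> case_N1 rho lam tau" "\<not> case_N2 rho lam tau" "\<not> N2_between rho lam tau (- gm)" using 2 by (auto simp: bd(2-) N2_between_def)
  have "behaviour_at_infinity rho lam tau (- gm) c u \<longleftrightarrow> u \<sim>[at_infinity] (%x. c * ln (norm x))" for c and u :: "real^'n => real"
   by (simp only: behaviour_at_infinity_def n 2 simp_thms)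
  from trans[OF this bc] show ?thesis by (rule that[OF order.refl gm(1) hf]) (use n in auto)
 next
  case 3
  obtain Y where Y: "0 < Y" "{y. 0 < y & h y = 0} = {Y}" "\<forall>y\<ge>Y. y - Y <= h y" "\<forall>y. 0 < y & y < Y --> h y < 0"
   by (rule case_N1_root[OF 3])
  have Y0: "h Y = 0" using Y(2) by auto
  have lt: "Y < gm" using g Y(4)[rule_format, of gm] Y0 gm by (cases Y gm rule: linorder_cases) auto
  have v: "varpi1 rho lam tau = - Y" using varpi_eq(1)[of Y Y] Y(2) by simp
  have hf: "half (q - 1) gm Y level F (%_. 0)"
  proof (rule half_F_simple[OF gm(2) less_imp_le[OF Y(1)] lt _ Fp Y(1) zero_less_one])
   show "h x > 0" if "Y < x" for x using Y(3)[rule_format, of x] that by simp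
   show "Y * e <= F (Y + e)" if "0 <= e" for e using Fc[of Y e Y 1] Y(1) Y(3)[rule_format, of "Y + e"] that by simp
  qed (use F_h Y(1) Y0 in auto)
  have bc: "u \<sim>[at_infinity] (%x. c * norm x powr (- varpi1 rho lam tau)) \<longleftrightarrow> u \<sim>[at_infinity] (%x. c * exp (Y * ln (norm x) + 0))"
   for c and u :: "real^'n => real" by (rule behaviour_cong) (simp add: v powr_def)
  have n: "\<not> case_N0 rho lam tau" "\<not> case_N0_log rho lam tau" "\<not> case_N2 rho lam tau" "\<not> N2_between rho lam tau (- gm)" "- gm < varpi1 rho lam tau" using 3 lt v by (auto simp: bd(2-) N2_between_def)
  have "behaviour_at_infinity rho lam tau (- gm) c u \<longleftrightarrow> u \<sim>[at_infinity] (%x. c * norm x powr (- varpi1 rho lam tau))" for c and u :: "real^'n => real"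
   by (simp only: behaviour_at_infinity_def n 3 simp_thms)
  from trans[OF this bc] show ?thesis by (rule that[OF less_imp_le[OF Y(1)] lt hf]) (use n in auto)
 next
  case 4
  have l: "lam > 0" "0 < tau" using 4 by (auto simp: case_N2_def)
  obtain Y2 Y1 where Y: "0 < Y2" "Y2 <= ystar" "ystar <= Y1" "h Y2 = 0" "h Y1 = 0" "{y. 0 < y & h y = 0} = {Y2, Y1}"
   "if rho = Upsilon lam tau then Y2 = ystar & Y1 = ystar else Y2 < ystar & ystar < Y1"
   by (rule case_N2_roots[OF 4])
  have Y1: "0 < Y1" using Y by simp
  have v: "varpi1 rho lam tau = - Y1" "varpi2 rho lam tau = - Y2" using varpi_eq[OF Y(6)] Y(2,3) by auto
  from N2_location[OF 4 gm Y(1-5)] show ?thesis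
  proof
   assume lt: "gm < Y2"
   \<comment> \<open>Since \<open>gm\<close> is below the minimum point of \<open>h\<close>, the
     value \<open>h gm\<close> bounds \<open>h\<close> from below on the whole interval; this gives
     the linear lower bound for \<open>F\<close> at 0.\<close>
   have hg: "h gm <= h y" if "0 < y" "y <= gm" for y using h_decreasing[OF l that(1), of gm] that lt Y(2) by (cases "y = gm") auto
   have "half (q - 1) gm 0 level F (%_. 0)"
   proof (rule half_F_simple[OF gm(2) order.refl gm(1) F_0 Fp[OF order.refl] g gm(1)])
    show "h x > 0" if "0 < x" "x <= gm" for x using hg[OF that] g by simp
    show "h gm * e <= F (0 + e)" if "0 <= e" "e <= gm" for e using hg[of e] that by (cases "e = 0") (auto simp: F_h mult.commute)
   qed
   then show ?thesis by (rule that[OF order.refl gm(1)]) (use 4 v lt Y gm l in \<open>auto simp: bd N2_between_def\<close>)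
  next
   assume lt: "Y1 < gm"
   have hp: "h x > 0" if "Y1 < x" for x using h_increasing[OF l Y(3) that] Y(5) by simp
   have nb: "\<not> N2_between rho lam tau (- gm)" using v lt Y by (auto simp: N2_between_def)
   have FY: "F Y1 = 0" using F_h[OF Y1] Y(5) by simp
   define corr where "corr t = (if rho = Upsilon lam tau then ln t / ((1 + tau) / 2) else 0)" for t
   have hf: "half (q - 1) gm Y1 level F corr"
   proof (cases "rho = Upsilon lam tau")
    case True
    then have Y7: "Y2 = ystar" "Y1 = ystar" using Y(7) by auto
    obtain C where C: "C > 0" "\<forall>x. abs x <= ystar / 2 --> abs (F (ystar + x) - (1 + tau) / 2 * x^2) <= C * abs x ^ 3"
     by (rule F_double_root[OF l True])
    have C2: "abs (F (Y1 + e) - (1 + tau) / 2 * e^2) <= C * e ^ 3" if "0 <= e" "e <= Y1 / 2" for e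
     using C(2)[rule_format, of e] that Y7 by simp
    have "half (q - 1) gm Y1 level F (%t. ln t / ((1 + tau) / 2))"
     by (rule half_F_double[OF gm(2) less_imp_le[OF Y1] lt FY Fp[OF less_imp_le[OF Y1] _ hp] _ half_gt_zero[OF Y1] C(1) C2])
      (use tau in auto)
    then show ?thesis using True by (simp add: corr_def[abs_def])
   next
    case False
    then have Y8: "ystar < Y1" using Y(7) by auto
    define c where "c = 1 - (ystar / Y1) powr (tau + 1)"
    have "(ystar / Y1) powr (tau + 1) < 1 powr (tau + 1)" using Y8 Y1 l ystar_pos[OF l] by (intro powr_less_mono2) auto
    then have c: "c > 0" by (simp add: c_def)
    have "half (q - 1) gm Y1 level F (%_. 0)"
    proof (rule half_F_simple[OF gm(2) less_imp_le[OF Y1] lt FY Fp[OF less_imp_le[OF Y1] _ hp] mult_pos_pos[OF Y1 c] zero_less_one])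
     show "Y1 * c * e <= F (Y1 + e)" if "0 <= e" for e
      using h_linear_above[OF l, of Y1 "Y1 + e"] Y(5) Y8 Y1 that c by (intro Fc) (auto simp: c_def)
    qed
    then show ?thesis using False by (simp add: corr_def[abs_def])
   qed
   have bc: "u \<sim>[at_infinity] (%x. c * Psi rho lam tau (norm x)) \<longleftrightarrow> u \<sim>[at_infinity] (%x. c * exp (Y1 * ln (norm x) + corr (ln (norm x))))"
    for c and u :: "real^'n => real"
    by (rule behaviour_cong) (unfold Psi_def v corr_def, simp add: powr_def exp_add mult.commute)
   have n: "\<not> case_N0 rho lam tau" "\<not> case_N0_log rho lam tau" "\<not> case_N1 rho lam tau" "- gm < varpi1 rho lam tau" using 4 v lt l by (auto simp: bd(2-))
   have "behaviour_at_infinity rho lam tau (- gm) c u \<longleftrightarrow> u \<sim>[at_infinity] (%x. c * Psi rho lam tau (norm x))" for c and u :: "real^'n => real"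
    by (simp only: behaviour_at_infinity_def n 4 nb simp_thms)
   from trans[OF this bc] show ?thesis by (rule that[OF less_imp_le[OF Y1] lt hf]) (use n nb in auto)
  qed
 qed
qed

lemma F_reflected: "continuous_on A (%v. F (2 * gm - v))" by (intro continuous_intros)

text \<open>Above \<open>gm\<close> the next zero of \<open>F\<close> is
  \<open>Y = - varpi2\<close>. After reflection it becomes \<open>2 * gm - Y\<close>, below
  \<open>gm\<close>, so the reflected problem is again an instance of \<open>half\<close>.\<close>

lemma minus_end:
 assumes gm: "gm > 0" "F gm > 0" and b: "N2_between rho lam tau (- gm)"
 obtains Y corr where "gm < Y" "half (q - 1) gm (2 * gm - Y) level (%v. F (2 * gm - v)) corr"
  "!!r. 0 < r ==> r < 1 ==> Phi rho lam tau r = exp (Y * ln r + corr (- ln r))"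
proof -
 have N2: "case_N2 rho lam tau" using b by (simp add: N2_between_def)
 have l: "lam > 0" "0 < tau" using N2 by (auto simp: case_N2_def)
 obtain Y Y1 where Y: "0 < Y" "Y <= ystar" "ystar <= Y1" "h Y = 0" "h Y1 = 0" "{y. 0 < y & h y = 0} = {Y, Y1}"
  "if rho = Upsilon lam tau then Y = ystar & Y1 = ystar else Y < ystar & ystar < Y1"
  by (rule case_N2_roots[OF N2])
 have v: "varpi2 rho lam tau = - Y" using varpi_eq[OF Y(6)] Y(2,3) by auto
 then have lt: "gm < Y" using b by (simp add: N2_between_def)
 have e: "2 * gm - Y < gm" "F (2 * gm - (2 * gm - Y)) = 0" "exp ((q - 1) * level) = F (2 * gm - gm)"
  using lt F_h[OF Y(1)] Y(4) exp_level[OF gm(2)] by auto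
 have p: "F (2 * gm - x) > 0" if "2 * gm - Y < x" "x <= gm" for x
  using h_decreasing[OF l, of "2 * gm - x" Y] that gm(1) Y(2,4) h_pos_iff[of "2 * gm - x"] by simp
 have lip: "\<exists>L>0. \<forall>x\<in>{a..gm}. \<forall>y\<in>{a..gm}. abs (F (2 * gm - x) - F (2 * gm - y)) <= L * abs (x - y)" for a
 proof -
  obtain L where "L > 0" "!!x y. x \<in> {gm..2 * gm - a} ==> y \<in> {gm..2 * gm - a} ==> abs (F x - F y) <= L * abs (x - y)"
   using F_lipschitz_above[OF gm(1)] by metis
  from this(1) this(2)[of "2 * gm - x" "2 * gm - y" for x y] show ?thesis by (intro exI[of _ L]) (auto simp: abs_minus_commute)
 qed
 have k: "q - 1 > 0" using q by simp
 define corr where "corr t = (if rho = Upsilon lam tau then ln t / ((1 + tau) / 2) else 0)" for t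
 show ?thesis
 proof (rule that[OF lt])
  show "Phi rho lam tau r = exp (Y * ln r + corr (- ln r))" if "0 < r" "r < 1" for r
   using that unfolding Phi_def v corr_def by (simp add: powr_def exp_add mult.commute)
  show "half (q - 1) gm (2 * gm - Y) level (%v. F (2 * gm - v)) corr"
  proof (cases "rho = Upsilon lam tau")
   case True
   then have Y7: "Y = ystar" using Y(7) by auto
   obtain C where C: "C > 0" "\<forall>x. abs x <= ystar / 2 --> abs (F (ystar + x) - (1 + tau) / 2 * x^2) <= C * abs x ^ 3"
    by (rule F_double_root[OF l True])
   have C2: "abs (F (2 * gm - (2 * gm - Y + e)) - (1 + tau) / 2 * e^2) <= C * e ^ 3" if "0 <= e" "e <= Y / 2" for e
    using C(2)[rule_format, of "- e"] that Y7 by simp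
   have "half (q - 1) gm (2 * gm - Y) level (%v. F (2 * gm - v)) (%t. ln t / ((1 + tau) / 2))"
    by (rule half_doubleI[OF k e(1) F_reflected e(2) p e(3) lip _ half_gt_zero[OF Y(1)] C(1) C2]) (use tau in auto)
   then show ?thesis using True by (simp add: corr_def[abs_def])
  next
   case False
   then have Y8: "Y < ystar" using Y(7) by auto
   define c where "c = (ystar / Y) powr (tau + 1) - 1"
   have "1 < (ystar / Y) powr (tau + 1)" using Y8 Y(1) l by (intro gr_one_powr) auto
   then have c: "c > 0" by (simp add: c_def)
   \<comment> \<open>The factor \<open>Y / 2\<close> is the lower bound for \<open>Y - e\<close> in
     \<open>F (Y - e) = (Y - e) * h (Y - e)\<close>.\<close>
   have "Y / 2 * c * e <= F (2 * gm - (2 * gm - Y + e))" if "0 <= e" "e <= Y / 2" for e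
   proof -
    have "c * e <= h (Y - e)" using h_linear_below[OF l, of "Y - e" Y] Y(1,4) Y8 that by (simp add: c_def)
    then have "Y / 2 * (c * e) <= (Y - e) * h (Y - e)" using c that by (intro mult_mono) auto
    then show ?thesis using F_h[of "Y - e"] that Y(1) by simp
   qed
   then have "half (q - 1) gm (2 * gm - Y) level (%v. F (2 * gm - v)) (%_. 0)"
    using c Y(1) by (intro half_simpleI[OF k e(1) F_reflected e(2) p e(3) lip, of "Y / 2 * c" "Y / 2"]) auto
   then show ?thesis using False by (simp add: corr_def[abs_def])
  qed
 qed
qed

text \<open>Outside the intermediate range \<open>gm\<close> lies above all zeros of
  \<open>h\<close>, and \<open>h\<close> stays positive from there on.\<close>

lemma no_minus_end:
 assumes gm: "gm > 0" "F gm > 0" and b: "\<not> N2_between rho lam tau (- gm)" and y: "gm <= y"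
 shows "F y > 0"
proof -
 have g: "h gm > 0" and y0: "0 < y" using gm y by (auto simp: h_pos_iff)
 consider "case_N0 rho lam tau" "\<not> case_N0_log rho lam tau" | "case_N0_log rho lam tau" | "case_N1 rho lam tau" | "case_N2 rho lam tau"
  using tau by (auto simp: case_N0_def case_N0_log_def case_N1_def case_N2_def) (metis antisym_conv3 not_le order_le_less)
 then have "h y > 0"
 proof cases
  case 1
  then show ?thesis using case_N0_bound[OF 1] y0 by (metis less_le_trans)
 next
  case 2
  then have "h y = y - (2 * rho - lam)" using y0 by (intro h_affine) (auto simp: case_N0_log_def)
  with 2 y0 show ?thesis by (simp add: case_N0_log_def)
 next
  case 3
  obtain Y where Y: "0 < Y" "{y. 0 < y & h y = 0} = {Y}" "\<forall>y\<ge>Y. y - Y <= h y" "\<forall>y. 0 < y & y < Y --> h y < 0"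
   by (rule case_N1_root[OF 3])
  have "h Y = 0" using Y(2) by auto
  then have "Y < gm" using g Y(4)[rule_format, of gm] gm by (cases Y gm rule: linorder_cases) auto
  then show ?thesis using Y(3)[rule_format, of y] y by simp
 next
  case 4
  have l: "lam > 0" "0 < tau" using 4 by (auto simp: case_N2_def)
  obtain Y2 Y1 where Y: "0 < Y2" "Y2 <= ystar" "ystar <= Y1" "h Y2 = 0" "h Y1 = 0" "{y. 0 < y & h y = 0} = {Y2, Y1}"
   "if rho = Upsilon lam tau then Y2 = ystar & Y1 = ystar else Y2 < ystar & ystar < Y1"
   by (rule case_N2_roots[OF 4])
  have "varpi2 rho lam tau = - Y2" using varpi_eq[OF Y(6)] Y(2,3) by auto
  then have "Y1 < gm" using N2_location[OF 4 gm Y(1-5)] b 4 gm(1) by (auto simp: N2_between_def)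
  then show ?thesis using h_increasing[OF l Y(3), of y] Y(5) y by simp
 qed
 then show ?thesis using h_pos_iff[OF y0] by simp
qed

end

section \<open>Classification of the solutions\<close>

lemma has_real_derivative_glue:
 fixes f g :: "real => real"
 assumes f: "!!t. 0 <= t ==> (f has_real_derivative f' t) (at t within {0..})"
  and g: "!!t. 0 <= t ==> (g has_real_derivative g' t) (at t within {0..})" and 0: "f 0 = g 0" "f' 0 = - g' 0"
 shows "((%t. if 0 <= t then f t else g (- t)) has_real_derivative (if 0 <= t then f' t else - g' (- t))) (at t)"
proof -
 define X D where "X t = (if 0 <= t then f t else g (- t))" and "D t = (if 0 <= t then f' t else - g' (- t))" for t
 have e: "f t = X t" "f' t = D t" if "0 <= t" for t using that by (simp_all add: X_def D_def)
 have e': "g (- t) = X t" "- g' (- t) = D t" if "t <= 0" for t using that 0 by (cases "t = 0"; simp add: X_def D_def)+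
 have r: "(X has_real_derivative D t) (at t within {0..})" if "0 <= t" for t
  by (rule has_field_derivative_transform_within[OF f[OF that, unfolded e(2)[OF that]] zero_less_one]) (simp_all add: that e)
 have l: "(X has_real_derivative D t) (at t within {..0})" if "t <= 0" for t
 proof -
  have img: "uminus ` {..0::real} = {0..}" by force
  have "((%t. g (- t)) has_real_derivative D t) (at t within {..0})"
   using DERIV_image_chain[of g "g' (- t)" uminus t "{..0}" "- 1"] g[of "- t"] that DERIV_minus[OF DERIV_ident] e'(2)[OF that]
   unfolding img o_def by auto
  then show ?thesis by (rule has_field_derivative_transform_within[OF _ zero_less_one]) (simp_all add: that e')
 qed
 have "DERIV X t :> D t"
 proof (cases t "0::real" rule: linorder_cases)
  case equal
  have "(X has_real_derivative D t) (at t within {0..} \<union> {..0})"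
   using r[of t] l[of t] equal unfolding has_field_derivative_iff by (simp add: at_within_union filterlim_sup)
  moreover have "{0..} \<union> {..0} = (UNIV :: real set)" by auto
  ultimately show ?thesis by simp
 qed (use r[of t] l[of t] at_within_interior[of t "{..0}"] at_within_interior[of t "{0..}"] in auto)
 then show ?thesis unfolding X_def[abs_def] D_def .
qed

text \<open>If the slope is below \<open>gm\<close> at some time, the trajectory becomes a
  \<open>tail\<close> and \<open>asym\<close> applies. Otherwise it stays at or above
  \<open>gm\<close>, and \<open>to_equilibrium\<close> applies to the reflected trajectory.\<close>

lemma (in half) dichotomy:
 assumes c: "!!A. continuous_on A Ph"
  and ds: "!!t. DERIV s t :> y t - gm" and dy: "!!t. DERIV y t :> exp (k * s t) - Ph (y t)"
  and s: "!!t. s t <= s0" and y: "!!t. y t <= B"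
 shows "(s \<longlongrightarrow> s0) at_top & (\<forall>t. gm <= y t) \<or> (\<exists>l. ((%t. s t + (gm - e1) * t - corr t) \<longlongrightarrow> l) at_top)"
proof (cases "\<exists>T. y T < gm")
 case True
 then obtain T where "y T < gm" ..
 from tail_from_below[OF k e1 cPh pPh s0 ds dy above_root[OF e1 Ph0 ds dy s] s this]
 obtain T' where "tail k gm e1 T' Ph s y" "exp (k * s T') < Ph gm" by blast
 with asym[OF this(1) tail.s_to_minus_infinity[OF this]] show ?thesis by blast
next
 case False
 have "((%t. s (- t)) \<longlongrightarrow> s0) at_bot"
 proof (rule to_equilibrium[OF k _ _ _ reflected_derivatives[OF ds dy]])
  \<comment> \<open>A lower bound of the reflected slope takes the place of a zero here; the minimum
    with \<open>gm - 1\<close> makes it strictly smaller than \<open>gm\<close>.\<close>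
  show "min (2 * gm - B) (gm - 1) < gm" by simp
  show "min (2 * gm - B) (gm - 1) <= 2 * gm - y (- t)" for t using y[of "- t"] by simp
  show "continuous_on {min (2 * gm - B) (gm - 1)..gm} (%v. Ph (2 * gm - v))" by (intro continuous_on_compose2[OF c[of UNIV]] continuous_intros) auto
 qed (use False s s0 in \<open>auto simp: not_less\<close>)
 from filterlim_compose[OF this filterlim_uminus_at_bot_at_top] show ?thesis using False by (simp add: not_less)
qed

lemma filterlim_ln_norm:
 "filterlim (%x::'a::euclidean_space. ln (norm x)) at_bot (at 0)" "filterlim (%x::'a. ln (norm x)) at_top at_infinity"
proof -
 have "filterlim (norm :: 'a => real) (at_right 0) (at 0)"
  unfolding filterlim_at using tendsto_norm_zero[OF tendsto_ident_at] by (auto simp: eventually_at_filter)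
 then show "filterlim (%x::'a. ln (norm x)) at_bot (at 0)" by (rule filterlim_compose[OF ln_at_0])
 show "filterlim (%x::'a. ln (norm x)) at_top at_infinity" by (rule filterlim_compose[OF ln_at_top filterlim_norm_at_top])
qed

lemma asymp_equiv_exp:
 fixes u g :: "'a => real"
 assumes f: "filterlim f G \<F>" and d: "((%t. a t - b t) \<longlongrightarrow> (0::real)) G"
  and u: "\<forall>\<^sub>F x in \<F>. u x = exp (a (f x))" and g: "\<forall>\<^sub>F x in \<F>. g x = exp (b (f x))"
 shows "u \<sim>[\<F>] g"
proof -
 have "((%x. exp (a (f x) - b (f x))) \<longlongrightarrow> exp 0) \<F>" by (intro tendsto_intros filterlim_compose[OF d f])
 then have "(%x. exp (a (f x))) \<sim>[\<F>] (%x. exp (b (f x)))" by (intro asymp_equivI') (simp add: exp_diff)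
 then show ?thesis using asymp_equiv_cong[OF u g] by simp
qed

lemma asymp_equiv_at_0:
 fixes u g :: "'a::euclidean_space => real"
 assumes "((%t. a t - b t) \<longlongrightarrow> 0) at_bot" "!!x. x ~= 0 ==> u x = exp (a (ln (norm x)))" "!!x. x ~= 0 ==> norm x < 1 ==> g x = exp (b (ln (norm x)))"
 shows "u \<sim>[at 0] g"
 by (rule asymp_equiv_exp[OF filterlim_ln_norm(1) assms(1)])
  (use assms(2,3) in \<open>auto simp: eventually_at dist_norm intro!: exI[of _ 1]\<close>)

lemma asymp_equiv_at_infinity:
 fixes u g :: "'a::euclidean_space => real"
 assumes "((%t. a t - b t) \<longlongrightarrow> 0) at_top" "!!x. x ~= 0 ==> u x = exp (a (ln (norm x)))" "!!x. x ~= 0 ==> g x = exp (b (ln (norm x)))"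
 shows "u \<sim>[at_infinity] g"
 by (rule asymp_equiv_exp[OF filterlim_ln_norm(2) assms(1)])
  (auto simp: eventually_at_infinity intro!: exI[of _ 1] assms(2,3))

section \<open>Uniqueness, and translation between trajectories and solutions\<close>

context params
begin

text \<open>The difference of the logarithms tends to 0 at both ends, so it is at most
  \<open>e\<close> on the boundary of a sufficiently large annulus, and by comparison also
  inside.\<close>

lemma positive_solution_unique:
 fixes u v :: "real^'n => real"
 assumes u: "positive_solution rho lam tau th q u" and v: "positive_solution rho lam tau th q v"
  and 0: "u \<sim>[at 0] v" and inf: "u \<sim>[at_infinity] v"
 shows "u = v"
proof -
 have le: "ln (u x) - ln (v x) <= 0" if u: "positive_solution rho lam tau th q u" and v: "positive_solution rho lam tau th q v"
  and 0: "u \<sim>[at 0] v" and inf: "u \<sim>[at_infinity] v" and x: "x ~= 0" for u v :: "real^'n => real" and x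
 proof (rule field_le_epsilon)
  fix e :: real assume e: "0 < e"
  have small: "\<forall>\<^sub>F y in G. y ~= 0 --> ln (u y) - ln (v y) <= e" if "u \<sim>[G] v" for G
  proof -
   have "\<forall>\<^sub>F y in G. u y / v y < exp e" using order_tendstoD(2)[OF asymp_equivD[OF that], of "exp e"] e
    by (auto elim!: eventually_mono split: if_splits)
   then show ?thesis
   proof (rule eventually_mono, intro impI)
    fix y :: "real^'n" assume h: "u y / v y < exp e" "y ~= 0"
    then have p: "u y > 0" "v y > 0" using u v by (auto simp: positive_solution_def)
    then have "ln (u y / v y) < ln (exp e)" using h by (intro ln_less_cancel_iff[THEN iffD2]) auto
    then show "ln (u y) - ln (v y) <= e" using p by (simp add: ln_divide_pos)
   qed
  qed
  obtain d where d: "d > 0" "!!y. y ~= 0 ==> norm y < d ==> ln (u y) - ln (v y) <= e"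
   using small[OF 0] by (auto simp: eventually_at dist_norm)
  obtain b where b: "!!y. b <= norm y ==> y ~= 0 ==> ln (u y) - ln (v y) <= e"
   using small[OF inf] by (auto simp: eventually_at_infinity)
  define a1 b1 where "a1 = min (ln (d / 2)) (ln (norm x))" and "b1 = max (ln (max b 1)) (ln (norm x))"
  have "exp a1 <= exp (ln (d / 2))" "exp a1 <= exp (ln (norm x))" "exp (ln (max b 1)) <= exp b1" "exp (ln (norm x)) <= exp b1"
   unfolding a1_def b1_def by (simp_all only: exp_le_cancel_iff)
  then have ab: "exp a1 < d" "exp a1 <= norm x" "norm x <= exp b1" "b <= exp b1" using d(1) x by auto
  have "ln (u x) - ln (v x) <= e"
  proof (rule log_sol_comparison[OF positive_solution_log_sol[OF u] positive_solution_log_sol[OF v] zero_less_one _ _ less_imp_le[OF e] ab(2,3)])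
   show "y \<in> - {0}" if "exp a1 <= norm y" for y :: "real^'n" using that exp_gt_zero[of a1] by auto
   show "ln (u y) - ln (v y) <= e" if "norm y = exp a1 \<or> norm y = exp b1" for y
   proof -
    have "y ~= 0" using that exp_gt_zero by (metis norm_zero less_irrefl)
    then show ?thesis using that d(2)[of y] b[of y] ab(1,4) by auto
   qed
  qed
  then show "ln (u x) - ln (v x) <= 0 + e" by simp
 qed
 have "u x = v x" if x: "x ~= 0" for x
 proof -
  have "ln (u x) = ln (v x)" using le[OF u v 0 inf x] le[OF v u _ _ x] 0 inf by (simp add: asymp_equiv_sym)
  then show ?thesis using u v x by (simp add: positive_solution_def)
 qed
 then show ?thesis using u v by (intro extensionalityI[of u "- {0}" v]) (auto simp: positive_solution_def)
qed

definition ode :: "(real => real) => (real => real) => bool" where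
 "ode s y \<longleftrightarrow> (\<forall>t. DERIV s t :> y t - gm & DERIV y t :> exp ((q - 1) * s t) - F (y t))"

lemma odeD: "ode s y ==> DERIV s t :> y t - gm" "ode s y ==> DERIV y t :> exp ((q - 1) * s t) - F (y t)"
 by (auto simp: ode_def)

lemma ode_shift: "ode s y ==> ode (%t. s (t + a)) (%t. y (t + a))"
 unfolding ode_def using DERIV_shift by blast

definition sol :: "(real => real) => real^'n => real" where
 "sol s = restrict (%x. exp (s (ln (norm x)) + gm * ln (norm x))) (- {0})"

lemma sol_eq: "x ~= 0 ==> sol s x = exp (s (ln (norm x)) + gm * ln (norm x))" by (simp add: sol_def)

lemma sol_positive_solution:
 assumes "ode s y" shows "positive_solution rho lam tau th q (sol s :: real^'n => real)"
 unfolding sol_def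
proof (rule log_sol_positive_solution[OF radial_log_sol_UNIV[of "%t. s t + gm * t" y]])
 show "DERIV (%t. s t + gm * t) t :> y t" for t by (auto intro!: derivative_eq_intros odeD[OF assms])
qed (use odeD(2)[OF assms] in simp)

text \<open>The bound on \<open>s\<close> is the Keller-Osserman bound. The bound on the slope comes
  from the Lipschitz estimate for \<open>hi\<close>, which for a radial function is the profile
  itself.\<close>

lemma positive_solution_sol:
 fixes u :: "real^'n => real"
 assumes d: "CARD('n) >= 2" and F: "F gm > 0" and u: "positive_solution rho lam tau th q u"
 obtains s y B where "u = sol s" "ode s y" "!!t. s t <= level" "!!t. abs (y t) <= B"
proof -
 note z = positive_solution_log_sol[OF u]
 obtain xi xi1 where x: "!!x. x ~= 0 ==> ln (u x) = xi (ln (norm x))" "!!t. DERIV xi t :> xi1 t"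
  "!!t. DERIV xi1 t :> 1 * exp ((q - 1) * (xi t - gm * t)) - F (xi1 t)"
  by (rule log_sol_ode[OF d z zero_less_one]) blast
 define s where "s t = xi t - gm * t" for t
 obtain e :: "real^'n" where e: "norm e = 1" using vector_choose_size[of 1] by auto
 have ne: "exp t *\<^sub>R e ~= 0" "ln (norm (exp t *\<^sub>R e)) = t" for t using e by auto
 have hi: "hi (%x. ln (u x)) t = xi t" for t
 proof -
  obtain y where "norm y = exp t" "ln (u y) = hi (%x. ln (u x)) t" using hi_attained[OF log_solD(5)[OF z]] by blast
  moreover from this(1) have "y ~= 0" by auto
  ultimately show ?thesis using x(1)[of y] by simp
 qed
 obtain B h where B: "h > 0" "!!r t. abs (r - t) <= h ==> abs (xi r - xi t) <= B * abs (r - t)"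
 proof (rule hi_lipschitz[where 'a = "real^'n"], goal_cases)
  case (2 B h) from 2(3) 2(4)[OF z zero_less_one] show ?case unfolding hi by (rule that)
 qed (use d in auto)
 have "abs (xi1 t) <= B" for t
 proof (rule tendsto_upperbound[OF tendsto_rabs[OF x(2)[of t, unfolded DERIV_def]]])
  have "abs ((xi (t + r) - xi t) / r) <= B" if "r ~= 0" "abs r < h" for r using B(2)[of "t + r" t] that by (simp add: abs_divide field_simps)
  then show "\<forall>\<^sub>F r in at 0. abs ((xi (t + r) - xi t) / r) <= B" using B(1) by (auto simp: eventually_at intro!: exI[of _ h])
 qed simp
 moreover have "u = sol s"
 proof (rule extensionalityI[of _ "- {0}"])
  fix y :: "real^'n" assume "y \<in> - {0}"
  then show "u y = sol s y" using u x(1)[of y] by (simp add: sol_eq s_def positive_solution_def flip: x(1))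
 qed (use u in \<open>auto simp: positive_solution_def sol_def\<close>)
 moreover have "ode s xi1" unfolding ode_def s_def using x(2,3) by (auto intro!: derivative_eq_intros)
 moreover have "s t <= level" for t
 proof -
  have "exp ((q - 1) * s t) <= exp ((q - 1) * level)"
   using keller_osserman[OF z zero_less_one ne(1), of t] x(1)[OF ne(1), of t] F unfolding ne(2)
   by (simp add: s_def W0_def exp_level)
  then show ?thesis using q by simp
 qed
 ultimately show ?thesis by (intro that) auto
qed

lemma sol_asymp_at_0:
 "((%t. s t + gm * t - b t) \<longlongrightarrow> 0) at_bot ==> (!!x. x ~= 0 ==> norm x < 1 ==> g x = exp (b (ln (norm x)))) ==> sol s \<sim>[at 0] (g :: real^'n => real)"
 by (rule asymp_equiv_at_0[of "%t. s t + gm * t"]) (auto simp: sol_eq)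

lemma sol_asymp_at_infinity:
 "((%t. s t + gm * t - b t) \<longlongrightarrow> 0) at_top ==> (!!x. x ~= 0 ==> g x = exp (b (ln (norm x)))) ==> sol s \<sim>[at_infinity] (g :: real^'n => real)"
 by (rule asymp_equiv_at_infinity[of "%t. s t + gm * t"]) (auto simp: sol_eq)

lemma U_sol_level: "F gm > 0 ==> x ~= 0 ==> U_sol rho lam tau th q (x :: real^'n) = exp (gm * ln (norm x) + level)"
 by (simp add: U_sol_eq level_def)

lemma sol_U_at_0:
 assumes "F gm > 0" "(s \<longlongrightarrow> level) at_bot" shows "sol s \<sim>[at 0] (U_sol rho lam tau th q :: real^'n => real)"
 using tendsto_diff[OF assms(2) tendsto_const[of level]] U_sol_level[OF assms(1)]
 by (intro sol_asymp_at_0[of _ "%t. gm * t + level"]) auto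

lemma sol_U_at_infinity:
 assumes "F gm > 0" "(s \<longlongrightarrow> level) at_top" shows "sol s \<sim>[at_infinity] (U_sol rho lam tau th q :: real^'n => real)"
 using tendsto_diff[OF assms(2) tendsto_const[of level]] U_sol_level[OF assms(1)]
 by (intro sol_asymp_at_infinity[of _ "%t. gm * t + level"]) auto

lemma sol_plus:
 assumes "((%t. s t + (gm - e1) * t - corr t) \<longlongrightarrow> ln c) at_top" "c > 0"
 shows "sol s \<sim>[at_infinity] (%x::real^'n. c * exp (e1 * ln (norm x) + corr (ln (norm x))))"
 using tendsto_diff[OF assms(1) tendsto_const[of "ln c"]] assms(2)
 by (intro sol_asymp_at_infinity[of _ "%t. ln c + (e1 * t + corr t)"]) (auto simp: algebra_simps exp_add)

lemma sol_minus:
 assumes "((%t. s (- t) + (Y - gm) * t - corr t) \<longlongrightarrow> ln b) at_top" "b > 0"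
  and Ph: "!!r. 0 < r ==> r < 1 ==> Phi rho lam tau r = exp (Y * ln r + corr (- ln r))"
 shows "sol s \<sim>[at 0] (%x::real^'n. b * Phi rho lam tau (norm x))"
proof (rule sol_asymp_at_0[of _ "%t. ln b + (Y * t + corr (- t))"])
 from filterlim_compose[OF tendsto_diff[OF assms(1) tendsto_const[of "ln b"]] filterlim_uminus_at_top_at_bot]
 show "((%t. s t + gm * t - (ln b + (Y * t + corr (- t)))) \<longlongrightarrow> 0) at_bot" by (simp add: algebra_simps)
qed (use assms(2) Ph in \<open>simp add: exp_add\<close>)

text \<open>A slope above \<open>gm\<close> would make the reflected trajectory a
  \<open>tail\<close> over an interval on which the reflected \<open>F\<close> is positive, and its
  slope would descend close to \<open>e = 2 * gm - B - 1\<close>. The bound \<open>B\<close> keeps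
  it at least 1 above \<open>e\<close>. Hence \<open>y <= gm\<close> throughout, and
  \<open>to_equilibrium\<close> applies.\<close>

lemma at_bot_other:
 assumes gm: "gm > 0" "F gm > 0" and nb: "\<not> N2_between rho lam tau (- gm)"
  and o: "ode s y" and s: "!!t. s t <= level" and B: "!!t. abs (y t) <= B"
 shows "(s \<longlongrightarrow> level) at_bot"
proof -
 have k: "q - 1 > 0" using q by simp
 note d = odeD[OF o] note r = reflected_derivatives[OF d]
 have "y t <= gm" for t
 proof (rule ccontr)
  assume n: "\<not> y t <= gm"
  define e where "e = 2 * gm - B - 1"
  have e: "e < gm" "!!t. e + 1 <= 2 * gm - y (- t)" using n B by (auto simp: e_def abs_le_iff) (smt (verit))
  have p: "F (2 * gm - v) > 0" if "v <= gm" for v using that by (intro no_minus_end[OF gm nb]) simp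
  have "\<exists>T'. tail (q - 1) gm e T' (%v. F (2 * gm - v)) (%t. s (- t)) (%t. 2 * gm - y (- t)) & exp ((q - 1) * s (- T')) < F (2 * gm - gm)"
  proof (rule tail_from_below[OF k e(1) F_reflected p _ r])
   show "e < 2 * gm - y (- t)" for t using e(2)[of t] by simp
   show "2 * gm - y (- (- t)) < gm" using n by simp
  qed (use s exp_level[OF gm(2)] in auto)
  then obtain T' where T: "tail (q - 1) gm e T' (%v. F (2 * gm - v)) (%t. s (- t)) (%t. 2 * gm - y (- t))" "exp ((q - 1) * s (- T')) < F (2 * gm - gm)" by blast
  from tail.y_tendsto[OF T(1) tail.s_to_minus_infinity[OF T], of "e + 1 / 2"] e(2) show False
   by (smt (verit) field_sum_of_halves)
 qed
 then show ?thesis using B s exp_level[OF gm(2)] d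
  by (intro to_equilibrium[OF k, of "min (- B) (gm - 1)" gm F level s y]) (auto intro!: continuous_intros min.coboundedI1 simp: abs_le_iff minus_le_iff)
qed

end

context half
begin

lemma asymptotics_shift:
 assumes "((%t. s t + (gm - e1) * t - corr t) \<longlongrightarrow> l) at_top"
 shows "((%t. s (t + a) + (gm - e1) * t - corr t) \<longlongrightarrow> l - (gm - e1) * a) at_top"
proof -
 have "filterlim (%t::real. t + a) at_top at_top" using filterlim_tendsto_add_at_top[OF tendsto_const[of a] filterlim_ident] by (simp add: add.commute)
 from tendsto_diff[OF tendsto_add[OF filterlim_compose[OF assms this] corr[of a]] tendsto_const[of "(gm - e1) * a"]]
 show ?thesis by (simp add: algebra_simps)
qed

lemma connecting_orbit_asymptotics:
 assumes c: "!!A. continuous_on A Ph"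
 obtains s y where "!!t. DERIV s t :> y t - gm" "!!t. DERIV y t :> exp (k * s t) - Ph (y t)"
  "(s \<longlongrightarrow> s0) at_bot" "((%t. s t + (gm - e1) * t - corr t) \<longlongrightarrow> L) at_top"
proof -
 obtain s y where o: "!!t. DERIV s t :> y t - gm" "!!t. DERIV y t :> exp (k * s t) - Ph (y t)"
  "!!t. e1 < y t" "!!t. y t < gm" "!!t. s t <= s0" "(s \<longlongrightarrow> s0) at_bot"
  by (rule connecting_orbit) blast
 obtain l where l: "((%t. s t + (gm - e1) * t - corr t) \<longlongrightarrow> l) at_top"
  using dichotomy[OF c o(1,2,5) less_imp_le[OF o(4)]] o(4) by (meson not_le)
 define a where "a = (l - L) / (gm - e1)"
 have f: "filterlim (%t::real. t + a) at_bot at_bot"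
  unfolding filterlim_at_bot eventually_at_bot_linorder by (metis le_diff_eq)
 show ?thesis
 proof (rule that[of "%t. s (t + a)" "%t. y (t + a)"])
  show "((%t. s (t + a) + (gm - e1) * t - corr t) \<longlongrightarrow> L) at_top" using asymptotics_shift[OF l, of a] e1 by (simp add: a_def)
  show "((%t. s (t + a)) \<longlongrightarrow> s0) at_bot" by (rule filterlim_compose[OF o(6) f])
 qed (intro DERIV_shift[THEN iffD1] o(1,2))+
qed

end

section \<open>Solutions with prescribed behaviour at both ends\<close>

context params
begin

lemma ode_reflect:
 assumes "!!t. DERIV s t :> y t - gm" "!!t. DERIV y t :> exp ((q - 1) * s t) - F (2 * gm - y t)"
 shows "ode (%t. s (- t)) (%t. 2 * gm - y (- t))"
 unfolding ode_def using reflected_derivatives[OF assms] by simp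

text \<open>Half orbits from the same point \<open>(sig, gm)\<close>, one forward and one reflected,
  are glued at time 0. There are two free parameters, \<open>sig\<close> and a time shift
  \<open>a\<close>, for the two constants \<open>A\<close> and \<open>B\<close>.\<close>

lemma solution_two_ended:
 assumes H: "half (q - 1) gm 0 level F (%_. 0)" and H': "half (q - 1) gm (2 * gm - Y) level (%v. F (2 * gm - v)) corr"
  and Y: "0 < gm" "gm < Y"
 obtains s y where "ode s y" "((%t. s t + (gm - 0) * t - 0) \<longlongrightarrow> A) at_top" "((%t. s (- t) + (Y - gm) * t - corr t) \<longlongrightarrow> B) at_top"
proof -
 interpret H: half "q - 1" gm 0 level F "%_. 0" by (rule H)
 interpret H': half "q - 1" gm "2 * gm - Y" level "%v. F (2 * gm - v)" corr by (rule H')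
 \<comment> \<open>A shift by \<open>a\<close> lowers the constant at plus infinity by
   \<open>gm * a\<close> and raises the one at minus infinity by \<open>(Y - gm) * a\<close>. The
   combination \<open>K\<close> is invariant under shifts, so \<open>sig\<close> is found from
   \<open>K sig = K0\<close> by the intermediate value theorem, and then \<open>a\<close> from one
   of the constants.\<close>
 define K where "K sig = (Y - gm) * H.C sig + gm * H'.C sig" for sig
 define K0 where "K0 = (Y - gm) * A + gm * B"
 have incr: "Y * (sig' - sig) <= K sig' - K sig" if "sig <= sig'" "sig' < level" for sig sig'
 proof -
  have "(Y - gm) * (sig' - sig) <= (Y - gm) * (H.C sig' - H.C sig)" "gm * (sig' - sig) <= gm * (H'.C sig' - H'.C sig)"
   using H.C_increasing[OF that] H'.C_increasing[OF that] Y by (auto intro!: mult_left_mono)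
  then show ?thesis by (simp add: K_def algebra_simps)
 qed
 define sig0 where "sig0 = level - 1"
 define sig1 where "sig1 = sig0 - abs (K sig0 - K0) / Y"
 have "sig1 <= sig0" "Y * (sig0 - sig1) = abs (K sig0 - K0)" using Y by (auto simp: sig1_def)
 then have K1: "sig1 <= sig0" "K sig1 <= K0" using incr[of sig1 sig0] by (auto simp: sig0_def)
 obtain sig' where s': "sig' < level" "(abs K0 + abs (gm * H'.C sig0)) / (Y - gm) < H.C sig'" by (rule H.C_unbounded)
 define sig2 where "sig2 = max sig' sig0"
 have s2: "sig2 < level" "sig' <= sig2" "sig0 <= sig2" using s'(1) by (auto simp: sig2_def sig0_def)
 have "H.C sig' <= H.C sig2" "H'.C sig0 <= H'.C sig2" using H.C_increasing[OF s2(2,1)] H'.C_increasing[OF s2(3,1)] s2 by auto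
 then have "(Y - gm) * H.C sig' <= (Y - gm) * H.C sig2" "gm * H'.C sig0 <= gm * H'.C sig2" using Y by (auto intro!: mult_left_mono)
 moreover have "abs K0 + abs (gm * H'.C sig0) < (Y - gm) * H.C sig'" using s'(2) Y by (simp add: pos_divide_less_eq mult.commute)
 ultimately have K2: "K0 <= K sig2" by (simp add: K_def)
 have "continuous_on {sig1..sig2} K" unfolding K_def
  by (intro continuous_intros continuous_on_subset[OF H.C_continuous] continuous_on_subset[OF H'.C_continuous]) (use s2 in auto)
 then obtain sig where sg: "sig <= sig2" "K sig = K0" using IVT'[of K sig1 K0 sig2] K1 K2 s2 by auto
 have lt: "sig < level" using sg s2 by simp
 note S = H.SY[OF less_imp_le[OF lt]] and S' = H'.SY[OF less_imp_le[OF lt]]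
 define s y where "s t = (if 0 <= t then H.S sig t else H'.S sig (- t))" and "y t = (if 0 <= t then H.Y sig t else 2 * gm - H'.Y sig (- t))" for t
 have D1: "(s has_real_derivative (if 0 <= t then H.Y sig t - gm else - (H'.Y sig (- t) - gm))) (at t)" for t
  unfolding s_def by (rule has_real_derivative_glue) (use H.orbitD(1)[OF S(1)] H'.orbitD(1)[OF S'(1)] S S' in auto)
 have D2: "(y has_real_derivative
  (if 0 <= t then exp ((q - 1) * H.S sig t) - F (H.Y sig t) else - (0 - (exp ((q - 1) * H'.S sig (- t)) - F (2 * gm - H'.Y sig (- t)))))) (at t)" for t
  unfolding y_def by (rule has_real_derivative_glue[of "H.Y sig" _ "%t. 2 * gm - H'.Y sig t"])
   (use H.orbitD(2)[OF S(1)] DERIV_diff[OF DERIV_const H'.orbitD(2)[OF S'(1)]] S S' in auto)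
 have o: "ode s y" unfolding ode_def
 proof (intro allI conjI)
  show "DERIV s t :> y t - gm" for t by (rule DERIV_cong[OF D1]) (simp add: y_def)
  show "DERIV y t :> exp ((q - 1) * s t) - F (y t)" for t by (rule DERIV_cong[OF D2]) (simp add: s_def y_def)
 qed
 define a where "a = (H.C sig - A) / gm"
 have l: "((%t. s t + (gm - 0) * t - 0) \<longlongrightarrow> H.C sig) at_top"
  by (rule Lim_transform_eventually[OF H.C_lim[OF lt]]) (auto simp: s_def eventually_at_top_linorder intro!: exI[of _ 0])
 have l': "((%t. s (- t) + (gm - (2 * gm - Y)) * t - corr t) \<longlongrightarrow> H'.C sig) at_top"
  by (rule Lim_transform_eventually[OF H'.C_lim[OF lt]]) (auto simp: s_def eventually_at_top_linorder intro!: exI[of _ 1])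
 have ga: "gm * a = H.C sig - A" using Y by (simp add: a_def)
 have "gm * (H'.C sig + (Y - gm) * a) = gm * B"
 proof -
  have "gm * (H'.C sig + (Y - gm) * a) = gm * H'.C sig + (Y - gm) * (gm * a)" by (simp add: algebra_simps)
  then show ?thesis using sg(2) unfolding ga K_def K0_def by (simp add: algebra_simps)
 qed
 then have e: "H'.C sig + (Y - gm) * a = B" using Y(1) by simp
 show ?thesis
 proof (rule that[OF ode_shift[OF o, of a]])
  show "((%t. s (t + a) + (gm - 0) * t - 0) \<longlongrightarrow> A) at_top" using H.asymptotics_shift[OF l, of a] ga by simp
  show "((%t. s (- t + a) + (Y - gm) * t - corr t) \<longlongrightarrow> B) at_top"
   using H'.asymptotics_shift[of "%t. s (- t)", OF l', of "- a"] e by (simp add: algebra_simps)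
 qed
qed

lemma ex1_positive_solution:
 fixes g0 g1 :: "real^'n => real"
 assumes "positive_solution rho lam tau th q u" "u \<sim>[at 0] g0" "u \<sim>[at_infinity] g1"
 shows "\<exists>!u. positive_solution rho lam tau th q u & u \<sim>[at 0] g0 & u \<sim>[at_infinity] g1"
proof (rule ex1I[of _ u])
 fix v assume v: "positive_solution rho lam tau th q v & v \<sim>[at 0] g0 & v \<sim>[at_infinity] g1"
 then show "v = u" using assms
  by (intro positive_solution_unique) (auto intro: asymp_equiv_trans[OF _ asymp_equiv_symI])
qed (use assms in simp)

text \<open>The bound \<open>s <= level\<close> gives \<open>u <= exp level * r powr gm\<close>,
  which tends to 0 at the origin; the profile increases because the logarithmic slope exceeds
  \<open>e1 >= 0\<close>.\<close>

lemma positive_solution_profile: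
 fixes u :: "real^'n => real"
 assumes d: "CARD('n) >= 2" and gm: "gm > 0" "F gm > 0" and u: "positive_solution rho lam tau th q u"
  and H: "half (q - 1) gm e1 level F corr" "0 <= e1"
 shows "\<exists>v :: real => real. (\<forall>x. x ~= 0 --> u x = v (norm x)) & (v \<longlongrightarrow> 0) (at_right 0) & (\<forall>r>0. \<exists>D>0. DERIV v r :> D)"
proof -
 interpret H: half "q - 1" gm e1 level F corr by (rule H)
 obtain s y B where s: "u = sol s" "ode s y" "!!t. s t <= level" "!!t. abs (y t) <= B" by (rule positive_solution_sol[OF d gm(2) u]) blast
 define v where "v r = exp (s (ln r) + gm * ln r)" for r
 have y: "0 < y t" for t using above_root[where Ph = F and s = s and y = y, OF H.e1 H.Ph0 odeD[OF s(2)] s(3), of t] H(2) by simp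
 have "(v \<longlongrightarrow> 0) (at_right 0)"
 proof (rule tendsto_sandwich[OF _ _ tendsto_const])
  have "((%r. exp level * r powr gm) \<longlongrightarrow> exp level * 0 powr gm) (at_right (0::real))"
   using gm(1) by (intro tendsto_intros) (auto simp: eventually_at_filter)
  then show "((%r. exp level * r powr gm) \<longlongrightarrow> 0) (at_right (0::real))" by simp
  show "\<forall>\<^sub>F r in at_right 0. v r <= exp level * r powr gm"
   using s(3) by (auto simp: v_def powr_def eventually_at_filter simp flip: exp_add)
 qed (auto simp: v_def)
 moreover have "\<exists>D>0. DERIV v r :> D" if r: "0 < r" for r
 proof (intro exI conjI)
  show "DERIV v r :> v r * ((y (ln r) - gm) * (1 / r) + gm * (1 / r))"
   unfolding v_def using r by (auto intro!: derivative_eq_intros DERIV_chain'[OF _ odeD(1)[OF s(2)]])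
  show "0 < v r * ((y (ln r) - gm) * (1 / r) + gm * (1 / r))" using y[of "ln r"] r by (simp add: v_def field_simps)
 qed
 ultimately show ?thesis by (intro exI[of _ v]) (simp add: s(1) sol_eq v_def)
qed

end

context params
begin

lemma sol_at_infinity_cases:
 fixes u :: "real^'n => real"
 assumes d: "CARD('n) >= 2" and F: "F gm > 0" and u: "positive_solution rho lam tau th q u" and H: "half (q - 1) gm e1 level F corr"
 shows "u \<sim>[at_infinity] U_sol rho lam tau th q \<or> (\<exists>c>0. u \<sim>[at_infinity] (%x. c * exp (e1 * ln (norm x) + corr (ln (norm x)))))"
proof -
 obtain s y B where s: "u = sol s" "ode s y" "!!t. s t <= level" "!!t. abs (y t) <= B" by (rule positive_solution_sol[OF d F u]) blast
 have "(s \<longlongrightarrow> level) at_top \<or> (\<exists>l. ((%t. s t + (gm - e1) * t - corr t) \<longlongrightarrow> l) at_top)"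
  using half.dichotomy[OF H continuous_F odeD[OF s(2)] s(3), of B] s(4) by (auto simp: abs_le_iff)
 then show ?thesis
 proof (elim disjE exE)
  fix l assume "((%t. s t + (gm - e1) * t - corr t) \<longlongrightarrow> l) at_top"
  then show ?thesis using sol_plus[of s e1 corr "exp l", where 'n = 'n] s(1) by (intro disjI2 exI[of _ "exp l"]) simp
 qed (use sol_U_at_infinity[OF F, where 'n = 'n] s(1) in simp)
qed

lemma sol_at_0_cases:
 fixes u :: "real^'n => real"
 assumes d: "CARD('n) >= 2" and F: "F gm > 0" and u: "positive_solution rho lam tau th q u"
  and H: "half (q - 1) gm (2 * gm - Y) level (%v. F (2 * gm - v)) corr"
  and Ph: "!!r. 0 < r ==> r < 1 ==> Phi rho lam tau r = exp (Y * ln r + corr (- ln r))"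
 shows "u \<sim>[at 0] U_sol rho lam tau th q \<or> (\<exists>b>0. u \<sim>[at 0] (%x. b * Phi rho lam tau (norm x)))"
proof -
 obtain s y B where s: "u = sol s" "ode s y" "!!t. s t <= level" "!!t. abs (y t) <= B" by (rule positive_solution_sol[OF d F u]) blast
 have "((%t. s (- t)) \<longlongrightarrow> level) at_top \<or> (\<exists>l. ((%t. s (- t) + (gm - (2 * gm - Y)) * t - corr t) \<longlongrightarrow> l) at_top)"
  using half.dichotomy[OF H F_reflected reflected_derivatives[OF odeD[OF s(2)]] s(3), of "2 * gm + B"] s(4)
  by (auto simp: abs_le_iff minus_le_iff)
 then show ?thesis
 proof (elim disjE exE)
  assume "((%t. s (- t)) \<longlongrightarrow> level) at_top"
  from filterlim_compose[OF this filterlim_uminus_at_top_at_bot] show ?thesis using sol_U_at_0[OF F, where 'n = 'n] s(1) by simp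
 next
  fix l assume "((%t. s (- t) + (gm - (2 * gm - Y)) * t - corr t) \<longlongrightarrow> l) at_top"
  then show ?thesis using sol_minus[of s Y corr "exp l", OF _ _ Ph, where 'n = 'n] s(1) by (intro disjI2 exI[of _ "exp l"]) simp
 qed
qed

lemma u_infty_unique:
 fixes g1 :: "real => real^'n => real"
 assumes F: "F gm > 0" and H: "half (q - 1) gm e1 level F corr" and c: "c > 0"
 shows "\<exists>!u :: real^'n => real. positive_solution rho lam tau th q u & u \<sim>[at 0] U_sol rho lam tau th q &
  u \<sim>[at_infinity] (%x. c * exp (e1 * ln (norm x) + corr (ln (norm x))))"
proof -
 obtain s y where s: "!!t. DERIV s t :> y t - gm" "!!t. DERIV y t :> exp ((q - 1) * s t) - F (y t)"
  "(s \<longlongrightarrow> level) at_bot" "((%t. s t + (gm - e1) * t - corr t) \<longlongrightarrow> ln c) at_top"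
  by (rule half.connecting_orbit_asymptotics[OF H continuous_F[OF continuous_on_id], where L = "ln c"]) blast
 have o: "ode s y" using s by (simp add: ode_def)
 show ?thesis by (rule ex1_positive_solution[OF sol_positive_solution[OF o] sol_U_at_0[OF F s(3)] sol_plus[OF s(4) c]])
qed

lemma u_b_unique:
 assumes F: "F gm > 0" and H: "half (q - 1) gm (2 * gm - Y) level (%v. F (2 * gm - v)) corr" and b: "b > 0"
  and Ph: "!!r. 0 < r ==> r < 1 ==> Phi rho lam tau r = exp (Y * ln r + corr (- ln r))"
 shows "\<exists>!u :: real^'n => real. positive_solution rho lam tau th q u & u \<sim>[at 0] (%x. b * Phi rho lam tau (norm x)) &
  u \<sim>[at_infinity] U_sol rho lam tau th q"
proof -
 obtain s y where s: "!!t. DERIV s t :> y t - gm" "!!t. DERIV y t :> exp ((q - 1) * s t) - F (2 * gm - y t)"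
  "(s \<longlongrightarrow> level) at_bot" "((%t. s t + (gm - (2 * gm - Y)) * t - corr t) \<longlongrightarrow> ln b) at_top"
  by (rule half.connecting_orbit_asymptotics[OF H F_reflected, where L = "ln b"]) blast
 have m: "((%t. s (- (- t)) + (Y - gm) * t - corr t) \<longlongrightarrow> ln b) at_top" using s(4) by simp
 show ?thesis
  by (rule ex1_positive_solution[OF sol_positive_solution[OF ode_reflect[OF s(1,2)]] sol_minus[OF m b Ph]
     sol_U_at_infinity[OF F filterlim_compose[OF s(3) filterlim_uminus_at_bot_at_top]]])
qed

lemma u_b_infty_unique:
 assumes H: "half (q - 1) gm 0 level F (%_. 0)" and H': "half (q - 1) gm (2 * gm - Y) level (%v. F (2 * gm - v)) corr"
  and gm: "0 < gm" "gm < Y" and b: "b > 0" and c: "c > 0"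
  and Ph: "!!r. 0 < r ==> r < 1 ==> Phi rho lam tau r = exp (Y * ln r + corr (- ln r))"
 shows "\<exists>!u :: real^'n => real. positive_solution rho lam tau th q u & u \<sim>[at 0] (%x. b * Phi rho lam tau (norm x)) &
  u \<sim>[at_infinity] (%x. c)"
proof -
 obtain s y where s: "ode s y" "((%t. s t + (gm - 0) * t - 0) \<longlongrightarrow> ln c) at_top" "((%t. s (- t) + (Y - gm) * t - corr t) \<longlongrightarrow> ln b) at_top"
  by (rule solution_two_ended[OF H H' gm])
 have "sol s \<sim>[at_infinity] (%x::real^'n. c)" using sol_plus[OF s(2) c, where 'n = 'n] by simp
 from ex1_positive_solution[OF sol_positive_solution[OF s(1)] sol_minus[OF s(3) b Ph] this] show ?thesis by simp
qed

end

theorem theorem1p1: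
  fixes \<rho> lam \<tau> \<theta> q \<beta> :: real
  assumes "CARD('n::finite) \<ge> 2" and "q > 1" and "0 \<le> \<tau>" and "\<tau> < 1"
    and "\<beta> = beta_exp \<theta> q"
  shows
    "((\<exists>u :: real^'n \<Rightarrow> real. positive_solution \<rho> lam \<tau> \<theta> q u) \<longleftrightarrow> f_rho \<rho> lam \<tau> \<beta> > 0) \<and>
     (\<theta> < -2 \<and> f_rho \<rho> lam \<tau> \<beta> > 0 \<longrightarrow>
        (\<forall>u :: real^'n \<Rightarrow> real. positive_solution \<rho> lam \<tau> \<theta> q u \<longrightarrow>
           (\<exists>v :: real \<Rightarrow> real. (\<forall>x. x \<noteq> 0 \<longrightarrow> u x = v (norm x)) \<and>
              (v \<longlongrightarrow> 0) (at_right 0) \<and>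
              (\<forall>r>0. \<exists>D>0. (v has_real_derivative D) (at r)))) \<and>
        (\<forall>c>0. \<exists>!u :: real^'n \<Rightarrow> real. is_u_infty \<rho> lam \<tau> \<theta> q c u) \<and>
        (N2_between \<rho> lam \<tau> \<beta> \<longrightarrow>
           (\<forall>b>0. \<forall>c>0.
              (\<exists>!u :: real^'n \<Rightarrow> real. is_u_b \<rho> lam \<tau> \<theta> q b u) \<and>
              (\<exists>!u :: real^'n \<Rightarrow> real. is_u_b_infty \<rho> lam \<tau> \<theta> q b c u))) \<and>
        {u :: real^'n \<Rightarrow> real. positive_solution \<rho> lam \<tau> \<theta> q u} =
          (if N2_between \<rho> lam \<tau> \<beta>
           then {U_sol \<rho> lam \<tau> \<theta> q} \<union> {u_infty \<rho> lam \<tau> \<theta> q c | c. c > 0}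
                \<union> {u_b \<rho> lam \<tau> \<theta> q b | b. b > 0}
                \<union> {u_b_infty \<rho> lam \<tau> \<theta> q b c | b c. b > 0 \<and> c > 0}
           else {U_sol \<rho> lam \<tau> \<theta> q} \<union> {u_infty \<rho> lam \<tau> \<theta> q c | c. c > 0}))"
  proof -
 interpret params \<rho> lam \<tau> \<theta> q by unfold_locales (use assms in auto)
 have \<beta>: "\<beta> = - gm" by (simp add: assms(5) gm_def)
 have f: "f_rho \<rho> lam \<tau> \<beta> = F gm" using assms(5) f_rho_beta by simp
 note d = assms(1)
 let ?U = "U_sol \<rho> lam \<tau> \<theta> q :: real^'n => real"
 let ?pos = "positive_solution \<rho> lam \<tau> \<theta> q :: (real^'n => real) => bool"
 show ?thesis
 proof (rule conjI[OF existence_iff[where 'n = 'n, folded f]], rule impI)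
  assume a: "\<theta> < - 2 & f_rho \<rho> lam \<tau> \<beta> > 0"
  \<comment> \<open>The condition on the exponent of the weight says that \<open>gm\<close> is
    positive.\<close>
  have "0 < (q - 1) * gm" using a theta by linarith
  then have gm: "gm > 0" "F gm > 0" using q a f by (auto simp: zero_less_mult_iff)
  obtain e1 corr where e1: "0 <= e1" "e1 < gm" and H: "half (q - 1) gm e1 level F corr"
   and beh: "!!c (u :: real^'n => real). behaviour_at_infinity \<rho> lam \<tau> (- gm) c u \<longleftrightarrow>
    u \<sim>[at_infinity] (%x. c * exp (e1 * ln (norm x) + corr (ln (norm x))))"
   and btw: "N2_between \<rho> lam \<tau> (- gm) ==> e1 = 0 & corr = (%_. 0)"
   by (rule plus_end[OF gm, where 'n = 'n]) blast
  have ui: "is_u_infty \<rho> lam \<tau> \<theta> q c u \<longleftrightarrow> ?pos u & u \<sim>[at 0] ?U &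
   u \<sim>[at_infinity] (%x. c * exp (e1 * ln (norm x) + corr (ln (norm x))))" for c and u :: "real^'n => real"
   by (simp only: is_u_infty_def \<beta>[unfolded assms(5)] beh)
  have ui1: "\<exists>!u :: real^'n => real. is_u_infty \<rho> lam \<tau> \<theta> q c u" if "c > 0" for c
   unfolding ui by (rule u_infty_unique[OF gm(2) H that])
  have ui_the: "is_u_infty \<rho> lam \<tau> \<theta> q c (u_infty \<rho> lam \<tau> \<theta> q c :: real^'n => real)" if "c > 0" for c
   unfolding u_infty_def by (rule theI'[OF ui1[OF that]])
  have ui_eq: "u = u_infty \<rho> lam \<tau> \<theta> q c" if "c > 0" "is_u_infty \<rho> lam \<tau> \<theta> q c u" for c and u :: "real^'n => real"
   unfolding u_infty_def by (rule the1_equality[OF ui1[OF that(1)], symmetric, OF that(2)])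
  have U_eq: "u = ?U" if "?pos u" "u \<sim>[at 0] ?U" "u \<sim>[at_infinity] ?U" for u
   by (rule positive_solution_unique[OF that(1) U_sol_positive_solution[OF gm(2)] that(2,3)])
  have inf: "u \<sim>[at_infinity] ?U \<or> (\<exists>c>0. u \<sim>[at_infinity] (%x. c * exp (e1 * ln (norm x) + corr (ln (norm x)))))" if "?pos u" for u
   by (rule sol_at_infinity_cases[OF d gm(2) that H])
  have from_U: "u = ?U \<or> (\<exists>c>0. u = u_infty \<rho> lam \<tau> \<theta> q c)" if "?pos u" "u \<sim>[at 0] ?U" for u
   using inf[OF that(1)]
  proof (elim disjE exE conjE)
   fix c assume c: "0 < c" "u \<sim>[at_infinity] (%x. c * exp (e1 * ln (norm x) + corr (ln (norm x))))"
   have "is_u_infty \<rho> lam \<tau> \<theta> q c u" unfolding ui using that c(2) by (intro conjI)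
   then show ?thesis using ui_eq[OF c(1)] c(1) by blast
  qed (use U_eq[OF that] in blast)
  have radial: "\<forall>u :: real^'n => real. positive_solution \<rho> lam \<tau> \<theta> q u -->
   (\<exists>v :: real => real. (\<forall>x. x ~= 0 --> u x = v (norm x)) & (v \<longlongrightarrow> 0) (at_right 0) & (\<forall>r>0. \<exists>D>0. DERIV v r :> D))"
   using positive_solution_profile[OF d gm _ H e1(1)] by blast
  have Upos: "?pos ?U" by (rule U_sol_positive_solution[OF gm(2)])
  have infpos: "?pos (u_infty \<rho> lam \<tau> \<theta> q c)" if "c > 0" for c using ui_the[OF that] by (simp add: ui)
  show "(\<forall>u :: real^'n => real. positive_solution \<rho> lam \<tau> \<theta> q u -->
     (\<exists>v :: real => real. (\<forall>x. x ~= 0 --> u x = v (norm x)) &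
       (v \<longlongrightarrow> 0) (at_right 0) &
       (\<forall>r>0. \<exists>D>0. DERIV v r :> D))) &
    (\<forall>c>0. \<exists>!u :: real^'n => real. is_u_infty \<rho> lam \<tau> \<theta> q c u) &
    (N2_between \<rho> lam \<tau> \<beta> -->
     (\<forall>b>0. \<forall>c>0.
       (\<exists>!u :: real^'n => real. is_u_b \<rho> lam \<tau> \<theta> q b u) &
       (\<exists>!u :: real^'n => real. is_u_b_infty \<rho> lam \<tau> \<theta> q b c u))) &
    {u :: real^'n => real. positive_solution \<rho> lam \<tau> \<theta> q u} =
     (if N2_between \<rho> lam \<tau> \<beta>
     then {U_sol \<rho> lam \<tau> \<theta> q} \<union> {u_infty \<rho> lam \<tau> \<theta> q c | c. c > 0}
        \<union> {u_b \<rho> lam \<tau> \<theta> q b | b. b > 0}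
        \<union> {u_b_infty \<rho> lam \<tau> \<theta> q b c | b c. b > 0 & c > 0}
     else {U_sol \<rho> lam \<tau> \<theta> q} \<union> {u_infty \<rho> lam \<tau> \<theta> q c | c. c > 0})"
  proof (cases "N2_between \<rho> lam \<tau> \<beta>")
   case False
   then have nb: "\<not> N2_between \<rho> lam \<tau> (- gm)" by (simp add: \<beta>)
   \<comment> \<open>In this case \<open>F\<close> is positive above \<open>gm\<close>, so every
     trajectory starts at the equilibrium.\<close>
   have "u \<sim>[at 0] ?U" if u: "?pos u" for u
   proof -
    obtain s y B where s: "u = sol s" "ode s y" "!!t. s t <= level" "!!t. abs (y t) <= B"
     by (rule positive_solution_sol[OF d gm(2) u]) blast
    show ?thesis unfolding s(1) by (rule sol_U_at_0[OF gm(2) at_bot_other[OF gm nb s(2-4)]])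
   qed
   then have "{u. ?pos u} = {?U} \<union> {u_infty \<rho> lam \<tau> \<theta> q c | c. c > 0}" using from_U Upos infpos by blast
   then show ?thesis using radial ui1 False by simp
  next
   case True
   then have b: "N2_between \<rho> lam \<tau> (- gm)" by (simp add: \<beta>)
   \<comment> \<open>The behaviour at infinity other than that of the power solution is then
     convergence to a positive constant.\<close>
   have e0: "e1 = 0" "corr = (%_. 0)" using btw[OF b] by auto
   obtain Y corr' where Y: "gm < Y" and H': "half (q - 1) gm (2 * gm - Y) level (%v. F (2 * gm - v)) corr'"
    and \<Phi>: "!!r. 0 < r ==> r < 1 ==> Phi \<rho> lam \<tau> r = exp (Y * ln r + corr' (- ln r))"
    by (rule minus_end[OF gm b]) blast
   have ub1: "\<exists>!u :: real^'n => real. is_u_b \<rho> lam \<tau> \<theta> q b u" if "b > 0" for b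
    unfolding is_u_b_def by (rule u_b_unique[OF gm(2) H' that \<Phi>])
   have ubi1: "\<exists>!u :: real^'n => real. is_u_b_infty \<rho> lam \<tau> \<theta> q b c u" if "b > 0" "c > 0" for b c
    unfolding is_u_b_infty_def by (rule u_b_infty_unique[OF H[unfolded e0] H' gm(1) Y that \<Phi>])
   have ub_eq: "u = u_b \<rho> lam \<tau> \<theta> q b" if "b > 0" "is_u_b \<rho> lam \<tau> \<theta> q b u" for b and u :: "real^'n => real"
    unfolding u_b_def by (rule the1_equality[OF ub1[OF that(1)], symmetric, OF that(2)])
   have ubi_eq: "u = u_b_infty \<rho> lam \<tau> \<theta> q b c" if "b > 0" "c > 0" "is_u_b_infty \<rho> lam \<tau> \<theta> q b c u"
    for b c and u :: "real^'n => real"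
    unfolding u_b_infty_def by (rule the1_equality[OF ubi1[OF that(1,2)], symmetric, OF that(3)])
   have ubpos: "?pos (u_b \<rho> lam \<tau> \<theta> q b)" if "b > 0" for b
    using theI'[OF ub1[OF that]] unfolding u_b_def[symmetric] by (simp add: is_u_b_def)
   have ubipos: "?pos (u_b_infty \<rho> lam \<tau> \<theta> q b c)" if "b > 0" "c > 0" for b c
    using theI'[OF ubi1[OF that]] unfolding u_b_infty_def[symmetric] by (simp add: is_u_b_infty_def)
   have inf': "u \<sim>[at_infinity] ?U \<or> (\<exists>c>0. u \<sim>[at_infinity] (%x. c))" if "?pos u" for u
    using inf[OF that] by (simp add: e0)
   have cls: "u = ?U \<or> (\<exists>c>0. u = u_infty \<rho> lam \<tau> \<theta> q c) \<or> (\<exists>b>0. u = u_b \<rho> lam \<tau> \<theta> q b)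
    \<or> (\<exists>b>0. \<exists>c>0. u = u_b_infty \<rho> lam \<tau> \<theta> q b c)" if u: "?pos u" for u
   proof -
    have "u \<sim>[at 0] ?U \<or> (\<exists>b>0. u \<sim>[at 0] (%x. b * Phi \<rho> lam \<tau> (norm x)))"
     by (rule sol_at_0_cases[OF d gm(2) u H' \<Phi>])
    then show ?thesis
    proof (elim disjE exE conjE)
     fix b assume b: "0 < b" "u \<sim>[at 0] (%x. b * Phi \<rho> lam \<tau> (norm x))"
     \<comment> \<open>With \<open>b\<close> prescribed at the origin, the two possibilities at
       infinity give the two remaining families.\<close>
     show ?thesis using inf'[OF u] ub_eq[of b u] ubi_eq[of b _ u] b u unfolding is_u_b_def is_u_b_infty_def by blast
    qed (use from_U[OF u] in blast)
   qed
   have "{u. ?pos u} = {?U} \<union> {u_infty \<rho> lam \<tau> \<theta> q c | c. c > 0} \<union> {u_b \<rho> lam \<tau> \<theta> q b | b. b > 0}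
    \<union> {u_b_infty \<rho> lam \<tau> \<theta> q b c | b c. b > 0 & c > 0}" (is "_ = ?R")
   proof (intro set_eqI iffI)
    show "u \<in> ?R" if "u \<in> {u. ?pos u}" for u using cls[of u] that by simp blast
    show "u \<in> {u. ?pos u}" if "u \<in> ?R" for u using that Upos infpos ubpos ubipos by (elim UnE CollectE exE conjE) auto
   qed
   then show ?thesis using radial ui1 ub1 ubi1 True by simp
  qed
 qed
qed

end
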